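(* Let $\mathbb{F}=\mathbb{F}_2$. For every matroid $N$, every positive real $\zeta$, and every integer $d\ge |N|-2$, there exist positive reals $\beta$ and $\varepsilon_0$, a positive nonincreasing function $\eta:\mathbb{Z}^+\to\mathbb{R}^+$, and positive nondecreasing functions $r,\nu:\mathbb{Z}^+\to\mathbb{Z}^+$ such that the following holds for all $\varepsilon\le\varepsilon_0$. Let $M\subseteq\mathbb{F}^n\setminus\{0\}$ be a matroid with an $(\eta,r,d)$-regular partition $f_1+f_2+f_3$ with corresponding factor $\mathcal B$. If $n\ge\nu(|\mathcal B|)$ and there exists a homomorphism from $N$ to the $(\varepsilon,\zeta)$-reduced matroid $R_{\varepsilon,\zeta}$, then $M$ contains at least $\beta\,\frac{(2^n)^{r(N)}}{\|\mathcal B\|^{|N|}}$ copies of $N$.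
   Context: A (simple binary) matroid of rank $r$ is a subset of $\mathbb{F}_2^r\setminus\{0\}$ spanning $\mathbb{F}_2^r$; $r(N)$ is its rank and $|N|$ its number of elements. A copy of $N$ in $M\subseteq\mathbb{F}^n$ is the image $\iota(N)\subseteq M$ of an injective linear map $\iota:\mathbb{F}^{r(N)}\to\mathbb{F}^n$; a homomorphism from $N$ to a set $R\subseteq\mathbb{F}^n$ is any linear map $\iota:\mathbb{F}^{r(N)}\to\mathbb{F}^n$ with $\iota(N)\subseteq R$. Let $\mathbb{T}=\mathbb{R}/\mathbb{Z}$, $\mathrm{e}(x)=e^{2\pi i x}$. For $f:\mathbb{F}^n\to\mathbb{C}$ and $d\ge1$, the Gowers norm is $\|f\|_{U^d}=\big|\mathbb{E}_{x,h_1,\dots,h_d}\prod_{i\in\{0,1\}^d}\mathcal{C}^{i_1+\dots+i_d}f(x+\sum_j i_jh_j)\big|^{1/2^d}$, $\mathcal C$ being complex conjugation. A (nonclassical) polynomial of degree at most $d$ is a map $P:\mathbb{F}^n\to\mathbb{T}$ with $\sum_{i\in\{0,1\}^{d+1}}(-1)^{|i|}P(x+\sum_j i_jh_j)=0$ for all $x,h_1,\dots,h_{d+1}$. Every such $P$ can be written uniquely as $\alpha+\sum c_{d_1,\dots,d_n,k}|x_1|^{d_1}\cdots|x_n|^{d_n}/2^{k+1}\bmod 1$ with $c\in\{0,1\}$, $d_i\in\{0,1\}$, $0<\sum d_i\le d-k$; the depth of $P$ is the largest $k$ with some nonzero coefficient; by convention all polynomials have shift $\alpha=0$, so a depth-$k$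 polynomial takes values in $\frac{1}{2^{k+1}}\mathbb{Z}/\mathbb{Z}$. A polynomial factor $\mathcal B$ defined by polynomials $P_1,\dots,P_C$ (depths $k_1,\dots,k_C$) is the partition of $\mathbb{F}^n$ into atoms $\{x: P_i(x)=b_i\ \forall i\}$; its complexity is $|\mathcal B|=C$, its degree is $\max_i\deg P_i$, and its order is $\|\mathcal B\|=\prod_{i=1}^C2^{k_i+1}$. The $d$-rank of a polynomial $P$ is the least $r$ such that $P$ is a function of $r$ polynomials of degree at most $d-1$. The rank of $\mathcal B$ is the least $r$ such that for some $(\lambda_1,\dots,\lambda_C)\in\mathbb{Z}^C$ with $(\lambda_i\bmod 2^{k_i+1})_i\ne0$, $\sum_i\lambda_iP_i$ has $d$-rank at most $r$, where $d=\max_i\deg(\lambda_iP_i)$. For $r:\mathbb{Z}_{>0}\to\mathbb{Z}_{>0}$, $\mathcal B$ is $r$-regular if its rank exceeds $r(|\mathcal B|)$. For $f=1_M$, an $(\eta,r,d)$-regular partition of $M$ with corresponding factor $\mathcal B$ is a decomposition $f=f_1+f_2+f_3$ with $f_i:\mathbb{F}^n\to\mathbb{R}$ and a polynomial factor $\mathcal B$ of degree at most $d$ such that: $f_1=\mathbb{E}[f\mid\mathcal B]$ (average of $f$ over the atom); $\|f_2\|_{U^{d+1}}\le\eta(|\mathcal B|)$; $\|f_3\|_2\le\delta$ for some $\delta$; $f_1$ and $f_1+f_3$ take values in $[0,1]$, $f_2,f_3$ in $[-1,1]$; and $\mathcal B$ is $r$-regular. The $(\varepsilon,\zeta)$-reduced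 matroid $R_{\varepsilon,\zeta}\subseteq\mathbb{F}^n$ is the union of those atoms $b$ of $\mathcal B$ with $\mathbb{E}[|f_3(x)|^2\mid x\in b]\le\varepsilon^2$ and $\mathbb{E}[f(x)\mid x\in b]\ge\zeta$. *)

theory Defs
  imports Complex_Main
    "HOL-Library.Z2"
    "HOL-Library.Function_Algebras"
    "HOL-Library.FuncSet"
    "HOL-Library.Extended_Nat"
    "HOL-Library.Indicator_Function"
begin

section \<open>The spaces \<open>\<bbbF>\<^sub>2\<^sup>n\<close>\<close>

text \<open>
  The dimension is quantified inside the theorem, so all the spaces live in the
  single type \<open>nat \<Rightarrow> bit\<close> (addition is pointwise): the vectors of length \<open>n\<close> are those
  that vanish from coordinate \<open>n\<close> on.
\<close>

definition FF :: "nat \<Rightarrow> (nat \<Rightarrow> bit) set" where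
  "FF n = {x. \<forall>i\<ge>n. x i = 0}"

definition f2_scale :: "bit \<Rightarrow> (nat \<Rightarrow> bit) \<Rightarrow> (nat \<Rightarrow> bit)" where
  "f2_scale c x = (\<lambda>i. c * x i)"

interpretation F2: vector_space f2_scale
  by unfold_locales (auto simp: f2_scale_def fun_eq_iff algebra_simps)

definition linear_map :: "nat \<Rightarrow> nat \<Rightarrow> ((nat \<Rightarrow> bit) \<Rightarrow> (nat \<Rightarrow> bit)) \<Rightarrow> bool" where
  "linear_map m n \<phi> \<longleftrightarrow>
     \<phi> \<in> FF m \<rightarrow> FF n \<and>
     (\<forall>x\<in>FF m. \<forall>y\<in>FF m. \<phi> (x + y) = \<phi> x + \<phi> y) \<and>
     (\<forall>c. \<forall>x\<in>FF m. \<phi> (f2_scale c x) = f2_scale c (\<phi> x))"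


section \<open>Simple binary matroids\<close>

definition matroid :: "nat \<Rightarrow> (nat \<Rightarrow> bit) set \<Rightarrow> bool" where
  "matroid n M \<longleftrightarrow> M \<subseteq> FF n - {0} \<and> F2.span M = FF n"

text \<open>A copy is the image set, so maps with the same image are counted once.\<close>

definition copies :: "nat \<Rightarrow> (nat \<Rightarrow> bit) set \<Rightarrow> nat \<Rightarrow> (nat \<Rightarrow> bit) set \<Rightarrow> (nat \<Rightarrow> bit) set set" where
  "copies m N n M = {\<phi> ` N | \<phi>. linear_map m n \<phi> \<and> inj_on \<phi> (FF m) \<and> \<phi> ` N \<subseteq> M}"

definition matroid_hom ::
  "nat \<Rightarrow> (nat \<Rightarrow> bit) set \<Rightarrow> nat \<Rightarrow> (nat \<Rightarrow> bit) set \<Rightarrow> ((nat \<Rightarrow> bit) \<Rightarrow> (nat \<Rightarrow> bit)) \<Rightarrow> bool" where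
  "matroid_hom m N n R \<phi> \<longleftrightarrow> linear_map m n \<phi> \<and> \<phi> ` N \<subseteq> R"


section \<open>Averages and norms\<close>

definition avg :: "'a set \<Rightarrow> ('a \<Rightarrow> 'b::real_normed_field) \<Rightarrow> 'b" where
  "avg A f = (\<Sum>x\<in>A. f x) / of_nat (card A)"

text \<open>
  Here and below a vertex of the cube \<open>{0,1}\<^sup>d\<close> is given by its support
  \<open>I \<subseteq> {..<d}\<close>, so that \<open>sum h I\<close> is the corresponding sum of the directions.
\<close>

definition gowers_norm :: "nat \<Rightarrow> nat \<Rightarrow> ((nat \<Rightarrow> bit) \<Rightarrow> complex) \<Rightarrow> real" where
  "gowers_norm n d f =
     cmod (avg (FF n \<times> ({..<d} \<rightarrow>\<^sub>E FF n))
       (\<lambda>(x, h). \<Prod>I\<in>Pow {..<d}. (cnj ^^ card I) (f (x + sum h I)))) powr (1 / 2 ^ d)"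

definition l2_norm :: "nat \<Rightarrow> ((nat \<Rightarrow> bit) \<Rightarrow> real) \<Rightarrow> real" where
  "l2_norm n f = sqrt (avg (FF n) (\<lambda>x. \<bar>f x\<bar>\<^sup>2))"


section \<open>The circle group \<open>\<real>/\<int>\<close>\<close>

quotient_type circle = real / "\<lambda>x y :: real. x - y \<in> \<int>"
proof (rule equivpI)
  show "reflp (\<lambda>x y :: real. x - y \<in> \<int>)"
    by (simp add: reflp_def)
  show "symp (\<lambda>x y :: real. x - y \<in> \<int>)"
    by (rule sympI) (metis Ints_minus minus_diff_eq)
  show "transp (\<lambda>x y :: real. x - y \<in> \<int>)"
  proof (rule transpI)
    fix x y z :: real
    assume "x - y \<in> \<int>" "y - z \<in> \<int>"
    then have "(x - y) + (y - z) \<in> \<int>" by (rule Ints_add)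
    then show "x - z \<in> \<int>" by simp
  qed
qed

lift_definition circle_of_real :: "real \<Rightarrow> circle" is "\<lambda>x. x" .

instantiation circle :: ab_group_add
begin

lift_definition zero_circle :: circle is 0 .

lift_definition plus_circle :: "circle \<Rightarrow> circle \<Rightarrow> circle" is "(+)"
proof -
  fix a b c d :: real
  assume "a - b \<in> \<int>" "c - d \<in> \<int>"
  then have "(a - b) + (c - d) \<in> \<int>" by (rule Ints_add)
  then show "a + c - (b + d) \<in> \<int>" by (simp add: algebra_simps)
qed

lift_definition uminus_circle :: "circle \<Rightarrow> circle" is uminus
proof -
  fix a b :: real
  assume "a - b \<in> \<int>"
  then have "- (a - b) \<in> \<int>" by (rule Ints_minus)
  then show "- a - - b \<in> \<int>" by (simp add: algebra_simps)
qed

lift_definition minus_circle :: "circle \<Rightarrow> circle \<Rightarrow> circle" is "(-)"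
proof -
  fix a b c d :: real
  assume "a - b \<in> \<int>" "c - d \<in> \<int>"
  then have "(a - b) - (c - d) \<in> \<int>" by (rule Ints_diff)
  then show "a - c - (b - d) \<in> \<int>" by (simp add: algebra_simps)
qed

instance
  by standard (transfer; simp add: algebra_simps)+

end

lift_definition zmul :: "int \<Rightarrow> circle \<Rightarrow> circle" is "\<lambda>k x. of_int k * x"
proof -
  fix k :: int and x y :: real
  assume "x - y \<in> \<int>"
  then have "of_int k * (x - y) \<in> \<int>" by (intro Ints_mult) auto
  then show "of_int k * x - of_int k * y \<in> \<int>" by (simp add: algebra_simps)
qed


section \<open>Nonclassical polynomials\<close>

text \<open>
  Degree below \<open>m\<close>, i.e. at most \<open>m - 1\<close>. The bound is strict so that \<open>m = 0\<close> needs
  no separate treatment: only the zero function has degree below \<open>0\<close>.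
\<close>

definition poly_deg_less :: "nat \<Rightarrow> nat \<Rightarrow> ((nat \<Rightarrow> bit) \<Rightarrow> circle) \<Rightarrow> bool" where
  "poly_deg_less n m P \<longleftrightarrow>
     (\<forall>x\<in>FF n. \<forall>h\<in>{..<m} \<rightarrow>\<^sub>E FF n.
        (\<Sum>I\<in>Pow {..<m}. zmul ((-1) ^ card I) (P (x + sum h I))) = 0)"

definition poly_deg_le :: "nat \<Rightarrow> nat \<Rightarrow> ((nat \<Rightarrow> bit) \<Rightarrow> circle) \<Rightarrow> bool" where
  "poly_deg_le n d P \<longleftrightarrow> poly_deg_less n (Suc d) P"

definition poly_degree :: "nat \<Rightarrow> ((nat \<Rightarrow> bit) \<Rightarrow> circle) \<Rightarrow> nat" where
  "poly_degree n P = (LEAST d. poly_deg_le n d P)"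

text \<open>
  \<open>poly_expansion n d P \<alpha> c\<close>: \<open>P\<close> equals \<open>\<alpha>\<close> plus the sum of the monomials
  \<open>\<Prod>i\<in>S. \<bar>x\<^sub>i\<bar>\<close> divided by \<open>2\<^sup>k\<^sup>+\<^sup>1\<close>, over the pairs \<open>(S, k)\<close> in \<open>c\<close>. Such a pair stands for
  a coefficient equal to \<open>1\<close>, where \<open>S\<close> is the set of indices with exponent \<open>d\<^sub>i = 1\<close>; all other
  coefficients are \<open>0\<close>.
\<close>

definition poly_expansion ::
  "nat \<Rightarrow> nat \<Rightarrow> ((nat \<Rightarrow> bit) \<Rightarrow> circle) \<Rightarrow> circle \<Rightarrow> (nat set \<times> nat) set \<Rightarrow> bool" where
  "poly_expansion n d P \<alpha> c \<longleftrightarrow>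
     c \<subseteq> {(S, k). S \<subseteq> {..<n} \<and> 0 < card S \<and> card S + k \<le> d} \<and>
     (\<forall>x\<in>FF n. P x =
        \<alpha> + circle_of_real (\<Sum>(S, k)\<in>c. (\<Prod>i\<in>S. of_bool (x i = 1)) / 2 ^ (k + 1)))"

text \<open>
  For a constant \<open>P\<close> there is no nonzero coefficient, and the depth is \<open>Sup {} = 0\<close>. (A factor
  with a constant among its polynomials has rank \<open>0\<close>, so it is never regular.)
\<close>

definition poly_depth :: "nat \<Rightarrow> ((nat \<Rightarrow> bit) \<Rightarrow> circle) \<Rightarrow> nat" where
  "poly_depth n P = Sup {k. \<exists>d \<alpha> c S. poly_expansion n d P \<alpha> c \<and> (S, k) \<in> c}"

definition zero_shift :: "nat \<Rightarrow> ((nat \<Rightarrow> bit) \<Rightarrow> circle) \<Rightarrow> bool" where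
  "zero_shift n P \<longleftrightarrow> (\<exists>d c. poly_expansion n d P 0 c)"

text \<open>
  The rank is infinite if there is no suitable family; this happens for \<open>d = 1\<close> and
  nonconstant \<open>Q\<close>. Zero shift is not required of the members of the family, as changing a
  shift does not affect which functions factor through it.
\<close>

definition d_rank :: "nat \<Rightarrow> nat \<Rightarrow> ((nat \<Rightarrow> bit) \<Rightarrow> circle) \<Rightarrow> enat" where
  "d_rank n d Q =
     Inf {enat (length Qs) | Qs. (\<forall>P\<in>set Qs. poly_deg_less n d P) \<and>
            (\<exists>\<Gamma> :: circle list \<Rightarrow> circle. \<forall>x\<in>FF n. Q x = \<Gamma> (map (\<lambda>P. P x) Qs))}"


section \<open>Polynomial factors\<close>

text \<open>
  A factor is given by the list \<open>Ps\<close> of its defining polynomials; its complexity is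
  \<open>length Ps\<close>. The list is nonempty because growth functions such as \<open>r\<close> are only
  defined at positive complexities.
\<close>

definition poly_factor :: "nat \<Rightarrow> ((nat \<Rightarrow> bit) \<Rightarrow> circle) list \<Rightarrow> bool" where
  "poly_factor n Ps \<longleftrightarrow>
     0 < length Ps \<and> (\<forall>P\<in>set Ps. (\<exists>d. poly_deg_le n d P) \<and> zero_shift n P)"

definition factor_degree :: "nat \<Rightarrow> ((nat \<Rightarrow> bit) \<Rightarrow> circle) list \<Rightarrow> nat" where
  "factor_degree n Ps = Max (poly_degree n ` set Ps)"

definition factor_order :: "nat \<Rightarrow> ((nat \<Rightarrow> bit) \<Rightarrow> circle) list \<Rightarrow> nat" where
  "factor_order n Ps = (\<Prod>i<length Ps. 2 ^ (poly_depth n (Ps ! i) + 1))"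

definition factor_atom ::
  "nat \<Rightarrow> ((nat \<Rightarrow> bit) \<Rightarrow> circle) list \<Rightarrow> circle list \<Rightarrow> (nat \<Rightarrow> bit) set" where
  "factor_atom n Ps b = {x \<in> FF n. map (\<lambda>P. P x) Ps = b}"

definition factor_atoms :: "nat \<Rightarrow> ((nat \<Rightarrow> bit) \<Rightarrow> circle) list \<Rightarrow> (nat \<Rightarrow> bit) set set" where
  "factor_atoms n Ps = range (factor_atom n Ps) - {{}}"

definition cond_avg ::
  "nat \<Rightarrow> ((nat \<Rightarrow> bit) \<Rightarrow> circle) list \<Rightarrow> ((nat \<Rightarrow> bit) \<Rightarrow> real) \<Rightarrow> (nat \<Rightarrow> bit) \<Rightarrow> real" where
  "cond_avg n Ps f x = avg (factor_atom n Ps (map (\<lambda>P. P x) Ps)) f"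

definition factor_rank :: "nat \<Rightarrow> ((nat \<Rightarrow> bit) \<Rightarrow> circle) list \<Rightarrow> enat" where
  "factor_rank n Ps =
     Inf {d_rank n
            (Max ((\<lambda>i. poly_degree n (\<lambda>x. zmul (l i) ((Ps ! i) x))) ` {..<length Ps}))
            (\<lambda>x. \<Sum>i<length Ps. zmul (l i) ((Ps ! i) x))
          | l :: nat \<Rightarrow> int.
            \<exists>i<length Ps. l i mod 2 ^ (poly_depth n (Ps ! i) + 1) \<noteq> 0}"

definition regular_factor :: "nat \<Rightarrow> (nat \<Rightarrow> nat) \<Rightarrow> ((nat \<Rightarrow> bit) \<Rightarrow> circle) list \<Rightarrow> bool" where
  "regular_factor n r Ps \<longleftrightarrow> factor_rank n Ps > enat (r (length Ps))"


section \<open>Regular partitions and reduced matroids\<close>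

definition regular_partition ::
  "nat \<Rightarrow> (nat \<Rightarrow> bit) set \<Rightarrow> (nat \<Rightarrow> real) \<Rightarrow> (nat \<Rightarrow> nat) \<Rightarrow> nat \<Rightarrow>
   ((nat \<Rightarrow> bit) \<Rightarrow> real) \<Rightarrow> ((nat \<Rightarrow> bit) \<Rightarrow> real) \<Rightarrow> ((nat \<Rightarrow> bit) \<Rightarrow> real) \<Rightarrow>
   ((nat \<Rightarrow> bit) \<Rightarrow> circle) list \<Rightarrow> bool" where
  "regular_partition n M \<eta> r d f1 f2 f3 Ps \<longleftrightarrow>
     poly_factor n Ps \<and> factor_degree n Ps \<le> d \<and>
     (\<forall>x\<in>FF n. indicator M x = f1 x + f2 x + f3 x) \<and>
     (\<forall>x\<in>FF n. f1 x = cond_avg n Ps (indicator M) x) \<and>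
     gowers_norm n (d + 1) (\<lambda>x. complex_of_real (f2 x)) \<le> \<eta> (length Ps) \<and>
     (\<exists>\<delta>. l2_norm n f3 \<le> \<delta>) \<and>
     (\<forall>x\<in>FF n. f1 x \<in> {0..1} \<and> f1 x + f3 x \<in> {0..1} \<and>
        f2 x \<in> {-1..1} \<and> f3 x \<in> {-1..1}) \<and>
     regular_factor n r Ps"

definition reduced_matroid ::
  "nat \<Rightarrow> (nat \<Rightarrow> bit) set \<Rightarrow> ((nat \<Rightarrow> bit) \<Rightarrow> real) \<Rightarrow> ((nat \<Rightarrow> bit) \<Rightarrow> circle) list \<Rightarrow>
   real \<Rightarrow> real \<Rightarrow> (nat \<Rightarrow> bit) set" where
  "reduced_matroid n M f3 Ps \<epsilon> \<zeta> =
     \<Union>{b \<in> factor_atoms n Ps.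
          avg b (\<lambda>x. \<bar>f3 x\<bar>\<^sup>2) \<le> \<epsilon>\<^sup>2 \<and> avg b (indicator M :: _ \<Rightarrow> real) \<ge> \<zeta>}"

end

(*
The heart of the matter is that a nonclassical polynomial of degree d over F_2 whose top-order
derivative form is biased has bounded d-rank.  Symmetric multilinear forms over F_2 are handled by
directional Cauchy-Schwarz and an energy-free regularisation: a biased form is, on generic
arguments, a function of boundedly many forms of smaller order, and by equidistribution of the
latter it is a sum over partitions of the arguments into blocks.  For a polynomial P, after a
linear change of variables of bounded corank the form of 2P has no singleton blocks and is again
biased, so induction on d provides a bounded-rank square root R of 2P.  Then P - R is 2-torsion with
an alternating biased top form, and such a form is integrated explicitly: counting block
partitions inside the support of x gives a product of binomial coefficients, which modulo powers of
two depends only on polynomials of smaller degree.  Carrying all further halvings along closes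
the induction.

Given this, the characters of a regular factor evaluated at linear forms either vanish identically
as functions of the remaining variables or have small average, which yields the equidistribution
of the values of the factor, also conditionally on one of the points.  In the counting the
Gowers-small part is removed by telescoping, since degree-d phases do not affect the norm of order
d + 1, and the L2-small part by Chebyshev's inequality.
*)
theory Submission
 imports Defs "HOL-Library.Multiset"
begin

text \<open>Over F_2 polarization cannot recover a polynomial from its top form, as d! is not
  invertible. Its place is taken by D_a D_a = -2 D_a: the top form of P with a repeated argument is
  the top form of 2P. Subtracting a square root of 2P therefore leaves a 2-torsion polynomial, whose
  form is alternating and thus given by its values at sets of basis vectors. The numerical core is
  that binom(w, m) modulo 2^(t+1) depends on w modulo 2^(t+m) only. If w counts blocks of size s,
  the phase w / 2^(t+m) has degree at most s + t + m - 1, which is below d + t when m + s \<le> d.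
  For s \<ge> 2 this follows from m s \<le> d and s < d; for s = 1 and m = d it fails, which is why
  singleton blocks have to be removed beforehand. The condition d \<ge> |N| - 2 reflects that each
  of the |N| - 1 other factors costs one application of Cauchy-Schwarz, while the norm of order d +
  1 provides d + 1 of them. The factor 1 / ||B||^|N| is the share of the trivial character among the
  characters of the values at the |N| points: even for dependent linear forms it contributes
  fully.\<close>

declare add_bit_eq_xor [simp del] mult_bit_eq_and [simp del]

type_synonym vec = "nat => bit"

section \<open>Finite subgroups of an abelian group\<close>

definition fin_grp :: "'a::ab_group_add set => bool" where
 "fin_grp W \<longleftrightarrow> finite W & 0 : W & (\<forall>x\<in>W. \<forall>y\<in>W. x - y : W)"

lemma fin_grp_finite: "fin_grp W ==> finite W"
 and fin_grp_zero: "fin_grp W ==> 0 : W"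
 and fin_grp_diff: "fin_grp W ==> x : W ==> y : W ==> x - y : W"
 by (auto simp: fin_grp_def)

lemma fin_grp_uminus: "fin_grp W ==> x : W ==> - x : W"
 using fin_grp_diff[of W 0 x] fin_grp_zero[of W] by simp

lemma fin_grp_add: "fin_grp W ==> x : W ==> y : W ==> x + y : W"
 using fin_grp_diff[of W x "- y"] fin_grp_uminus[of W y] by simp

lemma fin_grp_card: "fin_grp W ==> card W > 0"
 by (auto simp: fin_grp_def card_gt_0_iff)

lemma fin_grp_sum: "fin_grp W ==> (!!i. i : I ==> f i : W) ==> sum f I : W"
 by (induction I rule: infinite_finite_induct) (auto intro: fin_grp_add fin_grp_zero)

section \<open>Averages\<close>

lemma avg_cong: "(!!x. x : A ==> f x = g x) ==> avg A f = avg A g"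
 by (auto simp: avg_def intro: arg_cong2[where f = "(/)"] sum.cong)

lemma avg_shift:
 assumes "fin_grp W" "b : W"
 shows "avg W (%w. f (w + b)) = avg W f"
proof -
 have "(\<Sum>w\<in>W. f (w + b)) = sum f W"
  by (rule sum.reindex_bij_witness[where i = "%w. w - b" and j = "%w. w + b"])
   (use assms in \<open>auto intro: fin_grp_diff fin_grp_add\<close>)
 then show ?thesis by (simp add: avg_def)
qed

lemma avg_const: "card A > 0 ==> avg A (%_. c) = c"
 by (simp add: avg_def)

lemma avg_cmult_left: "avg A (%x. c * f x) = c * avg A f"
 by (simp add: avg_def sum_distrib_left)

lemma avg_cmult_right: "avg A (%x. f x * c) = avg A f * c"
 by (simp add: avg_def sum_distrib_right)

lemma avg_add: "avg A (%x. f x + g x) = avg A f + avg A g"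
 by (simp add: avg_def sum.distrib add_divide_distrib)

lemma avg_diff: "avg A (%x. f x - g x) = avg A f - avg A g"
 by (simp add: avg_def sum_subtractf diff_divide_distrib)

lemma avg_sum: "avg A (%x. \<Sum>i\<in>I. f i x) = (\<Sum>i\<in>I. avg A (f i))"
 by (simp add: avg_def sum.swap[of _ I] sum_divide_distrib)

lemma avg_swap: "avg A (%a. avg B (%b. f a b)) = avg B (%b. avg A (%a. f a b))"
 by (simp add: avg_def sum_divide_distrib[symmetric] sum.swap[of _ A B] field_simps)

lemma avg_mono:
 fixes f :: "'a => real"
 shows "(!!x. x : A ==> f x \<le> g x) ==> avg A f \<le> avg A g"
 by (auto simp: avg_def intro!: divide_right_mono sum_mono)

lemma avg_nonneg:
 fixes f :: "'a => real"
 shows "(!!x. x : A ==> 0 \<le> f x) ==> 0 \<le> avg A f"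
 by (auto simp: avg_def intro!: divide_nonneg_nonneg sum_nonneg)

lemma norm_avg_le: "norm (avg A f) \<le> avg A (%x. norm (f x))"
 by (auto simp: avg_def norm_divide intro!: divide_right_mono norm_sum)

lemma avg_le_const:
 fixes f :: "'a => real"
 assumes "!!x. x : A ==> f x \<le> c" "0 \<le> c"
 shows "avg A f \<le> c"
proof (cases "card A > 0")
 case True
 have "avg A f \<le> avg A (%_. c)" by (rule avg_mono) (use assms in auto)
 then show ?thesis using True by (simp add: avg_const)
next
 case False
 then show ?thesis using assms by (simp add: avg_def)
qed

lemma avg_of_real: "avg A (%x. of_real (f x)) = (of_real (avg A f) :: complex)"
 by (simp add: avg_def)

lemma Re_avg: "Re (avg A f) = avg A (%x. Re (f x))"
 by (simp add: avg_def Re_divide_of_nat)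

lemma cnj_avg: "cnj (avg A f) = avg A (%x. cnj (f x))"
 by (simp add: avg_def)

lemma avg_square_le:
 fixes f :: "'a => real"
 shows "(avg A f)\<^sup>2 \<le> avg A (%x. (f x)\<^sup>2)"
proof (cases "card A > 0")
 case True
 have "0 \<le> avg A (%x. (f x - avg A f)\<^sup>2)" by (rule avg_nonneg) simp
 also have "... = avg A (%x. (f x)\<^sup>2 - 2 * avg A f * f x + (avg A f)\<^sup>2)"
  by (simp add: power2_diff algebra_simps)
 also have "... = avg A (%x. (f x)\<^sup>2) - (avg A f)\<^sup>2"
  using True by (simp add: avg_add avg_diff avg_cmult_left avg_const power2_eq_square)
 finally show ?thesis by simp
qed (simp add: avg_def)

lemma avg_power_le:
 fixes f :: "'a => real"
 assumes "!!x. x : A ==> 0 \<le> f x"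
 shows "(avg A f) ^ (2 ^ m) \<le> avg A (%x. f x ^ (2 ^ m))"
proof (induction m)
 case (Suc m)
 have "(avg A f) ^ (2 ^ Suc m) = ((avg A f) ^ (2 ^ m))\<^sup>2"
  by (simp add: power_even_eq)
 also have "... \<le> (avg A (%x. f x ^ (2 ^ m)))\<^sup>2"
  by (rule power_mono[OF Suc.IH]) (simp add: avg_nonneg assms)
 also have "... \<le> avg A (%x. (f x ^ (2 ^ m))\<^sup>2)"
  by (rule avg_square_le)
 finally show ?case by (simp add: power_even_eq)
qed simp

section \<open>Iterated averages over lists of fixed length\<close>

fun EE :: "'a set => nat => ('a list => 'b::real_normed_field) => 'b" where
 "EE A 0 F = F []"
| "EE A (Suc m) F = avg A (%a. EE A m (%as. F (a # as)))"

lemma EE_cong: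
 "(!!as. length as = m ==> set as \<subseteq> A ==> F as = G as) ==> EE A m F = EE A m G"
proof (induction m arbitrary: F G)
 case (Suc m)
 have "EE A m (%as. F (a # as)) = EE A m (%as. G (a # as))" if "a : A" for a
  by (rule Suc.IH, rule Suc.prems) (use that in auto)
 then show ?case unfolding EE.simps by (rule avg_cong)
qed simp

lemma EE_add: "EE A m (%as. F as + G as) = EE A m F + EE A m G"
 by (induction m arbitrary: F G) (auto simp: avg_add)

lemma EE_cmult: "EE A m (%as. c * F as) = c * EE A m F"
 by (induction m arbitrary: F) (auto simp: avg_cmult_left)

lemma EE_const: "card A > 0 ==> EE A m (%_. c) = c"
 by (induction m) (auto simp: avg_const)

lemma EE_avg_swap: "EE A m (%as. avg B (%b. F as b)) = avg B (%b. EE A m (%as. F as b))"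
proof (induction m arbitrary: F)
 case (Suc m)
 show ?case unfolding EE.simps Suc.IH by (rule avg_swap)
qed simp

lemma EE_avg_lists: "EE A m F = avg {as. set as \<subseteq> A & length as = m} F"
proof (induction m arbitrary: F)
 case 0
 have "{as. set as \<subseteq> A & length as = 0} = {[]}" by auto
 then show ?case by (simp add: avg_def)
next
 case (Suc m)
 let ?L = "%m. {as. set as \<subseteq> A & length as = m}"
 show ?case
 proof (cases "finite A")
  case True
  have L: "?L (Suc m) = (%(a, as). a # as) ` (A \<times> ?L m)"
   by (auto simp: length_Suc_conv image_iff)
  have inj: "inj_on (%(a, as). a # as) (A \<times> ?L m)" by (auto simp: inj_on_def)
  have "sum F (?L (Suc m)) = (\<Sum>a\<in>A. \<Sum>as\<in>?L m. F (a # as))"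
   unfolding L by (subst sum.reindex[OF inj]) (simp add: sum.cartesian_product case_prod_unfold)
  moreover have "card (?L (Suc m)) = card A * card (?L m)"
   unfolding L by (subst card_image[OF inj]) (simp add: card_cartesian_product)
  ultimately show ?thesis
   by (simp add: Suc.IH avg_def sum_divide_distrib[symmetric] mult.commute)
 next
  case False
  \<comment> \<open>For infinite \<open>A\<close> the set of lists is infinite too, and both sides
    are 0 because \<open>avg\<close> over an infinite set is.\<close>
  have "infinite (?L (Suc m))"
  proof
   assume fin: "finite (?L (Suc m))"
   have "(%a. replicate (Suc m) a) ` A \<subseteq> ?L (Suc m)" by auto
   moreover have "inj_on (%a. replicate (Suc m) a) A" by (auto simp: inj_on_def)
   ultimately show False using fin False by (meson finite_imageD finite_subset)
  qed
  then have "avg (?L (Suc m)) F = 0" by (simp add: avg_def)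
  moreover have "EE A (Suc m) F = 0" using False by (simp add: avg_def)
  ultimately show ?thesis by simp
 qed
qed

section \<open>Directional Cauchy--Schwarz\<close>

definition Dl :: "'w::ab_group_add => ('w => complex) => 'w => complex" where
 "Dl b F w = F (w + b) * cnj (F w)"

fun Dls :: "('a => 'w::ab_group_add) list => 'a list => ('w => complex) => 'w => complex" where
 "Dls (i # is) (a # as) F = Dls is as (Dl (i a) F)"
| "Dls _ _ F = F"

text \<open>A direction is a homomorphism from a parameter group into the domain, not a single
  vector, so that averages run over all translates along it. The directions used later shift one
  coordinate of a tuple (\<open>sing\<close>) or a whole set of coordinates
  (\<open>msing\<close>).\<close>

definition dirhom :: "'a::ab_group_add set => 'w::ab_group_add set => ('a => 'w) => bool" where
 "dirhom A W i \<longleftrightarrow> (\<forall>a\<in>A. i a : W) & (\<forall>a\<in>A. \<forall>b\<in>A. i (a - b) = i a - i b)"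

definition inv_dir :: "'a set => 'w::ab_group_add set => ('a => 'w) => ('w => 'c) => bool" where
 "inv_dir A W i H \<longleftrightarrow> (\<forall>w\<in>W. \<forall>a\<in>A. H (w + i a) = H w)"

lemma Dl_bound:
 assumes "fin_grp W" "b : W" "!!w. w : W ==> cmod (F w) \<le> 1" "w : W"
 shows "cmod (Dl b F w) \<le> 1"
 using mult_mono[of "cmod (F (w + b))" 1 "cmod (F w)" 1] assms(3)[OF fin_grp_add[OF assms(1,4,2)]]
  assms(3)[OF assms(4)]
 by (simp add: Dl_def norm_mult)

lemma Dl_prod_list:
 "Dl b (%w. G w * prod_list (map (%(i, H). H w) L)) w
  = Dl b G w * prod_list (map (%(i, H). H w) (map (%(i, H). (i, Dl b H)) L))"
proof (induction L arbitrary: G)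
 case (Cons iH L)
 obtain i H where iH: "iH = (i, H)" by fastforce
 have "Dl b (%w. G w * prod_list (map (%(i, H). H w) (iH # L))) w
   = Dl b (%w. (G w * H w) * prod_list (map (%(i, H). H w) L)) w"
  by (simp add: iH mult.assoc)
 also have "... = Dl b (%w. G w * H w) w * prod_list (map (%(i, H). H w) (map (%(i, H). (i, Dl b H)) L))"
  by (rule Cons.IH)
 also have "Dl b (%w. G w * H w) w = Dl b G w * Dl b H w"
  by (simp add: Dl_def)
 finally show ?case by (simp add: iH mult.assoc)
qed simp

text \<open>Averaging over the translates by \<open>i a\<close> does not change the mean and lets
  the invariant \<open>H\<close> factor out; Cauchy-Schwarz then removes \<open>H\<close>. Expanding
  the square gives pairs \<open>a\<close>, \<open>b\<close>, and the homomorphism property merges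
  them into the single increment \<open>i (a - b)\<close>.\<close>

lemma CS_step:
 assumes W: "fin_grp W" and A: "fin_grp A" and i: "dirhom A W i"
  and H: "!!w. w : W ==> cmod (H w) \<le> 1" "inv_dir A W i H"
 shows "(cmod (avg W (%w. F w * H w)))\<^sup>2 \<le> Re (avg A (%a. avg W (Dl (i a) F)))"
proof -
 have iW: "a : A ==> i a : W" and id: "a : A ==> b : A ==> i (a - b) = i a - i b" for a b
  using i by (auto simp: dirhom_def)
 let ?K = "%w. avg A (%a. F (w + i a))"
 have "avg W (%w. F w * H w) = avg A (%a. avg W (%w. F (w + i a) * H (w + i a)))"
  using avg_shift[OF W iW, of _ "%w. F w * H w"] A
  by (subst avg_cong[where g = "%_. avg W (%w. F w * H w)"]) (auto simp: avg_const fin_grp_card)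
 also have "... = avg A (%a. avg W (%w. F (w + i a) * H w))"
  using H(2) by (intro avg_cong) (auto simp: inv_dir_def)
 also have "... = avg W (%w. ?K w * H w)"
  by (subst avg_swap) (simp add: avg_cmult_right)
 finally have E: "avg W (%w. F w * H w) = avg W (%w. ?K w * H w)" .
 have "cmod (avg W (%w. ?K w * H w)) \<le> avg W (%w. cmod (?K w))"
  using norm_avg_le[of W "%w. ?K w * H w"]
  by (rule order_trans) (auto intro!: avg_mono simp: norm_mult mult_left_le H(1))
 then have "(cmod (avg W (%w. F w * H w)))\<^sup>2 \<le> (avg W (%w. cmod (?K w)))\<^sup>2"
  unfolding E by (intro power_mono) auto
 also have "... \<le> avg W (%w. (cmod (?K w))\<^sup>2)" by (rule avg_square_le)
 also have "... = Re (avg W (%w. ?K w * cnj (?K w)))"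
  by (simp only: Re_avg complex_norm_square[symmetric] Re_complex_of_real)
 also have "avg W (%w. ?K w * cnj (?K w))
   = avg W (%w. avg A (%b. avg A (%a. F (w + i a) * cnj (F (w + i b)))))"
  by (simp only: avg_cmult_right avg_cmult_left cnj_avg)
 also have "... = avg A (%b. avg A (%a. avg W (%w. F (w + i a) * cnj (F (w + i b)))))"
  by (subst avg_swap, rule avg_cong, subst avg_swap, rule refl)
 also have "... = avg A (%b. avg A (%a. avg W (%w. F (w + i (a - b)) * cnj (F w))))"
 proof (rule avg_cong, rule avg_cong)
  fix b a assume ab: "b : A" "a : A"
  have "avg W (%w. F (w + i a) * cnj (F (w + i b)))
    = avg W (%w. F ((w + i b) + i (a - b)) * cnj (F (w + i b)))"
   using ab by (simp add: id)
  also have "... = avg W (%w. F (w + i (a - b)) * cnj (F w))"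
   by (rule avg_shift[OF W iW[OF ab(1)], of "%w. F (w + i (a - b)) * cnj (F w)"])
  finally show "avg W (%w. F (w + i a) * cnj (F (w + i b)))
    = avg W (%w. F (w + i (a - b)) * cnj (F w))" .
 qed
 also have "... = avg A (%b. avg A (%a. avg W (%w. F (w + i a) * cnj (F w))))"
 proof (rule avg_cong)
  fix b assume b: "b : A"
  show "avg A (%a. avg W (%w. F (w + i (a - b)) * cnj (F w)))
    = avg A (%a. avg W (%w. F (w + i a) * cnj (F w)))"
   using avg_shift[OF A fin_grp_uminus[OF A b], of "%a. avg W (%w. F (w + i a) * cnj (F w))"]
   by simp
 qed
 also have "... = avg A (%a. avg W (Dl (i a) F))"
  using A by (simp add: avg_const fin_grp_card Dl_def[abs_def])
 finally show ?thesis .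
qed

text \<open>Every step removes one factor. The remaining factors are differenced along
  \<open>i a\<close>; they stay bounded, and they stay invariant in their own directions because
  translations commute, so the induction goes on with a shorter list.\<close>

lemma directional_CS:
 assumes W: "fin_grp W" and A: "fin_grp A"
 shows "[|length L = Suc m; \<forall>w\<in>W. cmod (G w) \<le> 1;
   \<forall>(i, H)\<in>set L. dirhom A W i & (\<forall>w\<in>W. cmod (H w) \<le> 1) & inv_dir A W i H|] ==>
  cmod (avg W (%w. G w * prod_list (map (%(i, H). H w) L))) ^ (2 ^ Suc m)
   \<le> Re (EE A (Suc m) (%as. avg W (Dls (map fst L) as G)))"
proof (induction m arbitrary: L G)
 case 0
 then obtain i H where L: "L = [(i, H)]" by (cases L) auto
 show ?case using CS_step[OF W A, of i H G] 0 L by simp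
next
 case (Suc m)
 obtain i H L' where L: "L = (i, H) # L'" "length L' = Suc m"
  using Suc.prems(1) by (cases L) auto
 let ?F = "%w. G w * prod_list (map (%(i, H). H w) L')"
 let ?L = "%a. map (%(j, H). (j, Dl (i a) H)) L'"
 have iH: "dirhom A W i" "!!w. w : W ==> cmod (H w) \<le> 1" "inv_dir A W i H"
  using Suc.prems(3) L by auto
 have fstL: "map fst (?L a) = map fst L'" for a
  by (auto simp: case_prod_unfold)
 have IH: "cmod (avg W (Dl (i a) ?F)) ^ (2 ^ Suc m) \<le> Re (EE A (Suc m) (%as. avg W (Dls (map fst L') as (Dl (i a) G))))"
  if a: "a : A" for a
 proof -
  have ia: "i a : W" using iH(1) a by (auto simp: dirhom_def)
  have "\<forall>(j, K)\<in>set (?L a). dirhom A W j & (\<forall>w\<in>W. cmod (K w) \<le> 1) & inv_dir A W j K"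
  proof (clarsimp)
   fix j K assume jK: "(j, K) : set L'"
   then have p: "dirhom A W j" "\<forall>w\<in>W. cmod (K w) \<le> 1" "inv_dir A W j K"
    using Suc.prems(3) L by auto
   have "inv_dir A W j (Dl (i a) K)"
    unfolding inv_dir_def Dl_def
   proof (intro ballI)
    fix w b assume w: "w : W" "b : A"
    have "K (w + j b + i a) = K ((w + i a) + j b)" by (simp add: ac_simps)
    also have "... = K (w + i a)"
     using p(3) w fin_grp_add[OF W w(1) ia] unfolding inv_dir_def by blast
    finally show "K (w + j b + i a) * cnj (K (w + j b)) = K (w + i a) * cnj (K w)"
     using p(3) w by (auto simp: inv_dir_def)
   qed
   then show "dirhom A W j & (\<forall>w\<in>W. cmod (Dl (i a) K w) \<le> 1) & inv_dir A W j (Dl (i a) K)"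
    using p Dl_bound[OF W ia, of K] by auto
  qed
  moreover have "\<forall>w\<in>W. cmod (Dl (i a) G w) \<le> 1"
   using Suc.prems(2) Dl_bound[OF W ia, of G] by auto
  ultimately have "cmod (avg W (%w. Dl (i a) G w * prod_list (map (%(i, H). H w) (?L a)))) ^ (2 ^ Suc m)
    \<le> Re (EE A (Suc m) (%as. avg W (Dls (map fst (?L a)) as (Dl (i a) G))))"
   using L(2) by (intro Suc.IH) auto
  moreover have "avg W (Dl (i a) ?F) = avg W (%w. Dl (i a) G w * prod_list (map (%(i, H). H w) (?L a)))"
   by (rule avg_cong) (rule Dl_prod_list)
  ultimately show ?thesis by (simp only: fstL)
 qed
 have F: "(%w. G w * prod_list (map (%(i, H). H w) L)) = (%w. ?F w * H w)"
  by (simp add: L ac_simps)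
 have "cmod (avg W (%w. ?F w * H w)) ^ (2 ^ Suc (Suc m)) = ((cmod (avg W (%w. ?F w * H w)))\<^sup>2) ^ (2 ^ Suc m)"
  by (simp add: power_mult)
 also have "... \<le> (avg A (%a. cmod (avg W (Dl (i a) ?F)))) ^ (2 ^ Suc m)"
 proof (intro power_mono)
  have "(cmod (avg W (%w. ?F w * H w)))\<^sup>2 \<le> Re (avg A (%a. avg W (Dl (i a) ?F)))"
   by (rule CS_step[OF W A iH])
  also have "... \<le> cmod (avg A (%a. avg W (Dl (i a) ?F)))" by (rule complex_Re_le_cmod)
  also have "... \<le> avg A (%a. cmod (avg W (Dl (i a) ?F)))" by (rule norm_avg_le)
  finally show "(cmod (avg W (%w. ?F w * H w)))\<^sup>2 \<le> avg A (%a. cmod (avg W (Dl (i a) ?F)))" .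
 qed simp
 also have "... \<le> avg A (%a. cmod (avg W (Dl (i a) ?F)) ^ (2 ^ Suc m))"
  by (rule avg_power_le) simp
 also have "... \<le> avg A (%a. Re (EE A (Suc m) (%as. avg W (Dls (map fst L') as (Dl (i a) G)))))"
  by (rule avg_mono) (rule IH)
 also have "... = Re (EE A (Suc (Suc m)) (%as. avg W (Dls (map fst L) as G)))"
  by (simp add: L Re_avg del: EE.simps(2)) (simp add: Re_avg)
 finally show ?case unfolding F .
qed

section \<open>Vectors over F_2 and groups of tuples of vectors\<close>

lemma bit_add_self: "(b::bit) + b = 0"
 by (cases b) auto

lemma vec_add_self: "(x::vec) + x = 0"
 by (rule ext) (simp add: bit_add_self)

lemma finite_UNIV_bit: "finite (UNIV :: bit set)"
proof -
 have "UNIV = {0, 1 :: bit}" by (auto intro: bit_not_one_iff[THEN iffD1])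
 then show ?thesis by (metis finite.emptyI finite_insert)
qed

lemma vec_minus: "(x::vec) - y = x + y"
 using vec_add_self[of y] by (metis add.right_neutral add_diff_cancel_right' add.assoc)

lemma fin_grp_FF: "fin_grp (FF n)"
proof -
 have "finite {f :: vec. \<forall>x. (x : {..<n} --> f x : UNIV) & (x \<notin> {..<n} --> f x = 0)}"
  by (rule finite_set_of_finite_funs) (auto intro: finite_UNIV_bit)
 moreover have "FF n = {f :: vec. \<forall>x. (x : {..<n} --> f x : UNIV) & (x \<notin> {..<n} --> f x = 0)}"
  by (auto simp: FF_def)
 ultimately have "finite (FF n)" by simp
 then show ?thesis by (auto simp: fin_grp_def FF_def)
qed

lemmas FF_add = fin_grp_add[OF fin_grp_FF] and FF_zero = fin_grp_zero[OF fin_grp_FF]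
 and FF_sum = fin_grp_sum[OF fin_grp_FF] and FF_finite = fin_grp_finite[OF fin_grp_FF]
 and FF_card_pos = fin_grp_card[OF fin_grp_FF]

text \<open>Tuples are total functions that vanish off \<open>I\<close>, so that pointwise addition
  makes them a finite group and averages over them are translation invariant.\<close>

definition VI :: "'i set => nat => ('i => vec) set" where
 "VI I n = {h. (\<forall>i\<in>I. h i : FF n) & (\<forall>i. i \<notin> I --> h i = 0)}"

lemma VI_D: "h : VI I n ==> h i : FF n"
 by (cases "i : I") (auto simp: VI_def FF_zero)

lemma fin_grp_VI: "finite I ==> fin_grp (VI I n)"
proof -
 assume I: "finite I"
 have "finite {h. \<forall>i. (i : I --> h i : FF n) & (i \<notin> I --> h i = 0)}"
  by (rule finite_set_of_finite_funs) (use I FF_finite in auto)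
 moreover have "VI I n = {h. \<forall>i. (i : I --> h i : FF n) & (i \<notin> I --> h i = 0)}"
  by (auto simp: VI_def)
 ultimately show ?thesis
  by (auto simp: fin_grp_def VI_def intro: FF_zero fin_grp_diff[OF fin_grp_FF])
qed

definition sing :: "'i => vec => 'i => vec" where
 "sing i a = (%k. if k = i then a else 0)"

lemma dirhom_sing: "i : I ==> dirhom (FF n) (VI I n) (sing i)"
 by (auto simp: dirhom_def VI_def sing_def FF_zero)

lemma EE_VI: "EE (FF n) m F = avg (VI {..<m} n) (%h. F (map h [0..<m]))"
proof -
 let ?L = "{as. set as \<subseteq> FF n & length as = m}"
 have bij: "bij_betw (%h. map h [0..<m]) (VI {..<m} n) ?L"
 proof (rule bij_betw_byWitness[where f' = "%as i. if i < m then as ! i else 0"])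
  show "\<forall>h\<in>VI {..<m} n. (%i. if i < m then map h [0..<m] ! i else 0) = h"
   by (auto simp: VI_def fun_eq_iff)
  show "\<forall>as\<in>?L. map (%i. if i < m then as ! i else 0) [0..<m] = as"
   by (auto intro: nth_equalityI)
  show "(%h. map h [0..<m]) ` VI {..<m} n \<subseteq> ?L"
   by (auto intro: VI_D)
  show "(%as i. if i < m then as ! i else 0) ` ?L \<subseteq> VI {..<m} n"
   by (auto simp: VI_def FF_zero)
 qed
 show ?thesis
  using sum.reindex_bij_betw[OF bij, of F] bij_betw_same_card[OF bij]
  by (simp add: EE_avg_lists avg_def)
qed

section \<open>Phases and iterated differences\<close>

text \<open>A unitary character of the group of values. The two instances are \<open>\<chi>\<close>
  on bits and \<open>ee\<close> on the circle.\<close>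

definition phase :: "('g::ab_group_add => complex) => bool" where
 "phase \<phi> \<longleftrightarrow> (\<forall>x y. \<phi> (x - y) = \<phi> x * cnj (\<phi> y)) & (\<forall>x. cmod (\<phi> x) = 1)"

fun Ds :: "('a => 'w::ab_group_add) list => 'a list => ('w => 'g::ab_group_add) => 'w => 'g" where
 "Ds (i # is) (a # as) f = Ds is as (%w. f (w + i a) - f w)"
| "Ds _ _ f = f"

lemma Dls_phase: "phase \<phi> ==> Dls is as (%w. \<phi> (f w)) = (%w. \<phi> (Ds is as f w))"
proof (induction "is" as f rule: Ds.induct)
 case (1 i "is" a as f)
 have "Dl (i a) (%w. \<phi> (f w)) = (%w. \<phi> (f (w + i a) - f w))"
  using 1(2) by (simp add: Dl_def phase_def fun_eq_iff)
 then show ?case using 1 by simp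
qed auto

lemma Ds_zero: "Ds is as (%_. 0) = (%_. 0)"
proof (induction "is" arbitrary: as)
 case (Cons i "is")
 then show ?case by (cases as) auto
qed simp

lemma Ds_add: "Ds is as (%w. f w + g w) = (%w. Ds is as f w + Ds is as g w)"
proof (induction "is" arbitrary: as f g)
 case (Cons i "is")
 show ?case
 proof (cases as)
  case (Cons a as')
  have "(%w. f (w + i a) + g (w + i a) - (f w + g w))
    = (%w. (f (w + i a) - f w) + (g (w + i a) - g w))" by (auto simp: fun_eq_iff)
  then show ?thesis
   using Cons.IH[of as' "%w. f (w + i a) - f w" "%w. g (w + i a) - g w"] by (simp add: Cons)
 qed simp
qed simp

lemma Ds_sum: "Ds is as (%w. \<Sum>k\<in>I. f k w) = (%w. \<Sum>k\<in>I. Ds is as (f k) w)"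
 by (induction I rule: infinite_finite_induct) (auto simp: Ds_zero Ds_add)

lemma Ds_cong:
 assumes "fin_grp W" "\<forall>i\<in>set is. dirhom A W i" "set as \<subseteq> A"
  "!!w. w : W ==> f w = g w" "w : W"
 shows "Ds is as f w = Ds is as g w"
 using assms(2-)
proof (induction "is" arbitrary: as f g)
 case (Cons i "is")
 show ?case
 proof (cases as)
  case (Cons a as')
  have "i a : W" using Cons.prems(1,2) Cons by (auto simp: dirhom_def)
  then show ?thesis
   using Cons.prems Cons fin_grp_add[OF assms(1)]
   by (auto intro!: Cons.IH)
 qed (use Cons.prems in auto)
qed auto

text \<open>The difference in the invariant direction is 0 when its turn comes, since the earlier
  differences in other directions preserve the invariance.\<close>

lemma Ds_inv:
 assumes W: "fin_grp W"
 shows "[|\<forall>i\<in>set is. dirhom A W i; set as \<subseteq> A; length as = length is; i : set is;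
  inv_dir A W i f; w : W|] ==> Ds is as f w = 0"
proof (induction "is" arbitrary: as f)
 case (Cons j "is")
 obtain a as' where as: "as = a # as'" using Cons.prems(3) by (cases as) auto
 have ja: "j a : W" using Cons.prems(1,2) as by (auto simp: dirhom_def)
 show ?case
 proof (cases "i = j")
  case True
  have "Ds is as' (%w. f (w + j a) - f w) w = Ds is as' (%_. 0) w"
   by (rule Ds_cong[OF W, of _ A]) (use Cons.prems True as in \<open>auto simp: inv_dir_def\<close>)
  then show ?thesis using as by (simp add: Ds_zero)
 next
  case False
  have "inv_dir A W i (%w. f (w + j a) - f w)"
   unfolding inv_dir_def
  proof (intro ballI)
   fix w b assume w: "w : W" "b : A"
   have "f (w + i b + j a) = f ((w + j a) + i b)" by (simp add: ac_simps)
   also have "... = f (w + j a)"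
    using Cons.prems(5) w fin_grp_add[OF W w(1) ja] unfolding inv_dir_def by blast
   finally show "f (w + i b + j a) - f (w + i b) = f (w + j a) - f w"
    using Cons.prems(5) w by (auto simp: inv_dir_def)
  qed
  then have "Ds is as' (%w. f (w + j a) - f w) w = 0"
   using Cons.prems False as by (intro Cons.IH) auto
  then show ?thesis using as by simp
 qed
qed simp

text \<open>The case in which Cauchy-Schwarz is applied to a phase whose exponent has a full
  difference that is constant in the base point: the average over \<open>W\<close> disappears and
  only the increments remain.\<close>

lemma phase_bound:
 assumes W: "fin_grp W" and A: "fin_grp A" and ph: "phase \<phi>" and L: "length L = Suc m"
  and H: "\<forall>(i, H)\<in>set L. dirhom A W i & (\<forall>w\<in>W. cmod (H w) \<le> 1) & inv_dir A W i H"
  and D: "!!as w. length as = Suc m ==> set as \<subseteq> A ==> w : W ==> Ds (map fst L) as \<psi> w = \<Theta> as"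
 shows "cmod (avg W (%w. \<phi> (\<psi> w) * prod_list (map (%(i, H). H w) L))) ^ (2 ^ Suc m)
   \<le> Re (EE A (Suc m) (%as. \<phi> (\<Theta> as)))"
proof -
 have "cmod (avg W (%w. \<phi> (\<psi> w) * prod_list (map (%(i, H). H w) L))) ^ (2 ^ Suc m)
   \<le> Re (EE A (Suc m) (%as. avg W (Dls (map fst L) as (%w. \<phi> (\<psi> w)))))"
  by (rule directional_CS[OF W A L _ H]) (use ph in \<open>auto simp: phase_def\<close>)
 also have "EE A (Suc m) (%as. avg W (Dls (map fst L) as (%w. \<phi> (\<psi> w))))
   = EE A (Suc m) (%as. \<phi> (\<Theta> as))"
 proof (rule EE_cong)
  fix as assume as: "length as = Suc m" "set as \<subseteq> A"
  have "avg W (Dls (map fst L) as (%w. \<phi> (\<psi> w))) = avg W (%w. \<phi> (\<Theta> as))"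
   by (rule avg_cong) (simp add: Dls_phase[OF ph] D as)
  then show "avg W (Dls (map fst L) as (%w. \<phi> (\<psi> w))) = \<phi> (\<Theta> as)"
   using fin_grp_card[OF W] by (simp add: avg_const)
 qed
 finally show ?thesis .
qed

section \<open>Symmetric multilinear forms as functions of multisets\<close>

definition \<chi> :: "bit => complex" where
 "\<chi> b = (if b = 0 then 1 else -1)"

lemma phase_\<chi>: "phase \<chi>"
proof -
 have "\<chi> (x - y) = \<chi> x * cnj (\<chi> y)" for x y
  by (cases x; cases y) (auto simp: \<chi>_def)
 then show ?thesis by (auto simp: phase_def \<chi>_def)
qed

lemma \<chi>_add: "\<chi> (x + y) = \<chi> x * \<chi> y"
 by (cases x; cases y) (auto simp: \<chi>_def)

lemma \<chi>_zero [simp]: "\<chi> 0 = 1"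
 by (simp add: \<chi>_def)

lemma \<chi>_sum: "\<chi> (sum f I) = (\<Prod>i\<in>I. \<chi> (f i))"
 by (induction I rule: infinite_finite_induct) (auto simp: \<chi>_add \<chi>_zero)

text \<open>With a multiset as argument, symmetry is built in. \<open>alt\<close> is a parameter so
  that one development serves symmetric and alternating forms; families generating an alternating
  form are then alternating as well.\<close>

definition form :: "bool => nat => nat => (vec multiset => bit) => bool" where
 "form alt n s T \<longleftrightarrow>
   (\<forall>a\<in>FF n. \<forall>b\<in>FF n. \<forall>M. set_mset M \<subseteq> FF n & Suc (size M) = s -->
    T (add_mset (a + b) M) = T (add_mset a M) + T (add_mset b M)) &
   (alt --> (\<forall>a\<in>FF n. \<forall>M. set_mset M \<subseteq> FF n & Suc (Suc (size M)) = s -->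
    T (add_mset a (add_mset a M)) = 0))"

text \<open>The arguments of a symmetric form are collected in a multiset.\<close>

definition hm :: "('i => vec) => 'i set => vec multiset" where
 "hm h J = image_mset h (mset_set J)"

lemma hm_empty [simp]: "hm h {} = {#}"
 by (simp add: hm_def)

lemma hm_insert: "finite J ==> j \<notin> J ==> hm h (insert j J) = add_mset (h j) (hm h J)"
 by (simp add: hm_def)

lemma hm_remove: "finite J ==> j : J ==> hm h J = add_mset (h j) (hm h (J - {j}))"
 using hm_insert[of "J - {j}" j h] by (simp add: insert_absorb)

lemma size_hm [simp]: "size (hm h J) = card J"
 by (simp add: hm_def)

lemma set_hm: "finite J ==> set_mset (hm h J) = h ` J"
 by (simp add: hm_def)

lemma hm_cong: "(!!i. i : J ==> h i = k i) ==> hm h J = hm k J"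
 by (cases "finite J") (auto simp: hm_def intro: image_mset_cong)

lemma hm_bij: "bij_betw g I J ==> hm h J = hm (h \<circ> g) I"
proof -
 assume g: "bij_betw g I J"
 then have "mset_set J = image_mset g (mset_set I)"
  by (simp add: image_mset_mset_set bij_betw_def)
 then show ?thesis by (simp add: hm_def multiset.map_comp)
qed

lemma hm_mset_upt: "hm h {..<m} = mset (map h [0..<m])"
 by (simp add: hm_def mset_set_upto_eq_mset_upto)

lemma form_add:
 "form alt n s T ==> a : FF n ==> b : FF n ==> set_mset M \<subseteq> FF n ==> Suc (size M) = s ==>
  T (add_mset (a + b) M) = T (add_mset a M) + T (add_mset b M)"
 by (auto simp: form_def)

lemma form_zero:
 assumes "form alt n s T" "set_mset M \<subseteq> FF n" "Suc (size M) = s"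
 shows "T (add_mset 0 M) = 0"
 using form_add[OF assms(1) FF_zero FF_zero assms(2,3)] by simp

lemma form_slice:
 assumes "form alt n s T" "set_mset A \<subseteq> FF n"
 shows "form alt n (s - size A) (%M. T (M + A))"
 unfolding form_def
proof (intro conjI ballI allI impI)
 fix a b M assume "a : FF n" "b : FF n" "set_mset M \<subseteq> FF n & Suc (size M) = s - size A"
 then show "T (add_mset (a + b) M + A) = T (add_mset a M + A) + T (add_mset b M + A)"
  using form_add[OF assms(1), of a b "M + A"] assms(2) by auto
next
 fix a M assume "alt" "a : FF n" "set_mset M \<subseteq> FF n & Suc (Suc (size M)) = s - size A"
 moreover from this have "set_mset (M + A) \<subseteq> FF n & Suc (Suc (size (M + A))) = s"
  using assms(2) by auto
 ultimately have "T (add_mset a (add_mset a (M + A))) = 0"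
  using assms(1) unfolding form_def by blast
 then show "T (add_mset a (add_mset a M) + A) = 0" by simp
qed

lemma form_sum:
 assumes "!!k. k : K ==> form alt n s (T k)"
 shows "form alt n s (%M. \<Sum>k\<in>K. T k M)"
 unfolding form_def
proof (intro conjI ballI allI impI)
 fix a b M assume "a : FF n" "b : FF n" "set_mset M \<subseteq> FF n & Suc (size M) = s"
 then show "(\<Sum>k\<in>K. T k (add_mset (a + b) M)) = (\<Sum>k\<in>K. T k (add_mset a M)) + (\<Sum>k\<in>K. T k (add_mset b M))"
  unfolding sum.distrib[symmetric] by (intro sum.cong refl form_add[OF assms]) auto
next
 fix a M assume "alt" "a : FF n" "set_mset M \<subseteq> FF n & Suc (Suc (size M)) = s"
 then show "(\<Sum>k\<in>K. T k (add_mset a (add_mset a M))) = 0"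
  using assms by (intro sum.neutral) (auto simp: form_def)
qed

definition lin :: "nat => (vec => vec) => bool" where
 "lin n \<pi> \<longleftrightarrow> (\<forall>a\<in>FF n. \<pi> a : FF n) & (\<forall>a\<in>FF n. \<forall>b\<in>FF n. \<pi> (a + b) = \<pi> a + \<pi> b)"

lemma form_expand:
 assumes T: "form alt n s T" and J: "finite J"
 shows "[|card J + size A = s; x ` J \<subseteq> FF n; y ` J \<subseteq> FF n; set_mset A \<subseteq> FF n|] ==>
  T (hm (%i. x i + y i) J + A) = (\<Sum>K\<in>Pow J. T (hm x K + hm y (J - K) + A))"
 using J
proof (induction J arbitrary: A)
 case empty
 then show ?case by simp
next
 case (insert j J)
 let ?xy = "%i. x i + y i"
 have "set_mset (hm ?xy J) \<subseteq> FF n"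
  using insert by (auto simp: set_hm intro!: FF_add)
 then have "T (hm ?xy (insert j J) + A)
   = T (add_mset (x j) (hm ?xy J + A)) + T (add_mset (y j) (hm ?xy J + A))"
  using insert by (subst form_add[OF T, symmetric]) (auto simp: hm_insert)
 also have "T (add_mset (x j) (hm ?xy J + A)) = (\<Sum>K\<in>Pow J. T (hm x K + hm y (J - K) + add_mset (x j) A))"
  using insert by (subst insert.IH[symmetric]) auto
 also have "... = (\<Sum>K\<in>Pow J. T (hm x (insert j K) + hm y (insert j J - insert j K) + A))"
 proof (rule sum.cong[OF refl])
  fix K assume K: "K : Pow J"
  then have "finite K" "j \<notin> K" "insert j J - insert j K = J - K"
   using insert by (auto intro: finite_subset)
  then show "T (hm x K + hm y (J - K) + add_mset (x j) A)
    = T (hm x (insert j K) + hm y (insert j J - insert j K) + A)"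
   by (simp add: hm_insert)
 qed
 also have "... = (\<Sum>K\<in>insert j ` Pow J. T (hm x K + hm y (insert j J - K) + A))"
  using insert.hyps by (subst sum.reindex) (auto simp: inj_on_def)
 also have "T (add_mset (y j) (hm ?xy J + A)) = (\<Sum>K\<in>Pow J. T (hm x K + hm y (J - K) + add_mset (y j) A))"
  using insert by (subst insert.IH[symmetric]) auto
 also have "... = (\<Sum>K\<in>Pow J. T (hm x K + hm y (insert j J - K) + A))"
 proof (rule sum.cong[OF refl])
  fix K assume K: "K : Pow J"
  then have "insert j J - K = insert j (J - K)" "j \<notin> J - K" "finite (J - K)"
   using insert by auto
  then show "T (hm x K + hm y (J - K) + add_mset (y j) A) = T (hm x K + hm y (insert j J - K) + A)"
   by (simp add: hm_insert)
 qed
 finally have "T (hm ?xy (insert j J) + A)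
   = (\<Sum>K\<in>Pow J. T (hm x K + hm y (insert j J - K) + A))
    + (\<Sum>K\<in>insert j ` Pow J. T (hm x K + hm y (insert j J - K) + A))"
  by (simp only: add.commute)
 also have "... = (\<Sum>K\<in>Pow (insert j J). T (hm x K + hm y (insert j J - K) + A))"
  unfolding Pow_insert by (rule sum.union_disjoint[symmetric]) (use insert.hyps in auto)
 finally show ?case .
qed

definition bias :: "nat => nat => (vec multiset => bit) => real" where
 "bias n s T = Re (EE (FF n) s (%as. \<chi> (T (mset as))))"

lemma bias_VI: "bias n s T = Re (avg (VI {..<s} n) (%h. \<chi> (T (hm h {..<s}))))"
 unfolding bias_def EE_VI by (simp only: hm_mset_upt)

text \<open>By additivity, a difference in one coordinate replaces the argument there by the
  increment and forgets its old value. \<open>A\<close> collects the increments that have already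
  been inserted.\<close>

lemma Ds_form:
 assumes W: "fin_grp W" and T: "form alt n s T"
 shows "[|finite J; distinct js; set js \<subseteq> J; \<forall>j\<in>set js. dirhom (FF n) W (\<iota> j);
  \<forall>w\<in>W. \<forall>i\<in>J. z w i : FF n;
  \<forall>w\<in>W. \<forall>i\<in>J. \<forall>j\<in>set js. \<forall>a\<in>FF n. z (w + \<iota> j a) i = z w i + (if i = j then a else 0);
  card J + size A = s; set_mset A \<subseteq> FF n; length as = length js; set as \<subseteq> FF n; w : W|] ==>
  Ds (map \<iota> js) as (%w. T (hm (z w) J + A)) w = T (hm (z w) (J - set js) + mset as + A)"
proof (induction js arbitrary: as J A)
 case (Cons j js)
 obtain a as' where as: "as = a # as'" using Cons.prems by (cases as) auto
 have a: "a : FF n" using Cons.prems as by auto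
 have j: "j : J" using Cons.prems by auto
 have cJ: "card J = Suc (card (J - {j}))"
  using card_Suc_Diff1[OF Cons.prems(1) j] by (rule sym)
 have "Ds (map \<iota> (j # js)) as (%w. T (hm (z w) J + A)) w
   = Ds (map \<iota> js) as' (%w. T (hm (z (w + \<iota> j a)) J + A) - T (hm (z w) J + A)) w"
  by (simp add: as)
 also have "... = Ds (map \<iota> js) as' (%w. T (hm (z w) (J - {j}) + add_mset a A)) w"
 proof (rule Ds_cong[OF W, of _ "FF n"])
  fix w assume w: "w : W"
  have z1: "z (w + \<iota> j a) j = z w j + a" using Cons.prems w a j by auto
  have z2: "hm (z (w + \<iota> j a)) (J - {j}) = hm (z w) (J - {j})"
   by (rule hm_cong) (use Cons.prems w a in auto)
  have M: "set_mset (hm (z w) (J - {j}) + A) \<subseteq> FF n" "Suc (size (hm (z w) (J - {j}) + A)) = s"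
   using Cons.prems w cJ by (auto simp: set_hm simp del: card_Diff_insert)
  have zj: "z w j : FF n" using Cons.prems w j by auto
  show "T (hm (z (w + \<iota> j a)) J + A) - T (hm (z w) J + A) = T (hm (z w) (J - {j}) + add_mset a A)"
   using form_add[OF T zj a M] Cons.prems(1) j
   by (simp add: hm_remove[of J j] z1 z2)
 qed (use Cons.prems as in auto)
 also have "... = T (hm (z w) (J - {j} - set js) + mset as' + add_mset a A)"
 proof (rule Cons.IH)
  show "card (J - {j}) + size (add_mset a A) = s"
   using Cons.prems(7) cJ by simp
 qed (use Cons.prems as a in auto)
 also have "J - {j} - set js = J - set (j # js)" by auto
 finally show ?case by (simp add: as)
qed simp

text \<open>Differences are taken along one direction for each element of \<open>J\<close>. A term
  outside \<open>\<Lambda>0\<close> is invariant in one of them and disappears; a term in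
  \<open>\<Lambda>0\<close> is a form in all the arguments of \<open>J\<close> and becomes its value
  at the increments. What remains is a bias.\<close>

lemma form_char_bound:
 assumes W: "fin_grp W" and js: "distinct js" "set js = J" "J ~= {}"
  and \<iota>: "\<forall>j\<in>J. dirhom (FF n) W (\<iota> j)"
  and z: "\<forall>w\<in>W. \<forall>i\<in>J. z w i : FF n"
   "\<forall>w\<in>W. \<forall>i\<in>J. \<forall>j\<in>J. \<forall>a\<in>FF n. z (w + \<iota> j a) i = z w i + (if i = j then a else 0)"
  and \<Lambda>: "finite \<Lambda>" "\<Lambda>0 \<subseteq> \<Lambda>" and \<tau>: "!!k. k : \<Lambda>0 ==> form alt n (card J) (\<tau> k)"
   "!!k w. k : \<Lambda>0 ==> w : W ==> g k w = \<tau> k (hm (z w) J)"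
  and inv: "!!k. k : \<Lambda> - \<Lambda>0 ==> \<exists>j\<in>J. inv_dir (FF n) W (\<iota> j) (g k)"
 shows "cmod (avg W (%w. \<chi> (\<Sum>k\<in>\<Lambda>. g k w))) ^ (2 ^ card J) \<le> bias n (card J) (%M. \<Sum>k\<in>\<Lambda>0. \<tau> k M)"
proof -
 have J: "finite J" using js by auto
 have lenjs: "length js = card J" using js distinct_card[of js] by simp
 then obtain m where m: "card J = Suc m" using js(3) J by (cases "card J") auto
 \<comment> \<open>The factors to be eliminated are all 1: only the differencing along the
   directions is wanted.\<close>
 define L where "L = map (%j. (\<iota> j, %w::'a. 1::complex)) js"
 have fstL: "map fst L = map \<iota> js" by (simp add: L_def)
 have one: "prod_list (map (%(i, H). H w) L) = 1" for w
  unfolding L_def by (induction js) auto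
 have D: "Ds (map fst L) as (%w. \<Sum>k\<in>\<Lambda>. g k w) w = (\<Sum>k\<in>\<Lambda>0. \<tau> k (mset as))"
  if as: "length as = Suc m" "set as \<subseteq> FF n" and w: "w : W" for as w
 proof -
  have "Ds (map \<iota> js) as (g k) w = (if k : \<Lambda>0 then \<tau> k (mset as) else 0)" if k: "k : \<Lambda>" for k
  proof (cases "k : \<Lambda>0")
   case True
   have "Ds (map \<iota> js) as (g k) w = Ds (map \<iota> js) as (%w. \<tau> k (hm (z w) J + {#})) w"
    by (rule Ds_cong[OF W, of _ "FF n"]) (use \<iota> js as w True \<tau> in auto)
   also have "... = \<tau> k (hm (z w) (J - set js) + mset as + {#})"
    by (rule Ds_form[OF W \<tau>(1)[OF True]]) (use True J js \<iota> z as w m lenjs in auto)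
   finally show ?thesis using True js by simp
  next
   case False
   then obtain j where "j : J" "inv_dir (FF n) W (\<iota> j) (g k)" using inv k by auto
   then have "Ds (map \<iota> js) as (g k) w = 0"
    using \<iota> as w js m lenjs by (intro Ds_inv[OF W, of _ "FF n" _ "\<iota> j"]) auto
   then show ?thesis using False by simp
  qed
  then have "(\<Sum>k\<in>\<Lambda>. Ds (map \<iota> js) as (g k) w) = (\<Sum>k\<in>\<Lambda>. if k : \<Lambda>0 then \<tau> k (mset as) else 0)"
   by (rule sum.cong[OF refl])
  also have "... = (\<Sum>k\<in>\<Lambda>0. \<tau> k (mset as))"
   using \<Lambda> by (simp add: sum.If_cases Int_absorb1)
  finally show ?thesis by (simp add: fstL Ds_sum)
 qed
 have "cmod (avg W (%w. \<chi> (\<Sum>k\<in>\<Lambda>. g k w) * prod_list (map (%(i, H). H w) L))) ^ (2 ^ Suc m)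
   \<le> Re (EE (FF n) (Suc m) (%as. \<chi> (\<Sum>k\<in>\<Lambda>0. \<tau> k (mset as))))"
  by (rule phase_bound[OF W fin_grp_FF phase_\<chi> _ _ D])
   (use \<iota> js lenjs m in \<open>auto simp: L_def inv_dir_def\<close>)
 then show ?thesis unfolding one by (simp add: bias_def m)
qed

section \<open>Families of forms and determination\<close>

type_synonym fml = "(nat \<times> (vec multiset => bit)) list"

definition fam :: "bool => nat => nat => fml => bool" where
 "fam alt n d F \<longleftrightarrow> (\<forall>(s, \<tau>)\<in>set F. 1 \<le> s & s < d & form alt n s \<tau>)"

definition agree :: "nat set => fml => (nat => vec) => (nat => vec) => bool" where
 "agree I F h h' \<longleftrightarrow> (\<forall>(s, \<tau>)\<in>set F. \<forall>J\<subseteq>I. card J = s --> \<tau> (hm h J) = \<tau> (hm h' J))"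

text \<open>The index set is an arbitrary finite \<open>I\<close>, so that the notion applies to
  subtuples of a tuple; this is what makes it transitive.\<close>

definition gen :: "nat => fml => nat => (vec multiset => bit) => bool" where
 "gen n F d T \<longleftrightarrow> (\<forall>I h h'. finite I & card I = d & h ` I \<subseteq> FF n & h' ` I \<subseteq> FF n & agree I F h h'
   --> T (hm h I) = T (hm h' I))"

lemma genD:
 "gen n F d T ==> finite I ==> card I = d ==> h ` I \<subseteq> FF n ==> h' ` I \<subseteq> FF n ==> agree I F h h' ==>
  T (hm h I) = T (hm h' I)"
 unfolding gen_def by blast

lemma agree_subset: "agree I F h h' ==> J \<subseteq> I ==> agree J F h h'"
 unfolding agree_def by blast

lemma agreeD:
 "agree I F h h' ==> p : set F ==> J \<subseteq> I ==> card J = fst p ==> snd p (hm h J) = snd p (hm h' J)"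
 unfolding agree_def by (cases p) auto

lemma agree_mono: "agree I F h h' ==> set G \<subseteq> set F ==> agree I G h h'"
 unfolding agree_def by blast

lemma gen_trans:
 assumes "gen n F d T" "!!s \<tau>. (s, \<tau>) : set F ==> gen n G s \<tau>"
 shows "gen n G d T"
 unfolding gen_def
proof (intro allI impI, elim conjE)
 fix I h h' assume I: "finite I" "card I = d" "h ` I \<subseteq> FF n" "h' ` I \<subseteq> FF n" "agree I G h h'"
 have "\<tau> (hm h J) = \<tau> (hm h' J)" if "(s, \<tau>) : set F" "J \<subseteq> I" "card J = s" for s \<tau> J
  using genD[OF assms(2)[OF that(1)], of J h h'] that I agree_subset[OF I(5) that(2)]
  by (meson finite_subset image_mono order_trans)
 then have "agree I F h h'" unfolding agree_def by blast
 then show "T (hm h I) = T (hm h' I)" by (rule genD[OF assms(1) I(1-4)])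
qed

lemma gen_mem: "(s, \<tau>) : set F ==> gen n F s \<tau>"
 unfolding gen_def agree_def by blast

lemma gen_standard:
 assumes "!!h h'. h ` {..<d} \<subseteq> FF n ==> h' ` {..<d} \<subseteq> FF n ==> agree {..<d} F h h' ==>
  T (hm h {..<d}) = T (hm h' {..<d})"
 shows "gen n F d T"
 unfolding gen_def
proof (intro allI impI, elim conjE)
 fix I h h' assume I: "finite I" "card I = d" "h ` I \<subseteq> FF n" "h' ` I \<subseteq> FF n" "agree I F h h'"
 obtain g where g: "bij_betw g {..<d} I"
  using ex_bij_betw_nat_finite[OF I(1)] I(2) by (auto simp: atLeast0LessThan)
 have gJ: "hm (k \<circ> g) J = hm k (g ` J) & card (g ` J) = card J & g ` J \<subseteq> I" if "J \<subseteq> {..<d}" for J k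
  using hm_bij[of g J "g ` J" k] g that
  by (auto simp: bij_betw_def card_image inj_on_subset)
 have "agree {..<d} F (h \<circ> g) (h' \<circ> g)"
  using I(5) unfolding agree_def by (auto simp: gJ split: prod.splits)
 moreover have "(h \<circ> g) ` {..<d} \<subseteq> FF n" "(h' \<circ> g) ` {..<d} \<subseteq> FF n"
  using g I(3,4) by (auto simp: bij_betw_def)
 ultimately show "T (hm h I) = T (hm h' I)"
  using assms[of "h \<circ> g" "h' \<circ> g"] hm_bij[OF g, of h] hm_bij[OF g, of h'] by simp
qed

text \<open>Sums of equal order are enough: differencing along a maximal set of arguments keeps only
  the forms whose order is the size of that set.\<close>

definition reg :: "nat => real => fml => bool" where
 "reg n \<theta> F \<longleftrightarrow> (\<forall>s X. X \<subseteq> {i. i < length F & fst (F ! i) = s} & X ~= {} -->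
   bias n s (%M. \<Sum>i\<in>X. snd (F ! i) M) < \<theta>)"

definition GenP :: "bool => nat => bool" where
 "GenP alt d \<longleftrightarrow> (\<forall>\<delta>>0. \<exists>K. \<forall>n T. form alt n d T & bias n d T \<ge> \<delta> -->
   (\<exists>F. length F \<le> K & fam alt n d F & gen n F d T))"

section \<open>Regularization\<close>

lemma finite_bounded_msets:
 assumes "finite A"
 shows "finite {X. set_mset X \<subseteq> A & size X \<le> (K::nat)}"
proof -
 have "{X. set_mset X \<subseteq> A & size X \<le> K} \<subseteq> mset ` {xs. set xs \<subseteq> A & length xs \<le> K}"
 proof
  fix X assume X: "X : {X. set_mset X \<subseteq> A & size X \<le> K}"
  obtain xs where "mset xs = X" using ex_mset by blast
  with X show "X : mset ` {xs. set xs \<subseteq> A & length xs \<le> K}"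
   by (intro image_eqI[of _ _ xs]) auto
 qed
 then show ?thesis using finite_lists_length_le[OF assms] finite_surj by blast
qed

lemma regularize_step:
 assumes fam: "fam alt n d F" and i0: "i0 < length F"
  and X: "X \<subseteq> {i. i < length F & fst (F ! i) = s}" "i0 : X"
  and G: "fam alt n s G" "gen n G s (%M. \<Sum>i\<in>X. snd (F ! i) M)"
 defines "F1 \<equiv> take i0 F @ drop (Suc i0) F @ G"
 shows "fam alt n d F1" "mset (map fst F1) = (mset (map fst F) - {#s#}) + mset (map fst G)"
  "!!t \<tau>. (t, \<tau>) : set F ==> gen n F1 t \<tau>"
proof -
 have F: "F = take i0 F @ F ! i0 # drop (Suc i0) F" using i0 by (rule id_take_nth_drop)
 have s: "fst (F ! i0) = s" using X by auto
 have "s < d" using fam i0 s nth_mem[OF i0] unfolding fam_def by fastforce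
 then have dG: "1 \<le> t & t < d & form alt n t \<tau>" if "(t, \<tau>) : set G" for t \<tau>
  using G(1) that unfolding fam_def by fastforce
 have dF: "1 \<le> t & t < d & form alt n t \<tau>" if "(t, \<tau>) : set F" for t \<tau>
  using fam that unfolding fam_def by fastforce
 have "set F1 \<subseteq> set F \<union> set G"
  unfolding F1_def by (auto dest: in_set_takeD in_set_dropD)
 then show "fam alt n d F1"
  unfolding fam_def using dF dG by blast
 have "mset (map fst F) = mset (map fst (take i0 F @ F ! i0 # drop (Suc i0) F))"
  using F by simp
 then have "mset (map fst F) = add_mset s (mset (map fst (take i0 F)) + mset (map fst (drop (Suc i0) F)))"
  by (simp add: s)
 then show "mset (map fst F1) = (mset (map fst F) - {#s#}) + mset (map fst G)"
  by (simp add: F1_def)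
 have other: "F ! i : set F1" if "i < length F" "i ~= i0" for i
 proof (cases "i < i0")
  case True
  then have "F ! i = take i0 F ! i" "i < length (take i0 F)" using that by auto
  then have "F ! i : set (take i0 F)" by (metis nth_mem)
  then show ?thesis by (simp add: F1_def)
 next
  case False
  then have "F ! i = drop (Suc i0) F ! (i - Suc i0)" "i - Suc i0 < length (drop (Suc i0) F)"
   using that i0 by auto
  then have "F ! i : set (drop (Suc i0) F)" by (metis nth_mem)
  then show ?thesis by (simp add: F1_def)
 qed
 show "gen n F1 t \<tau>" if "(t, \<tau>) : set F" for t \<tau>
 proof -
  obtain i where i: "i < length F" "F ! i = (t, \<tau>)" using \<open>(t, \<tau>) : set F\<close> by (auto simp: in_set_conv_nth)
  show ?thesis
  proof (cases "i = i0")
   case False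
   then show ?thesis using other[OF i(1)] i(2) by (auto intro: gen_mem)
  next
   case True
   have t: "t = s" using True i s by simp
   have finX: "finite X" using X(1) by (rule finite_subset) auto
   show ?thesis unfolding t gen_def
   proof (intro allI impI, elim conjE)
    fix I h h' assume I: "finite I" "card I = s" "h ` I \<subseteq> FF n" "h' ` I \<subseteq> FF n" "agree I F1 h h'"
    have "(\<Sum>j\<in>X. snd (F ! j) (hm h I)) = (\<Sum>j\<in>X. snd (F ! j) (hm h' I))"
     using genD[OF G(2) I(1-4)] agree_mono[OF I(5), of G] by (auto simp: F1_def)
    moreover have "(\<Sum>j\<in>X - {i0}. snd (F ! j) (hm h I)) = (\<Sum>j\<in>X - {i0}. snd (F ! j) (hm h' I))"
    proof (rule sum.cong[OF refl])
     fix j assume j: "j : X - {i0}"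
     then have "F ! j : set F1" "fst (F ! j) = s" using other[of j] X by auto
     then show "snd (F ! j) (hm h I) = snd (F ! j) (hm h' I)"
      using agreeD[OF I(5), of "F ! j" I] I(2) by simp
    qed
    moreover have "(\<Sum>j\<in>X. snd (F ! j) (hm k I))
      = snd (F ! i0) (hm k I) + (\<Sum>j\<in>X - {i0}. snd (F ! j) (hm k I))" for k
     using finX X(2) by (rule sum.remove)
    ultimately show "\<tau> (hm h I) = \<tau> (hm h' I)"
     using True i(2) by simp
   qed
  qed
 qed
qed

text \<open>Replacing a form by forms of smaller order decreases the multiset of orders in the
  well-founded multiset ordering. Since only finitely many multisets can follow a given one, a bound
  that depends on the multiset alone is obtained as a maximum.\<close>

lemma regularize_type:
 assumes IH: "!!s. 1 \<le> s ==> s < d ==> GenP alt s" and \<omega>: "!!m. (\<omega> m :: real) > 0"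
 shows "\<exists>M. \<forall>n F. fam alt n d F & mset (map fst F) = \<Delta> -->
  (\<exists>F'. length F' \<le> M & fam alt n d F' & reg n (\<omega> (length F')) F' & (\<forall>(s, \<tau>)\<in>set F. gen n F' s \<tau>))"
proof (induction \<Delta> rule: wfp_induct_rule[OF wfp_less_multiset, consumes 0, case_names wf less])
 case wf
 show ?case by (simp add: wfp_on_less)
next
 case (less \<Delta>)
 \<comment> \<open>All families of type \<open>\<Delta>\<close> have \<open>size \<Delta>\<close>
   members, so the threshold is a single number at this stage.\<close>
 define \<theta> where "\<theta> = \<omega> (size \<Delta>)"
 define S where "S = {s. 1 \<le> s & s < d}"
 have "\<exists>K. \<forall>s\<in>S. \<forall>n T. form alt n s T & bias n s T \<ge> \<theta> -->
   (\<exists>F. length F \<le> K s & fam alt n s F & gen n F s T)"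
  using IH \<omega>[of "size \<Delta>"] unfolding GenP_def S_def \<theta>_def
  by (intro bchoice ballI) auto
 then obtain K where K: "!!s n T. s : S ==> form alt n s T ==> bias n s T \<ge> \<theta> ==>
   (\<exists>F. length F \<le> K s & fam alt n s F & gen n F s T)" by blast
 \<comment> \<open>The types that one step can produce: some order \<open>s\<close> is traded for at
   most \<open>K s\<close> orders below \<open>s\<close>.\<close>
 define D where "D = (\<Union>s\<in>set_mset \<Delta>. (%X. \<Delta> - {#s#} + X) ` {X. set_mset X \<subseteq> {..<s} & size X \<le> K s})"
 have finD: "finite D" unfolding D_def by (auto intro!: finite_bounded_msets)
 have lt: "\<Delta>' < \<Delta>" if D': "\<Delta>' : D" for \<Delta>'
 proof -
  obtain s X where sX: "s \<in># \<Delta>" "set_mset X \<subseteq> {..<s}" "\<Delta>' = \<Delta> - {#s#} + X"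
   using D' unfolding D_def by blast
  have "multp (<) (\<Delta> - {#s#} + X) (\<Delta> - {#s#} + {#s#})"
   by (rule one_step_implies_multp) (use sX in auto)
  then show ?thesis using sX by (simp add: less_multiset_def)
 qed
 have "\<forall>\<Delta>'\<in>D. \<exists>M. \<forall>n F. fam alt n d F & mset (map fst F) = \<Delta>' -->
  (\<exists>F'. length F' \<le> M & fam alt n d F' & reg n (\<omega> (length F')) F' & (\<forall>(s, \<tau>)\<in>set F. gen n F' s \<tau>))"
  using less.IH lt by blast
 then obtain M where M: "!!\<Delta>' n F. \<Delta>' : D ==> fam alt n d F ==> mset (map fst F) = \<Delta>' ==>
  (\<exists>F'. length F' \<le> M \<Delta>' & fam alt n d F' & reg n (\<omega> (length F')) F' & (\<forall>(s, \<tau>)\<in>set F. gen n F' s \<tau>))"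
  using bchoice by metis
 define M0 where "M0 = Max (insert (size \<Delta>) (M ` D))"
 have M0: "size \<Delta> \<le> M0" "!!\<Delta>'. \<Delta>' : D ==> M \<Delta>' \<le> M0"
  using finD by (auto simp: M0_def)
 show ?case
 proof (intro exI[of _ M0] allI impI, elim conjE)
  fix n and F :: fml assume F: "fam alt n d F" "mset (map fst F) = \<Delta>"
  have len: "length F = size \<Delta>" using arg_cong[OF F(2), of size] by simp
  show "\<exists>F'. length F' \<le> M0 & fam alt n d F' & reg n (\<omega> (length F')) F' & (\<forall>(s, \<tau>)\<in>set F. gen n F' s \<tau>)"
  proof (cases "reg n \<theta> F")
   case True
   then show ?thesis using F len M0(1) by (intro exI[of _ F]) (auto simp: \<theta>_def intro: gen_mem)
  next
   case False
   then obtain s X where X: "X \<subseteq> {i. i < length F & fst (F ! i) = s}" "X ~= {}"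
     and b: "bias n s (%M. \<Sum>i\<in>X. snd (F ! i) M) \<ge> \<theta>"
    unfolding reg_def by (auto simp: not_less)
   obtain i0 where i0: "i0 : X" using X(2) by blast
   have Fi: "1 \<le> s & s < d & form alt n s (snd (F ! i))" if "i : X" for i
   proof -
    have "F ! i : set F" "fst (F ! i) = s" using that X(1) by auto
    then show ?thesis using F(1) unfolding fam_def by (metis (mono_tags, lifting) case_prodD prod.collapse)
   qed
   have sS: "s : S" using Fi[OF i0] by (auto simp: S_def)
   have "form alt n s (%M. \<Sum>i\<in>X. snd (F ! i) M)"
    by (rule form_sum) (use Fi in auto)
   then obtain G where G: "length G \<le> K s" "fam alt n s G" "gen n G s (%M. \<Sum>i\<in>X. snd (F ! i) M)"
    using K[OF sS _ b] by auto
   define F1 where "F1 = take i0 F @ drop (Suc i0) F @ G"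
   have i0F: "i0 < length F" using i0 X(1) by auto
   note st = regularize_step[OF F(1) i0F X(1) i0 G(2,3), folded F1_def]
   have "s \<in># \<Delta>" unfolding F(2)[symmetric] using i0F i0 X(1) by (auto intro!: image_eqI[of _ _ "F ! i0"])
   moreover have "set_mset (mset (map fst G)) \<subseteq> {..<s}" using G(2) by (auto simp: fam_def)
   ultimately have "mset (map fst F1) : D"
    unfolding st(2) F(2) D_def using G(1) by (intro UN_I[of s] image_eqI[OF refl]) auto
   from M[OF this st(1) refl] M0(2)[OF this] obtain F' where F': "length F' \<le> M0" "fam alt n d F'"
     "reg n (\<omega> (length F')) F'" "\<forall>(s, \<tau>)\<in>set F1. gen n F' s \<tau>"
    by (meson order_trans)
   have "\<forall>(s, \<tau>)\<in>set F. gen n F' s \<tau>"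
    using gen_trans[OF st(3)] F'(4) by blast
   then show ?thesis using F' by blast
  qed
 qed
qed

text \<open>A family with at most \<open>m\<close> members has one of finitely many types, over
  which the bound is maximized.\<close>

lemma regularize:
 assumes "!!s. 1 \<le> s ==> s < d ==> GenP alt s" "!!m. (\<omega> m :: real) > 0"
 shows "\<exists>M. \<forall>n F. fam alt n d F & length F \<le> m -->
  (\<exists>F'. length F' \<le> M & fam alt n d F' & reg n (\<omega> (length F')) F' & (\<forall>(s, \<tau>)\<in>set F. gen n F' s \<tau>))"
proof -
 define D where "D = {X. set_mset X \<subseteq> {..<d} & size X \<le> m}"
 have finD: "finite D" unfolding D_def by (auto intro!: finite_bounded_msets)
 obtain M where M: "!!\<Delta>' n F. fam alt n d F ==> mset (map fst F) = \<Delta>' ==>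
  (\<exists>F'. length F' \<le> M \<Delta>' & fam alt n d F' & reg n (\<omega> (length F')) F' & (\<forall>(s, \<tau>)\<in>set F. gen n F' s \<tau>))"
  using regularize_type[where \<omega> = \<omega>, OF assms] by metis
 have "\<exists>F'. length F' \<le> Max (insert 0 (M ` D)) & fam alt n d F' & reg n (\<omega> (length F')) F' & (\<forall>(s, \<tau>)\<in>set F. gen n F' s \<tau>)"
  if F: "fam alt n d F" "length F \<le> m" for n F
 proof -
  have "mset (map fst F) : D" using F by (auto simp: D_def fam_def)
  then have "M (mset (map fst F)) \<le> Max (insert 0 (M ` D))" using finD by auto
  then show ?thesis using M[OF F(1) refl] by (meson order_trans)
 qed
 then show ?thesis by blast
qed

section \<open>A biased form is mostly determined by finitely many of its slices\<close>

text \<open>The variance of a sum of independent centred variables: the cross terms vanish because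
  each factor has mean 0.\<close>

lemma EE_sum_square:
 fixes c :: "'a => real"
 assumes "card A > 0" "avg A c = 0"
 shows "EE A m (%ys. (sum_list (map c ys))) = 0"
  and "EE A m (%ys. (sum_list (map c ys))\<^sup>2) = m * avg A (%y. (c y)\<^sup>2)"
proof -
 show *: "EE A m (%ys. (sum_list (map c ys))) = 0" for m
  by (induction m) (auto simp: EE_add EE_const assms avg_const avg_add)
 show "EE A m (%ys. (sum_list (map c ys))\<^sup>2) = m * avg A (%y. (c y)\<^sup>2)"
 proof (induction m)
  case (Suc m)
  have "EE A m (%ys. (sum_list (map c (y # ys)))\<^sup>2) = (c y)\<^sup>2 + m * avg A (%y. (c y)\<^sup>2)" for y
  proof -
   have "EE A m (%ys. (sum_list (map c (y # ys)))\<^sup>2)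
     = EE A m (%ys. (c y)\<^sup>2 + (2 * c y * sum_list (map c ys) + (sum_list (map c ys))\<^sup>2))"
    by (simp add: power2_sum algebra_simps)
   also have "... = (c y)\<^sup>2 + (2 * c y * EE A m (%ys. sum_list (map c ys)) + m * avg A (%y. (c y)\<^sup>2))"
    by (simp only: EE_add EE_cmult Suc.IH EE_const[OF assms(1)])
   finally show ?thesis by (simp add: *)
  qed
  then show ?case
   by (simp only: EE.simps) (simp add: avg_add avg_const[OF assms(1)] algebra_simps)
 qed simp
qed

lemma avg_le_ex:
 fixes f :: "'a => real"
 assumes "card A > 0" "avg A f \<le> c"
 shows "\<exists>a\<in>A. f a \<le> c"
proof (rule ccontr)
 assume "\<not> ?thesis"
 then have *: "!!a. a : A ==> c < f a" by auto
 have "sum (%_. c) A < sum f A"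
  by (rule sum_strict_mono) (use * assms(1) card_gt_0_iff[of A] in auto)
 then show False using assms by (simp add: avg_def field_simps)
qed

lemma EE_le_ex:
 fixes f :: "'a list => real"
 assumes "card A > 0" "EE A m f \<le> c"
 shows "\<exists>as. length as = m & set as \<subseteq> A & f as \<le> c"
 using assms(2)
proof (induction m arbitrary: f)
 case (Suc m)
 obtain a where a: "a : A" "EE A m (%as. f (a # as)) \<le> c"
  using avg_le_ex[OF assms(1)] Suc.prems by auto
 from Suc.IH[OF a(2)] obtain as where "length as = m" "set as \<subseteq> A" "f (a # as) \<le> c" by auto
 then show ?case using a(1) by (intro exI[of _ "a # as"]) auto
qed auto

lemma bit_cancel: "(t::bit) + (t + u) = u"
 by (simp add: add.assoc[symmetric] bit_add_self)

text \<open>The bias is the mean of the sign of \<open>T\<close>, so for most \<open>h\<close> the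
  signs of T(h + y), summed over a suitable fixed sample of shifts \<open>y\<close>, give a positive
  number. By multilinearity T(h) + T(h + y) is a sum of slices of order below \<open>d\<close> and a
  constant. These slices therefore determine the sign at \<open>h\<close> times a positive number,
  hence the sign itself.\<close>

lemma majority:
 fixes \<delta> \<epsilon> :: real
 assumes "\<delta> > 0" "\<epsilon> > 0"
 shows "\<exists>K. \<forall>n T alt. form alt n d T & bias n d T \<ge> \<delta> -->
  (\<exists>F G. length F \<le> K & fam alt n d F & G \<subseteq> VI {..<d} n &
    card (VI {..<d} n - G) \<le> \<epsilon> * card (VI {..<d} n) &
    (\<forall>h\<in>G. \<forall>h'\<in>G. agree {..<d} F h h' --> T (hm h {..<d}) = T (hm h' {..<d})))"
proof -
 \<comment> \<open>By Chebyshev the exceptional share is at most m / (m \<delta>)^2 = 1 / (m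
   \<delta>^2), which has to be at most \<epsilon>.\<close>
 define m where "m = nat \<lceil>1 / (\<epsilon> * \<delta>\<^sup>2)\<rceil>"
 have m: "1 / (\<epsilon> * \<delta>\<^sup>2) \<le> m" unfolding m_def by linarith
 have "1 / (\<epsilon> * \<delta>\<^sup>2) > 0" using assms by simp
 with m have m0: "real m > 0" by linarith
 define KL where "KL = (SOME ks. set ks = {K. K \<subset> {..<d} & K ~= {}})"
 have "finite {K. K \<subset> {..<d} & K ~= {}}" by (rule finite_subset[of _ "Pow {..<d}"]) auto
 then have KL: "set KL = {K. K \<subset> {..<d} & K ~= {}}"
  unfolding KL_def by (rule someI_ex[OF finite_list])
 show ?thesis
 proof (intro exI[of _ "m * length KL"] allI impI, elim conjE)
  fix n T alt assume T: "form alt n d T" and b: "bias n d T \<ge> \<delta>"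
  let ?W = "VI {..<d} n"
  have W: "fin_grp ?W" by (rule fin_grp_VI) simp
  define X where "X h = Re (\<chi> (T (hm h {..<d})))" for h
  have X1: "(X h)\<^sup>2 = 1" for h by (simp add: X_def \<chi>_def)
  have bX: "avg ?W X = bias n d T" unfolding bias_VI Re_avg X_def ..
  define c where "c h y = X (h + y) - bias n d T" for h y
  have avgc: "avg ?W (c h) = 0" "avg ?W (%y. (c h y)\<^sup>2) \<le> 1" if h: "h : ?W" for h
  proof -
   have sh: "avg ?W (%y. f (h + y)) = avg ?W f" for f :: "_ => real"
    using avg_shift[OF W h, of f] by (simp add: add.commute)
   show "avg ?W (c h) = 0"
    unfolding c_def by (simp add: avg_diff sh bX avg_const fin_grp_card[OF W])
   have "(c h y)\<^sup>2 = 1 - 2 * bias n d T * X (h + y) + (bias n d T)\<^sup>2" for y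
    using X1[of "h + y"] by (simp add: c_def power2_diff)
   then have "avg ?W (%y. (c h y)\<^sup>2) = 1 - 2 * bias n d T * bias n d T + (bias n d T)\<^sup>2"
    by (simp add: avg_diff avg_add avg_cmult_left sh bX avg_const fin_grp_card[OF W])
   then show "avg ?W (%y. (c h y)\<^sup>2) \<le> 1" by (simp add: power2_eq_square)
  qed
  \<comment> \<open>For each \<open>h\<close> the mean square over random samples is at most
    \<open>m\<close>. Exchanging the averages yields one sample that is good on average over
    \<open>h\<close>.\<close>
  have "EE ?W m (%ys. avg ?W (%h. (sum_list (map (c h) ys))\<^sup>2)) \<le> m"
   unfolding EE_avg_swap
  proof (rule avg_le_const)
   fix h assume h: "h : ?W"
   show "EE ?W m (%ys. (sum_list (map (c h) ys))\<^sup>2) \<le> m"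
    using EE_sum_square(2)[OF fin_grp_card[OF W] avgc(1)[OF h], of m] avgc(2)[OF h]
    by (simp add: mult_left_le)
  qed simp
  from EE_le_ex[OF fin_grp_card[OF W] this] obtain ys where ys: "length ys = m" "set ys \<subseteq> ?W"
   and small: "avg ?W (%h. (sum_list (map (c h) ys))\<^sup>2) \<le> m" by auto
  define S where "S h = sum_list (map (%y. X (h + y)) ys)" for h
  have Sc: "sum_list (map (c h) ys) = S h - m * bias n d T" for h
   unfolding S_def c_def ys(1)[symmetric] by (induction ys) (auto simp: algebra_simps)
  define G where "G = {h\<in>?W. S h > 0}"
  have "card (?W - G) * (m * \<delta>)\<^sup>2 \<le> (\<Sum>h\<in>?W - G. (sum_list (map (c h) ys))\<^sup>2)"
  proof -
   have "(m * \<delta>)\<^sup>2 \<le> (sum_list (map (c h) ys))\<^sup>2" if "h : ?W - G" for h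
   proof -
    have "S h \<le> 0" using that by (auto simp: G_def)
    moreover have "m * \<delta> \<le> m * bias n d T" using b by (simp add: mult_left_mono)
    ultimately have "m * \<delta> \<le> m * bias n d T - S h" by linarith
    then have "(m * \<delta>)\<^sup>2 \<le> (m * bias n d T - S h)\<^sup>2"
     using assms by (intro power_mono) auto
    then show ?thesis by (simp add: Sc power2_commute)
   qed
   then show ?thesis using sum_mono[of "?W - G" "%_. (m * \<delta>)\<^sup>2"] by simp
  qed
  also have "... \<le> (\<Sum>h\<in>?W. (sum_list (map (c h) ys))\<^sup>2)"
   by (rule sum_mono2) (use fin_grp_finite[OF W] in auto)
  also have "... \<le> m * card ?W"
   using small fin_grp_card[OF W] by (simp add: avg_def field_simps)
  finally have a: "card (?W - G) * (m * \<delta>\<^sup>2) \<le> card ?W"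
   using m0 by (simp add: power2_eq_square algebra_simps)
  have e: "1 \<le> \<epsilon> * (m * \<delta>\<^sup>2)" using m assms by (simp add: field_simps)
  have cardG: "card (?W - G) \<le> \<epsilon> * card ?W"
  proof -
   have "card (?W - G) * (1::real) \<le> card (?W - G) * (\<epsilon> * (m * \<delta>\<^sup>2))"
    using e by (intro mult_left_mono) auto
   also have "... = \<epsilon> * (card (?W - G) * (m * \<delta>\<^sup>2))" by simp
   also have "... \<le> \<epsilon> * card ?W" using a assms by (intro mult_left_mono) auto
   finally show ?thesis by simp
  qed
  \<comment> \<open>All slices of the form: the arguments outside a nonempty proper subset
    \<open>K\<close> are frozen at a shift from the sample.\<close>
  define F where "F = concat (map (%y. map (%K. (card K, %M. T (M + hm y ({..<d} - K)))) KL) ys)"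
  have lenF: "length F = m * length KL"
   unfolding F_def by (simp add: length_concat comp_def ys(1) sum_list_triv)
  have setF: "set F = {(card K, %M. T (M + hm y ({..<d} - K))) |y K. y : set ys & K : set KL}"
   unfolding F_def by auto
  have "1 \<le> card K & card K < d & form alt n (card K) (%M. T (M + hm y ({..<d} - K)))"
   if y: "y : set ys" and "K : set KL" for y K
  proof -
   have K: "K \<subset> {..<d}" "K ~= {}" using \<open>K : set KL\<close> by (auto simp: KL)
   have cK: "card K < d" "0 < card K" "finite K"
    using K psubset_card_mono[of "{..<d}" K] finite_subset[of K "{..<d}"] by (auto simp: card_gt_0_iff)
   have "set_mset (hm y ({..<d} - K)) \<subseteq> FF n" using y ys(2) by (auto simp: set_hm intro: VI_D)
   from form_slice[OF T this] have "form alt n (d - (d - card K)) (%M. T (M + hm y ({..<d} - K)))"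
    using K cK by (simp add: card_Diff_subset)
   then show ?thesis using cK by auto
  qed
  then have famF: "fam alt n d F"
   unfolding fam_def setF by blast
  have det: "T (hm h {..<d}) = T (hm h' {..<d})" if h: "h : G" "h' : G" and ag: "agree {..<d} F h h'" for h h'
  proof -
   have hW: "h : ?W" "h' : ?W" using h by (auto simp: G_def)
   have ex: "T (hm k {..<d}) + T (hm (k + y) {..<d}) = (\<Sum>K\<in>Pow {..<d} - {{..<d}}. T (hm k K + hm y ({..<d} - K)))"
    if "k : ?W" "y : set ys" for k y
   proof -
    have "y : ?W" using that(2) ys(2) by blast
    then have ky: "k ` {..<d} \<subseteq> FF n" "y ` {..<d} \<subseteq> FF n" using that(1) by (auto intro: VI_D)
    have "T (hm (k + y) {..<d}) = T (hm (%i. k i + y i) {..<d} + {#})"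
     by (simp add: plus_fun_def)
    also have "... = (\<Sum>K\<in>Pow {..<d}. T (hm k K + hm y ({..<d} - K) + {#}))"
     by (rule form_expand[OF T]) (use ky in auto)
    also have "... = T (hm k {..<d}) + (\<Sum>K\<in>Pow {..<d} - {{..<d}}. T (hm k K + hm y ({..<d} - K)))"
     by (subst sum.remove[of _ "{..<d}"]) auto
    finally show ?thesis by (simp only: bit_cancel)
   qed
   have XX: "X k * X (k + y) = Re (\<chi> (T (hm k {..<d}) + T (hm (k + y) {..<d})))" for k y
    by (simp add: X_def \<chi>_add) (simp add: \<chi>_def)
   have "X h * X (h + y) = X h' * X (h' + y)" if y: "y : set ys" for y
   proof -
    have "(\<Sum>K\<in>Pow {..<d} - {{..<d}}. T (hm h K + hm y ({..<d} - K)))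
      = (\<Sum>K\<in>Pow {..<d} - {{..<d}}. T (hm h' K + hm y ({..<d} - K)))"
    proof (rule sum.cong[OF refl])
     fix K assume K: "K : Pow {..<d} - {{..<d}}"
     show "T (hm h K + hm y ({..<d} - K)) = T (hm h' K + hm y ({..<d} - K))"
     \<comment> \<open>The empty \<open>K\<close> belongs to no member of the family; its term does
       not involve \<open>h\<close> at all.\<close>
     proof (cases "K = {}")
      case False
      then have "(card K, %M. T (M + hm y ({..<d} - K))) : set F"
       unfolding setF KL using K y by blast
      then show ?thesis using ag K unfolding agree_def by fastforce
     qed simp
    qed
    then show ?thesis unfolding XX using ex[OF hW(1) y] ex[OF hW(2) y] by simp
   qed
   then have "sum_list (map (%y. X h * X (h + y)) ys) = sum_list (map (%y. X h' * X (h' + y)) ys)"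
    by (metis (no_types, lifting) map_eq_conv)
   then have XS: "X h * S h = X h' * S h'"
    unfolding S_def by (simp add: sum_list_const_mult)
   have "S h > 0" "S h' > 0" using h by (auto simp: G_def)
   then have "X h = X h'"
    using XS by (auto simp: X_def \<chi>_def split: if_splits)
   then show ?thesis by (auto simp: X_def \<chi>_def split: if_splits)
  qed
  show "\<exists>F G. length F \<le> m * length KL & fam alt n d F & G \<subseteq> ?W &
    card (?W - G) \<le> \<epsilon> * card ?W &
    (\<forall>h\<in>G. \<forall>h'\<in>G. agree {..<d} F h h' --> T (hm h {..<d}) = T (hm h' {..<d}))"
   using lenF famF cardG det by (intro exI[of _ F] exI[of _ G]) (auto simp: G_def)
 qed
qed

section \<open>Exactness\<close>

lemma agreeI:
 "(!!s \<tau> J. (s, \<tau>) : set F ==> J \<subseteq> I ==> s = card J ==> \<tau> (hm h J) = \<tau> (hm h' J)) ==> agree I F h h'"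
 unfolding agree_def by blast

lemma prod_one_plus:
 fixes f :: "'x => 'b::comm_ring_1"
 shows "finite A ==> (\<Prod>x\<in>A. 1 + f x) = (\<Sum>X\<in>Pow A. \<Prod>x\<in>X. f x)"
proof (induction A rule: finite_induct)
 case (insert a A)
 have "(\<Sum>X\<in>insert a ` Pow A. \<Prod>x\<in>X. f x) = (\<Sum>X\<in>Pow A. \<Prod>x\<in>insert a X. f x)"
  using insert.hyps by (subst sum.reindex) (auto simp: inj_on_def)
 also have "... = (\<Sum>X\<in>Pow A. f a * (\<Prod>x\<in>X. f x))"
  by (rule sum.cong[OF refl], rule prod.insert) (use insert.hyps in \<open>auto intro: finite_subset\<close>)
 also have "... = f a * (\<Prod>x\<in>A. 1 + f x)"
  by (simp add: sum_distrib_left insert.IH)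
 finally have *: "(\<Sum>X\<in>insert a ` Pow A. \<Prod>x\<in>X. f x) = f a * (\<Prod>x\<in>A. 1 + f x)" .
 have "(\<Sum>X\<in>Pow (insert a A). \<Prod>x\<in>X. f x)
   = (\<Sum>X\<in>Pow A. \<Prod>x\<in>X. f x) + (\<Sum>X\<in>insert a ` Pow A. \<Prod>x\<in>X. f x)"
  unfolding Pow_insert by (rule sum.union_disjoint) (use insert.hyps in auto)
 then show ?case unfolding * using insert by (simp add: algebra_simps)
qed simp

text \<open>Fourier inversion for the indicator of a bit pattern: the empty character gives the main
  term \<open>1 / 2 ^ card \<Omega>\<close>, and the normalized sum of all the others is at most
  \<open>\<rho>\<close>.\<close>

lemma equidist:
 fixes b :: "'x => 'w => bit"
 assumes W: "card W > 0" and \<Omega>: "finite \<Omega>" and \<rho>: "\<rho> \<ge> 0"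
  and small: "!!\<Lambda>. \<Lambda> \<subseteq> \<Omega> ==> \<Lambda> ~= {} ==> cmod (avg W (%w. \<chi> (\<Sum>x\<in>\<Lambda>. b x w))) \<le> \<rho>"
  and Z: "Z \<subseteq> \<Omega>"
 shows "\<bar>card {w\<in>W. {x\<in>\<Omega>. b x w = 1} = Z} / card W - 1 / 2 ^ card \<Omega>\<bar> \<le> \<rho>"
proof -
 define t where "t x = (if x : Z then 1 else 0 :: bit)" for x
 define I where "I w = (of_bool ({x\<in>\<Omega>. b x w = 1} = Z) :: complex)" for w
 have finW: "finite W" using W card_gt_0_iff by blast
 have I: "I w = (\<Sum>X\<in>Pow \<Omega>. \<chi> (\<Sum>x\<in>X. t x) * \<chi> (\<Sum>x\<in>X. b x w)) / 2 ^ card \<Omega>" for w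
 proof -
  have one: "1 + \<chi> (t x + b x w) = (if b x w = t x then 2 else 0)" for x
   by (cases "b x w"; cases "t x") (auto simp: \<chi>_def)
  have "(\<Prod>x\<in>\<Omega>. 1 + \<chi> (t x + b x w)) = 2 ^ card \<Omega> * I w"
  proof (cases "{x\<in>\<Omega>. b x w = 1} = Z")
   case True
   then have "b x w = t x" if "x : \<Omega>" for x
    using that by (cases "b x w") (auto simp: t_def)
   then show ?thesis using True by (simp add: one I_def)
  next
   case False
   have "{x\<in>\<Omega>. t x = 1} = Z" using Z by (auto simp: t_def)
   moreover have "{x\<in>\<Omega>. b x w = 1} = {x\<in>\<Omega>. t x = 1}" if "\<forall>x\<in>\<Omega>. b x w = t x" using that by auto
   ultimately obtain x where "x : \<Omega>" "b x w ~= t x" using False by blast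
   then have "(\<Prod>x\<in>\<Omega>. 1 + \<chi> (t x + b x w)) = 0"
    using \<Omega> by (intro prod_zero) (auto simp: one)
   then show ?thesis using False by (simp add: I_def)
  qed
  moreover have "(\<Prod>x\<in>\<Omega>. 1 + \<chi> (t x + b x w)) = (\<Sum>X\<in>Pow \<Omega>. \<Prod>x\<in>X. \<chi> (t x + b x w))"
   by (rule prod_one_plus[OF \<Omega>])
  moreover have "... = (\<Sum>X\<in>Pow \<Omega>. \<chi> (\<Sum>x\<in>X. t x) * \<chi> (\<Sum>x\<in>X. b x w))"
   by (simp only: \<chi>_sum \<chi>_add prod.distrib)
  ultimately show ?thesis by (simp add: field_simps)
 qed
 have avI: "avg W I = of_real (card {w\<in>W. {x\<in>\<Omega>. b x w = 1} = Z} / card W)"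
  using finW by (simp add: avg_def I_def sum.If_cases of_bool_def Int_def)
 define c where "c X = \<chi> (\<Sum>x\<in>X. t x) * avg W (%w. \<chi> (\<Sum>x\<in>X. b x w))" for X
 have "avg W I = (\<Sum>X\<in>Pow \<Omega>. c X) / 2 ^ card \<Omega>"
  unfolding I c_def avg_cmult_left[symmetric] avg_sum[symmetric]
  by (simp add: divide_inverse avg_cmult_right)
 also have "(\<Sum>X\<in>Pow \<Omega>. c X) = c {} + (\<Sum>X\<in>Pow \<Omega> - {{}}. c X)"
  using \<Omega> by (intro sum.remove) auto
 also have "c {} = 1" using W by (simp add: c_def avg_const)
 finally have "avg W I - 1 / 2 ^ card \<Omega> = (\<Sum>X\<in>Pow \<Omega> - {{}}. c X) / 2 ^ card \<Omega>"
  by (simp add: field_simps)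
 also have "cmod ... \<le> (\<Sum>X\<in>Pow \<Omega> - {{}}. \<rho>) / 2 ^ card \<Omega>"
  unfolding norm_divide
 proof (intro divide_mono order_trans[OF norm_sum] sum_mono)
  fix X assume "X : Pow \<Omega> - {{}}"
  then have "cmod (avg W (%w. \<chi> (\<Sum>x\<in>X. b x w))) \<le> \<rho>" by (intro small) auto
  moreover have "cmod (\<chi> u) = 1" for u by (simp add: \<chi>_def)
  ultimately show "cmod (c X) \<le> \<rho>" by (simp add: c_def norm_mult)
 qed (use \<rho> in \<open>auto simp: norm_power intro!: sum_nonneg\<close>)
 also have "... \<le> \<rho>"
 proof -
  have "real (card (Pow \<Omega> - {{}})) \<le> 2 ^ card \<Omega>"
   using \<Omega> card_mono[of "Pow \<Omega>" "Pow \<Omega> - {{}}"] by (simp add: card_Pow del: card_Diff_insert)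
  then show ?thesis using \<rho> by (simp add: divide_le_eq mult_left_mono mult.commute del: card_Diff_insert)
 qed
 finally have "cmod (avg W I - 1 / 2 ^ card \<Omega>) \<le> \<rho>" .
 moreover have "avg W I - 1 / 2 ^ card \<Omega>
   = of_real (card {w\<in>W. {x\<in>\<Omega>. b x w = 1} = Z} / card W - 1 / 2 ^ card \<Omega>)"
  unfolding avI by simp
 ultimately show ?thesis by (simp only: norm_of_real)
qed

text \<open>The vertex \<open>\<omega>\<close> of a cube with base point \<open>h\<close>, where
  each edge of the cube is itself a tuple of vectors.\<close>

definition zz :: "(nat => vec) => nat set => (nat \<times> nat => vec) => nat => vec" where
 "zz h \<omega> y = (%i. h i + (\<Sum>j\<in>\<omega>. y (j, i)))"

lemma zz_empty [simp]: "zz h {} y = h"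
 by (simp add: zz_def)

lemma zz_insert: "finite \<omega> ==> j \<notin> \<omega> ==> zz h (insert j \<omega>) y = (%i. zz h \<omega> y i + y (j, i))"
 by (simp add: zz_def ac_simps)

lemma zz_upd:
 assumes "finite \<omega>"
 shows "zz h \<omega> (y + sing (j, i) a) k = zz h \<omega> y k + (if k = i & j : \<omega> then a else 0)"
proof -
 have "(\<Sum>l\<in>\<omega>. (y + sing (j, i) a) (l, k)) = (\<Sum>l\<in>\<omega>. y (l, k)) + (\<Sum>l\<in>\<omega>. sing (j, i) a (l, k))"
  by (simp only: plus_fun_apply sum.distrib)
 also have "(\<Sum>l\<in>\<omega>. sing (j, i) a (l, k)) = (if k = i & j : \<omega> then a else 0)"
 proof (cases "k = i")
  case True
  then have "(\<Sum>l\<in>\<omega>. sing (j, i) a (l, k)) = (\<Sum>l\<in>\<omega>. if l = j then a else 0)"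
   by (intro sum.cong) (auto simp: sing_def)
  then show ?thesis using assms True by (simp add: sum.delta)
 qed (simp add: sing_def)
 finally show ?thesis unfolding zz_def by (simp only: add.assoc)
qed

lemma zz_FF: "h k : FF n ==> y : VI A n ==> zz h \<omega> y k : FF n"
 unfolding zz_def by (intro FF_add FF_sum) (auto intro: VI_D)

text \<open>As a function of the vertex, a form in the arguments \<open>J\<close> has degree at most
  \<open>card J\<close>, so its sum over a cube of larger dimension is 0. In the induction,
  splitting off the edge \<open>j\<close> produces the leading term twice, which cancels, and terms
  with fewer free arguments.\<close>

lemma cube_vanish:
 assumes \<tau>: "form alt n s \<tau>" and y: "y : VI A n"
 shows "[|finite \<kappa>; finite J; card J < card \<kappa>; card J + size B = s; h ` J \<subseteq> FF n; set_mset B \<subseteq> FF n|] ==>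
  (\<Sum>\<omega>\<in>Pow \<kappa>. \<tau> (hm (zz h \<omega> y) J + B)) = 0"
proof (induction \<kappa> arbitrary: J B rule: finite_induct)
 case (insert j \<kappa>)
 let ?f = "%\<omega>. \<tau> (hm (zz h \<omega> y) J + B)"
 let ?yj = "%i. y (j, i)"
 have ins: "?f (insert j \<omega>) = ?f \<omega> + (\<Sum>K\<in>Pow J - {J}. \<tau> (hm (zz h \<omega> y) K + (hm ?yj (J - K) + B)))"
  if \<omega>: "\<omega> : Pow \<kappa>" for \<omega>
 proof -
  have fj: "finite \<omega>" "j \<notin> \<omega>" using \<omega> insert.hyps by (auto intro: finite_subset)
  have "?f (insert j \<omega>) = (\<Sum>K\<in>Pow J. \<tau> (hm (zz h \<omega> y) K + hm ?yj (J - K) + B))"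
   unfolding zz_insert[OF fj]
   by (rule form_expand[OF \<tau>]) (use insert.prems zz_FF[OF _ y] VI_D[OF y] in auto)
  also have "... = \<tau> (hm (zz h \<omega> y) J + hm ?yj (J - J) + B)
    + (\<Sum>K\<in>Pow J - {J}. \<tau> (hm (zz h \<omega> y) K + hm ?yj (J - K) + B))"
   using insert.prems(1) by (intro sum.remove) auto
  finally show ?thesis by (simp add: add.assoc)
 qed
 have "(\<Sum>\<omega>\<in>Pow (insert j \<kappa>). ?f \<omega>) = (\<Sum>\<omega>\<in>Pow \<kappa>. ?f \<omega>) + (\<Sum>\<omega>\<in>insert j ` Pow \<kappa>. ?f \<omega>)"
  unfolding Pow_insert by (rule sum.union_disjoint) (use insert.hyps in auto)
 also have "(\<Sum>\<omega>\<in>insert j ` Pow \<kappa>. ?f \<omega>) = (\<Sum>\<omega>\<in>Pow \<kappa>. ?f (insert j \<omega>))"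
  using insert.hyps by (subst sum.reindex) (auto simp: inj_on_def)
 also have "... = (\<Sum>\<omega>\<in>Pow \<kappa>. ?f \<omega> + (\<Sum>K\<in>Pow J - {J}. \<tau> (hm (zz h \<omega> y) K + (hm ?yj (J - K) + B))))"
  by (rule sum.cong[OF refl ins])
 also have "... = (\<Sum>\<omega>\<in>Pow \<kappa>. ?f \<omega>)
   + (\<Sum>K\<in>Pow J - {J}. \<Sum>\<omega>\<in>Pow \<kappa>. \<tau> (hm (zz h \<omega> y) K + (hm ?yj (J - K) + B)))"
  by (simp only: sum.distrib sum.swap[of _ "Pow \<kappa>"])
 also have "(\<Sum>K\<in>Pow J - {J}. \<Sum>\<omega>\<in>Pow \<kappa>. \<tau> (hm (zz h \<omega> y) K + (hm ?yj (J - K) + B))) = 0"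
 proof (rule sum.neutral, rule ballI)
  fix K assume K: "K : Pow J - {J}"
  have fK: "finite K" using K insert.prems(1) by (auto intro: finite_subset)
  have cK: "card K < card J" using K insert.prems(1) by (intro psubset_card_mono) auto
  have cd: "card (J - K) = card J - card K" using K fK by (intro card_Diff_subset) auto
  show "(\<Sum>\<omega>\<in>Pow \<kappa>. \<tau> (hm (zz h \<omega> y) K + (hm ?yj (J - K) + B))) = 0"
  proof (rule insert.IH[OF fK])
   show "card K < card \<kappa>" using cK insert.prems(2) insert.hyps by simp
   show "card K + size (hm ?yj (J - K) + B) = s" using cK cd insert.prems(3) by simp
   show "h ` K \<subseteq> FF n" using K insert.prems(4) by auto
   show "set_mset (hm ?yj (J - K) + B) \<subseteq> FF n"
    using insert.prems(1,5) VI_D[OF y] by (auto simp: set_hm)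
  qed
 qed
 finally show ?case by (simp add: bit_add_self)
qed simp

text \<open>The iterated difference over the face \<open>\<kappa>\<close> of the cube; no signs are
  needed in characteristic 2.\<close>

definition DD :: "(vec multiset => bit) => nat set => (nat => vec) => nat set => (nat \<times> nat => vec) => bit" where
 "DD \<tau> J h \<kappa> y = (\<Sum>\<omega>\<in>Pow \<kappa>. \<tau> (hm (zz h \<omega> y) J))"

text \<open>The difference over the face \<open>\<omega>\<close> is the value at its top vertex plus
  values at smaller vertices, so the values can be recovered by induction on the size of the
  vertex.\<close>

lemma DD_determines:
 assumes D: "finite D" and 1: "!!\<kappa>. \<kappa> \<subseteq> D ==> \<kappa> ~= {} ==> DD \<tau> J h \<kappa> y = DD \<tau> J h' \<kappa> y'"
  and 2: "\<tau> (hm h J) = \<tau> (hm h' J)"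
 shows "\<omega> \<subseteq> D ==> \<tau> (hm (zz h \<omega> y) J) = \<tau> (hm (zz h' \<omega> y') J)"
proof (induction "card \<omega>" arbitrary: \<omega> rule: less_induct)
 case less
 have fin: "finite \<omega>" using less.prems D finite_subset by blast
 show ?case
 proof (cases "\<omega> = {}")
  case False
  have sp: "DD \<tau> J k \<omega> u = \<tau> (hm (zz k \<omega> u) J) + (\<Sum>\<kappa>\<in>Pow \<omega> - {\<omega>}. \<tau> (hm (zz k \<kappa> u) J))" for k u
   unfolding DD_def using fin by (intro sum.remove) auto
  have "(\<Sum>\<kappa>\<in>Pow \<omega> - {\<omega>}. \<tau> (hm (zz h \<kappa> y) J)) = (\<Sum>\<kappa>\<in>Pow \<omega> - {\<omega>}. \<tau> (hm (zz h' \<kappa> y') J))"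
  proof (rule sum.cong[OF refl])
   fix \<kappa> assume \<kappa>: "\<kappa> : Pow \<omega> - {\<omega>}"
   show "\<tau> (hm (zz h \<kappa> y) J) = \<tau> (hm (zz h' \<kappa> y') J)"
   proof (rule less.hyps)
    show "card \<kappa> < card \<omega>" using \<kappa> fin by (intro psubset_card_mono) auto
    show "\<kappa> \<subseteq> D" using \<kappa> less.prems by blast
   qed
  qed
  then show ?thesis using 1[OF less.prems False] unfolding sp by simp
 qed (simp add: 2)
qed

lemma ex_onto:
 assumes "finite J" "finite \<kappa>" "\<kappa> ~= {}" "card \<kappa> \<le> card J"
 shows "\<exists>f. f ` J = \<kappa>"
proof -
 obtain g where g: "g ` \<kappa> \<subseteq> J" "inj_on g \<kappa>" using card_le_inj[OF assms(2,1,4)] by blast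
 obtain c where c: "c : \<kappa>" using assms(3) by blast
 define f where "f i = (if i : g ` \<kappa> then inv_into \<kappa> g i else c)" for i
 have "f ` J \<subseteq> \<kappa>" using c by (auto simp: f_def inv_into_into)
 moreover have "x : f ` J" if "x : \<kappa>" for x
  by (rule image_eqI[of _ _ "g x"]) (use that g in \<open>auto simp: f_def\<close>)
 ultimately show ?thesis by blast
qed

lemma ex_max:
 fixes \<mu> :: "'a => nat"
 assumes "finite A" "A ~= {}"
 shows "\<exists>x\<in>A. \<forall>y\<in>A. \<mu> y \<le> \<mu> x"
 using Max_in[of "\<mu> ` A"] Max_ge[of "\<mu> ` A"] assms by fastforce

text \<open>Lets the single threshold \<open>\<rho> ^ (2 ^ d)\<close> serve characters that are
  differenced \<open>k \<le> d\<close> times.\<close>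

lemma power_tower_le:
 fixes c \<rho> :: real
 assumes "c ^ (2 ^ k) < \<rho> ^ (2 ^ d)" "k \<le> d" "0 < \<rho>" "\<rho> \<le> 1"
 shows "c \<le> \<rho>"
proof -
 have "(2::nat) ^ k \<le> 2 ^ d" using assms(2) by simp
 then have "\<rho> ^ (2 ^ d) \<le> \<rho> ^ (2 ^ k)" by (rule power_decreasing) (use assms in auto)
 then have "c ^ (2 ^ k) < \<rho> ^ (2 ^ k)" using assms by linarith
 then have "c < \<rho>" by (rule power_less_imp_less_base) (use assms in auto)
 then show ?thesis by simp
qed

text \<open>Faces of dimension above \<open>card J\<close> are left out because the corresponding
  \<open>DD\<close> vanishes identically. The remaining bits turn out to be jointly
  equidistributed.\<close>

definition Om :: "nat => fml => (nat set \<times> nat \<times> nat set) set" where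
 "Om d F = {(\<kappa>, q, J). \<kappa> \<subseteq> {..d} & \<kappa> ~= {} & q < length F & J \<subseteq> {..<d} & card J = fst (F ! q) & card \<kappa> \<le> card J}"

lemma Om_card: "finite (Om d F)" "card (Om d F) \<le> length F * 2 ^ (2 * d + 1)"
proof -
 have sub: "Om d F \<subseteq> Pow {..d} \<times> {..<length F} \<times> Pow {..<d}" by (auto simp: Om_def)
 then show "finite (Om d F)" by (rule finite_subset) auto
 have "card (Om d F) \<le> card (Pow {..d} \<times> {..<length F} \<times> Pow {..<d})"
  by (rule card_mono[OF _ sub]) auto
 also have "... = 2 ^ Suc d * (length F * 2 ^ d)"
  by (simp add: card_cartesian_product card_Pow)
 also have "... = length F * 2 ^ (Suc d + d)" by (simp only: power_add ac_simps)
 also have "Suc d + d = 2 * d + 1" by simp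
 finally show "card (Om d F) \<le> length F * 2 ^ (2 * d + 1)" .
qed

text \<open>Among the terms of the character take one with a face \<open>\<kappa>0\<close> of
  maximal size and then with a maximal argument set \<open>J0\<close>. A surjection from
  \<open>J0\<close> onto \<open>\<kappa>0\<close> assigns to every argument a cube direction in
  which it is moved. A term survives the differencing only if its vertex contains
  \<open>\<kappa>0\<close> and its argument set contains \<open>J0\<close>; by maximality both are
  equalities, and regularity bounds the sum of the forms that are left.\<close>

lemma DD_char:
 assumes F: "fam alt n d F" and rg: "reg n (\<rho> ^ (2 ^ d)) F" and \<rho>: "0 < \<rho>" "\<rho> \<le> 1"
  and h: "h ` {..<d} \<subseteq> FF n" and \<Lambda>: "\<Lambda> \<subseteq> Om d F" "\<Lambda> ~= {}"
 shows "cmod (avg (VI ({..d} \<times> {..<d}) n)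
  (%y. \<chi> (\<Sum>x\<in>\<Lambda>. DD (snd (F ! fst (snd x))) (snd (snd x)) h (fst x) y))) \<le> \<rho>"
proof -
 let ?W = "VI ({..d} \<times> {..<d}) n"
 let ?K = "%x :: nat set \<times> nat \<times> nat set. fst x" and ?Q = "%x :: nat set \<times> nat \<times> nat set. fst (snd x)"
  and ?J = "%x :: nat set \<times> nat \<times> nat set. snd (snd x)"
 have W: "fin_grp ?W" by (rule fin_grp_VI) simp
 have fin\<Lambda>: "finite \<Lambda>" using \<Lambda>(1) Om_card(1) finite_subset by blast
 have \<Lambda>D: "?K x \<subseteq> {..d}" "?K x ~= {}" "?Q x < length F" "?J x \<subseteq> {..<d}" "card (?J x) = fst (F ! ?Q x)"
  "card (?K x) \<le> card (?J x)" "finite (?K x)" "finite (?J x)" "card (?J x) \<le> d" if "x : \<Lambda>" for x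
 proof -
  have "x : Om d F" using that \<Lambda>(1) by blast
  then show a: "?K x \<subseteq> {..d}" "?K x ~= {}" "?Q x < length F" and b: "?J x \<subseteq> {..<d}" and
   "card (?J x) = fst (F ! ?Q x)" "card (?K x) \<le> card (?J x)"
   by (auto simp: Om_def split: prod.splits)
  show "finite (?K x)" "finite (?J x)" using a b finite_subset by auto
  show "card (?J x) \<le> d" using card_mono[OF _ b] by simp
 qed
 \<comment> \<open>Lexicographic comparison of the two sizes, since
   \<open>card (?J x) \<le> d\<close> is smaller than the weight \<open>d + 1\<close>.\<close>
 define \<mu> where "\<mu> x = card (?K x) * (d + 1) + card (?J x)" for x
 obtain x0 where x0: "x0 : \<Lambda>" and max: "!!x. x : \<Lambda> ==> \<mu> x \<le> \<mu> x0"
  using ex_max[OF fin\<Lambda> \<Lambda>(2), of \<mu>] by blast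
 define \<kappa>0 where "\<kappa>0 = ?K x0"
 define J0 where "J0 = ?J x0"
 note x0D = \<Lambda>D[OF x0, folded \<kappa>0_def J0_def]
 have maxK: "?K x = \<kappa>0" if "x : \<Lambda>" "\<kappa>0 \<subseteq> ?K x" for x
 proof (rule ccontr)
  assume "?K x ~= \<kappa>0"
  then have "card \<kappa>0 < card (?K x)" using that \<Lambda>D(7)[OF that(1)] by (intro psubset_card_mono) auto
  then have "(card \<kappa>0 + 1) * (d + 1) \<le> card (?K x) * (d + 1)" by (intro mult_right_mono) auto
  moreover have "\<mu> x \<le> \<mu> x0" by (rule max[OF that(1)])
  ultimately show False using x0D(9) by (simp add: \<mu>_def \<kappa>0_def J0_def)
 qed
 have maxJ: "?J x = J0" if "x : \<Lambda>" "?K x = \<kappa>0" "J0 \<subseteq> ?J x" for x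
 proof (rule ccontr)
  assume "?J x ~= J0"
  then have "card J0 < card (?J x)" using that \<Lambda>D(8)[OF that(1)] by (intro psubset_card_mono) auto
  moreover have "\<mu> x \<le> \<mu> x0" by (rule max[OF that(1)])
  ultimately show False using that(2) by (simp add: \<mu>_def \<kappa>0_def J0_def)
 qed
 obtain jj where jj: "jj ` J0 = \<kappa>0" using ex_onto[OF x0D(8,7,2,6)] by blast
 define \<iota> where "\<iota> i = sing (jj i, i)" for i
 obtain js where js: "set js = J0" "distinct js" using finite_distinct_list[OF x0D(8)] by blast
 define X where "X = {q. (\<kappa>0, q, J0) : \<Lambda>}"
 define \<Lambda>0 where "\<Lambda>0 = (%q. ((\<kappa>0, q, J0), \<kappa>0)) ` X"
 define \<Lambda>1 where "\<Lambda>1 = Sigma \<Lambda> (%x. Pow (?K x))"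
 define g where "g k y = snd (F ! ?Q (fst k)) (hm (zz h (snd k) y) (?J (fst k)))" for k y
 have J0ne: "J0 ~= {}" using x0D(2,6,7) by (auto simp: card_eq_0_iff)
 have finX: "finite X"
 proof -
  have "X \<subseteq> {..<length F}"
  proof
   fix q assume "q : X"
   then have "(\<kappa>0, q, J0) : \<Lambda>" by (simp add: X_def)
   from \<Lambda>D(3)[OF this] show "q : {..<length F}" by simp
  qed
  then show ?thesis by (rule finite_subset) simp
 qed
 have sum1: "(\<Sum>x\<in>\<Lambda>. DD (snd (F ! ?Q x)) (?J x) h (?K x) y) = (\<Sum>k\<in>\<Lambda>1. g k y)" for y
  unfolding DD_def \<Lambda>1_def g_def using fin\<Lambda> \<Lambda>D(7) by (subst sum.Sigma) (auto simp: case_prod_unfold)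
 have form1: "form alt n (card (?J x)) (snd (F ! ?Q x))" if "x : \<Lambda>" for x
  using F nth_mem[OF \<Lambda>D(3)[OF that]] \<Lambda>D(5)[OF that] unfolding fam_def by fastforce
 have kin: "fst k : \<Lambda>" "snd k \<subseteq> ?K (fst k)" "finite (snd k)" if "k : \<Lambda>1" for k
 proof -
  show k: "fst k : \<Lambda>" "snd k \<subseteq> ?K (fst k)" using that unfolding \<Lambda>1_def by auto
  show "finite (snd k)" using finite_subset[OF k(2) \<Lambda>D(7)[OF k(1)]] .
 qed
 have "cmod (avg ?W (%y. \<chi> (\<Sum>k\<in>\<Lambda>1. g k y))) ^ (2 ^ card J0)
   \<le> bias n (card J0) (%M. \<Sum>k\<in>\<Lambda>0. snd (F ! ?Q (fst k)) M)"
 proof (rule form_char_bound[OF W js(2,1) J0ne, where \<iota> = \<iota> and z = "zz h \<kappa>0" and alt = alt])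
  show "\<forall>j\<in>J0. dirhom (FF n) ?W (\<iota> j)"
  proof
   fix j assume "j : J0"
   then have "(jj j, j) : {..d} \<times> {..<d}" using jj x0D(1,4) by auto
   then show "dirhom (FF n) ?W (\<iota> j)" unfolding \<iota>_def by (rule dirhom_sing)
  qed
  show "\<forall>w\<in>?W. \<forall>i\<in>J0. zz h \<kappa>0 w i : FF n"
   using h x0D(4) by (auto intro!: zz_FF)
  show "\<forall>w\<in>?W. \<forall>i\<in>J0. \<forall>j\<in>J0. \<forall>a\<in>FF n. zz h \<kappa>0 (w + \<iota> j a) i = zz h \<kappa>0 w i + (if i = j then a else 0)"
  proof (intro ballI)
   fix w i j a assume "i : J0" "j : J0"
   then have "jj j : \<kappa>0" using jj by blast
   then show "zz h \<kappa>0 (w + \<iota> j a) i = zz h \<kappa>0 w i + (if i = j then a else 0)"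
    unfolding \<iota>_def zz_upd[OF x0D(7)] by simp
  qed
  show "finite \<Lambda>1" unfolding \<Lambda>1_def using fin\<Lambda> \<Lambda>D(7) by auto
  show "\<Lambda>0 \<subseteq> \<Lambda>1" unfolding \<Lambda>0_def \<Lambda>1_def X_def by auto
  show "form alt n (card J0) (snd (F ! ?Q (fst k)))" if k0: "k : \<Lambda>0" for k
  proof -
   obtain q where "k = ((\<kappa>0, q, J0), \<kappa>0)" "(\<kappa>0, q, J0) : \<Lambda>" using k0 by (auto simp: \<Lambda>0_def X_def)
   then show ?thesis using form1[of "(\<kappa>0, q, J0)"] by simp
  qed
  show "g k w = snd (F ! ?Q (fst k)) (hm (zz h \<kappa>0 w) J0)" if "k : \<Lambda>0" for k w
   using that by (auto simp: \<Lambda>0_def g_def)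
  show "\<exists>j\<in>J0. inv_dir (FF n) ?W (\<iota> j) (g k)" if k: "k : \<Lambda>1 - \<Lambda>0" for k
  proof -
   have kk: "fst k : \<Lambda>" "snd k \<subseteq> ?K (fst k)" "finite (snd k)" using kin k by auto
   show ?thesis
   proof (cases "\<kappa>0 \<subseteq> snd k")
    case False
    then obtain i where i: "i : J0" "jj i \<notin> snd k" using jj by blast
    have "zz h (snd k) (w + \<iota> i a) = zz h (snd k) w" for w a
     by (rule ext) (simp only: \<iota>_def zz_upd[OF kk(3)] i(2), simp)
    then have "inv_dir (FF n) ?W (\<iota> i) (g k)" unfolding inv_dir_def g_def by simp
    then show ?thesis using i by blast
   next
    case True
    then have K: "?K (fst k) = \<kappa>0" using maxK[OF kk(1)] kk(2) by blast
    then have sk: "snd k = \<kappa>0" using True kk(2) by blast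
    have "?J (fst k) ~= J0"
    proof
     assume J: "?J (fst k) = J0"
     have fk: "fst k = (\<kappa>0, ?Q (fst k), J0)" using K J by (metis prod.collapse)
     then have "?Q (fst k) : X" using kk(1) unfolding X_def by simp
     moreover have "k = ((\<kappa>0, ?Q (fst k), J0), \<kappa>0)" using fk sk by (metis prod.collapse)
     ultimately have "k : \<Lambda>0" unfolding \<Lambda>0_def by blast
     then show False using k by blast
    qed
    then obtain i where i: "i : J0" "i \<notin> ?J (fst k)" using maxJ[OF kk(1) K] by blast
    have "hm (zz h (snd k) (w + \<iota> i a)) (?J (fst k)) = hm (zz h (snd k) w) (?J (fst k))" for w a
    proof (rule hm_cong)
     fix l assume "l : ?J (fst k)"
     then have "l ~= i" using i by blast
     then show "zz h (snd k) (w + \<iota> i a) l = zz h (snd k) w l"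
      unfolding \<iota>_def zz_upd[OF kk(3)] by simp
    qed
    then have "inv_dir (FF n) ?W (\<iota> i) (g k)" unfolding inv_dir_def g_def by simp
    then show ?thesis using i by blast
   qed
  qed
 qed
 also have "bias n (card J0) (%M. \<Sum>k\<in>\<Lambda>0. snd (F ! ?Q (fst k)) M) = bias n (card J0) (%M. \<Sum>q\<in>X. snd (F ! q) M)"
  unfolding \<Lambda>0_def by (subst sum.reindex) (auto simp: inj_on_def)
 also have "... < \<rho> ^ (2 ^ d)"
 proof -
  have "X \<subseteq> {i. i < length F & fst (F ! i) = card J0}"
  proof
   fix q assume "q : X"
   then have "(\<kappa>0, q, J0) : \<Lambda>" by (simp add: X_def)
   from \<Lambda>D(3,5)[OF this] show "q : {i. i < length F & fst (F ! i) = card J0}" by simp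
  qed
  moreover have "?Q x0 : X"
   using x0 unfolding X_def \<kappa>0_def J0_def by simp
  ultimately show ?thesis using rg unfolding reg_def by blast
 qed
 finally show ?thesis unfolding sum1 by (rule power_tower_le) (use x0D(9) \<rho> in auto)
qed

text \<open>A shift of the edge \<open>j0\<close> translates the vertex by an arbitrary tuple, so
  the vertex is uniformly distributed.\<close>

lemma marginal:
 assumes j0: "j0 : \<omega>" "\<omega> \<subseteq> {..d}" and h: "h : VI {..<d} n"
 shows "avg (VI ({..d} \<times> {..<d}) n) (%y. f (zz h \<omega> y)) = avg (VI {..<d} n) f"
proof -
 let ?W = "VI ({..d} \<times> {..<d}) n" and ?V = "VI {..<d} n"
 have W: "fin_grp ?W" and V: "fin_grp ?V" by (auto intro: fin_grp_VI)
 have fin: "finite \<omega>" using j0(2) finite_subset by blast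
 have zV: "zz h \<omega> y : ?V" if "y : ?W" for y
 proof -
  have "zz h \<omega> y i = 0" if "i \<notin> {..<d}" for i
  proof -
   have "y (j, i) = 0" for j using \<open>y : ?W\<close> that by (auto simp: VI_def)
   moreover have "h i = 0" using h that by (auto simp: VI_def)
   ultimately show ?thesis by (simp add: zz_def)
  qed
  moreover have "zz h \<omega> y i : FF n" for i using zz_FF[OF VI_D[OF h] that] .
  ultimately show ?thesis by (auto simp: VI_def)
 qed
 define e where "e a = (%(j, i). if j = j0 then a i else (0::vec))" for a :: "nat => vec"
 have eW: "e a : ?W" if "a : ?V" for a
  using that j0 by (auto simp: VI_def e_def FF_zero)
 have ze: "zz h \<omega> (y + e a) = zz h \<omega> y + a" for y a
 proof (rule ext)
  fix i
  have "(\<Sum>j\<in>\<omega>. (y + e a) (j, i)) = (\<Sum>j\<in>\<omega>. y (j, i)) + (\<Sum>j\<in>\<omega>. e a (j, i))"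
   by (simp only: plus_fun_apply sum.distrib)
  also have "(\<Sum>j\<in>\<omega>. e a (j, i)) = (\<Sum>j\<in>\<omega>. if j = j0 then a i else 0)"
   unfolding e_def by (rule sum.cong[OF refl]) (simp only: case_prod_conv)
  also have "... = a i" using fin j0(1) by (simp only: sum.delta if_True)
  finally have eq: "(\<Sum>j\<in>\<omega>. (y + e a) (j, i)) = (\<Sum>j\<in>\<omega>. y (j, i)) + a i" .
  have "zz h \<omega> (y + e a) i = h i + ((\<Sum>j\<in>\<omega>. y (j, i)) + a i)"
   unfolding zz_def by (rule arg_cong[OF eq])
  also have "... = zz h \<omega> y i + a i" unfolding zz_def by (rule add.assoc[symmetric])
  finally show "zz h \<omega> (y + e a) i = (zz h \<omega> y + a) i"
   by (simp only: plus_fun_apply)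
 qed
 have "avg ?W (%y. f (zz h \<omega> y)) = avg ?V (%a. avg ?W (%y. f (zz h \<omega> y)))"
  using fin_grp_card[OF V] by (simp add: avg_const)
 also have "... = avg ?V (%a. avg ?W (%y. f (zz h \<omega> (y + e a))))"
  by (rule avg_cong) (rule avg_shift[OF W eW, of _ "%y. f (zz h \<omega> y)", symmetric])
 also have "... = avg ?W (%y. avg ?V (%a. f (a + zz h \<omega> y)))"
  unfolding ze by (subst avg_swap) (simp only: add.commute)
 also have "... = avg ?W (%y. avg ?V f)"
  by (rule avg_cong) (rule avg_shift[OF V zV])
 also have "... = avg ?V f" using fin_grp_card[OF W] by (simp add: avg_const)
 finally show ?thesis .
qed

text \<open>At most a quarter of \<open>1 / 2 ^ N\<close>, where \<open>N\<close> is the number of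
  bits in \<open>Om d F\<close>, by the bound in \<open>Om_card\<close>.\<close>

definition rr :: "nat => nat => real" where
 "rr d m = (1 / 2) ^ (m * 2 ^ (2 * d + 1) + 2)"

lemma rr_pos: "0 < rr d m" "rr d m \<le> 1"
 unfolding rr_def by (auto intro!: power_le_one simp del: power_Suc power_add)

text \<open>Self-correction: the form at \<open>h\<close> is the sum of its values at the other
  vertices of a cube of dimension d + 1 based at \<open>h\<close>. For \<open>h\<close> as well as
  for \<open>h'\<close>, more than half of all patterns of the \<open>DD\<close> bits are realized
  by cubes whose other vertices all lie in \<open>G\<close>. A common pattern gives two cubes on
  which the family agrees vertex by vertex, and \<open>det\<close> applies to each pair of
  vertices.\<close>

lemma exactness_VI:
 assumes T: "form alt n d T" and F: "fam alt n d F" and rg: "reg n (rr d (length F) ^ (2 ^ d)) F"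
  and G: "G \<subseteq> VI {..<d} n" "card (VI {..<d} n - G) \<le> (1 / 2 ^ (d + 3)) * card (VI {..<d} n)"
  and det: "!!h h'. h : G ==> h' : G ==> agree {..<d} F h h' ==> T (hm h {..<d}) = T (hm h' {..<d})"
  and hV: "h : VI {..<d} n" "h' : VI {..<d} n" and ag: "agree {..<d} F h h'"
 shows "T (hm h {..<d}) = T (hm h' {..<d})"
proof -
 let ?W = "VI ({..d} \<times> {..<d}) n" and ?V = "VI {..<d} n"
 define \<rho> where "\<rho> = rr d (length F)"
 define N where "N = card (Om d F)"
 have W: "fin_grp ?W" and V: "fin_grp ?V" by (auto intro: fin_grp_VI)
 note finW = fin_grp_finite[OF W] and cW = fin_grp_card[OF W]
 have \<rho>N: "\<rho> \<le> (1 / 2 ^ N) / 4"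
 proof -
  have "\<rho> = (1 / 2) ^ (length F * 2 ^ (2 * d + 1)) / 4" by (simp add: \<rho>_def rr_def power_add)
  also have "... \<le> (1 / 2) ^ N / 4"
   using Om_card(2)[of d F] by (intro divide_right_mono power_decreasing) (auto simp: N_def)
  finally show ?thesis by (simp add: power_one_over)
 qed
 define pat where "pat h y = {x\<in>Om d F. DD (snd (F ! fst (snd x))) (snd (snd x)) h (fst x) y = 1}" for h y
 define Gd where "Gd h = {y\<in>?W. \<forall>\<omega>\<in>Pow {..d} - {{}}. zz h \<omega> y : G}" for h
 \<comment> \<open>By a union bound at most 1/4 of the cubes have a vertex outside \<open>G\<close>,
   and every pattern has a share of at most 5/4 times \<open>1 / 2 ^ N\<close>; so the good cubes
   realize at least (3/4) / (5/4) = 3/5 of the patterns.\<close>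
 have big: "card (pat h ` Gd h) \<ge> (3 / 5) * 2 ^ N" if h: "h : ?V" for h
 proof -
  have hF: "h ` {..<d} \<subseteq> FF n" using VI_D[OF h] by auto
  have eq: "card {y\<in>?W. pat h y = Z} \<le> (1 / 2 ^ N + \<rho>) * card ?W" if "Z \<subseteq> Om d F" for Z
  proof -
   have "\<bar>card {y\<in>?W. pat h y = Z} / card ?W - 1 / 2 ^ N\<bar> \<le> \<rho>"
    unfolding pat_def N_def
    by (rule equidist[OF cW Om_card(1) _ DD_char[OF F rg[folded \<rho>_def] _ _ hF] that])
     (use rr_pos in \<open>auto simp: \<rho>_def less_imp_le\<close>)
   then have "card {y\<in>?W. pat h y = Z} / card ?W \<le> 1 / 2 ^ N + \<rho>" by linarith
   then show ?thesis using cW by (simp add: divide_le_eq)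
  qed
  have bad: "card {y\<in>?W. zz h \<omega> y \<notin> G} \<le> (1 / 2 ^ (d + 3)) * card ?W" if \<omega>: "\<omega> : Pow {..d} - {{}}" for \<omega>
  proof -
   obtain j0 where j0: "j0 : \<omega>" using \<omega> by blast
   have "avg ?W (%y. of_bool (zz h \<omega> y \<notin> G) :: real) = avg ?V (%v. of_bool (v \<notin> G))"
    by (rule marginal[OF j0 _ h, where f = "%v. of_bool (v \<notin> G)"]) (use \<omega> in auto)
   moreover have "avg ?W (%y. of_bool (zz h \<omega> y \<notin> G) :: real) = card {y\<in>?W. zz h \<omega> y \<notin> G} / card ?W"
    using finW by (simp add: avg_def of_bool_def sum.If_cases Int_def)
   moreover have "avg ?V (%v. of_bool (v \<notin> G) :: real) = card (?V - G) / card ?V"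
    using fin_grp_finite[OF V] by (simp add: avg_def of_bool_def sum.If_cases Int_def set_diff_eq)
   moreover have "card (?V - G) / card ?V \<le> 1 / 2 ^ (d + 3)"
    using G(2) fin_grp_card[OF V] by (simp add: divide_le_eq)
   ultimately have "card {y\<in>?W. zz h \<omega> y \<notin> G} / card ?W \<le> 1 / 2 ^ (d + 3)" by linarith
   then show ?thesis using cW by (simp add: divide_le_eq)
  qed
  have "?W - Gd h \<subseteq> (\<Union>\<omega>\<in>Pow {..d} - {{}}. {y\<in>?W. zz h \<omega> y \<notin> G})" by (auto simp: Gd_def)
  then have "card (?W - Gd h) \<le> card (\<Union>\<omega>\<in>Pow {..d} - {{}}. {y\<in>?W. zz h \<omega> y \<notin> G})"
   using finW by (intro card_mono) auto
  also have "... \<le> (\<Sum>\<omega>\<in>Pow {..d} - {{}}. card {y\<in>?W. zz h \<omega> y \<notin> G})"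
   by (rule card_UN_le) auto
  finally have "real (card (?W - Gd h)) \<le> (\<Sum>\<omega>\<in>Pow {..d} - {{}}. real (card {y\<in>?W. zz h \<omega> y \<notin> G}))"
   unfolding of_nat_sum[symmetric] of_nat_le_iff .
  also have "... \<le> (\<Sum>\<omega>\<in>Pow {..d} - {{}}. (1 / 2 ^ (d + 3)) * card ?W)"
   by (rule sum_mono) (rule bad)
  also have "... \<le> (\<Sum>\<omega>\<in>Pow {..d}. (1 / 2 ^ (d + 3)) * card ?W)"
   by (rule sum_mono2) auto
  also have "... = card ?W / 4" by (simp add: card_Pow power_add)
  finally have "card (?W - Gd h) \<le> real (card ?W) / 4" .
  moreover have "card ?W = card (Gd h) + card (?W - Gd h)"
  proof -
   have sub: "Gd h \<subseteq> ?W" by (auto simp: Gd_def)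
   show ?thesis
    using card_Diff_subset[OF finite_subset[OF sub finW] sub] card_mono[OF finW sub] by simp
  qed
  ultimately have g34: "(3 / 4) * card ?W \<le> card (Gd h)" by linarith
  have patO: "pat h ` Gd h \<subseteq> Pow (Om d F)" by (auto simp: pat_def)
  have finP: "finite (pat h ` Gd h)" using patO by (rule finite_subset) (simp add: Om_card)
  have "Gd h \<subseteq> (\<Union>Z\<in>pat h ` Gd h. {y\<in>?W. pat h y = Z})" by (auto simp: Gd_def)
  then have "card (Gd h) \<le> card (\<Union>Z\<in>pat h ` Gd h. {y\<in>?W. pat h y = Z})"
   by (rule card_mono[rotated]) (rule finite_UN_I[OF finP], use finW in simp)
  also have "... \<le> (\<Sum>Z\<in>pat h ` Gd h. card {y\<in>?W. pat h y = Z})" by (rule card_UN_le[OF finP])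
  finally have "real (card (Gd h)) \<le> (\<Sum>Z\<in>pat h ` Gd h. real (card {y\<in>?W. pat h y = Z}))"
   unfolding of_nat_sum[symmetric] of_nat_le_iff .
  also have "... \<le> (\<Sum>Z\<in>pat h ` Gd h. (1 / 2 ^ N + \<rho>) * card ?W)"
   by (rule sum_mono) (use eq patO in blast)
  also have "... = card (pat h ` Gd h) * (1 / 2 ^ N + \<rho>) * card ?W" by simp
  finally have "(3 / 4) * real (card ?W) \<le> card (pat h ` Gd h) * (1 / 2 ^ N + \<rho>) * card ?W"
   using g34 by linarith
  then have "3 / 4 \<le> card (pat h ` Gd h) * (1 / 2 ^ N + \<rho>)"
   by (rule mult_right_le_imp_le) (use cW in simp)
  also have "... \<le> card (pat h ` Gd h) * ((5 / 4) * (1 / 2 ^ N))"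
   using \<rho>N by (intro mult_left_mono) auto
  finally show ?thesis by (simp add: field_simps)
 qed
 have "pat h ` Gd h \<inter> pat h' ` Gd h' ~= {}"
 proof
  assume disj: "pat h ` Gd h \<inter> pat h' ` Gd h' = {}"
  have sub: "pat h ` Gd h \<union> pat h' ` Gd h' \<subseteq> Pow (Om d F)" by (auto simp: pat_def)
  have fin: "finite (Pow (Om d F))" by (simp add: Om_card)
  have "card (pat h ` Gd h) + card (pat h' ` Gd h') = card (pat h ` Gd h \<union> pat h' ` Gd h')"
   using sub fin disj by (intro card_Un_disjoint[symmetric]) (auto intro: finite_subset)
  also have "... \<le> card (Pow (Om d F))" by (rule card_mono[OF fin sub])
  also have "... = 2 ^ N" by (simp add: card_Pow N_def Om_card)
  finally have le: "card (pat h ` Gd h) + card (pat h' ` Gd h') \<le> 2 ^ N" .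
  have "real (card (pat h ` Gd h)) + real (card (pat h' ` Gd h')) \<le> 2 ^ N"
   using of_nat_le_iff[where 'a = real, THEN iffD2, OF le] by simp
  moreover have "(0::real) < 2 ^ N" by simp
  ultimately show False using big[OF hV(1)] big[OF hV(2)] by linarith
 qed
 then obtain y y' where y: "y : Gd h" "y' : Gd h'" and pp: "pat h y = pat h' y'" by auto
 have yW: "y : ?W" "y' : ?W" using y by (auto simp: Gd_def)
 have hF: "h ` {..<d} \<subseteq> FF n" "h' ` {..<d} \<subseteq> FF n" using VI_D hV by auto
 have agz: "agree {..<d} F (zz h \<omega> y) (zz h' \<omega> y')" if \<omega>: "\<omega> \<subseteq> {..d}" for \<omega>
 proof (rule agreeI)
  fix s \<tau> J assume s: "(s, \<tau>) : set F" and J: "J \<subseteq> {..<d}" "s = card J"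
  obtain q where q: "q < length F" "F ! q = (s, \<tau>)" using s by (auto simp: in_set_conv_nth)
  have \<tau>: "form alt n s \<tau>" using F s by (auto simp: fam_def)
  have finJ: "finite J" using J finite_subset by blast
  show "\<tau> (hm (zz h \<omega> y) J) = \<tau> (hm (zz h' \<omega> y') J)"
  proof (rule DD_determines[OF _ _ _ \<omega>])
   fix \<kappa> assume \<kappa>: "\<kappa> \<subseteq> {..d}" "\<kappa> ~= {}"
   have fin\<kappa>: "finite \<kappa>" using \<kappa> finite_subset by blast
   show "DD \<tau> J h \<kappa> y = DD \<tau> J h' \<kappa> y'"
   proof (cases "card \<kappa> \<le> card J")
    case True
    then have x: "(\<kappa>, q, J) : Om d F" using \<kappa> q J by (auto simp: Om_def)
    have "(\<kappa>, q, J) : pat h y \<longleftrightarrow> (\<kappa>, q, J) : pat h' y'" using pp by simp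
    then have "DD \<tau> J h \<kappa> y = 1 \<longleftrightarrow> DD \<tau> J h' \<kappa> y' = 1" using x q by (simp add: pat_def)
    then show ?thesis by (cases "DD \<tau> J h \<kappa> y"; cases "DD \<tau> J h' \<kappa> y'") auto
   next
    case False
    have "DD \<tau> J h \<kappa> y = 0"
     unfolding DD_def using cube_vanish[OF \<tau> yW(1) fin\<kappa> finJ, of "{#}" h] False J hF by auto
    moreover have "DD \<tau> J h' \<kappa> y' = 0"
     unfolding DD_def using cube_vanish[OF \<tau> yW(2) fin\<kappa> finJ, of "{#}" h'] False J hF by auto
    ultimately show ?thesis by simp
   qed
  next
   show "\<tau> (hm h J) = \<tau> (hm h' J)" using ag s J unfolding agree_def by blast
  qed simp
 qed
 \<comment> \<open>The cube has dimension d + 1, one more than the order of the form, and its empty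
   vertex is \<open>h\<close> itself.\<close>
 have Tz: "T (hm h {..<d}) = (\<Sum>\<omega>\<in>Pow {..d} - {{}}. T (hm (zz h \<omega> y) {..<d}))"
  if "y : ?W" "h ` {..<d} \<subseteq> FF n" for h y
 proof -
  have "0 = (\<Sum>\<omega>\<in>Pow {..d}. T (hm (zz h \<omega> y) {..<d}))"
   using cube_vanish[OF T that(1), of "{..d}" "{..<d}" "{#}" h] that(2) by simp
  also have "... = T (hm (zz h {} y) {..<d}) + (\<Sum>\<omega>\<in>Pow {..d} - {{}}. T (hm (zz h \<omega> y) {..<d}))"
   by (rule sum.remove) auto
  finally show ?thesis
   by (metis add.right_neutral bit_cancel zz_empty)
 qed
 have "T (hm (zz h \<omega> y) {..<d}) = T (hm (zz h' \<omega> y') {..<d})" if "\<omega> : Pow {..d} - {{}}" for \<omega>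
  by (rule det) (use that y agz in \<open>auto simp: Gd_def\<close>)
 then show ?thesis
  unfolding Tz[OF yW(1) hF(1)] Tz[OF yW(2) hF(2)] by (rule sum.cong[OF refl])
qed

lemma gen_from_VI:
 assumes "!!h h'. h : VI {..<d} n ==> h' : VI {..<d} n ==> agree {..<d} F h h' ==>
  T (hm h {..<d}) = T (hm h' {..<d})"
 shows "gen n F d T"
proof (rule gen_standard)
 fix h h' assume h: "h ` {..<d} \<subseteq> FF n" "h' ` {..<d} \<subseteq> FF n" and ag: "agree {..<d} F h h'"
 define tr where "tr h i = (if i < d then h i else (0::vec))" for h i
 have tr: "hm (tr k) J = hm k J" if "J \<subseteq> {..<d}" for k J
  by (rule hm_cong) (use that in \<open>auto simp: tr_def\<close>)
 have "agree {..<d} F (tr h) (tr h')"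
  using ag unfolding agree_def by (auto simp: tr)
 moreover have "tr h : VI {..<d} n" "tr h' : VI {..<d} n"
  using h by (auto simp: VI_def tr_def)
 ultimately have "T (hm (tr h) {..<d}) = T (hm (tr h') {..<d})" by (intro assms)
 then show "T (hm h {..<d}) = T (hm h' {..<d})" by (simp add: tr)
qed

text \<open>\<open>majority\<close> gives determination off a small set, regularization makes the
  family generic, and self-correction removes the exceptional set. Regularity is recorded in the
  conclusion because the structure of the form is read off from generic families.\<close>

theorem biased_form_generated:
 assumes "d \<ge> 1" "\<delta> > 0"
 shows "\<exists>K. \<forall>n T. form alt n d T & bias n d T \<ge> \<delta> -->
   (\<exists>F. length F \<le> K & fam alt n d F & gen n F d T & reg n (rr d (length F) ^ (2 ^ d)) F)"
 using assms
proof (induction d arbitrary: \<delta> rule: less_induct)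
 case (less d)
 have "GenP alt s" if "1 \<le> s" "s < d" for s
  unfolding GenP_def using less.IH[OF that(2,1)] by meson
 from regularize[of d alt "%m. rr d m ^ (2 ^ d)", OF this] rr_pos(1)
 have "\<exists>M. \<forall>n F. fam alt n d F & length F \<le> m -->
  (\<exists>F'. length F' \<le> M & fam alt n d F' & reg n (rr d (length F') ^ (2 ^ d)) F' & (\<forall>(s, \<tau>)\<in>set F. gen n F' s \<tau>))" for m
  by auto
 then obtain M where M: "!!m n F. fam alt n d F ==> length F \<le> m ==>
  (\<exists>F'. length F' \<le> M m & fam alt n d F' & reg n (rr d (length F') ^ (2 ^ d)) F' & (\<forall>(s, \<tau>)\<in>set F. gen n F' s \<tau>))"
  by metis
 \<comment> \<open>Fewer than \<open>2 ^ (d + 1)\<close> vertices are tested in the self-correction,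
   so this error per vertex amounts to at most 1/4 in total.\<close>
 have "1 / 2 ^ (d + 3) > (0::real)" by simp
 from majority[OF less.prems(2) this, of d]
 obtain K where K: "\<forall>n T alt. form alt n d T & bias n d T \<ge> \<delta> -->
  (\<exists>F G. length F \<le> K & fam alt n d F & G \<subseteq> VI {..<d} n &
    card (VI {..<d} n - G) \<le> 1 / 2 ^ (d + 3) * card (VI {..<d} n) &
    (\<forall>h\<in>G. \<forall>h'\<in>G. agree {..<d} F h h' --> T (hm h {..<d}) = T (hm h' {..<d})))" by blast
 show ?case
 proof (intro exI[of _ "M K"] allI impI, elim conjE)
  fix n T assume T: "form alt n d T" "bias n d T \<ge> \<delta>"
  obtain F G where F: "length F \<le> K" "fam alt n d F" and G: "G \<subseteq> VI {..<d} n"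
    "card (VI {..<d} n - G) \<le> 1 / 2 ^ (d + 3) * card (VI {..<d} n)"
    and det: "!!h h'. h : G ==> h' : G ==> agree {..<d} F h h' ==> T (hm h {..<d}) = T (hm h' {..<d})"
   using K T by meson
  obtain F' where F': "length F' \<le> M K" "fam alt n d F'" "reg n (rr d (length F') ^ (2 ^ d)) F'"
   and gn: "!!s \<tau>. (s, \<tau>) : set F ==> gen n F' s \<tau>"
   using M[OF F(2,1)] by blast
  have "agree {..<d} F h h'" if h: "h : G" "h' : G" "agree {..<d} F' h h'" for h h'
  proof (rule agreeI)
   fix s \<tau> J assume s: "(s, \<tau>) : set F" and J: "J \<subseteq> {..<d}" "s = card J"
   have "h ` J \<subseteq> FF n" "h' ` J \<subseteq> FF n" using h(1,2) G(1) by (auto intro: VI_D)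
   then show "\<tau> (hm h J) = \<tau> (hm h' J)"
    using genD[OF gn[OF s], of J h h'] J agree_subset[OF h(3) J(1)] finite_subset[OF J(1)] by auto
  qed
  then have "gen n F' d T"
   using exactness_VI[OF T(1) F'(2,3) G] det by (intro gen_from_VI) blast
  then show "\<exists>F. length F \<le> M K & fam alt n d F & gen n F d T & reg n (rr d (length F) ^ (2 ^ d)) F"
   using F' by blast
 qed
qed

section \<open>Structure of biased forms\<close>

definition Om2 :: "nat set => fml => (nat \<times> nat set) set" where
 "Om2 I F = {(q, J). q < length F & J \<subseteq> I & card J = fst (F ! q)}"

definition ev :: "fml => (nat => vec) => nat \<times> nat set => bit" where
 "ev F h x = snd (F ! fst x) (hm h (snd x))"

definition Zp :: "fml => nat set => (nat => vec) => (nat \<times> nat set) set" where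
 "Zp F I h = {x\<in>Om2 I F. ev F h x = 1}"

lemma Om2_D:
 "x : Om2 I F ==> fst x < length F" "x : Om2 I F ==> snd x \<subseteq> I"
 "x : Om2 I F ==> card (snd x) = fst (F ! fst x)"
 by (auto simp: Om2_def)

lemma Om2_finite: "finite I ==> finite (Om2 I F)"
 by (rule finite_subset[of _ "{..<length F} \<times> Pow I"]) (auto simp: Om2_def)

text \<open>Regularity makes every pattern of values occur with positive probability. There are d +
  1 arguments, one more than the form of order d has: the spare one is used to exploit additivity.
  In a character the blocks on one index set of maximal size survive the differencing.\<close>

lemma attain:
 assumes F: "fam alt n d F" and rg: "reg n (rr d (length F) ^ (2 ^ d)) F" and d: "d \<ge> 1"
  and Z: "Z \<subseteq> Om2 {..d} F"
 shows "\<exists>h\<in>VI {..d} n. Zp F {..d} h = Z"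
proof -
 let ?W = "VI {..d} n"
 define \<rho> where "\<rho> = rr d (length F)"
 have W: "fin_grp ?W" by (rule fin_grp_VI) simp
 have small: "cmod (avg ?W (%w. \<chi> (\<Sum>x\<in>\<Lambda>. ev F w x))) \<le> \<rho>"
  if \<Lambda>: "\<Lambda> \<subseteq> Om2 {..d} F" "\<Lambda> ~= {}" for \<Lambda>
 proof -
  have fin\<Lambda>: "finite \<Lambda>" using \<Lambda>(1) Om2_finite[of "{..d}" F] finite_subset by blast
  obtain x0 where x0: "x0 : \<Lambda>" and max: "!!x. x : \<Lambda> ==> card (snd x) \<le> card (snd x0)"
   using ex_max[OF fin\<Lambda> \<Lambda>(2), of "%x. card (snd x)"] by blast
  define J0 where "J0 = snd x0"
  define X where "X = {q. (q, J0) : \<Lambda>}"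
  define \<Lambda>0 where "\<Lambda>0 = (%q. (q, J0)) ` X"
  have \<Lambda>O: "x : Om2 {..d} F" if "x : \<Lambda>" for x using \<Lambda>(1) that by blast
  have fin: "finite (snd x)" if "x : \<Lambda>" for x
   using Om2_D(2)[OF \<Lambda>O[OF that]] finite_subset by blast
  have Fx: "1 \<le> card (snd x) & card (snd x) < d & form alt n (card (snd x)) (snd (F ! fst x))" if "x : \<Lambda>" for x
   using F nth_mem[OF Om2_D(1)[OF \<Lambda>O[OF that]]] Om2_D(3)[OF \<Lambda>O[OF that]] unfolding fam_def by fastforce
  have J0: "finite J0" "J0 ~= {}" "J0 \<subseteq> {..d}" "card J0 \<le> d"
   using fin[OF x0] Fx[OF x0] Om2_D(2)[OF \<Lambda>O[OF x0]] by (auto simp: J0_def)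
  obtain js where js: "set js = J0" "distinct js" using finite_distinct_list[OF J0(1)] by blast
  have "cmod (avg ?W (%w. \<chi> (\<Sum>x\<in>\<Lambda>. ev F w x))) ^ (2 ^ card J0)
    \<le> bias n (card J0) (%M. \<Sum>x\<in>\<Lambda>0. snd (F ! fst x) M)"
  proof (rule form_char_bound[OF W js(2,1) J0(2), where \<iota> = sing and z = "%w. w" and alt = alt])
   show "\<forall>j\<in>J0. dirhom (FF n) ?W (sing j)" using J0(3) by (auto intro: dirhom_sing)
   show "\<forall>w\<in>?W. \<forall>i\<in>J0. w i : FF n" by (auto intro: VI_D)
   show "\<forall>w\<in>?W. \<forall>i\<in>J0. \<forall>j\<in>J0. \<forall>a\<in>FF n. (w + sing j a) i = w i + (if i = j then a else 0)"
    by (intro ballI) (simp only: plus_fun_apply sing_def)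
   show "finite \<Lambda>" by (rule fin\<Lambda>)
   show "\<Lambda>0 \<subseteq> \<Lambda>" by (auto simp: \<Lambda>0_def X_def)
   show "form alt n (card J0) (snd (F ! fst x))" if x: "x : \<Lambda>0" for x
   proof -
    have "x : \<Lambda>" "snd x = J0" using x by (auto simp: \<Lambda>0_def X_def)
    then show ?thesis using Fx[of x] by simp
   qed
   show "ev F w x = snd (F ! fst x) (hm w J0)" if x: "x : \<Lambda>0" for x w
    using x by (auto simp: \<Lambda>0_def ev_def)
   show "\<exists>j\<in>J0. inv_dir (FF n) ?W (sing j) (%w. ev F w x)" if x: "x : \<Lambda> - \<Lambda>0" for x
   proof -
    have "snd x ~= J0"
    proof
     assume J: "snd x = J0"
     have e: "(fst x, J0) = x" using J by (simp add: prod_eq_iff)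
     then have "fst x : X" using x by (simp add: X_def)
     then have "(fst x, J0) : \<Lambda>0" unfolding \<Lambda>0_def by (rule imageI)
     then show False using x unfolding e by blast
    qed
    moreover have xL: "x : \<Lambda>" using x by blast
    moreover have "card (snd x) \<le> card J0" using max[OF xL] by (simp add: J0_def)
    ultimately have "\<not> J0 \<subseteq> snd x" using card_seteq[OF fin[OF xL], of J0] by blast
    then obtain j where j: "j : J0" "j \<notin> snd x" by blast
    have "hm (w + sing j a) (snd x) = hm w (snd x)" for w a
    proof (rule hm_cong)
     fix l assume "l : snd x"
     then have "l ~= j" using j by blast
     then show "(w + sing j a) l = w l" by (simp add: sing_def)
    qed
    then have "inv_dir (FF n) ?W (sing j) (%w. ev F w x)" unfolding inv_dir_def ev_def by simp
    then show ?thesis using j by blast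
   qed
  qed
  also have "bias n (card J0) (%M. \<Sum>x\<in>\<Lambda>0. snd (F ! fst x) M) = bias n (card J0) (%M. \<Sum>q\<in>X. snd (F ! q) M)"
   unfolding \<Lambda>0_def by (subst sum.reindex) (auto simp: inj_on_def)
  also have "... < \<rho> ^ (2 ^ d)"
  proof -
   have "X \<subseteq> {i. i < length F & fst (F ! i) = card J0}"
   proof
    fix q assume "q : X"
    then have "(q, J0) : Om2 {..d} F" using \<Lambda>O by (simp add: X_def)
    from Om2_D(1,3)[OF this] show "q : {i. i < length F & fst (F ! i) = card J0}" by simp
   qed
   moreover have "fst x0 : X" using x0 unfolding X_def J0_def by simp
   ultimately show ?thesis using rg unfolding reg_def \<rho>_def by blast
  qed
  finally show ?thesis by (rule power_tower_le) (use J0(4) rr_pos in \<open>auto simp: \<rho>_def\<close>)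
 qed
 have "\<bar>card {w\<in>?W. {x\<in>Om2 {..d} F. ev F w x = 1} = Z} / card ?W - 1 / 2 ^ card (Om2 {..d} F)\<bar> \<le> \<rho>"
  by (rule equidist[OF fin_grp_card[OF W] Om2_finite _ small Z])
   (use rr_pos in \<open>auto simp: \<rho>_def less_imp_le\<close>)
 moreover have "\<rho> < 1 / 2 ^ card (Om2 {..d} F)"
 proof -
  have "card (Om2 {..d} F) \<le> card ({..<length F} \<times> Pow {..d})"
   by (rule card_mono) (auto simp: Om2_def)
  also have "... = length F * 2 ^ (d + 1)" by (simp add: card_cartesian_product card_Pow)
  also have "... \<le> length F * 2 ^ (2 * d + 1)" by (intro mult_left_mono power_increasing) auto
  finally have "(1 / 2) ^ (length F * 2 ^ (2 * d + 1)) \<le> (1 / 2 :: real) ^ card (Om2 {..d} F)"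
   by (intro power_decreasing) auto
  moreover have "\<rho> = (1 / 2) ^ (length F * 2 ^ (2 * d + 1)) / 4"
   by (simp add: \<rho>_def rr_def power_add)
  moreover have "(0::real) < (1 / 2) ^ card (Om2 {..d} F)" by simp
  ultimately have "\<rho> < (1 / 2) ^ card (Om2 {..d} F)" by linarith
  then show ?thesis by (simp add: power_one_over)
 qed
 ultimately have "card {w\<in>?W. {x\<in>Om2 {..d} F. ev F w x = 1} = Z} / card ?W > 0" by linarith
 then have "{w\<in>?W. {x\<in>Om2 {..d} F. ev F w x = 1} = Z} ~= {}" by force
 then show ?thesis by (auto simp: Zp_def)
qed

text \<open>In characteristic 2 summation over subsets is its own inverse: a set below
  \<open>Z\<close> with complement of size c is counted 2^c times.\<close>

lemma mobius_bit:
 fixes g :: "'a set => bit"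
 shows "finite Z ==> (\<Sum>X\<in>Pow Z. \<Sum>Y\<in>Pow X. g Y) = g Z"
proof (induction Z arbitrary: g rule: finite_induct)
 case (insert a Z)
 have split: "sum k (Pow (insert a X)) = sum k (Pow X) + (\<Sum>Y\<in>Pow X. k (insert a Y))"
  if "X \<subseteq> Z" for X and k :: "'a set => bit"
 proof -
  have aX: "a \<notin> X" "finite X" using that insert.hyps finite_subset by auto
  have "sum k (Pow (insert a X)) = sum k (Pow X) + sum k (insert a ` Pow X)"
   unfolding Pow_insert by (rule sum.union_disjoint) (use aX in auto)
  also have "sum k (insert a ` Pow X) = (\<Sum>Y\<in>Pow X. k (insert a Y))"
   using aX by (subst sum.reindex) (auto simp: inj_on_def)
  finally show ?thesis .
 qed
 have "(\<Sum>X\<in>Pow (insert a Z). \<Sum>Y\<in>Pow X. g Y)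
   = (\<Sum>X\<in>Pow Z. \<Sum>Y\<in>Pow X. g Y) + (\<Sum>X\<in>Pow Z. \<Sum>Y\<in>Pow (insert a X). g Y)"
  by (rule split) simp
 also have "(\<Sum>X\<in>Pow Z. \<Sum>Y\<in>Pow (insert a X). g Y)
   = (\<Sum>X\<in>Pow Z. \<Sum>Y\<in>Pow X. g Y) + (\<Sum>X\<in>Pow Z. \<Sum>Y\<in>Pow X. g (insert a Y))"
  by (subst sum.distrib[symmetric], rule sum.cong[OF refl], rule split) simp
 finally show ?case by (simp add: insert.IH bit_cancel)
qed simp

text \<open>Set partitions of \<open>I\<close> into labelled blocks; the label names a form of the
  family and thereby fixes the size of the block.\<close>

definition PT :: "nat set => fml => (nat \<times> nat set) set set" where
 "PT I F = {X. X \<subseteq> Om2 I F & (\<forall>i\<in>I. \<exists>!x. x : X & i : snd x)}"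

definition btype :: "(nat \<times> nat set) set => nat => nat" where
 "btype X = (%q. card {x\<in>X. fst x = q})"

definition mp :: "(nat => nat) => nat \<times> nat set => nat \<times> nat set" where
 "mp \<sigma> x = (fst x, \<sigma> ` snd x)"

text \<open>Equal types allow the blocks to be matched label by label. Labels fix the sizes, so
  matched blocks are in bijection, and disjointness lets these bijections be glued.\<close>

lemma ex_block_bijection:
 assumes "finite X" "finite Y"
  "!!x. x : X \<union> Y ==> finite (snd x) & snd x ~= {} & card (snd x) = s (fst x)"
  "!!x y. x : X ==> y : X ==> x ~= y ==> snd x \<inter> snd y = {}"
  "!!x y. x : Y ==> y : Y ==> x ~= y ==> snd x \<inter> snd y = {}"
  "btype X = btype Y"
 shows "\<exists>\<sigma>. bij_betw \<sigma> (\<Union>(snd ` X)) (\<Union>(snd ` Y)) & mp \<sigma> ` X = Y"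
 using assms
proof (induction X arbitrary: Y rule: finite_induct)
 case empty
 have "{y\<in>Y. fst y = q} = {}" for q
  using fun_cong[OF empty.prems(5), of q] empty.prems(1) by (simp add: btype_def)
 then have "Y = {}" by blast
 then show ?case by (intro exI[of _ id]) (simp add: bij_betw_def)
next
 case (insert x X)
 have "card {z\<in>insert x X. fst z = fst x} = card {z\<in>Y. fst z = fst x}"
  using fun_cong[OF insert.prems(5), of "fst x"] by (simp add: btype_def)
 moreover have "card {z\<in>insert x X. fst z = fst x} > 0"
 proof -
  have "x : {z\<in>insert x X. fst z = fst x}" by simp
  moreover have "finite {z\<in>insert x X. fst z = fst x}" using insert.hyps(1) by simp
  ultimately show ?thesis by (metis card_gt_0_iff empty_iff)
 qed
 ultimately have "{z\<in>Y. fst z = fst x} ~= {}" by (metis card.empty less_irrefl)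
 then obtain y where y: "y : Y" "fst y = fst x" by blast
 have bt: "btype X = btype (Y - {y})"
 proof
  fix q
  have 1: "btype (insert x X) q = btype X q + (if q = fst x then 1 else 0)"
  proof (cases "q = fst x")
   case True
   then have "{z\<in>insert x X. fst z = q} = insert x {z\<in>X. fst z = q}" by auto
   then show ?thesis using True insert.hyps by (simp add: btype_def)
  next
   case False
   then have "{z\<in>insert x X. fst z = q} = {z\<in>X. fst z = q}" by auto
   then show ?thesis using False by (simp add: btype_def)
  qed
  have 2: "btype Y q = btype (Y - {y}) q + (if q = fst x then 1 else 0)"
  proof (cases "q = fst x")
   case True
   then have "{z\<in>Y. fst z = q} = insert y {z\<in>Y - {y}. fst z = q}" using y by auto
   then show ?thesis using True insert.prems(1) by (simp add: btype_def)
  next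
   case False
   then have "{z\<in>Y - {y}. fst z = q} = {z\<in>Y. fst z = q}" using y by auto
   then show ?thesis using False by (simp add: btype_def)
  qed
  show "btype X q = btype (Y - {y}) q" using 1 2 fun_cong[OF insert.prems(5), of q] by simp
 qed
 have "\<exists>\<sigma>. bij_betw \<sigma> (\<Union>(snd ` X)) (\<Union>(snd ` (Y - {y}))) & mp \<sigma> ` X = Y - {y}"
  by (rule insert.IH[OF _ _ _ _ bt]) (use insert.prems in auto)
 then obtain \<sigma> where \<sigma>: "bij_betw \<sigma> (\<Union>(snd ` X)) (\<Union>(snd ` (Y - {y})))" "mp \<sigma> ` X = Y - {y}" by blast
 have xy: "finite (snd x)" "finite (snd y)" "card (snd x) = card (snd y)"
  using insert.prems(2)[of x] insert.prems(2)[of y] y by auto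
 then obtain \<beta> where \<beta>: "bij_betw \<beta> (snd x) (snd y)" using finite_same_card_bij by blast
 define \<gamma> where "\<gamma> i = (if i : snd x then \<beta> i else \<sigma> i)" for i
 have dx: "snd z \<inter> snd x = {}" if "z : X" for z
  using insert.prems(3)[of z x] insert.hyps(2) that by auto
 have \<gamma>x: "bij_betw \<gamma> (snd x) (snd y)"
  using \<beta> by (rule bij_betw_cong[THEN iffD1, rotated]) (simp add: \<gamma>_def)
 have \<gamma>X: "bij_betw \<gamma> (\<Union>(snd ` X)) (\<Union>(snd ` (Y - {y})))"
 proof (rule bij_betw_cong[THEN iffD1, OF _ \<sigma>(1)])
  fix i assume "i : \<Union>(snd ` X)"
  then have "i \<notin> snd x" using dx by blast
  then show "\<sigma> i = \<gamma> i" by (simp add: \<gamma>_def)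
 qed
 have "snd y \<inter> \<Union>(snd ` (Y - {y})) = {}"
  using insert.prems(4)[of y] y(1) by blast
 note comb = bij_betw_combine[OF \<gamma>x \<gamma>X this]
 have "\<Union>(snd ` Y) = snd y \<union> \<Union>(snd ` (Y - {y}))" using y(1) by blast
 moreover have "\<Union>(snd ` insert x X) = snd x \<union> \<Union>(snd ` X)" by blast
 ultimately have "bij_betw \<gamma> (\<Union>(snd ` insert x X)) (\<Union>(snd ` Y))" using comb by simp
 moreover have "mp \<gamma> ` insert x X = Y"
 proof -
  have "mp \<gamma> x = y"
   using \<gamma>x y(2) by (simp add: mp_def bij_betw_def prod_eq_iff)
  moreover have "mp \<gamma> z = mp \<sigma> z" if "z : X" for z
   using dx[OF that] by (auto simp: mp_def \<gamma>_def intro!: image_cong)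
  ultimately have "mp \<gamma> ` insert x X = insert y (mp \<sigma> ` X)" by (simp cong: image_cong)
  then show ?thesis using \<sigma>(2) y(1) by auto
 qed
 ultimately show ?case by blast
qed

text \<open>Since every pattern is attained, the form is a function \<open>Fv\<close> of the
  pattern, and multilinearity turns into identities for \<open>Fv\<close>. They force its Mobius
  transform \<open>f\<close> to vanish unless every argument is covered exactly once. Symmetry of
  the form makes \<open>f\<close> invariant under permutations, hence a function of the block
  type.\<close>

lemma structure_gen:
 assumes T: "form alt n d T" and F: "fam alt n d F" and rg: "reg n (rr d (length F) ^ (2 ^ d)) F"
  and gn: "gen n F d T" and d: "d \<ge> 1"
 shows "\<exists>f :: (nat \<times> nat set) set => bit. (\<forall>X. f X ~= 0 --> X : PT {..<d} F) &
  (\<forall>X\<in>PT {..<d} F. \<forall>Y\<in>PT {..<d} F. btype X = btype Y --> f X = f Y) &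
  (\<forall>h. h ` {..<d} \<subseteq> FF n --> T (hm h {..<d}) = (\<Sum>X\<in>Pow (Zp F {..<d} h). f X))"
proof -
 let ?I = "{..<d}"
 have O12: "Om2 ?I F \<subseteq> Om2 {..d} F" by (auto simp: Om2_def)
 have finO: "finite (Om2 ?I F)" by (rule Om2_finite) simp
 have Zsub: "Zp F ?I h \<subseteq> Om2 ?I F" for h by (auto simp: Zp_def)
 have Zp1: "x : Zp F ?I h \<longleftrightarrow> x : Om2 ?I F & x : Zp F {..d} h" for x h
  using O12 by (auto simp: Zp_def)
 have F\<tau>: "1 \<le> card (snd x) & form alt n (card (snd x)) (snd (F ! fst x))" if "x : Om2 I F" for x I
  using F nth_mem[OF Om2_D(1)[OF that]] Om2_D(3)[OF that] unfolding fam_def by fastforce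
 have Tdet: "T (hm h ?I) = T (hm h' ?I)" if "h ` ?I \<subseteq> FF n" "h' ` ?I \<subseteq> FF n" "Zp F ?I h = Zp F ?I h'" for h h'
 proof (rule genD[OF gn _ _ that(1,2)])
  show "agree ?I F h h'"
  proof (rule agreeI)
   fix s \<tau> J assume s: "(s, \<tau>) : set F" and J: "J \<subseteq> ?I" "s = card J"
   obtain q where q: "q < length F" "F ! q = (s, \<tau>)" using s by (auto simp: in_set_conv_nth)
   have x: "(q, J) : Om2 ?I F" using q J by (simp add: Om2_def)
   have "(q, J) : Zp F ?I h \<longleftrightarrow> (q, J) : Zp F ?I h'" using that(3) by simp
   then have "\<tau> (hm h J) = 1 \<longleftrightarrow> \<tau> (hm h' J) = 1" using x q by (simp add: Zp_def ev_def)
   then show "\<tau> (hm h J) = \<tau> (hm h' J)" by (cases "\<tau> (hm h J)"; cases "\<tau> (hm h' J)") auto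
  qed
 qed auto
 define hZ where "hZ Z = (SOME h. h : VI {..d} n & Zp F {..d} h = Z)" for Z
 have hZ: "hZ Z : VI {..d} n" "Zp F {..d} (hZ Z) = Z" if "Z \<subseteq> Om2 {..d} F" for Z
  using someI_ex[of "%h. h : VI {..d} n & Zp F {..d} h = Z"] attain[OF F rg d that]
  unfolding hZ_def by blast+
 define Fv where "Fv Z = T (hm (hZ Z) ?I)" for Z
 have Fv: "Fv (Zp F ?I h) = T (hm h ?I)" if h: "h ` ?I \<subseteq> FF n" for h
 proof -
  have sub: "Zp F ?I h \<subseteq> Om2 {..d} F" using Zsub O12 by blast
  have "Zp F ?I (hZ (Zp F ?I h)) = Zp F ?I h"
  proof (rule set_eqI)
   fix x show "x : Zp F ?I (hZ (Zp F ?I h)) \<longleftrightarrow> x : Zp F ?I h"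
    using Zp1[of x "hZ (Zp F ?I h)"] hZ(2)[OF sub] Zsub[of h] by blast
  qed
  then show ?thesis unfolding Fv_def using h VI_D[OF hZ(1)[OF sub]] by (intro Tdet) auto
 qed
 define f where "f X = (if X \<subseteq> Om2 ?I F then \<Sum>Y\<in>Pow X. Fv Y else 0)" for X
 have rep: "T (hm h ?I) = (\<Sum>X\<in>Pow (Zp F ?I h). f X)" if h: "h ` ?I \<subseteq> FF n" for h
 proof -
  have "(\<Sum>X\<in>Pow (Zp F ?I h). f X) = (\<Sum>X\<in>Pow (Zp F ?I h). \<Sum>Y\<in>Pow X. Fv Y)"
   unfolding f_def by (rule sum.cong[OF refl]) (use Zsub[of h] in auto)
  also have "... = Fv (Zp F ?I h)" by (rule mobius_bit) (rule finite_subset[OF Zsub finO])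
  finally show ?thesis using Fv[OF h] by simp
 qed
 have finJ: "finite J" if "J \<subseteq> {..d}" for J using that finite_subset by blast
 \<comment> \<open>\<open>Z\<close> prescribes the values of the family in such a way that, when
   argument \<open>i\<close> is replaced by the spare argument \<open>d\<close>, exactly
   \<open>x\<close> is nonzero among the blocks through \<open>i\<close>. Adding argument
   \<open>d\<close> to argument \<open>i\<close> therefore inserts \<open>x\<close> into the pattern
   \<open>Y\<close>, and additivity of the form in this argument is the claimed identity.\<close>
 have addx: "Fv (insert x Y) = Fv Y + Fv (insert x {y\<in>Y. i \<notin> snd y})"
  if i: "i < d" and x: "x : Om2 ?I F" "i : snd x" "x \<notin> Y" and Y: "Y \<subseteq> Om2 ?I F" for i x Y
 proof -
  define \<eta> where "\<eta> J = (J - {i}) \<union> {d}" for J :: "nat set"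
  define Z where "Z = Y \<union> {mp' : Om2 {..d} F. d : snd mp' & i \<notin> snd mp' & fst mp' = fst x & snd mp' = \<eta> (snd x)}"
  have Zs: "Z \<subseteq> Om2 {..d} F" using Y O12 by (auto simp: Z_def)
  define h where "h = hZ Z"
  have h: "h : VI {..d} n" "Zp F {..d} h = Z" using hZ[OF Zs] by (auto simp: h_def)
  have hF: "h k : FF n" for k using VI_D[OF h(1)] .
  have evY: "ev F h y = 1 \<longleftrightarrow> y : Y" if "y : Om2 ?I F" for y
  proof -
   have "y : Z \<longleftrightarrow> y : Y" using that by (auto simp: Z_def Om2_def)
   moreover have "y : Z \<longleftrightarrow> ev F h y = 1" using h(2) that O12 unfolding Zp_def by blast
   ultimately show ?thesis by simp
  qed
  have card\<eta>: "card (\<eta> J) = card J" if "J \<subseteq> ?I" "i : J" for J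
  proof -
   have "d \<notin> J - {i}" "finite (J - {i})" using that finite_subset[of J ?I] by auto
   then have "card (\<eta> J) = Suc (card (J - {i}))" by (simp add: \<eta>_def)
   also have "... = card J" using that finite_subset[of J ?I] by (intro card_Suc_Diff1) auto
   finally show ?thesis .
  qed
  have ev\<eta>: "snd (F ! fst y) (hm h (\<eta> (snd y))) = 1 \<longleftrightarrow> y = x" if y: "y : Om2 ?I F" "i : snd y" for y
  proof -
   have c: "card (\<eta> (snd y)) = card (snd y)" using card\<eta> Om2_D(2)[OF y(1)] y(2) by blast
   have o: "(fst y, \<eta> (snd y)) : Om2 {..d} F"
    using y c i by (auto simp: Om2_def \<eta>_def)
   have "(fst y, \<eta> (snd y)) \<notin> Y" using Y by (auto simp: Om2_def \<eta>_def)
   then have "(fst y, \<eta> (snd y)) : Z \<longleftrightarrow> fst y = fst x & \<eta> (snd y) = \<eta> (snd x)"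
    using o i unfolding Z_def by (auto simp: \<eta>_def)
   also have "... \<longleftrightarrow> y = x"
   proof
    assume a: "fst y = fst x & \<eta> (snd y) = \<eta> (snd x)"
    have "snd y = insert i (\<eta> (snd y) - {d})" "snd x = insert i (\<eta> (snd x) - {d})"
     using y x Om2_D(2)[OF y(1)] Om2_D(2)[OF x(1)] by (auto simp: \<eta>_def)
    then show "y = x" using a by (metis prod.collapse)
   qed simp
   finally have "(fst y, \<eta> (snd y)) : Zp F {..d} h \<longleftrightarrow> y = x" unfolding h(2) .
   then show ?thesis using o by (simp add: Zp_def ev_def)
  qed
  define h1 where "h1 = h(i := h d)"
  define h2 where "h2 = h(i := h i + h d)"
  have hm1: "hm h1 J = hm h (\<eta> J)" if "J \<subseteq> ?I" "i : J" for J
  proof -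
   have fJ: "finite J" "finite (J - {i})" using that finite_subset[of J ?I] by auto
   have dJ: "d \<notin> J - {i}" using that by auto
   have "hm h1 J = add_mset (h d) (hm h1 (J - {i}))"
    using fJ(1) that(2) by (subst hm_remove) (auto simp: h1_def)
   also have "hm h1 (J - {i}) = hm h (J - {i})" by (rule hm_cong) (auto simp: h1_def)
   also have "add_mset (h d) (hm h (J - {i})) = hm h (\<eta> J)"
    using hm_insert[OF fJ(2) dJ, of h] by (simp add: \<eta>_def)
   finally show ?thesis .
  qed
  have hm0: "hm h1 J = hm h J" "hm h2 J = hm h J" if "i \<notin> J" for J
   by (rule hm_cong; use that in \<open>auto simp: h1_def h2_def\<close>)+
  have add2: "\<tau> (hm h2 J) = \<tau> (hm h J) + \<tau> (hm h1 J)"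
   if \<tau>: "form alt n (card J) \<tau>" and J: "J \<subseteq> ?I" "i : J" for \<tau> J
  proof -
   have fJ: "finite J" using J finite_subset[of J ?I] by auto
   have e: "hm h2 J = add_mset (h i + h d) (hm h (J - {i}))" "hm h1 J = add_mset (h d) (hm h (J - {i}))"
    "hm h J = add_mset (h i) (hm h (J - {i}))"
    using hm0[of "J - {i}"] hm_remove[OF fJ J(2)] by (auto simp: h1_def h2_def)
   show ?thesis unfolding e
   proof (rule form_add[OF \<tau> hF hF])
    show "set_mset (hm h (J - {i})) \<subseteq> FF n" using fJ hF by (auto simp: set_hm)
    show "Suc (size (hm h (J - {i}))) = card J" unfolding size_hm by (rule card_Suc_Diff1[OF fJ J(2)])
   qed
  qed
  have Z1: "Zp F ?I h1 = insert x {y\<in>Y. i \<notin> snd y}"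
  proof (rule set_eqI)
   fix y
   show "y : Zp F ?I h1 \<longleftrightarrow> y : insert x {y\<in>Y. i \<notin> snd y}"
   proof (cases "y : Om2 ?I F")
    case True
    show ?thesis
    proof (cases "i : snd y")
     case i: True
     have "ev F h1 y = 1 \<longleftrightarrow> y = x"
      using ev\<eta>[OF True i] hm1[OF Om2_D(2)[OF True] i] by (simp add: ev_def)
     then show ?thesis using True i by (simp add: Zp_def)
    next
     case False
     have "ev F h1 y = 1 \<longleftrightarrow> y : Y" using evY[OF True] hm0(1)[OF False] by (simp add: ev_def)
     then show ?thesis using True False x(2) by (auto simp: Zp_def)
    qed
   next
    case False
    then show ?thesis using x(1) Y by (auto simp: Zp_def)
   qed
  qed
  have Z2: "Zp F ?I h2 = insert x Y"
  proof (rule set_eqI)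
   fix y
   show "y : Zp F ?I h2 \<longleftrightarrow> y : insert x Y"
   proof (cases "y : Om2 ?I F")
    case True
    show ?thesis
    proof (cases "i : snd y")
     case i: True
     have "ev F h2 y = ev F h y + ev F h1 y"
      unfolding ev_def using F\<tau>[OF True] by (intro add2[OF _ Om2_D(2)[OF True] i]) auto
     moreover have "ev F h1 y = 1 \<longleftrightarrow> y = x"
      using ev\<eta>[OF True i] hm1[OF Om2_D(2)[OF True] i] by (simp add: ev_def)
     moreover have "ev F h y = 1 \<longleftrightarrow> y : Y" by (rule evY[OF True])
     ultimately have "ev F h2 y = 1 \<longleftrightarrow> y : insert x Y"
      using x(3) by (cases "ev F h y"; cases "ev F h1 y") auto
     then show ?thesis using True by (simp add: Zp_def)
    next
     case False
     have "ev F h2 y = 1 \<longleftrightarrow> y : Y" using evY[OF True] hm0(2)[OF False] by (simp add: ev_def)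
     then show ?thesis using True False x(2) by (auto simp: Zp_def)
    qed
   next
    case False
    then show ?thesis using x(1) Y by (auto simp: Zp_def)
   qed
  qed
  have Z0: "Zp F ?I h = Y"
  proof (rule set_eqI)
   fix y show "y : Zp F ?I h \<longleftrightarrow> y : Y" using evY[of y] Y by (auto simp: Zp_def)
  qed
  have "T (hm h2 ?I) = T (hm h ?I) + T (hm h1 ?I)"
   using T i by (intro add2) auto
  moreover have "h ` ?I \<subseteq> FF n" "h1 ` ?I \<subseteq> FF n" "h2 ` ?I \<subseteq> FF n"
   using hF FF_add by (auto simp: h1_def h2_def)
  ultimately show ?thesis using Fv[of h] Fv[of h1] Fv[of h2] unfolding Z0 Z1 Z2 by simp
 qed
 \<comment> \<open>Setting argument \<open>i\<close> to 0 makes the form vanish, and it leaves the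
   pattern unchanged because no block of \<open>Y\<close> contains \<open>i\<close>.\<close>
 have zeroi: "Fv Y = 0" if i: "i < d" and Y: "Y \<subseteq> Om2 ?I F" "!!y. y : Y ==> i \<notin> snd y" for i Y
 proof -
  have Zs: "Y \<subseteq> Om2 {..d} F" using Y O12 by blast
  define h where "h = (hZ Y)(i := 0)"
  have hF: "h k : FF n" for k using VI_D[OF hZ(1)[OF Zs]] FF_zero by (auto simp: h_def)
  have h0: "\<tau> (hm h J) = 0" if \<tau>: "form alt n (card J) \<tau>" and J: "J \<subseteq> ?I" "i : J" for \<tau> J
  proof -
   have fJ: "finite J" using J finite_subset[of J ?I] by auto
   have "hm h J = add_mset 0 (hm h (J - {i}))" using hm_remove[OF fJ J(2), of h] by (simp add: h_def)
   moreover have "\<tau> (add_mset 0 (hm h (J - {i}))) = 0"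
   proof (rule form_zero[OF \<tau>])
    show "set_mset (hm h (J - {i})) \<subseteq> FF n" using fJ hF by (auto simp: set_hm)
    show "Suc (size (hm h (J - {i}))) = card J" unfolding size_hm by (rule card_Suc_Diff1[OF fJ J(2)])
   qed
   ultimately show ?thesis by simp
  qed
  have "Zp F ?I h = Y"
  proof (rule set_eqI)
   fix y show "y : Zp F ?I h \<longleftrightarrow> y : Y"
   proof (cases "y : Om2 ?I F")
    case True
    show ?thesis
    proof (cases "i : snd y")
     case i: True
     have "ev F h y = 0" unfolding ev_def using F\<tau>[OF True] by (intro h0[OF _ Om2_D(2)[OF True] i]) auto
     moreover have "y \<notin> Y" using Y(2) i by blast
     ultimately show ?thesis by (simp add: Zp_def)
    next
     case False
     have "hm h (snd y) = hm (hZ Y) (snd y)" by (rule hm_cong) (use False in \<open>auto simp: h_def\<close>)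
     then have "ev F h y = ev F (hZ Y) y" by (simp add: ev_def)
     moreover have "y : Om2 {..d} F" using True O12 by blast
     moreover have "y : Zp F {..d} (hZ Y) \<longleftrightarrow> y : Y" using hZ(2)[OF Zs] by simp
     ultimately show ?thesis using True by (simp add: Zp_def)
    qed
   qed (use Y(1) in \<open>auto simp: Zp_def\<close>)
  qed
  moreover have "T (hm h ?I) = 0" using T i by (intro h0) auto
  ultimately show ?thesis using Fv[of h] hF by auto
 qed
 \<comment> \<open>If \<open>i\<close> is uncovered, every term of the transform is 0 by
   \<open>zeroi\<close>. If \<open>u\<close> and \<open>v\<close> both contain \<open>i\<close>, the
   subsets are grouped in fours by membership of \<open>u\<close> and \<open>v\<close>; by
   \<open>addx\<close>, inserting \<open>v\<close> changes \<open>Fv\<close> by the same amount with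
   and without \<open>u\<close>, so each group sums to 0.\<close>
 have supp: "X : PT ?I F" if fX: "f X ~= 0" for X
 proof -
  have XO: "X \<subseteq> Om2 ?I F" and fS: "f X = (\<Sum>Y\<in>Pow X. Fv Y)" using fX by (auto simp: f_def split: if_splits)
  have finX: "finite X" using XO finO finite_subset by blast
  have "\<exists>!x. x : X & i : snd x" if i: "i : ?I" for i
  proof (rule ccontr)
   assume no: "\<not> ?thesis"
   show False
   proof (cases "\<exists>x\<in>X. i : snd x")
    case False
    have "(\<Sum>Y\<in>Pow X. Fv Y) = 0"
     by (rule sum.neutral) (use zeroi[of i] i False XO in blast)
    then show False using fX fS by simp
   next
    case True
    then obtain u v where uv: "u : X" "v : X" "u ~= v" "i : snd u" "i : snd v" using no by blast
    define X' where "X' = X - {u, v}"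
    have X: "X = insert u (insert v X')" "u \<notin> insert v X'" "v \<notin> X'" "finite X'"
     using uv finX by (auto simp: X'_def)
    have split: "sum k (Pow (insert a A)) = sum k (Pow A) + (\<Sum>Y\<in>Pow A. k (insert a Y))"
     if "a \<notin> A" "finite A" for a A and k :: "_ => bit"
    proof -
     have "sum k (Pow (insert a A)) = sum k (Pow A) + sum k (insert a ` Pow A)"
      unfolding Pow_insert by (rule sum.union_disjoint) (use that in auto)
     also have "sum k (insert a ` Pow A) = (\<Sum>Y\<in>Pow A. k (insert a Y))"
      using that by (subst sum.reindex) (auto simp: inj_on_def)
     finally show ?thesis .
    qed
    have "(\<Sum>Y\<in>Pow X. Fv Y) = (\<Sum>Y\<in>Pow X'. (Fv Y + Fv (insert v Y)) + (Fv (insert u Y) + Fv (insert u (insert v Y))))"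
     unfolding X(1) using X(2-4) by (simp add: split sum.distrib)
    also have "... = 0"
    proof (rule sum.neutral, rule ballI)
     fix Y assume Y: "Y : Pow X'"
     have YO: "Y \<subseteq> Om2 ?I F" "insert u Y \<subseteq> Om2 ?I F" using Y XO uv by (auto simp: X'_def)
     have uvO: "u : Om2 ?I F" "v : Om2 ?I F" using uv XO by auto
     have vY: "v \<notin> Y" "v \<notin> insert u Y" using Y uv(3) by (auto simp: X'_def)
     define c where "c = Fv (insert v {y\<in>Y. i \<notin> snd y})"
     have 1: "Fv (insert v Y) = Fv Y + c"
      unfolding c_def by (rule addx[OF _ uvO(2) uv(5) vY(1) YO(1)]) (use i in simp)
     have "{y\<in>insert u Y. i \<notin> snd y} = {y\<in>Y. i \<notin> snd y}" using uv(4) by auto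
     then have "Fv (insert v (insert u Y)) = Fv (insert u Y) + c"
      unfolding c_def using addx[OF _ uvO(2) uv(5) vY(2) YO(2)] i by simp
     then have 2: "Fv (insert u (insert v Y)) = Fv (insert u Y) + c" by (simp add: insert_commute)
     show "(Fv Y + Fv (insert v Y)) + (Fv (insert u Y) + Fv (insert u (insert v Y))) = 0"
      unfolding 1 2 by (simp add: bit_cancel bit_add_self)
    qed
    finally show False using fX fS by simp
   qed
  qed
  then show ?thesis using XO by (simp add: PT_def)
 qed
 have sym: "f X = f (mp \<sigma> ` X)" if \<sigma>: "bij_betw \<sigma> ?I ?I" and X: "X \<subseteq> Om2 ?I F" for \<sigma> X
 proof -
  have mpO: "mp \<sigma> x : Om2 ?I F" if "x : Om2 ?I F" for x
  proof -
   have "card (\<sigma> ` snd x) = card (snd x)"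
    using \<sigma> Om2_D(2)[OF that] by (intro card_image) (auto simp: bij_betw_def intro: inj_on_subset)
   moreover have "\<sigma> ` snd x \<subseteq> ?I" using \<sigma> Om2_D(2)[OF that] unfolding bij_betw_def by blast
   ultimately show ?thesis using that by (auto simp: Om2_def mp_def)
  qed
  have inj: "inj_on (mp \<sigma>) (Om2 ?I F)"
  proof (rule inj_onI)
   fix x y assume xy: "x : Om2 ?I F" "y : Om2 ?I F" "mp \<sigma> x = mp \<sigma> y"
   then have "\<sigma> ` snd x = \<sigma> ` snd y" "fst x = fst y" by (auto simp: mp_def)
   moreover have "inj_on \<sigma> ?I" using \<sigma> by (simp add: bij_betw_def)
   ultimately have "snd x = snd y" using Om2_D(2)[OF xy(1)] Om2_D(2)[OF xy(2)] by (metis inj_on_image_eq_iff)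
   then show "x = y" using \<open>fst x = fst y\<close> by (simp add: prod_eq_iff)
  qed
  have surj: "mp \<sigma> ` Om2 ?I F = Om2 ?I F"
   using finO inj mpO by (intro endo_inj_surj) auto
  have Fs: "Fv Y = Fv (mp \<sigma> ` Y)" if Y: "Y \<subseteq> Om2 ?I F" for Y
  proof -
   have Y': "mp \<sigma> ` Y \<subseteq> Om2 {..d} F" using Y mpO O12 by blast
   define k where "k = hZ (mp \<sigma> ` Y)"
   have kF: "k i : FF n" for i using VI_D[OF hZ(1)[OF Y']] by (simp add: k_def)
   have hmk: "hm (k \<circ> \<sigma>) J = hm k (\<sigma> ` J)" if "J \<subseteq> ?I" for J
    using hm_bij[of \<sigma> J "\<sigma> ` J" k] \<sigma> that by (auto simp: bij_betw_def inj_on_subset)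
   have "Zp F ?I (k \<circ> \<sigma>) = Y"
   proof (rule set_eqI)
    fix x show "x : Zp F ?I (k \<circ> \<sigma>) \<longleftrightarrow> x : Y"
    proof (cases "x : Om2 ?I F")
     case True
     have e1: "ev F (k \<circ> \<sigma>) x = ev F k (mp \<sigma> x)"
      using hmk[OF Om2_D(2)[OF True]] by (simp add: ev_def mp_def)
     have "mp \<sigma> x : Om2 {..d} F" using mpO[OF True] O12 by blast
     moreover have "mp \<sigma> x : Zp F {..d} k \<longleftrightarrow> mp \<sigma> x : mp \<sigma> ` Y"
      using hZ(2)[OF Y'] by (simp add: k_def)
     ultimately have "ev F k (mp \<sigma> x) = 1 \<longleftrightarrow> mp \<sigma> x : mp \<sigma> ` Y" by (simp add: Zp_def)
     moreover have "mp \<sigma> x : mp \<sigma> ` Y \<longleftrightarrow> x : Y"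
      by (rule inj_on_image_mem_iff[OF inj True Y])
     ultimately show ?thesis using True e1 by (simp add: Zp_def)
    qed (use Y in \<open>auto simp: Zp_def\<close>)
   qed
   then have "Fv Y = T (hm (k \<circ> \<sigma>) ?I)" using Fv[of "k \<circ> \<sigma>"] kF by auto
   also have "... = T (hm k ?I)" using hmk[of ?I] \<sigma> by (simp add: bij_betw_def)
   finally show ?thesis by (simp add: Fv_def k_def)
  qed
  have "f (mp \<sigma> ` X) = (\<Sum>Y\<in>Pow (mp \<sigma> ` X). Fv Y)"
   using X mpO by (auto simp: f_def)
  also have "Pow (mp \<sigma> ` X) = (image (mp \<sigma>)) ` Pow X" by (simp add: image_Pow_surj)
  also have "(\<Sum>Y\<in>(image (mp \<sigma>)) ` Pow X. Fv Y) = (\<Sum>Y\<in>Pow X. Fv (mp \<sigma> ` Y))"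
   using inj_on_subset[OF inj X] by (subst sum.reindex) (auto intro: inj_on_image_Pow)
  also have "... = (\<Sum>Y\<in>Pow X. Fv Y)"
   by (rule sum.cong[OF refl], rule Fs[symmetric]) (use X in auto)
  finally show ?thesis using X by (simp add: f_def)
 qed
 have typeq: "f X = f Y" if X: "X : PT ?I F" and Y: "Y : PT ?I F" and bt: "btype X = btype Y" for X Y
 proof -
  have XO: "X \<subseteq> Om2 ?I F" "Y \<subseteq> Om2 ?I F" using X Y by (auto simp: PT_def)
  have cov: "\<Union>(snd ` A) = ?I" if "A : PT ?I F" for A
   using that Om2_D(2)[of _ ?I F] unfolding PT_def by blast
  have dis: "snd x \<inter> snd y = {}" if "A : PT ?I F" "x : A" "y : A" "x ~= y" for A x y
  proof (rule ccontr)
   assume "snd x \<inter> snd y ~= {}"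
   then obtain i where i: "i : snd x" "i : snd y" by blast
   have "snd x \<subseteq> ?I" using that(1,2) Om2_D(2) unfolding PT_def by blast
   then have "\<exists>!z. z : A & i : snd z" using that(1) i(1) unfolding PT_def by blast
   then show False using that i by blast
  qed
  have "\<exists>\<sigma>. bij_betw \<sigma> (\<Union>(snd ` X)) (\<Union>(snd ` Y)) & mp \<sigma> ` X = Y"
  proof (rule ex_block_bijection[where s = "%q. fst (F ! q)"])
   show "finite X" "finite Y" using XO finO finite_subset by blast+
   show "finite (snd x) & snd x ~= {} & card (snd x) = fst (F ! fst x)" if "x : X \<union> Y" for x
   proof -
    have "x : Om2 ?I F" using that XO by blast
    then show ?thesis using F\<tau>[of x ?I] Om2_D[of x ?I F] finite_subset[of "snd x" ?I] by auto
   qed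
  qed (use dis X Y bt in auto)
  then obtain \<sigma> where "bij_betw \<sigma> ?I ?I" "mp \<sigma> ` X = Y" using cov X Y by auto
  then show ?thesis using sym[OF _ XO(1)] by auto
 qed
 show ?thesis using supp typeq rep by (intro exI[of _ f]) blast
qed

theorem biased_form_structure:
 assumes "d \<ge> 1" "\<delta> > 0"
 shows "\<exists>K. \<forall>n T. form alt n d T & bias n d T \<ge> \<delta> -->
   (\<exists>F f. length F \<le> K & fam alt n d F & (\<forall>X. f X ~= (0::bit) --> X : PT {..<d} F) &
    (\<forall>X\<in>PT {..<d} F. \<forall>Y\<in>PT {..<d} F. btype X = btype Y --> f X = f Y) &
    (\<forall>h. h ` {..<d} \<subseteq> FF n --> T (hm h {..<d}) = (\<Sum>X\<in>Pow (Zp F {..<d} h). f X)))"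
proof -
 obtain K where K: "!!n T. form alt n d T ==> bias n d T \<ge> \<delta> ==>
   (\<exists>F. length F \<le> K & fam alt n d F & gen n F d T & reg n (rr d (length F) ^ (2 ^ d)) F)"
  using biased_form_generated[OF assms, of alt] by blast
 show ?thesis
 proof (intro exI[of _ K] allI impI, elim conjE)
  fix n T assume T: "form alt n d T" "bias n d T \<ge> \<delta>"
  obtain F where F: "length F \<le> K" "fam alt n d F" "gen n F d T" "reg n (rr d (length F) ^ (2 ^ d)) F"
   using K[OF T] by blast
  show "\<exists>F f. length F \<le> K & fam alt n d F & (\<forall>X. f X ~= (0::bit) --> X : PT {..<d} F) &
    (\<forall>X\<in>PT {..<d} F. \<forall>Y\<in>PT {..<d} F. btype X = btype Y --> f X = f Y) &
    (\<forall>h. h ` {..<d} \<subseteq> FF n --> T (hm h {..<d}) = (\<Sum>X\<in>Pow (Zp F {..<d} h). f X))"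
   using structure_gen[OF T(1) F(2,4,3) assms(1)] F(1,2) by (intro exI[of _ F]) blast
 qed
qed

section \<open>The circle\<close>

lemma zmul_add_left: "zmul (a + b) x = zmul a x + zmul b x"
 by transfer (simp add: algebra_simps)

lemma zmul_add_right: "zmul a (x + y) = zmul a x + zmul a y"
 by transfer (simp add: algebra_simps)

lemma zmul_zmul: "zmul a (zmul b x) = zmul (a * b) x"
 by transfer (simp add: algebra_simps)

lemma zmul_one [simp]: "zmul 1 x = x"
 by transfer simp

lemma zmul_zero_left [simp]: "zmul 0 x = 0"
 by transfer simp

lemma zmul_zero_right [simp]: "zmul a 0 = 0"
 by transfer simp

lemma zmul_minus_left: "zmul (- a) x = - zmul a x"
 by transfer simp

lemma zmul_minus_right: "zmul a (- x) = - zmul a x"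
 by transfer simp

lemma zmul_diff_right: "zmul a (x - y) = zmul a x - zmul a y"
 by transfer (simp add: algebra_simps)

lemma zmul_diff_left: "zmul (a - b) x = zmul a x - zmul b x"
 by transfer (simp add: algebra_simps)

lemma zmul_sum_right: "zmul a (sum f I) = (\<Sum>i\<in>I. zmul a (f i))"
 by (induction I rule: infinite_finite_induct) (auto simp: zmul_add_right)

lemma zmul_sum_left: "zmul (sum f I) x = (\<Sum>i\<in>I. zmul (f i) x)"
 by (induction I rule: infinite_finite_induct) (auto simp: zmul_add_left)

lemma zmul_two: "zmul 2 x = x + x"
 using zmul_add_left[of 1 1 x] by simp

lemma circle_of_real_add: "circle_of_real (x + y) = circle_of_real x + circle_of_real y"
 by transfer simp

lemma circle_of_real_zero: "circle_of_real 0 = 0"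
 by transfer simp

lemma circle_of_real_sum: "circle_of_real (sum f I) = (\<Sum>i\<in>I. circle_of_real (f i))"
 by (induction I rule: infinite_finite_induct) (auto simp: circle_of_real_add circle_of_real_zero)

lemma zmul_circle_of_real: "zmul k (circle_of_real x) = circle_of_real (of_int k * x)"
 by transfer simp

lemma circle_of_real_eq_zero: "circle_of_real x = 0 \<longleftrightarrow> x : \<int>"
 by transfer simp

lemma circle_exhaust: "\<exists>r. x = circle_of_real r"
 by transfer (metis Ints_0 diff_self)

lemma ex_half: "\<exists>y. zmul 2 y = x"
proof -
 obtain r where "x = circle_of_real r" using circle_exhaust by blast
 then show ?thesis by (intro exI[of _ "circle_of_real (r / 2)"]) (simp add: zmul_circle_of_real)
qed

text \<open>A chosen half. The half of 0 is fixed to be 0 so that coefficients that vanish stay zero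
  when a polynomial is halved.\<close>

definition hc :: "circle => circle" where
 "hc x = (if x = 0 then 0 else SOME y. zmul 2 y = x)"

lemma hc: "zmul 2 (hc x) = x"
 using someI_ex[OF ex_half[of x]] by (simp add: hc_def)

lemma hc_zero [simp]: "hc 0 = 0"
 by (simp add: hc_def)

lift_definition ee :: "circle => complex" is "%x. cis (2 * pi * x)"
proof -
 fix x y :: real assume "x - y : \<int>"
 then obtain k where k: "x - y = of_int k" by (auto simp: Ints_def)
 have "cis (2 * pi * x) = cis (2 * pi * y + 2 * pi * of_int k)"
  using k by (simp add: algebra_simps)
 also have "... = cis (2 * pi * y)"
  by (simp add: cis_mult[symmetric] cis_multiple_2pi)
 finally show "cis (2 * pi * x) = cis (2 * pi * y)" .
qed

lemma phase_ee: "phase ee"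
 unfolding phase_def
proof (intro conjI allI)
 show "ee (x - y) = ee x * cnj (ee y)" for x y
  by transfer (simp add: cis_cnj cis_mult algebra_simps)
 show "cmod (ee x) = 1" for x by transfer simp
qed

lemma ee_zero [simp]: "ee 0 = 1"
 by transfer simp

lemma ee_add: "ee (x + y) = ee x * ee y"
 by transfer (simp add: cis_mult algebra_simps)

text \<open>Identifies the bits with the 2-torsion of the circle.\<close>

definition half :: "bit => circle" where
 "half b = (if b = 0 then 0 else circle_of_real (1 / 2))"

lemma half_zero [simp]: "half 0 = 0"
 by (simp add: half_def)

lemma half_one_nonzero: "half 1 ~= 0"
proof -
 have "(1 / 2 :: real) \<notin> \<int>"
 proof
  assume "(1 / 2 :: real) : \<int>"
  then obtain k :: int where "(1 / 2 :: real) = of_int k" by (auto simp: Ints_def)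
  then have "(1::real) = of_int (2 * k)" by simp
  then have "1 = 2 * k" by linarith
  then show False by presburger
 qed
 then show ?thesis by (simp add: half_def circle_of_real_eq_zero)
qed

lemma half_inj: "half a = half b ==> a = b"
 using half_one_nonzero by (cases a; cases b) auto

lemma half_double: "half b + half b = 0"
proof -
 have "circle_of_real (1 / 2) + circle_of_real (1 / 2) = 0"
  by (simp add: circle_of_real_add[symmetric] circle_of_real_eq_zero)
 then show ?thesis by (simp add: half_def)
qed

lemma half_add: "half (a + b) = half a + half b"
 using half_double[of 1] by (cases a; cases b) (auto simp: bit_add_self)

lemma ee_half: "ee (half b) = \<chi> b"
proof (cases b)
 case one
 have "ee (circle_of_real (1 / 2)) = -1" by transfer simp
 then show ?thesis using one by (simp add: half_def \<chi>_def)
qed simp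

lemma two_torsion: "zmul 2 x = 0 ==> \<exists>b. x = half b"
proof -
 assume x: "zmul 2 x = 0"
 obtain r where r: "x = circle_of_real r" using circle_exhaust by blast
 then have "2 * r : \<int>" using x by (simp add: zmul_circle_of_real circle_of_real_eq_zero)
 then obtain k :: int where k: "2 * r = of_int k" by (auto simp: Ints_def)
 show ?thesis
 proof (cases "even k")
  case True
  then obtain l where "k = 2 * l" by blast
  then have "r = of_int l" using k by simp
  then have "x = half 0" using r by (simp add: circle_of_real_eq_zero)
  then show ?thesis by blast
 next
  case False
  then obtain l where "k = 2 * l + 1" by (rule oddE)
  then have "r = of_int l + 1 / 2" using k by simp
  then have "x = half 1" using r by (simp add: circle_of_real_add half_def) (simp add: circle_of_real_eq_zero)
  then show ?thesis by blast
 qed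
qed

lemma torsion_card: "finite {x. zmul (2 ^ k) x = 0}" "card {x. zmul (2 ^ k) x = 0} \<le> 2 ^ k"
proof -
 have sub: "{x. zmul (2 ^ k) x = 0} \<subseteq> (%j. circle_of_real (real j / 2 ^ k)) ` {..<2 ^ k}"
 proof
  fix x assume "x : {x. zmul (2 ^ k) x = 0}"
  then have x: "zmul (2 ^ k) x = 0" by simp
  obtain r where r: "x = circle_of_real r" using circle_exhaust by blast
  then have "2 ^ k * r : \<int>" using x by (simp add: zmul_circle_of_real circle_of_real_eq_zero)
  then obtain l :: int where l: "2 ^ k * r = of_int l" by (auto simp: Ints_def)
  define j where "j = nat (l mod 2 ^ k)"
  have j: "int j = l mod 2 ^ k" by (simp add: j_def)
  have "j < 2 ^ k" using j by (metis nat_less_iff j_def pos_mod_bound pos_mod_sign zero_less_numeral zero_less_power of_nat_numeral of_nat_power)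
  have "l = 2 ^ k * (l div 2 ^ k) + int j" using j by simp
  then have "real_of_int l = real_of_int (2 ^ k * (l div 2 ^ k) + int j)" by (rule arg_cong)
  also have "... = 2 ^ k * real_of_int (l div 2 ^ k) + real j" by simp
  finally have "real_of_int l = 2 ^ k * real_of_int (l div 2 ^ k) + real j" .
  then have "r = real_of_int (l div 2 ^ k) + real j / 2 ^ k" using l by (simp add: field_simps)
  then have "x = circle_of_real (real_of_int (l div 2 ^ k)) + circle_of_real (real j / 2 ^ k)"
   using r by (simp add: circle_of_real_add)
  moreover have "circle_of_real (real_of_int (l div 2 ^ k)) = 0" by (simp add: circle_of_real_eq_zero)
  ultimately have "x = circle_of_real (real j / 2 ^ k)" by simp
  then show "x : (%j. circle_of_real (real j / 2 ^ k)) ` {..<2 ^ k}" using \<open>j < 2 ^ k\<close> by blast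
 qed
 then show "finite {x. zmul (2 ^ k) x = 0}" by (rule finite_subset) simp
 have "card {x. zmul (2 ^ k) x = 0} \<le> card ((%j. circle_of_real (real j / 2 ^ k)) ` {..<2 ^ k})"
  by (rule card_mono[OF _ sub]) simp
 also have "... \<le> card {..<(2::nat) ^ k}" by (rule card_image_le) simp
 finally show "card {x. zmul (2 ^ k) x = 0} \<le> 2 ^ k" by simp
qed

section \<open>Iterated differences and degree\<close>

fun DL :: "vec list => (vec => circle) => vec => circle" where
 "DL [] P = P"
| "DL (a # as) P = DL as (%x. P (x + a) - P x)"

lemma DL_fold: "DL as P = fold (%a P x. P (x + a) - P x) as P"
 by (induction as arbitrary: P) auto

lemma DL_perm: "mset as = mset bs ==> DL as P = DL bs P"
 unfolding DL_fold
 by (rule arg_cong[where f = "%g. g P"], rule fold_multiset_equiv) (auto simp: fun_eq_iff ac_simps)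

lemma DL_add: "DL as (%x. P x + Q x) = (%x. DL as P x + DL as Q x)"
proof (induction as arbitrary: P Q)
 case (Cons a as)
 have "(%x. P (x + a) + Q (x + a) - (P x + Q x)) = (%x. (P (x + a) - P x) + (Q (x + a) - Q x))"
  by (auto simp: fun_eq_iff)
 then show ?case using Cons.IH[of "%x. P (x + a) - P x" "%x. Q (x + a) - Q x"] by simp
qed simp

lemma DL_zmul: "DL as (%x. zmul k (P x)) = (%x. zmul k (DL as P x))"
proof (induction as arbitrary: P)
 case (Cons a as)
 have "(%x. zmul k (P (x + a)) - zmul k (P x)) = (%x. zmul k (P (x + a) - P x))"
  by (auto simp: fun_eq_iff zmul_diff_right)
 then show ?case using Cons.IH[of "%x. P (x + a) - P x"] by simp
qed simp

lemma DL_zero: "DL as (%_. 0) = (%_. 0)"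
 by (induction as) auto

lemma DL_sum: "DL as (%x. \<Sum>i\<in>I. P i x) = (%x. \<Sum>i\<in>I. DL as (P i) x)"
 by (induction I rule: infinite_finite_induct) (auto simp: DL_zero DL_add)

lemma DL_minus: "DL as (%x. - P x) = (%x. - DL as P x)"
 using DL_zmul[of as "-1" P] by (simp add: zmul_minus_left)

lemma DL_diff: "DL as (%x. P x - Q x) = (%x. DL as P x - DL as Q x)"
 using DL_add[of as P "%x. - Q x"] by (simp add: DL_minus)

lemma DL_append: "DL (as @ bs) P = DL bs (DL as P)"
 by (induction as arbitrary: P) auto

lemma DL_cong:
 assumes "set as \<subseteq> FF n" "!!x. x : FF n ==> P x = Q x" "x : FF n"
 shows "DL as P x = DL as Q x"
 using assms(1,2)
proof (induction as arbitrary: P Q)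
 case Nil
 then show ?case using assms(3) by simp
next
 case (Cons a as)
 have a: "a : FF n" "set as \<subseteq> FF n" using Cons.prems(1) by auto
 show ?case unfolding DL.simps
 proof (rule Cons.IH[OF a(2)])
  fix y assume y: "y : FF n"
  show "P (y + a) - P y = Q (y + a) - Q y"
   by (simp only: Cons.prems(2)[OF FF_add[OF y a(1)]] Cons.prems(2)[OF y])
 qed
qed

lemma DL_lin:
 assumes \<pi>: "lin n \<pi>"
 shows "[|set as \<subseteq> FF n; x : FF n|] ==> DL as (%x. P (\<pi> x)) x = DL (map \<pi> as) P (\<pi> x)"
proof (induction as arbitrary: P)
 case (Cons a as)
 have "DL (a # as) (%x. P (\<pi> x)) x = DL as (%x. (%y. P (y + \<pi> a) - P y) (\<pi> x)) x"
  unfolding DL.simps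
  by (rule DL_cong[of _ n]) (use Cons.prems \<pi> in \<open>auto simp: lin_def\<close>)
 also have "... = DL (map \<pi> as) (%y. P (y + \<pi> a) - P y) (\<pi> x)"
  using Cons.prems by (intro Cons.IH) auto
 finally show ?case by simp
qed simp

text \<open>Differences commute, so the directions form a multiset; this matches the arguments of a
  symmetric form.\<close>

definition DM :: "vec multiset => (vec => circle) => vec => circle" where
 "DM M P = DL (SOME as. mset as = M) P"

lemma DM_mset: "DM (mset as) P = DL as P"
 unfolding DM_def by (rule DL_perm) (rule someI[of "%bs. mset bs = mset as" as], rule refl)

lemma DM_empty [simp]: "DM {#} P = P"
 using DM_mset[of "[]" P] by simp

lemma DM_add_mset: "DM (add_mset a M) P = DM M (%x. P (x + a) - P x)"
proof -
 obtain as where as: "M = mset as" using ex_mset by metis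
 show ?thesis using DM_mset[of "a # as" P] DM_mset[of as "%x. P (x + a) - P x"] by (simp add: as)
qed

text \<open>Newton's expansion: translation by \<open>h j\<close> is the identity plus the
  difference in that direction, and the product over \<open>S\<close> is multiplied out.\<close>

lemma DM_expand:
 "finite S ==> P (y + sum h S) = (\<Sum>I\<in>Pow S. DM (hm h I) P y)"
proof (induction S arbitrary: P rule: finite_induct)
 case (insert j S)
 have "P (y + sum h (insert j S)) = (P (y + sum h S + h j) - P (y + sum h S)) + P (y + sum h S)"
  using insert.hyps by (simp add: ac_simps)
 also have "P (y + sum h S + h j) - P (y + sum h S) = (\<Sum>I\<in>Pow S. DM (hm h I) (%x. P (x + h j) - P x) y)"
  by (rule insert.IH)
 also have "... = (\<Sum>I\<in>Pow S. DM (hm h (insert j I)) P y)"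
 proof (rule sum.cong[OF refl])
  fix I assume I: "I : Pow S"
  then have "finite I" "j \<notin> I" using insert.hyps finite_subset by auto
  then show "DM (hm h I) (%x. P (x + h j) - P x) y = DM (hm h (insert j I)) P y"
   by (simp add: hm_insert DM_add_mset)
 qed
 also have "... = (\<Sum>I\<in>insert j ` Pow S. DM (hm h I) P y)"
  using insert.hyps by (subst sum.reindex) (auto simp: inj_on_def)
 also have "P (y + sum h S) = (\<Sum>I\<in>Pow S. DM (hm h I) P y)" by (rule insert.IH)
 also have "(\<Sum>I\<in>insert j ` Pow S. DM (hm h I) P y) + (\<Sum>I\<in>Pow S. DM (hm h I) P y)
   = (\<Sum>I\<in>Pow (insert j S). DM (hm h I) P y)"
  unfolding Pow_insert
  by (subst sum.union_disjoint) (use insert.hyps in \<open>auto simp: add.commute\<close>)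
 finally show ?case .
qed simp

definition pd :: "nat => nat => (vec => circle) => bool" where
 "pd n m P \<longleftrightarrow> (\<forall>as. length as = m & set as \<subseteq> FF n --> (\<forall>x\<in>FF n. DL as P x = 0))"

lemma pdD: "pd n m P ==> length as = m ==> set as \<subseteq> FF n ==> x : FF n ==> DL as P x = 0"
 by (auto simp: pd_def)

lemma pd_D: "pd n (Suc m) P ==> a : FF n ==> pd n m (%x. P (x + a) - P x)"
 unfolding pd_def
proof (intro allI impI ballI)
 fix as x
 assume P: "\<forall>as. length as = Suc m & set as \<subseteq> FF n --> (\<forall>x\<in>FF n. DL as P x = 0)" and "a : FF n"
  "length as = m & set as \<subseteq> FF n" "x : FF n"
 then show "DL as (%x. P (x + a) - P x) x = 0" using P[rule_format, of "a # as" x] by simp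
qed

lemma pd_from_D: "(!!a. a : FF n ==> pd n m (%x. P (x + a) - P x)) ==> pd n (Suc m) P"
 unfolding pd_def by (auto simp: length_Suc_conv)

lemma DL_vanish: "pd n m P ==> length as \<ge> m ==> set as \<subseteq> FF n ==> x : FF n ==> DL as P x = 0"
proof -
 assume a: "pd n m P" "length as \<ge> m" "set as \<subseteq> FF n" "x : FF n"
 have "DL as P x = DL (drop m as) (DL (take m as) P) x"
  using DL_append[of "take m as" "drop m as" P] by simp
 also have "... = DL (drop m as) (%_. 0) x"
 proof (rule DL_cong[of _ n])
  show "set (drop m as) \<subseteq> FF n" using a(3) by (auto dest: in_set_dropD)
  show "DL (take m as) P y = 0" if "y : FF n" for y
   using a that by (intro pdD[OF a(1)]) (auto dest: in_set_takeD)
 qed (rule a(4))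
 finally show ?thesis by (simp add: DL_zero)
qed

lemma pd_mono: "pd n m P ==> m \<le> k ==> pd n k P"
 unfolding pd_def[of n k] using DL_vanish[of n m P] by auto

lemma pd_add: "pd n m P ==> pd n m Q ==> pd n m (%x. P x + Q x)"
 by (simp add: pd_def DL_add)

lemma pd_diff: "pd n m P ==> pd n m Q ==> pd n m (%x. P x - Q x)"
 by (simp add: pd_def DL_diff)

lemma pd_zmul: "pd n m P ==> pd n m (%x. zmul k (P x))"
 by (simp add: pd_def DL_zmul)

lemma pd_zero: "pd n m (%_. 0)"
 by (simp add: pd_def DL_zero)

lemma pd_sum: "(!!i. i : I ==> pd n m (P i)) ==> pd n m (%x. \<Sum>i\<in>I. P i x)"
 by (simp add: pd_def DL_sum)

lemma pd_const: "pd n (Suc m) (%_. c)"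
 by (rule pd_from_D) (simp add: pd_zero)

lemma pd_lin: "pd n m P ==> lin n \<pi> ==> pd n m (%x. P (\<pi> x))"
 unfolding pd_def
proof (intro allI impI ballI)
 fix as x
 assume P: "\<forall>as. length as = m & set as \<subseteq> FF n --> (\<forall>x\<in>FF n. DL as P x = 0)" and l: "lin n \<pi>"
  and as: "length as = m & set as \<subseteq> FF n" and x: "x : FF n"
 have "DL as (%x. P (\<pi> x)) x = DL (map \<pi> as) P (\<pi> x)"
  by (rule DL_lin[OF l]) (use as x in auto)
 also have "... = 0"
 proof -
  have "length (map \<pi> as) = m & set (map \<pi> as) \<subseteq> FF n" "\<pi> x : FF n"
   using l as x by (auto simp: lin_def)
  then show ?thesis using P by blast
 qed
 finally show "DL as (%x. P (\<pi> x)) x = 0" .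
qed

lemma pd_cong: "(!!x. x : FF n ==> P x = Q x) ==> pd n m P ==> pd n m Q"
 unfolding pd_def using DL_cong[of _ n Q P] by auto

lemma vec_cancel: "(x::vec) + a + a = x"
 by (simp only: add.assoc vec_add_self add.right_neutral)

text \<open>As a + a = 0, a second difference in the same direction amounts to multiplication by -2.
  Every connection between degree and torsion in the sequel comes from this identity.\<close>

lemma DL_double: "DL (a # a # as) P x = - zmul 2 (DL (a # as) P x)"
proof -
 have e: "(P (y + a + a) - P (y + a)) - (P (y + a) - P y) = zmul (-2) (P (y + a) - P y)" for y
  unfolding vec_cancel by (simp add: zmul_minus_left zmul_two)
 have "DL (a # a # as) P x = DL as (%y. (P (y + a + a) - P (y + a)) - (P (y + a) - P y)) x"
  by simp
 also have "... = DL as (%y. zmul (-2) (P (y + a) - P y)) x" unfolding e ..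
 also have "... = zmul (-2) (DL (a # as) P x)" unfolding DL_zmul by simp
 finally show ?thesis by (simp add: zmul_minus_left)
qed

text \<open>Each factor 2 is traded for a repetition of a direction that is already present, until
  the number of directions reaches the degree bound.\<close>

lemma DL_torsion:
 assumes P: "pd n m P"
 shows "[|as ~= []; set as \<subseteq> FF n; x : FF n|] ==> zmul (2 ^ (m - length as)) (DL as P x) = 0"
proof (induction "m - length as" arbitrary: as)
 case 0
 then have "DL as P x = 0" by (intro DL_vanish[OF P]) auto
 then show ?case by simp
next
 case (Suc k)
 obtain a as' where as: "as = a # as'" using Suc.prems(1) by (cases as) auto
 have k: "k = m - length (a # as)" "m - length as = Suc k" using Suc.hyps(2) by auto
 have "zmul (2 ^ k) (DL (a # as) P x) = 0"
  using Suc.hyps(1)[OF k(1)] Suc.prems as k(1) by auto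
 then have "zmul (2 ^ k) (zmul 2 (DL as P x)) = 0"
  unfolding as DL_double by (simp add: zmul_minus_right)
 then show ?case unfolding k(2) by (simp add: zmul_zmul mult.commute)
qed

text \<open>An application of \<open>DL_torsion\<close> with one factor 2. It needs at least one
  direction, as doubling does not kill constants.\<close>

lemma pd_double: "pd n (Suc m) P ==> m \<ge> 1 ==> pd n m (%x. zmul 2 (P x))"
 unfolding pd_def[of n m]
proof (intro allI impI ballI)
 fix as x assume P: "pd n (Suc m) P" and m: "m \<ge> 1" and as: "length as = m & set as \<subseteq> FF n" and x: "x : FF n"
 have "zmul (2 ^ (Suc m - length as)) (DL as P x) = 0"
  by (rule DL_torsion[OF P]) (use as x m in auto)
 then show "DL as (%x. zmul 2 (P x)) x = 0" unfolding DL_zmul using as by simp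
qed

section \<open>Agreement with the definition of degree by signed sums over cubes\<close>

lemma zmul_sign_flip: "zmul ((-1) ^ m) A - zmul ((-1) ^ m) B = zmul ((-1) ^ Suc m) (B + - A)"
 by (simp add: zmul_minus_left zmul_diff_right)

lemma zmul_sign_sign: "zmul ((-1) ^ m) (zmul ((-1) ^ m) A) = A"
 by (simp add: zmul_zmul flip: power_mult_distrib)

lemma DL_cube: "DL (map h [0..<m]) P x = zmul ((-1) ^ m) (\<Sum>I\<in>Pow {..<m}. zmul ((-1) ^ card I) (P (x + sum h I)))"
proof (induction m arbitrary: x)
 case (Suc m)
 let ?S = "%x. \<Sum>I\<in>Pow {..<m}. zmul ((-1) ^ card I) (P (x + sum h I))"
 have "(\<Sum>I\<in>Pow {..<Suc m}. zmul ((-1) ^ card I) (P (x + sum h I)))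
   = ?S x + (\<Sum>I\<in>insert m ` Pow {..<m}. zmul ((-1) ^ card I) (P (x + sum h I)))"
  unfolding lessThan_Suc Pow_insert by (rule sum.union_disjoint) auto
 also have "(\<Sum>I\<in>insert m ` Pow {..<m}. zmul ((-1) ^ card I) (P (x + sum h I)))
   = (\<Sum>I\<in>Pow {..<m}. zmul ((-1) ^ card (insert m I)) (P (x + sum h (insert m I))))"
  by (subst sum.reindex) (auto simp: inj_on_def)
 also have "... = (\<Sum>I\<in>Pow {..<m}. - zmul ((-1) ^ card I) (P (x + h m + sum h I)))"
 proof (rule sum.cong[OF refl])
  fix I assume I: "I : Pow {..<m}"
  then have "finite I" "m \<notin> I" using finite_subset[of I "{..<m}"] by auto
  then show "zmul ((-1) ^ card (insert m I)) (P (x + sum h (insert m I)))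
    = - zmul ((-1) ^ card I) (P (x + h m + sum h I))"
   by (simp add: zmul_minus_left add.assoc)
 qed
 also have "... = - ?S (x + h m)" by (rule sum_negf)
 finally have e: "(\<Sum>I\<in>Pow {..<Suc m}. zmul ((-1) ^ card I) (P (x + sum h I))) = ?S x + - ?S (x + h m)" .
 have "DL (map h [0..<Suc m]) P x = DL (map h [0..<m]) P (x + h m) - DL (map h [0..<m]) P x"
  by (simp add: DL_append)
 also have "... = zmul ((-1) ^ m) (?S (x + h m)) - zmul ((-1) ^ m) (?S x)" by (simp only: Suc.IH)
 also have "... = zmul ((-1) ^ Suc m) (?S x + - ?S (x + h m))"
  by (rule zmul_sign_flip)
 finally show ?case unfolding e .
qed simp

lemma pd_iff: "poly_deg_less n m P \<longleftrightarrow> pd n m P"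
proof
 assume P: "poly_deg_less n m P"
 show "pd n m P"
  unfolding pd_def
 proof (intro allI impI ballI)
  fix as x assume as: "length as = m & set as \<subseteq> FF n" and x: "x : FF n"
  define h where "h = restrict (%i. as ! i) {..<m}"
  have h: "h : {..<m} \<rightarrow>\<^sub>E FF n" using as by (auto simp: h_def)
  have "as = map h [0..<m]" using as by (intro nth_equalityI) (auto simp: h_def)
  then have "DL as P x = zmul ((-1) ^ m) (\<Sum>I\<in>Pow {..<m}. zmul ((-1) ^ card I) (P (x + sum h I)))"
   by (simp only: DL_cube)
  also have "(\<Sum>I\<in>Pow {..<m}. zmul ((-1) ^ card I) (P (x + sum h I))) = 0"
   using P x h unfolding poly_deg_less_def by blast
  finally show "DL as P x = 0" by simp
 qed
next
 assume P: "pd n m P"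
 show "poly_deg_less n m P"
  unfolding poly_deg_less_def
 proof (intro ballI)
  fix x h assume x: "x : FF n" and h: "h : {..<m} \<rightarrow>\<^sub>E FF n"
  let ?S = "\<Sum>I\<in>Pow {..<m}. zmul ((-1) ^ card I) (P (x + sum h I))"
  have "set (map h [0..<m]) \<subseteq> FF n"
  proof
   fix a assume "a : set (map h [0..<m])"
   then obtain i where "i < m" "a = h i" by auto
   then show "a : FF n" using h by (auto simp: PiE_def Pi_def)
  qed
  from pdD[OF P _ this x] have "DL (map h [0..<m]) P x = 0" by (simp only: length_map length_upt diff_zero)
  then have z: "zmul ((-1) ^ m) ?S = 0" unfolding DL_cube .
  have "?S = zmul ((-1) ^ m) (zmul ((-1) ^ m) ?S)"
   by (rule zmul_sign_sign[symmetric])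
  also have "... = 0" unfolding z by (rule zmul_zero_right)
  finally show "?S = 0" .
 qed
qed

section \<open>Monomials\<close>

definition mono :: "nat set => vec => int" where
 "mono S x = (\<Prod>i\<in>S. of_bool (x i = 1))"

lemma mono_eq: "finite S ==> mono S x = of_bool (\<forall>i\<in>S. x i = 1)"
 unfolding mono_def by (induction S rule: finite_induct) auto

text \<open>Over the integers a coordinate flipped by \<open>a\<close> changes its factor from x_i
  to 1 - x_i; the product over the flipped coordinates is then multiplied out.\<close>

lemma mono_shift:
 fixes x a :: vec
 assumes S: "finite S"
 defines "H \<equiv> {i\<in>S. a i = 1}"
 shows "mono S (x + a) = (\<Sum>K\<in>Pow H. (-1) ^ card K * mono ((S - H) \<union> K) x)"
proof -
 have H: "finite H" "H \<subseteq> S" using S by (auto simp: H_def)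
 let ?b = "%i. of_bool (x i = 1) :: int"
 have "mono S (x + a) = (\<Prod>i\<in>S - H. of_bool ((x + a) i = 1)) * (\<Prod>i\<in>H. of_bool ((x + a) i = 1))"
  unfolding mono_def using prod.subset_diff[OF H(2) S] by simp
 also have "(\<Prod>i\<in>S - H. of_bool ((x + a) i = 1)) = (\<Prod>i\<in>S - H. ?b i)"
 proof (rule prod.cong[OF refl])
  fix i assume "i : S - H"
  then have "a i = 0" by (auto simp: H_def)
  then show "of_bool ((x + a) i = 1) = ?b i" by simp
 qed
 also have "(\<Prod>i\<in>H. of_bool ((x + a) i = 1)) = (\<Prod>i\<in>H. 1 + - ?b i)"
 proof (rule prod.cong[OF refl])
  fix i assume "i : H"
  then have "a i = 1" by (simp add: H_def)
  then show "of_bool ((x + a) i = 1) = 1 + - ?b i"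
   by (cases "x i") (auto simp: bit_add_self)
 qed
 also have "... = (\<Sum>K\<in>Pow H. \<Prod>i\<in>K. - ?b i)" by (rule prod_one_plus[OF H(1)])
 also have "(\<Prod>i\<in>S - H. ?b i) * ... = (\<Sum>K\<in>Pow H. (-1) ^ card K * mono ((S - H) \<union> K) x)"
  unfolding sum_distrib_left
 proof (rule sum.cong[OF refl])
  fix K assume K: "K : Pow H"
  have "mono ((S - H) \<union> K) x = (\<Prod>i\<in>S - H. ?b i) * (\<Prod>i\<in>K. ?b i)"
   unfolding mono_def by (rule prod.union_disjoint) (use S H K finite_subset[of K H] in auto)
  moreover have "(\<Prod>i\<in>K. - ?b i) = (-1) ^ card K * (\<Prod>i\<in>K. ?b i)" by (rule prod_uminus)
  ultimately show "(\<Prod>i\<in>S - H. ?b i) * (\<Prod>i\<in>K. - ?b i) = (-1) ^ card K * mono ((S - H) \<union> K) x"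
   by simp
 qed
 finally show ?thesis .
qed

lemma zmul_pow_mono: "zmul (2 ^ k) a = 0 ==> k \<le> l ==> zmul (2 ^ l) a = 0"
proof -
 assume a: "zmul (2 ^ k) a = 0" "k \<le> l"
 have "(2::int) ^ l = 2 ^ (l - k) * 2 ^ k" using a(2) by (simp flip: power_add)
 then have "zmul (2 ^ l) a = zmul (2 ^ (l - k)) (zmul (2 ^ k) a)" by (simp add: zmul_zmul)
 then show ?thesis using a(1) by simp
qed

lemma zmul_swap: "zmul a (zmul b x) = zmul b (zmul a x)"
 by (simp add: zmul_zmul mult.commute)

text \<open>A difference consists of smaller monomials, for which the same torsion of
  \<open>a\<close> suffices although the degree bound is one less, and of the monomial itself with
  coefficient (-1)^c - 1. This coefficient is even, and its factor 2 reduces the torsion by one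
  power.\<close>

lemma pd_mono_term:
 "[|finite S; zmul (2 ^ (m - card S)) a = 0|] ==> pd n m (%x. zmul (mono S x) a)"
proof (induction m arbitrary: S a)
 case 0
 then show ?case by (simp add: pd_zero)
next
 case (Suc m)
 show ?case
 proof (rule pd_from_D)
  fix b assume "b : FF n"
  define H where "H = {i\<in>S. b i = 1}"
  have H: "finite H" "H \<subseteq> S" using Suc.prems by (auto simp: H_def)
  have SH: "S - H \<union> H = S" and SH': "S \<union> H = S" using H by blast+
  have eq: "zmul (mono S (x + b)) a - zmul (mono S x) a
    = (\<Sum>K\<in>Pow H - {H}. zmul (mono ((S - H) \<union> K) x) (zmul ((-1) ^ card K) a))
     + zmul (mono S x) (zmul ((-1) ^ card H - 1) a)" for x
  proof -
   have "mono S (x + b) = (\<Sum>K\<in>Pow H - {H}. (-1) ^ card K * mono ((S - H) \<union> K) x) + (-1) ^ card H * mono S x"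
    unfolding mono_shift[OF Suc.prems(1), where a = b, folded H_def]
    using H(1) by (subst sum.remove[of _ H]) (auto simp: SH SH')
   then have "zmul (mono S (x + b)) a
     = (\<Sum>K\<in>Pow H - {H}. zmul ((-1) ^ card K * mono ((S - H) \<union> K) x) a) + zmul ((-1) ^ card H * mono S x) a"
    by (simp only: zmul_add_left zmul_sum_left)
   then show ?thesis
    by (simp add: zmul_zmul mult.commute zmul_diff_left zmul_diff_right left_diff_distrib)
  qed
  show "pd n m (%x. zmul (mono S (x + b)) a - zmul (mono S x) a)"
   unfolding eq
  proof (intro pd_add pd_sum Suc.IH)
   fix K assume K: "K : Pow H - {H}"
   show "finite (S - H \<union> K)" using Suc.prems(1) H K finite_subset[of K H] by auto
   have "S - H \<union> K \<subset> S" using H K by blast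
   then have "card (S - H \<union> K) < card S" by (rule psubset_card_mono[OF Suc.prems(1)])
   then have "zmul (2 ^ (m - card (S - H \<union> K))) a = 0"
    by (intro zmul_pow_mono[OF Suc.prems(2)]) simp
   then show "zmul (2 ^ (m - card (S - H \<union> K))) (zmul ((-1) ^ card K) a) = 0"
    by (subst zmul_swap) simp
  next
   show "finite S" by (rule Suc.prems(1))
   have "zmul (2 ^ (m - card S)) (zmul 2 a) = 0"
   proof (cases "card S \<le> m")
    case True
    then show ?thesis using Suc.prems(2) by (simp add: Suc_diff_le zmul_zmul mult.commute)
   next
    case False
    then show ?thesis using Suc.prems(2) by simp
   qed
   moreover have "\<exists>c. (-1) ^ card H - 1 = c * (2::int)"
   proof (cases "even (card H)")
    case True
    then show ?thesis by (intro exI[of _ 0]) simp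
   next
    case False
    then show ?thesis by (intro exI[of _ "-1"]) simp
   qed
   ultimately show "zmul (2 ^ (m - card S)) (zmul ((-1) ^ card H - 1) a) = 0"
    by (metis zmul_swap zmul_zmul zmul_zero_right)
  qed
 qed
qed

section \<open>Basis vectors and coefficients of a polynomial\<close>

definition eu :: "nat => vec" where
 "eu i = (%k. if k = i then 1 else 0)"

lemma eu_FF: "i < n ==> eu i : FF n"
 by (auto simp: FF_def eu_def)

lemma sum_fun_apply': "(sum f I :: vec) k = (\<Sum>i\<in>I. f i k)"
 by (induction I rule: infinite_finite_induct) auto

lemma vec_sum_eu:
 assumes "x : FF n"
 shows "x = sum eu {i. x i = 1}" "{i. x i = 1} \<subseteq> {..<n}"
proof -
 show sub: "{i. x i = 1} \<subseteq> {..<n}" using assms by (auto simp: FF_def) (metis not_less zero_neq_one)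
 have fin: "finite {i. x i = 1}" by (rule finite_subset[OF sub]) simp
 show "x = sum eu {i. x i = 1}"
 proof
  fix k
  have "sum eu {i. x i = 1} k = (\<Sum>i\<in>{i. x i = 1}. if i = k then 1 else 0)"
   unfolding sum_fun_apply' by (rule sum.cong[OF refl]) (simp add: eu_def)
  also have "... = (if k : {i. x i = 1} then 1 else 0)" using fin by (simp add: sum.delta)
  also have "... = x k" by (cases "x k") auto
  finally show "x k = sum eu {i. x i = 1} k" by simp
 qed
qed

text \<open>By Newton's expansion at 0, this derivative along basis vectors is the coefficient of
  \<open>mono S\<close> in \<open>P\<close>.\<close>

definition cf :: "(vec => circle) => nat set => circle" where
 "cf P S = DM (hm eu S) P 0"

lemma mono_expansion:
 assumes x: "x : FF n"
 shows "P x = (\<Sum>S\<in>Pow {..<n}. zmul (mono S x) (cf P S))"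
proof -
 let ?X = "{i. x i = 1}"
 have sub: "?X \<subseteq> {..<n}" by (rule vec_sum_eu(2)[OF x])
 have fin: "finite ?X" by (rule finite_subset[OF sub]) simp
 have "P x = P (0 + sum eu ?X)" using vec_sum_eu(1)[OF x] by simp
 also have "... = (\<Sum>S\<in>Pow ?X. cf P S)" unfolding cf_def by (rule DM_expand[OF fin])
 also have "... = (\<Sum>S\<in>Pow {..<n}. zmul (mono S x) (cf P S))"
 proof (rule sum.mono_neutral_cong_left)
  show "\<forall>S\<in>Pow {..<n} - Pow ?X. zmul (mono S x) (cf P S) = 0"
  proof
   fix S assume S: "S : Pow {..<n} - Pow ?X"
   then have "finite S" "\<not> (\<forall>i\<in>S. x i = 1)" using finite_subset[of S "{..<n}"] by auto
   then have "mono S x = 0" by (simp only: mono_eq of_bool_eq)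
   then show "zmul (mono S x) (cf P S) = 0" by simp
  qed
  show "cf P S = zmul (mono S x) (cf P S)" if "S : Pow ?X" for S
   using that finite_subset[OF _ fin, of S] by (auto simp: mono_eq)
 qed (use sub in auto)
 finally show ?thesis .
qed

lemma hm_list:
 assumes "finite S"
 obtains as where "mset as = hm h S" "length as = card S" "set as = h ` S"
proof -
 obtain as where as: "mset as = hm h S" using ex_mset by blast
 then have "length as = card S" by (metis size_hm size_mset)
 moreover have "set as = h ` S" using as assms by (metis set_hm set_mset_mset)
 ultimately show ?thesis using as that by blast
qed

lemma cf_torsion:
 assumes P: "pd n m P" and S: "S \<subseteq> {..<n}" "S ~= {}"
 shows "zmul (2 ^ (m - card S)) (cf P S) = 0"
proof -
 have fin: "finite S" using S(1) finite_subset by blast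
 obtain as where as: "mset as = hm eu S" "length as = card S" "set as = eu ` S" using hm_list[OF fin] .
 have "zmul (2 ^ (m - length as)) (DL as P 0) = 0"
  by (rule DL_torsion[OF P _ _ FF_zero]) (use as S eu_FF in auto)
 then show ?thesis using as by (simp add: cf_def DM_mset[symmetric])
qed

text \<open>All coefficients are halved. This raises their torsion by one power of 2, and hence the
  degree by one.\<close>

lemma poly_root:
 assumes P: "pd n (Suc m) P"
 shows "\<exists>Q. pd n (Suc (Suc m)) Q & (\<forall>x\<in>FF n. zmul 2 (Q x) = P x)"
proof -
 define Q where "Q x = (\<Sum>S\<in>Pow {..<n}. zmul (mono S x) (hc (cf P S)))" for x
 have "zmul 2 (Q x) = P x" if "x : FF n" for x
  unfolding Q_def zmul_sum_right mono_expansion[OF that, of P]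
  by (rule sum.cong[OF refl]) (simp add: zmul_swap[of 2] hc)
 moreover have "pd n (Suc (Suc m)) Q"
  unfolding Q_def
 proof (rule pd_sum)
  fix S assume S: "S : Pow {..<n}"
  have fin: "finite S" using S finite_subset by auto
  show "pd n (Suc (Suc m)) (%x. zmul (mono S x) (hc (cf P S)))"
  proof (cases "S = {}")
   case True
   then show ?thesis by (simp add: mono_def pd_const)
  next
   case False
   have t: "zmul (2 ^ (Suc m - card S)) (cf P S) = 0" using cf_torsion[OF P _ False] S by blast
   have "zmul (2 ^ (Suc (Suc m) - card S)) (hc (cf P S)) = 0"
   proof (cases "card S \<le> Suc m")
    case True
    then have "(2::int) ^ (Suc (Suc m) - card S) = 2 ^ (Suc m - card S) * 2" by (simp add: Suc_diff_le)
    then have "zmul (2 ^ (Suc (Suc m) - card S)) (hc (cf P S)) = zmul (2 ^ (Suc m - card S)) (zmul 2 (hc (cf P S)))"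
     by (simp add: zmul_zmul)
    then show ?thesis by (simp add: hc t)
   next
    case False
    then have "cf P S = 0" using t by simp
    then show ?thesis by simp
   qed
   then show ?thesis by (rule pd_mono_term[OF fin])
  qed
 qed
 ultimately show ?thesis by blast
qed

section \<open>Top forms\<close>

text \<open>A derivative of maximal order of a polynomial takes only the values \<open>0\<close> and \<open>1/2\<close>.\<close>

definition tb :: "(vec => circle) => vec multiset => bit" where
 "tb P M = (if DM M P 0 = 0 then 0 else 1)"

lemma DM_vanish: "pd n m P ==> size M \<ge> m ==> set_mset M \<subseteq> FF n ==> x : FF n ==> DM M P x = 0"
proof -
 assume a: "pd n m P" "size M \<ge> m" "set_mset M \<subseteq> FF n" "x : FF n"
 obtain as where as: "M = mset as" using ex_mset by metis
 show ?thesis unfolding as DM_mset using a as by (intro DL_vanish[OF a(1)]) auto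
qed

lemma DM_diff: "DM M (%x. P x - Q x) = (%x. DM M P x - DM M Q x)"
 unfolding DM_def by (rule DL_diff)

lemma DM_add: "DM M (%x. P x + Q x) = (%x. DM M P x + DM M Q x)"
 unfolding DM_def by (rule DL_add)

lemma DM_zmul: "DM M (%x. zmul k (P x)) = (%x. zmul k (DM M P x))"
 unfolding DM_def by (rule DL_zmul)

lemma DM_double: "DM (add_mset a (add_mset a M)) P x = - zmul 2 (DM (add_mset a M) P x)"
proof -
 obtain as where as: "M = mset as" using ex_mset by metis
 show ?thesis using DL_double[of a as P x] DM_mset[of "a # a # as" P] DM_mset[of "a # as" P] by (simp add: as)
qed

lemma DM_half:
 assumes P: "pd n (Suc d) P" and M: "size M = d" "d \<ge> 1" "set_mset M \<subseteq> FF n"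
 shows "DM M P 0 = half (tb P M)"
proof -
 obtain as where as: "M = mset as" using ex_mset by metis
 have "zmul (2 ^ (Suc d - length as)) (DL as P 0) = 0"
  by (rule DL_torsion[OF P _ _ FF_zero]) (use as M in auto)
 then have "zmul 2 (DM M P 0) = 0" using as M by (simp add: DM_mset)
 then obtain b where b: "DM M P 0 = half b" using two_torsion by blast
 then have "tb P M = b" using half_one_nonzero by (cases b) (auto simp: tb_def)
 then show ?thesis using b by simp
qed

lemma DM_add_vec:
 "DM (add_mset (a + b) M) P x = DM (add_mset a M) P x + DM (add_mset b M) P x + DM (add_mset a (add_mset b M)) P x"
proof -
 have "(%x. P (x + (a + b)) - P x)
   = (%x. ((P (x + a) - P x) + (P (x + b) - P x)) + ((P (x + b + a) - P (x + b)) - (P (x + a) - P x)))"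
  by (simp add: fun_eq_iff ac_simps)
 then have "DM (add_mset (a + b) M) P
   = DM M (%x. ((P (x + a) - P x) + (P (x + b) - P x)) + ((P (x + b + a) - P (x + b)) - (P (x + a) - P x)))"
  unfolding DM_add_mset by (rule arg_cong)
 also have "... = (%x. (DM (add_mset a M) P x + DM (add_mset b M) P x)
   + DM M (%x. (P (x + b + a) - P (x + b)) - (P (x + a) - P x)) x)"
  unfolding DM_add_mset DM_add ..
 also have "DM M (%x. (P (x + b + a) - P (x + b)) - (P (x + a) - P x)) = DM (add_mset a (add_mset b M)) P"
  unfolding DM_add_mset by (rule refl)
 finally have e: "DM (add_mset (a + b) M) P
   = (%x. (DM (add_mset a M) P x + DM (add_mset b M) P x) + DM (add_mset a (add_mset b M)) P x)" .
 show ?thesis unfolding e ..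
qed

text \<open>The defect of additivity is a derivative of order d + 1, which vanishes. A repeated
  argument yields by \<open>DM_double\<close> a derivative of 2P, so the form is alternating as soon
  as P is 2-torsion.\<close>

lemma form_tb:
 assumes P: "pd n (Suc d) P" and d: "d \<ge> 1" and alt: "alt ==> \<forall>x\<in>FF n. zmul 2 (P x) = 0"
 shows "form alt n d (tb P)"
 unfolding form_def
proof (intro conjI ballI allI impI)
 fix a b M assume ab: "a : FF n" "b : FF n" and M: "set_mset M \<subseteq> FF n & Suc (size M) = d"
 have "DM (add_mset a (add_mset b M)) P 0 = 0"
  by (rule DM_vanish[OF P _ _ FF_zero]) (use ab M in auto)
 then have "DM (add_mset (a + b) M) P 0 = DM (add_mset a M) P 0 + DM (add_mset b M) P 0"
  by (simp add: DM_add_vec)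
 moreover have h: "DM (add_mset c M) P 0 = half (tb P (add_mset c M))" if "c : FF n" for c
  by (rule DM_half[OF P]) (use that M d in auto)
 ultimately have "half (tb P (add_mset (a + b) M)) = half (tb P (add_mset a M) + tb P (add_mset b M))"
  using ab FF_add by (simp add: h half_add)
 then show "tb P (add_mset (a + b) M) = tb P (add_mset a M) + tb P (add_mset b M)" by (rule half_inj)
next
 fix a M assume a: "alt" "a : FF n" and M: "set_mset M \<subseteq> FF n & Suc (Suc (size M)) = d"
 obtain as where as: "mset as = add_mset a M" using ex_mset by blast
 have "zmul 2 (DM (add_mset a M) P 0) = DL as (%x. zmul 2 (P x)) 0"
  unfolding as[symmetric] DM_mset DL_zmul ..
 also have "... = DL as (%_. 0) 0"
 proof (rule DL_cong[of _ n])
  have "set as = set_mset (add_mset a M)" using as by (metis set_mset_mset)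
  then show "set as \<subseteq> FF n" using a M by auto
 qed (use alt[OF a(1)] FF_zero in auto)
 finally have "DM (add_mset a (add_mset a M)) P 0 = 0" unfolding DM_double by (simp add: DL_zero)
 then show "tb P (add_mset a (add_mset a M)) = 0" by (simp add: tb_def)
qed

section \<open>Finite rank\<close>

text \<open>Bounded rank phrased as determination by the listed polynomials; the function through
  which \<open>Q\<close> factors is recovered only in \<open>frank_d_rank\<close>.\<close>

definition frank :: "nat => nat => nat => (vec => circle) => bool" where
 "frank n m K Q \<longleftrightarrow> (\<exists>Qs. length Qs \<le> K & (\<forall>P\<in>set Qs. pd n m P) &
   (\<forall>x\<in>FF n. \<forall>y\<in>FF n. (\<forall>P\<in>set Qs. P x = P y) --> Q x = Q y))"

lemma frankI:
 "length Qs \<le> K ==> (!!P. P : set Qs ==> pd n m P) ==>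
  (!!x y. x : FF n ==> y : FF n ==> (!!P. P : set Qs ==> P x = P y) ==> Q x = Q y) ==> frank n m K Q"
 unfolding frank_def by (intro exI[of _ Qs]) blast

lemma frank_mono: "frank n m K Q ==> K \<le> K' ==> frank n m K' Q"
 unfolding frank_def using order_trans by blast

lemma frank_add:
 assumes "frank n m K P" "frank n m L Q"
 shows "frank n m (K + L) (%x. P x + Q x)"
proof -
 obtain Ps where Ps: "length Ps \<le> K" "!!R. R : set Ps ==> pd n m R"
  "!!x y. x : FF n ==> y : FF n ==> (\<forall>R\<in>set Ps. R x = R y) ==> P x = P y"
  using assms(1) unfolding frank_def by blast
 obtain Qs where Qs: "length Qs \<le> L" "!!R. R : set Qs ==> pd n m R"
  "!!x y. x : FF n ==> y : FF n ==> (\<forall>R\<in>set Qs. R x = R y) ==> Q x = Q y"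
  using assms(2) unfolding frank_def by blast
 show ?thesis
 proof (rule frankI[of "Ps @ Qs"])
  show "length (Ps @ Qs) \<le> K + L" using Ps(1) Qs(1) by simp
  show "pd n m R" if "R : set (Ps @ Qs)" for R using that Ps(2) Qs(2) by auto
  fix x y assume xy: "x : FF n" "y : FF n" and e: "!!R. R : set (Ps @ Qs) ==> R x = R y"
  have "P x = P y" by (rule Ps(3)[OF xy]) (use e in simp)
  moreover have "Q x = Q y" by (rule Qs(3)[OF xy]) (use e in simp)
  ultimately show "P x + Q x = P y + Q y" by simp
 qed
qed

lemma frank_lin:
 assumes "frank n m K P" and \<pi>: "lin n \<pi>"
 shows "frank n m K (%x. P (\<pi> x))"
proof -
 obtain Ps where Ps: "length Ps \<le> K" "!!R. R : set Ps ==> pd n m R"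
  "!!x y. x : FF n ==> y : FF n ==> (\<forall>R\<in>set Ps. R x = R y) ==> P x = P y"
  using assms(1) unfolding frank_def by blast
 show ?thesis
 proof (rule frankI[of "map (%R x. R (\<pi> x)) Ps"])
  show "length (map (%R x. R (\<pi> x)) Ps) \<le> K" using Ps(1) by simp
  show "pd n m R" if "R : set (map (%R x. R (\<pi> x)) Ps)" for R
   using that Ps(2) pd_lin[OF _ \<pi>] by auto
  fix x y assume xy: "x : FF n" "y : FF n" and e: "!!R. R : set (map (%R x. R (\<pi> x)) Ps) ==> R x = R y"
  show "P (\<pi> x) = P (\<pi> y)"
  proof (rule Ps(3))
   show "\<pi> x : FF n" "\<pi> y : FF n" using \<pi> xy by (auto simp: lin_def)
   show "\<forall>R\<in>set Ps. R (\<pi> x) = R (\<pi> y)"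
   proof
    fix R assume "R : set Ps"
    then have "(%x. R (\<pi> x)) : set (map (%R x. R (\<pi> x)) Ps)" by auto
    from e[OF this] show "R (\<pi> x) = R (\<pi> y)" .
   qed
  qed
 qed
qed

lemma frank_self: "pd n m Q ==> frank n m 1 Q"
 by (rule frankI[of "[Q]"]) auto

lemma frank_const: "(!!x. x : FF n ==> Q x = c) ==> frank n m 0 Q"
 by (rule frankI[of "[]"]) auto

text \<open>A tower of successive halves of \<open>P\<close>: the induction on the degree needs all of them, since it is applied to \<open>2P\<close>.\<close>

definition chain :: "nat => nat => nat => nat => (vec => circle) => bool" where
 "chain n d K L P \<longleftrightarrow> (\<exists>R. (\<forall>x\<in>FF n. R 0 x = P x) &
   (\<forall>t<L. \<forall>x\<in>FF n. zmul 2 (R (Suc t) x) = R t x) &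
   (\<forall>t\<le>L. pd n (Suc (d + t)) (R t) & frank n (d + t) K (R t)))"

section \<open>Linear maps close to the identity\<close>

definition sc :: "bit => vec => vec" where
 "sc b v = (if b = 0 then 0 else v)"

lemma sc_add: "sc (a + b) v = sc a v + sc b v"
 by (cases a; cases b) (auto simp: sc_def vec_add_self bit_add_self)

lemma sc_FF: "v : FF n ==> sc b v : FF n"
 by (auto simp: sc_def FF_zero)

definition additive :: "nat => (vec => bit) => bool" where
 "additive n l \<longleftrightarrow> (\<forall>x\<in>FF n. \<forall>y\<in>FF n. l (x + y) = l x + l y)"

text \<open>The identity plus a map of rank at most \<open>K\<close>, written as a sum of
  \<open>K\<close> maps of rank at most one.\<close>

definition nid :: "nat => nat => (vec => vec) => bool" where
 "nid n K \<pi> \<longleftrightarrow> lin n \<pi> & (\<exists>l e. (\<forall>j<K. additive n (l j) & e j : FF n) &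
   (\<forall>x\<in>FF n. \<pi> x = x + (\<Sum>j<K. sc (l j x) (e j))))"

lemma lin_comp: "lin n \<pi> ==> lin n \<rho> ==> lin n (%x. \<pi> (\<rho> x))"
 by (simp add: lin_def)

lemma linD: "lin n \<pi> ==> x : FF n ==> \<pi> x : FF n"
 by (simp add: lin_def)

lemma additive_lin: "additive n l ==> lin n \<pi> ==> additive n (%x. l (\<pi> x))"
 by (simp add: additive_def lin_def)

lemma nid_id: "nid n K (%x. x)"
proof -
 have "\<exists>l e. (\<forall>j<K. additive n (l j) & e j : FF n) &
   (\<forall>x\<in>FF n. x = x + (\<Sum>j<K. sc (l j x) (e j)))"
  by (rule exI[of _ "%_ _. 0"], rule exI[of _ "%_. 0"]) (simp add: additive_def FF_zero sc_def)
 then show ?thesis unfolding nid_def by (simp add: lin_def)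
qed

lemma sum_lessThan_split:
 fixes f :: "nat => 'a::comm_monoid_add"
 shows "(\<Sum>j<K + L. f j) = (\<Sum>j<L. f j) + (\<Sum>j<K. f (j + L))"
 by (induction K) (simp_all add: add.assoc)

lemma nid_mono:
 assumes "nid n K \<pi>" "K \<le> K'"
 shows "nid n K' \<pi>"
proof -
 obtain l e where le: "!!j. j < K ==> additive n (l j) & e j : FF n"
  "!!x. x : FF n ==> \<pi> x = x + (\<Sum>j<K. sc (l j x) (e j))" and \<pi>: "lin n \<pi>"
  using assms(1) unfolding nid_def by blast
 define l' where "l' j = (if j < K then l j else (%_. 0))" for j
 define e' where "e' j = (if j < K then e j else 0)" for j
 have "(\<Sum>j<K'. sc (l' j x) (e' j)) = (\<Sum>j<K. sc (l j x) (e j))" for x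
  by (rule sum.mono_neutral_cong_right) (use assms(2) in \<open>auto simp: l'_def e'_def sc_def\<close>)
 then have "\<forall>x\<in>FF n. \<pi> x = x + (\<Sum>j<K'. sc (l' j x) (e' j))" using le(2) by metis
 moreover have "\<forall>j<K'. additive n (l' j) & e' j : FF n"
  using le(1) by (simp add: l'_def e'_def additive_def FF_zero)
 ultimately show ?thesis unfolding nid_def using \<pi> by blast
qed

lemma nid_comp:
 assumes "nid n K \<pi>" "nid n L \<rho>"
 shows "nid n (K + L) (%x. \<pi> (\<rho> x))"
proof -
 obtain l e where le: "!!j. j < K ==> additive n (l j) & e j : FF n"
  "!!x. x : FF n ==> \<pi> x = x + (\<Sum>j<K. sc (l j x) (e j))" and \<pi>: "lin n \<pi>"
  using assms(1) unfolding nid_def by blast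
 obtain l1 e1 where le1: "!!j. j < L ==> additive n (l1 j) & e1 j : FF n"
  "!!x. x : FF n ==> \<rho> x = x + (\<Sum>j<L. sc (l1 j x) (e1 j))" and \<rho>: "lin n \<rho>"
  using assms(2) unfolding nid_def by blast
 define l' where "l' j = (if j < L then l1 j else (%x. l (j - L) (\<rho> x)))" for j
 define e' where "e' j = (if j < L then e1 j else e (j - L))" for j
 have "\<pi> (\<rho> x) = x + (\<Sum>j<K + L. sc (l' j x) (e' j))" if x: "x : FF n" for x
 proof -
  have "(\<Sum>j<K + L. sc (l' j x) (e' j)) = (\<Sum>j<L. sc (l' j x) (e' j)) + (\<Sum>j<K. sc (l' (j + L) x) (e' (j + L)))"
   by (rule sum_lessThan_split)
  also have "... = (\<Sum>j<L. sc (l1 j x) (e1 j)) + (\<Sum>j<K. sc (l j (\<rho> x)) (e j))"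
   by (simp add: l'_def e'_def)
  finally have s: "(\<Sum>j<K + L. sc (l' j x) (e' j)) = (\<Sum>j<L. sc (l1 j x) (e1 j)) + (\<Sum>j<K. sc (l j (\<rho> x)) (e j))" .
  have "\<pi> (\<rho> x) = \<rho> x + (\<Sum>j<K. sc (l j (\<rho> x)) (e j))" by (rule le(2)[OF linD[OF \<rho> x]])
  also have "... = (x + (\<Sum>j<L. sc (l1 j x) (e1 j))) + (\<Sum>j<K. sc (l j (\<rho> x)) (e j))"
   by (rule arg_cong[OF le1(2)[OF x]])
  finally show ?thesis unfolding s add.assoc .
 qed
 moreover have "additive n (l' j) & e' j : FF n" if "j < K + L" for j
  using that le(1)[of "j - L"] le1(1)[of j] additive_lin[OF _ \<rho>] by (auto simp: l'_def e'_def)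
 ultimately show ?thesis unfolding nid_def using lin_comp[OF \<pi> \<rho>] by blast
qed

text \<open>If \<open>l\<close> does not vanish on the image of \<open>\<pi>\<close>, choose
  \<open>e\<close> with l(\<pi> e) = 1. The map sending x to x + l(\<pi> x) e has its image in the
  kernel of l \<circ> \<pi>, and it is applied before \<open>\<pi>\<close>; the earlier functionals
  stay zero because they vanish on the whole image of \<open>\<pi>\<close>.\<close>

lemma kill_functionals:
 assumes "\<forall>l\<in>set ls. additive n l"
 shows "\<exists>\<pi>. nid n (length ls) \<pi> & (\<forall>l\<in>set ls. \<forall>x\<in>FF n. l (\<pi> x) = 0)"
 using assms
proof (induction ls)
 case Nil
 then show ?case using nid_id[of n 0] by auto
next
 case (Cons l ls)
 obtain \<pi> where \<pi>: "nid n (length ls) \<pi>" "!!k x. k : set ls ==> x : FF n ==> k (\<pi> x) = 0"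
  using Cons by auto
 have lin\<pi>: "lin n \<pi>" using \<pi>(1) by (simp add: nid_def)
 show ?case
 proof (cases "\<forall>x\<in>FF n. l (\<pi> x) = 0")
  case True
  then show ?thesis using nid_mono[OF \<pi>(1), of "Suc (length ls)"] \<pi>(2) by auto
 next
  case False
  then obtain e where e: "e : FF n" "l (\<pi> e) = 1" by (auto intro: bit_not_zero_iff[THEN iffD1])
  define k where "k x = l (\<pi> x)" for x
  have ak: "additive n k" unfolding k_def using additive_lin[OF _ lin\<pi>] Cons.prems by simp
  define \<rho> where "\<rho> x = x + sc (k x) e" for x
  have lin\<rho>: "lin n \<rho>"
   unfolding lin_def
  proof (intro conjI ballI)
   fix a b assume ab: "a : FF n" "b : FF n"
   show "\<rho> a : FF n" unfolding \<rho>_def by (intro FF_add ab sc_FF e)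
   have kk: "k (a + b) = k a + k b" using ak ab by (simp add: additive_def)
   show "\<rho> (a + b) = \<rho> a + \<rho> b"
    unfolding \<rho>_def kk sc_add by (simp only: ac_simps)
  qed
  have "nid n 1 \<rho>"
   unfolding nid_def
  proof (intro conjI lin\<rho> exI[of _ "%_. k"] exI[of _ "%_. e"])
   show "\<forall>j<1. additive n k & e : FF n" using ak e by simp
   show "\<forall>x\<in>FF n. \<rho> x = x + (\<Sum>j<(1::nat). sc (k x) e)"
    by (simp add: \<rho>_def)
  qed
  then have "nid n (length ls + 1) (%x. \<pi> (\<rho> x))" by (rule nid_comp[OF \<pi>(1)])
  moreover have "k' (\<pi> (\<rho> x)) = 0" if k': "k' : set (l # ls)" and x: "x : FF n" for k' x
  proof (cases "k' : set ls")
   case True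
   then show ?thesis using \<pi>(2) linD[OF lin\<rho> x] by blast
  next
   case False
   then have "k' = l" using k' by simp
   have "k (\<rho> x) = k x + k (sc (k x) e)"
    unfolding \<rho>_def using ak x sc_FF[OF e(1)] by (simp only: additive_def)
   also have "... = 0"
   proof (cases "k x")
    case zero
    have "k 0 + k 0 = k 0" using ak FF_zero[of n] unfolding additive_def by (metis add.right_neutral)
    then have "k 0 = 0" by (simp add: bit_add_self)
    then show ?thesis by (simp add: zero sc_def)
   next
    case one
    then show ?thesis using e(2) by (simp add: sc_def k_def bit_add_self)
   qed
   finally show ?thesis using \<open>k' = l\<close> by (simp add: k_def)
  qed
  ultimately show ?thesis by (intro exI[of _ "%x. \<pi> (\<rho> x)"]) simp
 qed
qed

lemma pd_half_additive:
 assumes "additive n l"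
 shows "pd n 2 (%x. half (l x))"
proof -
 have "pd n (Suc 1) (%x. half (l x))"
 proof (rule pd_from_D)
  fix a assume a: "a : FF n"
  have "pd n (Suc 0) (%x. half (l (x + a)) - half (l x))"
  proof (rule pd_cong[OF _ pd_const[of n 0 "half (l a)"]])
   fix x assume x: "x : FF n"
   have "l (x + a) = l x + l a" using assms x a by (simp add: additive_def)
   then have "half (l (x + a)) = half (l x) + half (l a)" by (simp only: half_add)
   then show "half (l a) = half (l (x + a)) - half (l x)" by simp
  qed
  then show "pd n 1 (%x. half (l (x + a)) - half (l x))" by simp
 qed
 then show ?thesis by (simp add: numeral_2_eq_2)
qed

text \<open>The vector x differs from \<pi> x by one of \<open>2 ^ k\<close> fixed vectors, selected
  by \<open>k\<close> linear functionals. So P(x) is P(\<pi> x) plus a difference of P in that fixed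
  direction, which has degree below d. The functionals have degree below d because d \<ge>
  2.\<close>

lemma frank_nid:
 assumes P: "pd n (Suc d) P" and d: "d \<ge> 2" and \<pi>: "nid n k \<pi>" and fr: "frank n d K (%x. P (\<pi> x))"
 shows "frank n d (K + k + 2 ^ k) P"
proof -
 obtain l e where le: "!!j. j < k ==> additive n (l j) & e j : FF n"
  "!!x. x : FF n ==> \<pi> x = x + (\<Sum>j<k. sc (l j x) (e j))" and lin: "lin n \<pi>"
  using \<pi> unfolding nid_def by blast
 obtain Qs where Qs: "length Qs \<le> K" "!!R. R : set Qs ==> pd n d R"
  "!!x y. x : FF n ==> y : FF n ==> (\<forall>R\<in>set Qs. R x = R y) ==> P (\<pi> x) = P (\<pi> y)"
  using fr unfolding frank_def by blast
 obtain Is where Is: "set Is = Pow {..<k}" "distinct Is" using finite_distinct_list[of "Pow {..<k}"] by auto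
 have lenIs: "length Is = 2 ^ k" using distinct_card[OF Is(2)] by (simp add: Is(1) card_Pow)
 define A where "A = map (%j x. half (l j x)) [0..<k]"
 define B where "B = map (%I x. P (\<pi> x + sum e I) - P (\<pi> x)) Is"
 define I where "I x = {j. j < k & l j x = 1}" for x
 have eF: "sum e J : FF n" if "J \<subseteq> {..<k}" for J using that le(1) by (intro FF_sum) auto
 have Psplit: "P x = P (\<pi> x) + (P (\<pi> x + sum e (I x)) - P (\<pi> x))" if x: "x : FF n" for x
 proof -
  have "(\<Sum>j<k. sc (l j x) (e j)) = sum e (I x)"
   by (rule sum.mono_neutral_cong_right) (auto simp: I_def sc_def)
  then have "\<pi> x + sum e (I x) = x + sum e (I x) + sum e (I x)" using le(2)[OF x] by (simp only:)
  also have "... = x" by (rule vec_cancel)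
  finally show ?thesis by simp
 qed
 show ?thesis
 proof (rule frankI[of "Qs @ A @ B"])
  show "length (Qs @ A @ B) \<le> K + k + 2 ^ k" using Qs(1) lenIs by (simp add: A_def B_def)
  show "pd n d R" if R: "R : set (Qs @ A @ B)" for R
  proof -
   consider "R : set Qs" | "R : set A" | "R : set B" using R by auto
   then show ?thesis
   proof cases
    case 2
    then obtain j where "j < k" "R = (%x. half (l j x))" by (auto simp: A_def)
    then show ?thesis using pd_mono[OF pd_half_additive d] le(1) by simp
   next
    case 3
    then obtain J where J: "J \<subseteq> {..<k}" "R = (%x. P (\<pi> x + sum e J) - P (\<pi> x))"
     using Is(1) by (auto simp: B_def)
    have "pd n d (%x. P (x + sum e J) - P x)" by (rule pd_D[OF P eF[OF J(1)]])
    from pd_lin[OF this lin] show ?thesis unfolding J(2) .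
   qed (rule Qs(2))
  qed
  fix x y assume xy: "x : FF n" "y : FF n" and eq: "!!R. R : set (Qs @ A @ B) ==> R x = R y"
  have 1: "P (\<pi> x) = P (\<pi> y)" by (rule Qs(3)[OF xy]) (use eq in simp)
  have "l j x = l j y" if "j < k" for j
  proof -
   have "(%x. half (l j x)) : set A" using that by (auto simp: A_def)
   then have "half (l j x) = half (l j y)" using eq[of "%x. half (l j x)"] by simp
   then show ?thesis by (rule half_inj)
  qed
  then have I: "I x = I y" by (auto simp: I_def)
  have "I x : set Is" using Is(1) by (auto simp: I_def)
  then have "(%z. P (\<pi> z + sum e (I x)) - P (\<pi> z)) : set B" by (auto simp: B_def)
  then have "P (\<pi> x + sum e (I x)) - P (\<pi> x) = P (\<pi> y + sum e (I x)) - P (\<pi> y)"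
   using eq[of "%z. P (\<pi> z + sum e (I x)) - P (\<pi> z)"] by simp
  then show "P x = P y" using Psplit[OF xy(1)] Psplit[OF xy(2)] 1 I by argo
 qed
qed

section \<open>Forms determined by functions that miss a variable\<close>

text \<open>The joint values of \<open>G\<close> split the tuples into at most \<open>B ^ N\<close>
  cells on which the sign of \<open>S\<close> is constant, so for some cell the correlation of this
  sign with the indicator of the cell is at least \<open>1 / B ^ N\<close>. The indicator is a
  product of functions each of which misses a variable; these are eliminated by Cauchy-Schwarz, and
  the bias of \<open>S\<close> is left.\<close>

lemma box:
 fixes G :: "((nat => vec) => circle) set"
 assumes S: "form alt n k S" and k: "k \<ge> 1" and G: "finite G" "card G \<le> N" and B: "B \<ge> 1"
  and miss: "!!g. g : G ==> \<exists>i<k. inv_dir (FF n) (VI {..<k} n) (sing i) g"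
  and val: "!!g. g : G ==> finite (g ` VI {..<k} n) & card (g ` VI {..<k} n) \<le> B"
  and det: "!!h h'. h : VI {..<k} n ==> h' : VI {..<k} n ==> (!!g. g : G ==> g h = g h') ==>
   S (hm h {..<k}) = S (hm h' {..<k})"
 shows "bias n k S \<ge> (1 / B ^ N) ^ (2 ^ k)"
proof -
 let ?W = "VI {..<k} n"
 have W: "fin_grp ?W" by (rule fin_grp_VI) simp
 note finW = fin_grp_finite[OF W] and cW = fin_grp_card[OF W]
 define pt where "pt h = restrict (%g. g h) G" for h
 have ptsub: "pt ` ?W \<subseteq> PiE G (%g. g ` ?W)" by (auto simp: pt_def)
 have finpt: "finite (pt ` ?W)" using finW by simp
 have "card (pt ` ?W) \<le> card (PiE G (%g. g ` ?W))"
  by (rule card_mono[OF _ ptsub]) (use G val in \<open>auto intro: finite_PiE\<close>)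
 also have "... = (\<Prod>g\<in>G. card (g ` ?W))" by (rule card_PiE[OF G(1)])
 also have "... \<le> (\<Prod>g\<in>G. B)" by (rule prod_mono) (use val in auto)
 also have "... = B ^ card G" by simp
 also have "... \<le> B ^ N" using B G(2) by (rule power_increasing[rotated])
 finally have cpt: "card (pt ` ?W) \<le> B ^ N" .
 define c where "c p = \<chi> (S (hm (SOME h. h : ?W & pt h = p) {..<k}))" for p
 have cS: "\<chi> (S (hm h {..<k})) = c (pt h)" if h: "h : ?W" for h
 proof -
  define h' where "h' = (SOME h'. h' : ?W & pt h' = pt h)"
  have h': "h' : ?W & pt h' = pt h" unfolding h'_def by (rule someI[of _ h]) (use h in simp)
  have "S (hm h {..<k}) = S (hm h' {..<k})"
  proof (rule det[OF h])
   show "h' : ?W" using h' by blast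
   show "g h = g h'" if "g : G" for g
    using fun_cong[OF conjunct2[OF h'], of g] that by (simp add: pt_def)
  qed
  then show ?thesis by (simp add: c_def h'_def)
 qed
 have cc: "\<chi> b * \<chi> b = 1" for b by (simp add: \<chi>_def)
 \<comment> \<open>The square of the sign is 1. One of its two factors is replaced by its constant
   value \<open>c p\<close> on the cell.\<close>
 have "(1::complex) = avg ?W (%h. \<chi> (S (hm h {..<k})) * \<chi> (S (hm h {..<k})))"
  using cW by (simp add: cc avg_const)
 also have "... = avg ?W (%h. \<Sum>p\<in>pt ` ?W. c p * (\<chi> (S (hm h {..<k})) * of_bool (pt h = p)))"
 proof (rule avg_cong)
  fix h assume h: "h : ?W"
  have "(\<Sum>p\<in>pt ` ?W. c p * (\<chi> (S (hm h {..<k})) * of_bool (pt h = p)))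
    = (\<Sum>p\<in>pt ` ?W. if p = pt h then c p * \<chi> (S (hm h {..<k})) else 0)"
   by (rule sum.cong) auto
  also have "... = c (pt h) * \<chi> (S (hm h {..<k}))" using finpt h by (simp add: sum.delta)
  finally show "\<chi> (S (hm h {..<k})) * \<chi> (S (hm h {..<k}))
    = (\<Sum>p\<in>pt ` ?W. c p * (\<chi> (S (hm h {..<k})) * of_bool (pt h = p)))"
   using cS[OF h] by simp
 qed
 also have "... = (\<Sum>p\<in>pt ` ?W. c p * avg ?W (%h. \<chi> (S (hm h {..<k})) * of_bool (pt h = p)))"
  by (simp only: avg_sum avg_cmult_left)
 finally have one: "1 = cmod (\<Sum>p\<in>pt ` ?W. c p * avg ?W (%h. \<chi> (S (hm h {..<k})) * of_bool (pt h = p)))"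
  by (metis norm_one)
 define a where "a p = cmod (avg ?W (%h. \<chi> (S (hm h {..<k})) * of_bool (pt h = p)))" for p
 have "1 \<le> (\<Sum>p\<in>pt ` ?W. a p)"
 proof -
  have "cmod (c p) = 1" for p by (simp add: c_def \<chi>_def)
  then have "cmod (c p * avg ?W (%h. \<chi> (S (hm h {..<k})) * of_bool (pt h = p))) = a p" for p
   by (simp add: norm_mult a_def)
  then show ?thesis using one norm_sum[of "%p. c p * avg ?W (%h. \<chi> (S (hm h {..<k})) * of_bool (pt h = p))" "pt ` ?W"]
   by simp
 qed
 have "\<exists>p\<in>pt ` ?W. a p \<ge> 1 / B ^ N"
 proof (rule ccontr)
  assume "\<not> ?thesis"
  then have lt: "!!p. p : pt ` ?W ==> a p < 1 / B ^ N" by (meson not_le)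
  have "pt ` ?W ~= {}" using cW by (auto simp: card_gt_0_iff)
  then have "(\<Sum>p\<in>pt ` ?W. a p) < (\<Sum>p\<in>pt ` ?W. 1 / real (B ^ N))"
   using lt finpt by (intro sum_strict_mono) auto
  also have "... = real (card (pt ` ?W)) * (1 / real (B ^ N))" by simp
  also have "... \<le> real (B ^ N) * (1 / real (B ^ N))"
   using cpt by (intro mult_right_mono) (simp_all only: of_nat_le_iff, simp)
  also have "... \<le> 1" by simp
  finally show False using \<open>1 \<le> (\<Sum>p\<in>pt ` ?W. a p)\<close> by simp
 qed
 then obtain p where p: "p : pt ` ?W" "a p \<ge> 1 / B ^ N" by blast
 have "\<forall>g\<in>G. \<exists>i. i < k & inv_dir (FF n) ?W (sing i) g" using miss by blast
 then obtain ms where ms: "!!g. g : G ==> ms g < k" "!!g. g : G ==> inv_dir (FF n) ?W (sing (ms g)) g"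
  using bchoice by metis
 \<comment> \<open>The conditions that define the cell are grouped by a variable that they
   miss.\<close>
 define H where "H i h = (of_bool (\<forall>g\<in>G. ms g = i --> g h = p g) :: complex)" for i h
 have Hp: "(\<Prod>i\<in>{..<k}. H i h) = of_bool (pt h = p)" for h
 proof -
  have "pt h = p \<longleftrightarrow> (\<forall>g\<in>G. g h = p g)"
  proof
   assume "\<forall>g\<in>G. g h = p g"
   moreover have "p : extensional G" using p(1) by (auto simp: pt_def)
   ultimately show "pt h = p" unfolding pt_def by (auto simp: restrict_def extensional_def fun_eq_iff)
  qed (auto simp: pt_def)
  moreover have "(\<Prod>i\<in>{..<k}. H i h) = of_bool (\<forall>g\<in>G. g h = p g)"
  proof (cases "\<forall>g\<in>G. g h = p g")
   case True
   then show ?thesis by (simp add: H_def)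
  next
   case False
   then obtain g where "g : G" "g h ~= p g" by blast
   then have "H (ms g) h = 0" "ms g : {..<k}" using ms(1) by (auto simp: H_def)
   then have "(\<Prod>i\<in>{..<k}. H i h) = 0" by (intro prod_zero) auto
   moreover have "of_bool (\<forall>g\<in>G. g h = p g) = (0::complex)" by (simp only: False of_bool_eq)
   ultimately show ?thesis by (simp only:)
  qed
  ultimately show ?thesis by simp
 qed
 obtain m where m: "k = Suc m" using k by (cases k) auto
 define L where "L = map (%i. (sing i :: vec => nat => vec, H i)) [0..<k]"
 have fstL: "map fst L = map sing [0..<k]" by (simp add: L_def)
 have prodL: "prod_list (map (%(i, H). H h) L) = of_bool (pt h = p)" for h
 proof -
  have "prod_list (map (%(i, H). H h) L) = prod_list (map (%i. H i h) [0..<k])"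
   by (simp add: L_def comp_def)
  also have "... = (\<Prod>i\<in>{..<k}. H i h)" by (simp add: prod.distinct_set_conv_list[symmetric] atLeast0LessThan)
  finally show ?thesis using Hp by simp
 qed
 have D: "Ds (map fst L) as (%h. S (hm h {..<k})) w = S (mset as)"
  if as: "length as = Suc m" "set as \<subseteq> FF n" and w: "w : ?W" for as w
 proof -
  have "Ds (map sing [0..<k]) as (%h. S (hm h {..<k} + {#})) w = S (hm w ({..<k} - set [0..<k]) + mset as + {#})"
  proof (rule Ds_form[OF W S, where z = "%w. w"])
   show "\<forall>j\<in>set [0..<k]. dirhom (FF n) ?W (sing j)" by (auto intro: dirhom_sing)
   show "\<forall>w\<in>?W. \<forall>i\<in>{..<k}. w i : FF n" by (auto intro: VI_D)
   show "\<forall>w\<in>?W. \<forall>i\<in>{..<k}. \<forall>j\<in>set [0..<k]. \<forall>a\<in>FF n. (w + sing j a) i = w i + (if i = j then a else 0)"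
    by (intro ballI) (simp only: plus_fun_apply sing_def)
  qed (use as w m in auto)
  then show ?thesis by (simp add: fstL atLeast0LessThan)
 qed
 have "cmod (avg ?W (%h. \<chi> (S (hm h {..<k})) * prod_list (map (%(i, H). H h) L))) ^ (2 ^ Suc m)
   \<le> Re (EE (FF n) (Suc m) (%as. \<chi> (S (mset as))))"
 proof (rule phase_bound[OF W fin_grp_FF phase_\<chi> _ _ D])
  show "length L = Suc m" by (simp add: L_def m)
  show "\<forall>(i, H)\<in>set L. dirhom (FF n) ?W i & (\<forall>w\<in>?W. cmod (H w) \<le> 1) & inv_dir (FF n) ?W i H"
  proof
   fix iH assume "iH : set L"
   then obtain i where i: "i < k" "iH = (sing i, H i)" by (auto simp: L_def)
   have "inv_dir (FF n) ?W (sing i) (H i)"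
    unfolding inv_dir_def
   proof (intro ballI)
    fix w a assume wa: "w : ?W" "a : FF n"
    have inv: "g (w + sing i a) = g w" if "g : G" "ms g = i" for g
     using ms(2)[OF that(1)] that(2) wa by (simp add: inv_dir_def)
    have "(\<forall>g\<in>G. ms g = i --> g (w + sing i a) = p g) \<longleftrightarrow> (\<forall>g\<in>G. ms g = i --> g w = p g)"
     by (intro ball_cong refl imp_cong) (simp only: inv)
    then show "H i (w + sing i a) = H i w" unfolding H_def by (simp only:)
   qed
   moreover have "dirhom (FF n) ?W (sing i)" using i by (auto intro: dirhom_sing)
   ultimately show "case iH of (i, H) => dirhom (FF n) ?W i & (\<forall>w\<in>?W. cmod (H w) \<le> 1) & inv_dir (FF n) ?W i H"
    unfolding i(2) by (simp add: H_def)
  qed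
 qed
 then have "a p ^ (2 ^ k) \<le> bias n k S" unfolding prodL by (simp add: a_def bias_def m)
 moreover have "(1 / real B ^ N) ^ (2 ^ k) \<le> a p ^ (2 ^ k)"
  using p(2) by (intro power_mono) auto
 ultimately show ?thesis by simp
qed

section \<open>Integrating an alternating form of bounded strength\<close>

text \<open>Double counting: every point of the union is covered at least once, and equality of the
  totals leaves no room for a second time.\<close>

lemma cover_count:
 assumes X: "finite X" "!!x. x : X ==> finite (snd x)"
  and eq: "(\<Sum>x\<in>X. card (snd x)) = card (\<Union>(snd ` X))" and i: "i : \<Union>(snd ` X)"
 shows "\<exists>!x. x : X & i : snd x"
proof -
 let ?U = "\<Union>(snd ` X)"
 have finU: "finite ?U" using X by auto
 have ge: "1 \<le> card {x\<in>X. j : snd x}" if j: "j : ?U" for j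
 proof -
  obtain x where "x : {x\<in>X. j : snd x}" using j by blast
  then have "{x\<in>X. j : snd x} ~= {}" by blast
  then have "card {x\<in>X. j : snd x} ~= 0" using X(1) by simp
  then show ?thesis by simp
 qed
 have "(\<Sum>x\<in>X. card (snd x)) = (\<Sum>x\<in>X. \<Sum>j\<in>?U. of_bool (j : snd x))"
 proof (rule sum.cong[OF refl])
  fix x assume x: "x : X"
  then have "?U \<inter> snd x = snd x" by auto
  then show "card (snd x) = (\<Sum>j\<in>?U. of_bool (j : snd x))"
   using finU by (simp add: of_bool_def sum.If_cases Int_def)
 qed
 also have "... = (\<Sum>j\<in>?U. \<Sum>x\<in>X. of_bool (j : snd x))" by (rule sum.swap)
 also have "... = (\<Sum>j\<in>?U. card {x\<in>X. j : snd x})"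
  using X(1) by (intro sum.cong[OF refl]) (simp add: of_bool_def sum.If_cases Int_def)
 finally have s: "(\<Sum>j\<in>?U. card {x\<in>X. j : snd x}) = card ?U" using eq by simp
 have "card {x\<in>X. i : snd x} = 1"
 proof (rule ccontr)
  assume "card {x\<in>X. i : snd x} ~= 1"
  then have "1 < card {x\<in>X. i : snd x}" using ge[OF i] by linarith
  then have "(\<Sum>j\<in>?U. 1) < (\<Sum>j\<in>?U. card {x\<in>X. j : snd x})"
   using ge i by (intro sum_strict_mono_ex1[OF finU]) auto
  then show False using s by simp
 qed
 then obtain x where "{x\<in>X. i : snd x} = {x}" by (auto simp: card_1_singleton_iff)
 then have "z : {x\<in>X. i : snd x} \<longleftrightarrow> z = x" for z by simp
 then have "z : X & i : snd z \<longleftrightarrow> z = x" for z by (simp only: mem_Collect_eq)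
 then show ?thesis by simp
qed

lemma btype_sum:
 fixes s :: "nat => nat"
 assumes "finite X" "finite Y" "btype X = btype Y"
 shows "(\<Sum>x\<in>X. s (fst x)) = (\<Sum>x\<in>Y. s (fst x))"
proof -
 have g: "(\<Sum>x\<in>Z. s (fst x)) = (\<Sum>q\<in>{q. btype Z q ~= 0}. btype Z q * s q)" if "finite Z" for Z :: "(nat \<times> nat set) set"
 proof -
  have "(\<Sum>x\<in>Z. s (fst x)) = (\<Sum>q\<in>fst ` Z. \<Sum>x\<in>{x\<in>Z. fst x = q}. s (fst x))"
   by (rule sum.image_gen[OF that])
  also have "... = (\<Sum>q\<in>fst ` Z. btype Z q * s q)"
   by (rule sum.cong[OF refl]) (simp add: btype_def)
  also have "fst ` Z = {q. btype Z q ~= 0}"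
  proof -
   have "btype Z q = 0 \<longleftrightarrow> {x\<in>Z. fst x = q} = {}" for q
    unfolding btype_def by (rule card_0_eq) (use that in simp)
   then have "q : fst ` Z \<longleftrightarrow> btype Z q ~= 0" for q by (auto intro: rev_image_eqI)
   then show "fst ` Z = {q. btype Z q ~= 0}" by blast
  qed
  finally show ?thesis .
 qed
 show ?thesis unfolding g[OF assms(1)] g[OF assms(2)] assms(3) ..
qed

lemma PT_sub: "X : PT U F ==> X \<subseteq> Om2 U F"
 by (simp add: PT_def)

lemma PT_ex1: "X : PT U F ==> i : U ==> \<exists>!x. x : X & i : snd x"
 by (simp add: PT_def)

lemma PT_cover: "X : PT U F ==> \<Union>(snd ` X) = U"
proof
 assume X: "X : PT U F"
 show "\<Union>(snd ` X) \<subseteq> U" using Om2_D(2) PT_sub[OF X] by blast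
 show "U \<subseteq> \<Union>(snd ` X)"
 proof
  fix i assume "i : U"
  then obtain x where "x : X" "i : snd x" using ex1_implies_ex[OF PT_ex1[OF X]] by blast
  then show "i : \<Union>(snd ` X)" by (rule UN_I)
 qed
qed

lemma PT_disjoint:
 assumes "X : PT U F" "x : X" "y : X" "x ~= y"
 shows "snd x \<inter> snd y = {}"
proof (rule ccontr)
 assume "snd x \<inter> snd y ~= {}"
 then obtain i where i: "i : snd x" "i : snd y" by blast
 have "i : U" using Om2_D(2) PT_sub[OF assms(1)] assms(2) i(1) by blast
 from ex1E[OF PT_ex1[OF assms(1) this]] show False using assms(2-4) i by metis
qed

lemma PT_finite: "finite U ==> X : PT U F ==> finite X"
 by (rule finite_subset[OF PT_sub Om2_finite])

lemma PT_sum: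
 assumes "finite U" "X : PT U F"
 shows "(\<Sum>x\<in>X. card (snd x)) = card U"
proof -
 have "card (\<Union>x\<in>X. snd x) = (\<Sum>x\<in>X. card (snd x))"
 proof (rule card_UN_disjoint[OF PT_finite[OF assms]])
  show "\<forall>x\<in>X. finite (snd x)"
  proof
   fix x assume "x : X"
   then have "snd x \<subseteq> U" by (rule Om2_D(2)[OF subsetD[OF PT_sub[OF assms(2)]]])
   then show "finite (snd x)" using assms(1) by (rule finite_subset)
  qed
  show "\<forall>x\<in>X. \<forall>y\<in>X. x ~= y --> snd x \<inter> snd y = {}" using PT_disjoint[OF assms(2)] by simp
 qed
 then show ?thesis using PT_cover[OF assms(2)] by simp
qed

section \<open>Relabelling of block partitions along bijections\<close>

lemma mp_Om2:
 assumes "bij_betw \<sigma> I U" "x : Om2 I F"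
 shows "mp \<sigma> x : Om2 U F"
proof -
 have "card (\<sigma> ` snd x) = card (snd x)"
  using assms Om2_D(2)[OF assms(2)] by (intro card_image) (auto simp: bij_betw_def intro: inj_on_subset)
 moreover have "\<sigma> ` snd x \<subseteq> U" using assms(1) Om2_D(2)[OF assms(2)] unfolding bij_betw_def by blast
 ultimately show ?thesis using assms(2) by (auto simp: Om2_def mp_def)
qed

lemma mp_inj:
 assumes "bij_betw \<sigma> I U"
 shows "inj_on (mp \<sigma>) (Om2 I F)"
proof (rule inj_onI)
 fix x y assume xy: "x : Om2 I F" "y : Om2 I F" "mp \<sigma> x = mp \<sigma> y"
 then have e: "\<sigma> ` snd x = \<sigma> ` snd y" "fst x = fst y" by (auto simp: mp_def)
 have "inj_on \<sigma> I" using assms by (simp add: bij_betw_def)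
 then have "snd x = snd y"
  using inj_on_image_eq_iff[of \<sigma> I "snd x" "snd y"] Om2_D(2)[OF xy(1)] Om2_D(2)[OF xy(2)] e(1) by blast
 then show "x = y" using e(2) by (simp add: prod_eq_iff)
qed

lemma mp_btype:
 assumes "bij_betw \<sigma> I U" "X \<subseteq> Om2 I F"
 shows "btype (mp \<sigma> ` X) = btype X"
proof
 fix q
 have "{y\<in>mp \<sigma> ` X. fst y = q} = mp \<sigma> ` {x\<in>X. fst x = q}" by (auto simp: mp_def)
 moreover have "inj_on (mp \<sigma>) {x\<in>X. fst x = q}"
  by (rule inj_on_subset[OF mp_inj[OF assms(1), of F]]) (use assms(2) in auto)
 ultimately show "btype (mp \<sigma> ` X) q = btype X q" by (simp add: btype_def card_image)
qed

lemma mp_PT: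
 assumes \<sigma>: "bij_betw \<sigma> I U" and X: "X : PT I F"
 shows "mp \<sigma> ` X : PT U F"
proof -
 have XO: "X \<subseteq> Om2 I F" using X by (simp add: PT_def)
 have "\<exists>!y. y : mp \<sigma> ` X & u : snd y" if u: "u : U" for u
 proof -
  obtain i where i: "i : I" "u = \<sigma> i" using \<sigma> u by (auto simp: bij_betw_def)
  have iff: "u : snd (mp \<sigma> x) \<longleftrightarrow> i : snd x" if "x : X" for x
  proof -
   have "snd x \<subseteq> I" using that XO Om2_D(2) by blast
   then show ?thesis using \<sigma> i inj_on_image_mem_iff[of \<sigma> I i "snd x"] by (simp add: mp_def bij_betw_def)
  qed
  from PT_ex1[OF X i(1)] show ?thesis
  proof (rule ex1E)
   fix x assume x: "x : X & i : snd x" "\<forall>y. y : X & i : snd y --> y = x"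
   show ?thesis
   proof (rule ex1I[of _ "mp \<sigma> x"])
    show "mp \<sigma> x : mp \<sigma> ` X & u : snd (mp \<sigma> x)" using x(1) iff by simp
    fix y assume y: "y : mp \<sigma> ` X & u : snd y"
    then obtain z where z: "z : X" "y = mp \<sigma> z" by (auto simp only: image_iff)
    then have "i : snd z" using y iff by simp
    from z(1) this have "z : X & i : snd z" by (rule conjI)
    then have "z = x" by (rule mp[OF spec[OF x(2)]])
    then show "y = mp \<sigma> x" using z(2) by simp
   qed
  qed
 qed
 moreover have "mp \<sigma> ` X \<subseteq> Om2 U F" using XO mp_Om2[OF \<sigma>] by blast
 ultimately show ?thesis by (simp add: PT_def del: image_iff)
qed

lemma ev_mp:
 assumes "bij_betw \<sigma> I U" "x : Om2 I F"
 shows "ev F k (mp \<sigma> x) = ev F (k \<circ> \<sigma>) x"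
proof -
 have "bij_betw \<sigma> (snd x) (\<sigma> ` snd x)"
  using assms(1) Om2_D(2)[OF assms(2)] by (auto simp: bij_betw_def intro: inj_on_subset)
 from hm_bij[OF this, of k] show ?thesis by (simp add: ev_def mp_def)
qed

lemma bit_sum_count:
 fixes f :: "'a => bit"
 assumes "finite A"
 shows "sum f A = of_nat (card {x\<in>A. f x = 1})"
proof -
 have "sum f A = (\<Sum>x\<in>A. if f x = 1 then 1 else 0)"
  by (rule sum.cong[OF refl]) (metis bit_not_one_iff)
 also have "... = (\<Sum>x\<in>{x\<in>A. f x = 1}. 1)" using assms by (simp only: sum.inter_filter)
 finally show ?thesis by simp
qed

text \<open>Rewrites the structure result on an arbitrary set \<open>U\<close> of size
  \<open>d\<close> as the parity of a number of block partitions. In this shape it can be compared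
  with the coefficient of the monomial of \<open>U\<close>.\<close>

lemma structure_transport:
 assumes supp: "!!X. f X ~= (0::bit) ==> X : PT {..<d} F"
  and typed: "!!X Y. X : PT {..<d} F ==> Y : PT {..<d} F ==> btype X = btype Y ==> f X = f Y"
  and rep: "!!h. h ` {..<d} \<subseteq> FF n ==> T (hm h {..<d}) = (\<Sum>X\<in>Pow (Zp F {..<d} h). f X)"
  and U: "finite U" "card U = d" "k ` U \<subseteq> FF n"
 shows "T (hm k U) = of_nat (card {X\<in>PT U F. X \<subseteq> Zp F U k & (\<exists>Y\<in>PT {..<d} F. f Y = 1 & btype Y = btype X)})"
proof -
 let ?I = "{..<d}"
 obtain \<sigma> where \<sigma>: "bij_betw \<sigma> ?I U"
  using ex_bij_betw_nat_finite[OF U(1)] U(2) by (auto simp: atLeast0LessThan)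
 define \<tau> where "\<tau> = the_inv_into ?I \<sigma>"
 have \<tau>: "bij_betw \<tau> U ?I" unfolding \<tau>_def by (rule bij_betw_the_inv_into[OF \<sigma>])
 define A where "A = {X\<in>Pow (Zp F ?I (k \<circ> \<sigma>)). f X = 1}"
 define B where "B = {X\<in>PT U F. X \<subseteq> Zp F U k & (\<exists>Y\<in>PT ?I F. f Y = 1 & btype Y = btype X)}"
 have kI: "(k \<circ> \<sigma>) ` ?I \<subseteq> FF n" using \<sigma> U(3) by (auto simp: bij_betw_def)
 have Om: "Zp F ?I h \<subseteq> Om2 ?I F" for h by (auto simp: Zp_def)
 have fin: "finite (Pow (Zp F ?I (k \<circ> \<sigma>)))"
  using Om2_finite[of ?I F] finite_subset[OF Om] by simp
 have "bij_betw (image (mp \<sigma>)) A B"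
 proof (rule bij_betwI')
  fix X Y assume XY: "X : A" "Y : A"
  then have "X \<subseteq> Om2 ?I F" "Y \<subseteq> Om2 ?I F" using Om by (auto simp: A_def)
  then show "mp \<sigma> ` X = mp \<sigma> ` Y \<longleftrightarrow> X = Y"
   using inj_on_image_eq_iff[OF mp_inj[OF \<sigma>, of F]] by blast
 next
  fix X assume X: "X : A"
  then have XP: "X : PT ?I F" "f X = 1" and XZ: "X \<subseteq> Zp F ?I (k \<circ> \<sigma>)" using supp[of X] by (auto simp: A_def)
  have XO: "X \<subseteq> Om2 ?I F" using XZ Om by blast
  have "mp \<sigma> ` X \<subseteq> Zp F U k"
  proof
   fix y assume "y : mp \<sigma> ` X"
   then obtain x where x: "x : X" "y = mp \<sigma> x" by blast
   then have "ev F k y = 1" using ev_mp[OF \<sigma>, of x F k] XO XZ by (auto simp: Zp_def)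
   then show "y : Zp F U k" using mp_Om2[OF \<sigma>, of x F] x XO by (auto simp: Zp_def)
  qed
  then show "mp \<sigma> ` X : B"
   unfolding B_def using mp_PT[OF \<sigma> XP(1)] mp_btype[OF \<sigma> XO] XP by auto
 next
  fix Y assume Y: "Y : B"
  then have YP: "Y : PT U F" and YZ: "Y \<subseteq> Zp F U k" by (auto simp: B_def)
  have YO: "Y \<subseteq> Om2 U F" using YP by (simp add: PT_def)
  define X where "X = mp \<tau> ` Y"
  have inv: "mp \<sigma> (mp \<tau> y) = y" if "y : Y" for y
  proof -
   have "snd y \<subseteq> U" using that YO Om2_D(2) by blast
   then have "\<sigma> ` \<tau> ` snd y = snd y"
    using f_the_inv_into_f[of \<sigma> ?I] \<sigma> by (force simp: \<tau>_def bij_betw_def image_image)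
   then show ?thesis by (simp add: mp_def)
  qed
  have XY: "mp \<sigma> ` X = Y" unfolding X_def image_image using inv by simp
  have XP: "X : PT ?I F" unfolding X_def by (rule mp_PT[OF \<tau> YP])
  have XO: "X \<subseteq> Om2 ?I F" using XP by (simp add: PT_def)
  obtain Y0 where Y0: "Y0 : PT ?I F" "f Y0 = 1" "btype Y0 = btype Y" using Y by (auto simp: B_def)
  have "btype X = btype Y0" using mp_btype[OF \<sigma> XO] XY Y0(3) by simp
  then have "f X = 1" using typed[OF XP Y0(1)] Y0(2) by simp
  moreover have "X \<subseteq> Zp F ?I (k \<circ> \<sigma>)"
  proof
   fix x assume x: "x : X"
   then have "mp \<sigma> x : Zp F U k" using XY YZ by blast
   then have "ev F (k \<circ> \<sigma>) x = 1" using ev_mp[OF \<sigma>, of x F k] x XO by (auto simp: Zp_def)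
   then show "x : Zp F ?I (k \<circ> \<sigma>)" using x XO by (auto simp: Zp_def)
  qed
  ultimately show "\<exists>X\<in>A. Y = mp \<sigma> ` X" using XY by (auto simp: A_def)
 qed
 then have "card A = card B" by (rule bij_betw_same_card)
 moreover have "T (hm k U) = of_nat (card A)"
  unfolding hm_bij[OF \<sigma>] rep[OF kI] A_def by (rule bit_sum_count[OF fin])
 ultimately show ?thesis by (simp add: B_def)
qed

text \<open>Blocks with different labels are chosen independently, which gives one binomial
  coefficient per label.\<close>

lemma card_btype:
 assumes "finite A" "fst ` A \<subseteq> {..<l}"
 shows "card {X. X \<subseteq> A & (\<forall>q<l. btype X q = m q)} = (\<Prod>q<l. card {y\<in>A. fst y = q} choose m q)"
 using assms
proof (induction l arbitrary: A)
 case 0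
 then have "A = {}" by auto
 then have "{X. X \<subseteq> A & (\<forall>q<0. btype X q = m q)} = {{}}" by auto
 then show ?case by simp
next
 case (Suc l)
 define A0 where "A0 = {y\<in>A. fst y ~= l}"
 define A1 where "A1 = {y\<in>A. fst y = l}"
 define P where "P = {Z. Z \<subseteq> A1 & card Z = m l}"
 define Q where "Q = {X. X \<subseteq> A0 & (\<forall>q<l. btype X q = m q)}"
 have finA: "finite A0" "finite A1" using Suc.prems(1) by (auto simp: A0_def A1_def)
 have b: "btype (Z \<union> X) q = (if q = l then card Z else btype X q)" if "Z \<subseteq> A1" "X \<subseteq> A0" for Z X q
 proof (cases "q = l")
  case True
  then have "{x\<in>Z \<union> X. fst x = q} = Z" using that by (auto simp: A0_def A1_def)
  then show ?thesis using True by (simp add: btype_def)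
 next
  case False
  then have "{x\<in>Z \<union> X. fst x = q} = {x\<in>X. fst x = q}" using that by (auto simp: A1_def)
  then show ?thesis using False by (simp add: btype_def)
 qed
 have "bij_betw (%(Z, X). Z \<union> X) (P \<times> Q) {X. X \<subseteq> A & (\<forall>q<Suc l. btype X q = m q)}"
 proof (rule bij_betwI[where g = "%X. (X \<inter> A1, X \<inter> A0)"])
  show "(%(Z, X). Z \<union> X) : P \<times> Q \<rightarrow> {X. X \<subseteq> A & (\<forall>q<Suc l. btype X q = m q)}"
  proof
   fix p assume p: "p : P \<times> Q"
   obtain Z X where ZX: "p = (Z, X)" by fastforce
   have s: "Z \<subseteq> A1" "card Z = m l" "X \<subseteq> A0" "!!q. q < l ==> btype X q = m q"
    using p unfolding ZX P_def Q_def by auto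
   have "\<forall>q<Suc l. btype (Z \<union> X) q = m q" unfolding b[OF s(1,3)] using s(2,4) by auto
   moreover have "Z \<union> X \<subseteq> A" using s(1,3) by (auto simp: A0_def A1_def)
   ultimately show "(case p of (Z, X) => Z \<union> X) : {X. X \<subseteq> A & (\<forall>q<Suc l. btype X q = m q)}"
    by (simp add: ZX)
  qed
  show "(%X. (X \<inter> A1, X \<inter> A0)) : {X. X \<subseteq> A & (\<forall>q<Suc l. btype X q = m q)} \<rightarrow> P \<times> Q"
  proof
   fix X assume "X : {X. X \<subseteq> A & (\<forall>q<Suc l. btype X q = m q)}"
   then have X: "X \<subseteq> A" "!!q. q < Suc l ==> btype X q = m q" by auto
   have e: "btype X q = (if q = l then card (X \<inter> A1) else btype (X \<inter> A0) q)" for q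
   proof -
    have "X = (X \<inter> A1) \<union> (X \<inter> A0)" using X(1) by (auto simp: A0_def A1_def)
    then show ?thesis using b[of "X \<inter> A1" "X \<inter> A0" q] by simp
   qed
   have "card (X \<inter> A1) = m l" using X(2)[of l] e[of l] by simp
   moreover have "btype (X \<inter> A0) q = m q" if "q < l" for q using X(2)[of q] e[of q] that by simp
   ultimately show "(X \<inter> A1, X \<inter> A0) : P \<times> Q" by (simp add: P_def Q_def)
  qed
  show "(%X. (X \<inter> A1, X \<inter> A0)) ((%(Z, X). Z \<union> X) p) = p" if "p : P \<times> Q" for p
  proof -
   obtain Z X where ZX: "p = (Z, X)" by fastforce
   have "Z \<subseteq> A1" "X \<subseteq> A0" using that unfolding ZX P_def Q_def by auto
   then have "(Z \<union> X) \<inter> A1 = Z" "(Z \<union> X) \<inter> A0 = X" by (auto simp: A0_def A1_def)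
   then show ?thesis by (simp add: ZX)
  qed
  show "(%(Z, X). Z \<union> X) ((%X. (X \<inter> A1, X \<inter> A0)) X) = X" if "X : {X. X \<subseteq> A & (\<forall>q<Suc l. btype X q = m q)}" for X
   using that by (auto simp: A0_def A1_def)
 qed
 from bij_betw_same_card[OF this] have "card {X. X \<subseteq> A & (\<forall>q<Suc l. btype X q = m q)} = card P * card Q"
  by (simp only: card_cartesian_product)
 also have "card P = card A1 choose m l" unfolding P_def by (rule n_subsets[OF finA(2)])
 also have "card Q = (\<Prod>q<l. card {y\<in>A0. fst y = q} choose m q)"
  unfolding Q_def
 proof (rule Suc.IH[OF finA(1)])
  show "fst ` A0 \<subseteq> {..<l}" using Suc.prems(2) unfolding A0_def by fastforce
 qed
 also have "(\<Prod>q<l. card {y\<in>A0. fst y = q} choose m q) = (\<Prod>q<l. card {y\<in>A. fst y = q} choose m q)"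
 proof (rule prod.cong[OF refl])
  fix q assume "q : {..<l}"
  then have "{y\<in>A0. fst y = q} = {y\<in>A. fst y = q}" by (auto simp: A0_def)
  then show "(card {y\<in>A0. fst y = q} choose m q) = (card {y\<in>A. fst y = q} choose m q)" by simp
 qed
 finally show ?case by (simp add: A1_def mult.commute)
qed

text \<open>The number \<open>i\<close> contains at most i - 1 factors 2. Halving an even
  \<open>i\<close> costs one factor and decreases \<open>i\<close> by at least one.\<close>

lemma two_power_dvd:
 fixes B :: nat
 shows "i \<ge> 1 ==> 2 ^ e dvd i * B ==> 2 ^ (e + 1 - i) dvd B"
proof (induction i arbitrary: e rule: less_induct)
 case (less i)
 show ?case
 proof (cases "even i")
  case False
  then have "coprime ((2::nat) ^ e) i" by (simp add: coprime_power_left_iff)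
  then have "2 ^ e dvd B" using less.prems(2) by (simp add: coprime_dvd_mult_right_iff)
  moreover have "(2::nat) ^ (e + 1 - i) dvd 2 ^ e" using less.prems(1) by (intro le_imp_power_dvd) simp
  ultimately show ?thesis by (rule dvd_trans[rotated])
 next
  case True
  then obtain j where j: "i = 2 * j" by blast
  have j1: "j \<ge> 1" "j < i" using j less.prems(1) by auto
  show ?thesis
  proof (cases e)
   case 0
   then show ?thesis using j j1 by simp
  next
   case (Suc e')
   have "2 ^ e' dvd j * B" using less.prems(2) unfolding Suc j by (simp add: mult.assoc)
   then have "2 ^ (e' + 1 - j) dvd B" by (rule less.IH[OF j1(2,1)])
   moreover have "(2::nat) ^ (e + 1 - i) dvd 2 ^ (e' + 1 - j)"
    using j j1 Suc by (intro le_imp_power_dvd) simp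
   ultimately show ?thesis by (rule dvd_trans[rotated])
  qed
 qed
qed

text \<open>From i binom(2^(t+m), i) = 2^(t+m) binom(2^(t+m) - 1, i - 1), at least t + m + 1 - i
  factors 2 remain in the binomial coefficient, and this is at least t + 1 for i \<le> m. By
  Vandermonde this yields the period 2^(t+m) in \<open>binomial_period\<close>.\<close>

lemma binomial_period_step:
 "(2::nat) ^ (t + 1) dvd (\<Sum>i\<in>{1..m}. (2 ^ (t + m) choose i) * (w choose (m - i)))"
proof (rule dvd_sum)
 fix i assume i: "i : {1..m}"
 have "i * (2 ^ (t + m) choose i) = 2 ^ (t + m) * ((2 ^ (t + m) - 1) choose (i - 1))"
  by (rule times_binomial_minus1_eq) (use i in auto)
 then have "2 ^ (t + m) dvd i * (2 ^ (t + m) choose i)" by simp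
 then have "2 ^ (t + m + 1 - i) dvd (2 ^ (t + m) choose i)" using i by (intro two_power_dvd) auto
 moreover have "(2::nat) ^ (t + 1) dvd 2 ^ (t + m + 1 - i)" using i by (intro le_imp_power_dvd) auto
 ultimately have "2 ^ (t + 1) dvd (2 ^ (t + m) choose i)" by (rule dvd_trans[rotated])
 then show "2 ^ (t + 1) dvd (2 ^ (t + m) choose i) * (w choose (m - i))" by simp
qed

lemma binomial_period:
 "(2::int) ^ (t + 1) dvd int ((w + j * 2 ^ (t + m)) choose m) - int (w choose m)"
proof (induction j)
 case (Suc j)
 define v where "v = w + j * 2 ^ (t + m)"
 have "(2 ^ (t + m) + v) choose m = (\<Sum>i\<le>m. (2 ^ (t + m) choose i) * (v choose (m - i)))"
  by (rule vandermonde[symmetric])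
 also have "{..m} = insert 0 {1..m}" by auto
 also have "(\<Sum>i\<in>insert 0 {1..m}. (2 ^ (t + m) choose i) * (v choose (m - i)))
   = (v choose m) + (\<Sum>i\<in>{1..m}. (2 ^ (t + m) choose i) * (v choose (m - i)))"
  by (subst sum.insert) auto
 finally have "int ((2 ^ (t + m) + v) choose m) - int (v choose m)
   = int (\<Sum>i\<in>{1..m}. (2 ^ (t + m) choose i) * (v choose (m - i)))" by simp
 moreover have "(2::int) ^ (t + 1) dvd int (\<Sum>i\<in>{1..m}. (2 ^ (t + m) choose i) * (v choose (m - i)))"
  using binomial_period_step[of t m v] by (metis of_nat_dvd_iff of_nat_numeral of_nat_power)
 ultimately have "(2::int) ^ (t + 1) dvd int ((2 ^ (t + m) + v) choose m) - int (v choose m)" by simp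
 then have "(2::int) ^ (t + 1) dvd (int ((2 ^ (t + m) + v) choose m) - int (v choose m)) + (int (v choose m) - int (w choose m))"
  using Suc.IH by (intro dvd_add) (simp_all add: v_def)
 then show ?case by (simp add: v_def algebra_simps)
qed simp

lemma binomial_cong:
 assumes "(2::int) ^ e dvd int w - int w'" "t + m \<le> e"
 shows "(2::int) ^ (t + 1) dvd int (w choose m) - int (w' choose m)"
proof -
 have wlog: "(2::int) ^ (t + 1) dvd int (u choose m) - int (v choose m)"
  if d: "(2::int) ^ (t + m) dvd int u - int v" and vu: "v \<le> u" for u v
 proof -
  have "(2::nat) ^ (t + m) dvd u - v"
   using d vu by (metis int_dvd_int_iff of_nat_diff of_nat_numeral of_nat_power)
  then obtain j where "u - v = 2 ^ (t + m) * j" by blast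
  then have "u = v + j * 2 ^ (t + m)" using vu by (simp add: mult.commute)
  then show ?thesis using binomial_period by simp
 qed
 have d: "(2::int) ^ (t + m) dvd int w - int w'"
  using assms(1) le_imp_power_dvd[OF assms(2), of "2::int"] dvd_trans by blast
 then have d': "(2::int) ^ (t + m) dvd int w' - int w" by (metis dvd_minus_iff minus_diff_eq)
 show ?thesis
 proof (cases "w' \<le> w")
  case False
  then have "(2::int) ^ (t + 1) dvd int (w' choose m) - int (w choose m)" by (intro wlog[OF d']) simp
  then show ?thesis by (metis dvd_minus_iff minus_diff_eq)
 qed (rule wlog[OF d])
qed

lemma dvd_diff_prod:
 fixes a b :: "'i => int"
 assumes "!!i. i : I ==> c dvd a i - b i"
 shows "c dvd prod a I - prod b I"
 using assms
proof (induction I rule: infinite_finite_induct)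
 case (insert i I)
 have "prod a (insert i I) - prod b (insert i I) = a i * (prod a I - prod b I) + (a i - b i) * prod b I"
  using insert.hyps by (simp add: algebra_simps)
 then show ?case using insert by (simp add: dvd_add)
qed auto

lemma cr_eq_iff: "circle_of_real (real a / 2 ^ e) = circle_of_real (real b / 2 ^ e) \<longleftrightarrow> (2::int) ^ e dvd int a - int b"
proof -
 have "circle_of_real (real a / 2 ^ e) = circle_of_real (real b / 2 ^ e)
   \<longleftrightarrow> circle_of_real (real a / 2 ^ e) - circle_of_real (real b / 2 ^ e) = 0" by simp
 also have "circle_of_real (real a / 2 ^ e) - circle_of_real (real b / 2 ^ e)
   = circle_of_real (real a / 2 ^ e - real b / 2 ^ e)"
  by transfer simp
 also have "... = 0 \<longleftrightarrow> (real a / 2 ^ e - real b / 2 ^ e) : \<int>" by (rule circle_of_real_eq_zero)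
 also have "... \<longleftrightarrow> (2::int) ^ e dvd int a - int b"
 proof
  assume "(real a / 2 ^ e - real b / 2 ^ e) : \<int>"
  then obtain c where c: "real a / 2 ^ e - real b / 2 ^ e = of_int c" by (auto simp: Ints_def)
  then have "real a - real b = 2 ^ e * of_int c" by (simp add: field_simps)
  then have "real_of_int (int a - int b) = real_of_int (2 ^ e * c)" by simp
  then have "int a - int b = 2 ^ e * c" by (rule of_int_eq_iff[THEN iffD1])
  then show "(2::int) ^ e dvd int a - int b" by simp
 next
  assume "(2::int) ^ e dvd int a - int b"
  then obtain c where "int a - int b = 2 ^ e * c" by blast
  then have "real_of_int (int a - int b) = real_of_int (2 ^ e * c)" by (rule arg_cong)
  then have "real a - real b = 2 ^ e * of_int c" by simp
  then have "real a / 2 ^ e - real b / 2 ^ e = of_int c" by (simp add: field_simps)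
  then show "(real a / 2 ^ e - real b / 2 ^ e) : \<int>" by simp
 qed
 finally show ?thesis .
qed

lemma circle_of_nat_sum: "circle_of_real (real (card X) * r) = (\<Sum>x\<in>X. circle_of_real r)"
 by (simp add: circle_of_real_sum[symmetric])

lemma half_of_nat: "half (of_nat N) = circle_of_real (real N / 2)"
proof (induction N)
 case 0
 show ?case by (simp add: circle_of_real_zero)
next
 case (Suc N)
 have "half (of_nat (Suc N)) = half 1 + half (of_nat N)" by (simp only: of_nat_Suc half_add)
 also have "... = circle_of_real (1 / 2) + circle_of_real (real N / 2)" by (simp only: Suc.IH) (simp add: half_def)
 also have "... = circle_of_real (1 / 2 + real N / 2)" by (simp only: circle_of_real_add)
 also have "1 / 2 + real N / 2 = real (Suc N) / 2" by (simp add: field_simps)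
 finally show ?case .
qed

lemma root_chain:
 assumes "pd n (Suc m) Q"
 shows "\<exists>R. R 0 = Q & (\<forall>t. pd n (Suc (m + t)) (R t) & (\<forall>x\<in>FF n. zmul 2 (R (Suc t) x) = R t x))"
proof -
 have "\<exists>R. \<forall>t. (pd n (Suc (m + t)) (R t) & (t = 0 --> R t = Q)) & (\<forall>x\<in>FF n. zmul 2 (R (Suc t) x) = R t x)"
 proof (rule dependent_nat_choice)
  show "\<exists>P. pd n (Suc (m + 0)) P & (0 = 0 --> P = Q)" using assms by auto
  show "\<exists>P'. (pd n (Suc (m + Suc t)) P' & (Suc t = 0 --> P' = Q)) & (\<forall>x\<in>FF n. zmul 2 (P' x) = P x)"
   if "pd n (Suc (m + t)) P & (t = 0 --> P = Q)" for P t
   using poly_root[of n "m + t" P] that by auto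
 qed
 then show ?thesis by blast
qed

lemma mono_int_card: "finite S ==> mono S x = of_bool (S \<subseteq> {i. x i = 1})"
 by (simp add: mono_eq subset_eq)

text \<open>\<open>N x\<close> counts the sets of blocks of an admissible type, all blocks being
  nonzero at \<open>k\<close> and contained in the support of x. As a sum of monomials, N / 2 has
  the same coefficients of size d as P, so P - N / 2 has degree below d. As a sum of products of
  binomials in the block counts \<open>w q x\<close>, the phase N / 2^(t+1) depends only on the
  \<open>Wq t q\<close>, which have degree below d + t; this gives the whole tower.\<close>

lemma integrate:
 assumes F: "fam alt n d F" and d: "d \<ge> 2"
  and supp: "!!X. f X ~= (0::bit) ==> X : PT {..<d} F"
  and typed: "!!X Y. X : PT {..<d} F ==> Y : PT {..<d} F ==> btype X = btype Y ==> f X = f Y"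
  and rep: "!!h. h ` {..<d} \<subseteq> FF n ==> T (hm h {..<d}) = (\<Sum>X\<in>Pow (Zp F {..<d} h). f X)"
  and k: "!!i. i < n ==> k i : FF n"
  and nosing: "!!x. x : Om2 {..<n} F ==> card (snd x) = 1 ==> ev F k x = 0"
  and P: "pd n (Suc d) P" "!!x. x : FF n ==> zmul 2 (P x) = 0"
  and top: "!!U. U \<subseteq> {..<n} ==> card U = d ==> tb P (hm eu U) = T (hm k U)"
 shows "chain n d (length F + 1) L P"
proof -
 define E where "E = Zp F {..<n} k"
 define good where "good X \<longleftrightarrow> (\<exists>Y\<in>PT {..<d} F. f Y = 1 & btype Y = btype X)" for X
 \<comment> \<open>Blocks may overlap here. Their sizes add up to \<open>d\<close>, so a set with
   overlaps has a smaller union and only affects coefficients below the top.\<close>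
 define XX where "XX = {X. X \<subseteq> E & good X}"
 have EO: "E \<subseteq> Om2 {..<n} F" by (auto simp: E_def Zp_def)
 have finE: "finite E" using EO Om2_finite[of "{..<n}" F] finite_subset by blast
 have finXX: "finite XX" unfolding XX_def using finE by simp
 have Fs: "1 \<le> card (snd x) & card (snd x) < d & card (snd x) = fst (F ! fst x)" if "x : Om2 I F" for x I
  using F nth_mem[OF Om2_D(1)[OF that]] Om2_D(3)[OF that] unfolding fam_def by fastforce
 have blk: "finite (snd x)" "snd x \<subseteq> {..<n}" if "x : E" for x
  using that EO Om2_D(2)[of x "{..<n}" F] finite_subset[of "snd x" "{..<n}"] by auto
 \<comment> \<open>The type determines the block sizes, and some partition of \<open>{..<d}\<close>
   has the same type.\<close>
 have sumd: "(\<Sum>x\<in>X. card (snd x)) = d" if X: "X : XX" for X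
 proof -
  obtain Y where Y: "Y : PT {..<d} F" "btype Y = btype X" using X by (auto simp: XX_def good_def)
  have XE: "X \<subseteq> E" "finite X" using X finE finite_subset by (auto simp: XX_def)
  have YO: "Y \<subseteq> Om2 {..<d} F" "finite Y" using Y PT_finite[of "{..<d}"] by (auto simp: PT_def)
  have "(\<Sum>x\<in>X. card (snd x)) = (\<Sum>x\<in>X. fst (F ! fst x))"
   by (rule sum.cong[OF refl]) (use XE EO Fs in blast)
  also have "... = (\<Sum>x\<in>Y. fst (F ! fst x))"
   using btype_sum[OF XE(2) YO(2) Y(2)[symmetric], of "%q. fst (F ! q)"] .
  also have "... = (\<Sum>x\<in>Y. card (snd x))"
   by (rule sum.cong[OF refl]) (use YO Fs in \<open>blast dest: sym\<close>)
  also have "... = d" using PT_sum[OF _ Y(1)] by simp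
  finally show ?thesis .
 qed
 have cardU: "card (\<Union>(snd ` X)) \<le> d" "\<Union>(snd ` X) \<subseteq> {..<n}" if X: "X : XX" for X
 proof -
  have XE: "X \<subseteq> E" "finite X" using X finE finite_subset by (auto simp: XX_def)
  have "card (\<Union>(snd ` X)) \<le> (\<Sum>x\<in>X. card (snd x))" by (rule card_UN_le[OF XE(2)])
  then show "card (\<Union>(snd ` X)) \<le> d" using sumd[OF X] by simp
  show "\<Union>(snd ` X) \<subseteq> {..<n}" using blk(2) XE(1) by blast
 qed
 define Ex where "Ex x = {y\<in>E. snd y \<subseteq> {i. x i = 1}}" for x :: vec
 define N where "N x = card {X. X \<subseteq> Ex x & good X}" for x
 define G where "G t x = circle_of_real (real (N x) / 2 ^ (t + 1))" for t x
 have Gsum: "G t x = (\<Sum>X\<in>XX. zmul (mono (\<Union>(snd ` X)) x) (circle_of_real (1 / 2 ^ (t + 1))))" for t x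
 proof -
  have e: "{X. X \<subseteq> Ex x & good X} = {X\<in>XX. \<Union>(snd ` X) \<subseteq> {i. x i = 1}}"
   by (auto simp: Ex_def XX_def)
  have "(\<Sum>X\<in>XX. zmul (mono (\<Union>(snd ` X)) x) (circle_of_real (1 / 2 ^ (t + 1))))
    = (\<Sum>X\<in>XX. if \<Union>(snd ` X) \<subseteq> {i. x i = 1} then circle_of_real (1 / 2 ^ (t + 1)) else 0)"
  proof (rule sum.cong[OF refl])
   fix X assume X: "X : XX"
   have "finite (\<Union>(snd ` X))" using cardU(2)[OF X] finite_subset by blast
   then show "zmul (mono (\<Union>(snd ` X)) x) (circle_of_real (1 / 2 ^ (t + 1)))
     = (if \<Union>(snd ` X) \<subseteq> {i. x i = 1} then circle_of_real (1 / 2 ^ (t + 1)) else 0)"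
    by (simp only: mono_int_card) simp
  qed
  also have "... = (\<Sum>X\<in>{X\<in>XX. \<Union>(snd ` X) \<subseteq> {i. x i = 1}}. circle_of_real (1 / 2 ^ (t + 1)))"
   by (rule sum.inter_filter[OF finXX, symmetric])
  also have "... = circle_of_real (real (card {X\<in>XX. \<Union>(snd ` X) \<subseteq> {i. x i = 1}}) * (1 / 2 ^ (t + 1)))"
   by (rule circle_of_nat_sum[symmetric])
  also have "... = G t x" unfolding G_def N_def e by simp
  finally show ?thesis ..
 qed
 have Gpd: "pd n (Suc (d + t)) (G t)" for t
 proof -
  have "pd n (Suc (d + t)) (%x. \<Sum>X\<in>XX. zmul (mono (\<Union>(snd ` X)) x) (circle_of_real (1 / 2 ^ (t + 1))))"
  proof (rule pd_sum, rule pd_mono_term)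
   fix X assume X: "X : XX"
   show "finite (\<Union>(snd ` X))" using cardU(2)[OF X] finite_subset by blast
   have "zmul (2 ^ (t + 1)) (circle_of_real (1 / 2 ^ (t + 1))) = 0"
    by (simp add: zmul_circle_of_real circle_of_real_eq_zero)
   then show "zmul (2 ^ (Suc (d + t) - card (\<Union>(snd ` X)))) (circle_of_real (1 / 2 ^ (t + 1))) = 0"
    by (rule zmul_pow_mono) (use cardU(1)[OF X] in linarith)
  qed
  then show ?thesis unfolding Gsum[abs_def] .
 qed
 have Gdouble: "zmul 2 (G (Suc t) x) = G t x" for t x
  unfolding G_def zmul_circle_of_real by simp
 define w where "w q x = card {y\<in>Ex x. fst y = q}" for q x
 \<comment> \<open>The denominator is as large as it can be: monomials of size s over 2^(t + d - s)
   just have degree below d + t.\<close>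
 define Wq where "Wq t q x = circle_of_real (real (w q x) / 2 ^ (t + d - fst (F ! q)))" for t q x
 have sq: "fst (F ! q) < d" if "q < length F" for q
  using F nth_mem[OF that] unfolding fam_def by fastforce
 have Wpd: "pd n (d + t) (Wq t q)" if q: "q < length F" for t q
 proof -
  have e: "Wq t q x = (\<Sum>y\<in>{y\<in>E. fst y = q}. zmul (mono (snd y) x) (circle_of_real (1 / 2 ^ (t + d - fst (F ! q)))))" for x
  proof -
   have "(\<Sum>y\<in>{y\<in>E. fst y = q}. zmul (mono (snd y) x) (circle_of_real (1 / 2 ^ (t + d - fst (F ! q)))))
    = (\<Sum>y\<in>{y\<in>E. fst y = q}. if snd y \<subseteq> {i. x i = 1} then circle_of_real (1 / 2 ^ (t + d - fst (F ! q))) else 0)"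
    by (rule sum.cong[OF refl]) (simp add: mono_int_card blk(1))
   also have "... = (\<Sum>y\<in>{y\<in>{y\<in>E. fst y = q}. snd y \<subseteq> {i. x i = 1}}. circle_of_real (1 / 2 ^ (t + d - fst (F ! q))))"
    by (rule sum.inter_filter[symmetric]) (use finE in simp)
   also have "{y\<in>{y\<in>E. fst y = q}. snd y \<subseteq> {i. x i = 1}} = {y\<in>Ex x. fst y = q}"
    by (auto simp: Ex_def)
   also have "(\<Sum>y\<in>{y\<in>Ex x. fst y = q}. circle_of_real (1 / 2 ^ (t + d - fst (F ! q))))
     = circle_of_real (real (card {y\<in>Ex x. fst y = q}) * (1 / 2 ^ (t + d - fst (F ! q))))"
    by (rule circle_of_nat_sum[symmetric])
   finally show ?thesis by (simp add: Wq_def w_def)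
  qed
  have "pd n (d + t) (%x. \<Sum>y\<in>{y\<in>E. fst y = q}. zmul (mono (snd y) x) (circle_of_real (1 / 2 ^ (t + d - fst (F ! q)))))"
  proof (rule pd_sum, rule pd_mono_term)
   fix y assume y: "y : {y\<in>E. fst y = q}"
   then show "finite (snd y)" using blk by blast
   have "card (snd y) = fst (F ! q)" using y EO Fs[of y "{..<n}"] by auto
   then show "zmul (2 ^ (d + t - card (snd y))) (circle_of_real (1 / 2 ^ (t + d - fst (F ! q)))) = 0"
    by (simp add: zmul_circle_of_real circle_of_real_eq_zero add.commute)
  qed
  then show ?thesis unfolding e[abs_def] .
 qed
 have finEx: "finite (Ex x)" for x using finE by (simp add: Ex_def)
 define TT where "TT = {btype Y |Y. Y : PT {..<d} F & f Y = 1}"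
 have finTT: "finite TT"
 proof -
  have "PT {..<d} F \<subseteq> Pow (Om2 {..<d} F)" by (auto simp: PT_def)
  then have "finite (PT {..<d} F)" using Om2_finite[of "{..<d}" F] finite_subset by auto
  then show ?thesis unfolding TT_def by simp
 qed
 have Nform: "N x = (\<Sum>m\<in>TT. \<Prod>q<length F. w q x choose m q)" for x
 proof -
  have "{X. X \<subseteq> Ex x & good X} = (\<Union>m\<in>TT. {X. X \<subseteq> Ex x & btype X = m})"
   by (auto simp: good_def TT_def)
  then have "N x = card (\<Union>m\<in>TT. {X. X \<subseteq> Ex x & btype X = m})" by (simp add: N_def)
  also have "... = (\<Sum>m\<in>TT. card {X. X \<subseteq> Ex x & btype X = m})"
   by (rule card_UN_disjoint[OF finTT]) (use finEx in auto)
  also have "... = (\<Sum>m\<in>TT. \<Prod>q<length F. w q x choose m q)"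
  proof (rule sum.cong[OF refl])
   fix m assume "m : TT"
   then obtain Y where Y: "Y \<subseteq> Om2 {..<d} F" "m = btype Y" by (auto simp: TT_def PT_def)
   have m0: "m q = 0" if "\<not> q < length F" for q
   proof -
    have "{y\<in>Y. fst y = q} = {}" using Y(1) Om2_D(1)[of _ "{..<d}" F] that by blast
    then show ?thesis unfolding Y(2) btype_def by (simp only: card.empty)
   qed
   have ExF: "fst ` Ex x \<subseteq> {..<length F}" using EO Om2_D(1)[of _ "{..<n}" F] by (auto simp: Ex_def)
   have "btype X = m \<longleftrightarrow> (\<forall>q<length F. btype X q = m q)" if "X \<subseteq> Ex x" for X
   proof
    assume a: "\<forall>q<length F. btype X q = m q"
    show "btype X = m"
    proof
     fix q show "btype X q = m q"
     proof (cases "q < length F")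
      case False
      then have "{y\<in>X. fst y = q} = {}" using ExF that by blast
      then have "btype X q = 0" unfolding btype_def by (simp only: card.empty)
      then show ?thesis using m0[OF False] by simp
     qed (use a in blast)
    qed
   qed simp
   then have "{X. X \<subseteq> Ex x & btype X = m} = {X. X \<subseteq> Ex x & (\<forall>q<length F. btype X q = m q)}" by blast
   then show "card {X. X \<subseteq> Ex x & btype X = m} = (\<Prod>q<length F. w q x choose m q)"
    using card_btype[OF finEx ExF] by (simp add: w_def)
  qed
  finally show ?thesis .
 qed
 have Gfr: "frank n (d + t) (length F) (G t)" for t
 proof (rule frankI[of "map (Wq t) [0..<length F]"])
  show "length (map (Wq t) [0..<length F]) \<le> length F" by simp
  show "pd n (d + t) R" if "R : set (map (Wq t) [0..<length F])" for R using that Wpd by auto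
  fix x y assume eq: "!!R. R : set (map (Wq t) [0..<length F]) ==> R x = R y"
  have fac: "(2::int) ^ (t + 1) dvd int (w q x choose m q) - int (w q y choose m q)"
   if q: "q < length F" and m: "m : TT" for q m
  proof -
   obtain Y where Y: "Y : PT {..<d} F" "m = btype Y" using m by (auto simp: TT_def)
   have YO: "Y \<subseteq> Om2 {..<d} F" "finite Y" using Y PT_finite[of "{..<d}"] by (auto simp: PT_def)
   have "Wq t q x = Wq t q y" by (rule eq) (use q in auto)
   then have dv: "(2::int) ^ (t + d - fst (F ! q)) dvd int (w q x) - int (w q y)"
    unfolding Wq_def by (rule cr_eq_iff[THEN iffD1])
   \<comment> \<open>A label absent from the type contributes the factor 1, and for size 1 the count
     \<open>w\<close> is 0 by \<open>nosing\<close>. For s \<ge> 2 the inequality m + s \<le> d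
     required by \<open>binomial_cong\<close> follows from m s \<le> d if m \<ge> 2, and from s < d
     if m = 1.\<close>
   consider "m q = 0" | "m q ~= 0" "fst (F ! q) = 1" | "m q ~= 0" "fst (F ! q) ~= 1" by blast
   then show ?thesis
   proof cases
    case 2
    have "{y\<in>Ex z. fst y = q} = {}" for z
    proof (rule ccontr)
     assume "{y\<in>Ex z. fst y = q} ~= {}"
     then obtain u where u: "u : E" "fst u = q" by (auto simp: Ex_def)
     then have "ev F k u = 0" using nosing[of u] Fs[of u "{..<n}"] EO 2(2) by auto
     then show False using u by (simp add: E_def Zp_def)
    qed
    then have "w q z = 0" for z unfolding w_def by (simp only: card.empty)
    then show ?thesis by simp
   next
    case 3
    have ms: "m q * fst (F ! q) \<le> d"
    proof -
     have "m q * fst (F ! q) = (\<Sum>u\<in>{u\<in>Y. fst u = q}. card (snd u))"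
      using YO(1) Fs[of _ "{..<d}"] by (subst sum.cong[OF refl, of _ _ "%_. fst (F ! q)"]) (auto simp: Y(2) btype_def)
     also have "... \<le> (\<Sum>u\<in>Y. card (snd u))" by (rule sum_mono2[OF YO(2)]) auto
     also have "... = d" using PT_sum[OF _ Y(1)] by simp
     finally show ?thesis .
    qed
    have "fst (F ! q) ~= 0" using F nth_mem[OF q] unfolding fam_def by fastforce
    then have s2: "fst (F ! q) \<ge> 2" using 3(2) by linarith
    have "m q + fst (F ! q) \<le> d"
    proof (cases "m q = 1")
     case True
     then show ?thesis using sq[OF q] by simp
    next
     case False
     then obtain a where a: "m q = a + 2" using 3(1) by (metis One_nat_def add_2_eq_Suc' not0_implies_Suc)
     obtain b where b: "fst (F ! q) = b + 2" using s2 by (metis add.commute le_Suc_ex)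
     have "m q + fst (F ! q) \<le> m q * fst (F ! q)" unfolding a b by (simp add: algebra_simps)
     then show ?thesis using ms by simp
    qed
    then show ?thesis by (intro binomial_cong[OF dv]) simp
   qed simp
  qed
  have "int (N x) - int (N y)
    = (\<Sum>m\<in>TT. (\<Prod>q<length F. int (w q x choose m q)) - (\<Prod>q<length F. int (w q y choose m q)))"
   unfolding Nform by (simp add: sum_subtractf)
  also have "(2::int) ^ (t + 1) dvd ..."
   by (rule dvd_sum, rule dvd_diff_prod) (use fac in auto)
  finally show "G t x = G t y" unfolding G_def by (rule cr_eq_iff[THEN iffD2])
 qed
 define Q where "Q x = P x - G 0 x" for x
 define nS where "nS S = card {X\<in>XX. \<Union>(snd ` X) = S}" for S
 have G0: "G 0 x = (\<Sum>S\<in>Pow {..<n}. zmul (mono S x) (half (of_nat (nS S))))" for x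
 proof -
  have "G 0 x = (\<Sum>X\<in>XX. zmul (mono (\<Union>(snd ` X)) x) (circle_of_real (1 / 2)))"
   by (simp add: Gsum)
  also have "... = (\<Sum>S\<in>Pow {..<n}. \<Sum>X\<in>{X\<in>XX. \<Union>(snd ` X) = S}. zmul (mono (\<Union>(snd ` X)) x) (circle_of_real (1 / 2)))"
   by (rule sum.group[symmetric]) (use finXX cardU(2) in auto)
  also have "... = (\<Sum>S\<in>Pow {..<n}. zmul (mono S x) (half (of_nat (nS S))))"
  proof (rule sum.cong[OF refl])
   fix S
   have "(\<Sum>X\<in>{X\<in>XX. \<Union>(snd ` X) = S}. zmul (mono (\<Union>(snd ` X)) x) (circle_of_real (1 / 2)))
     = (\<Sum>X\<in>{X\<in>XX. \<Union>(snd ` X) = S}. zmul (mono S x) (circle_of_real (1 / 2)))"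
    by (rule sum.cong[OF refl]) simp
   also have "... = zmul (mono S x) (\<Sum>X\<in>{X\<in>XX. \<Union>(snd ` X) = S}. circle_of_real (1 / 2))"
    by (rule zmul_sum_right[symmetric])
   also have "(\<Sum>X\<in>{X\<in>XX. \<Union>(snd ` X) = S}. circle_of_real (1 / 2)) = half (of_nat (nS S))"
    unfolding nS_def half_of_nat circle_of_nat_sum[symmetric] by simp
   finally show "(\<Sum>X\<in>{X\<in>XX. \<Union>(snd ` X) = S}. zmul (mono (\<Union>(snd ` X)) x) (circle_of_real (1 / 2)))
     = zmul (mono S x) (half (of_nat (nS S)))" .
  qed
  finally show ?thesis .
 qed
 have hmF: "set_mset (hm eu S) \<subseteq> FF n" if "S \<subseteq> {..<n}" for S
  using that finite_subset[OF that] eu_FF by (auto simp: set_hm)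
 \<comment> \<open>For a set \<open>U\<close> of size \<open>d\<close>, the members of
   \<open>XX\<close> with union \<open>U\<close> are exactly the block partitions of
   \<open>U\<close>: sizes that add up to \<open>d\<close> leave no overlap.\<close>
 have coef: "cf P U = half (of_nat (nS U))" if U: "U \<subseteq> {..<n}" "card U = d" for U
 proof -
  have finU: "finite U" using U(1) finite_subset by blast
  have "cf P U = half (tb P (hm eu U))"
   unfolding cf_def by (rule DM_half[OF P(1)]) (use U d hmF in auto)
  also have "tb P (hm eu U) = T (hm k U)" by (rule top[OF U])
  also have "T (hm k U) = of_nat (card {X\<in>PT U F. X \<subseteq> Zp F U k & (\<exists>Y\<in>PT {..<d} F. f Y = 1 & btype Y = btype X)})"
   by (rule structure_transport[OF supp typed rep finU U(2)]) (use k U(1) in auto)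
  also have "{X\<in>PT U F. X \<subseteq> Zp F U k & (\<exists>Y\<in>PT {..<d} F. f Y = 1 & btype Y = btype X)} = {X\<in>XX. \<Union>(snd ` X) = U}"
  proof (rule set_eqI)
   fix X
   show "X : {X\<in>PT U F. X \<subseteq> Zp F U k & (\<exists>Y\<in>PT {..<d} F. f Y = 1 & btype Y = btype X)} \<longleftrightarrow> X : {X\<in>XX. \<Union>(snd ` X) = U}"
   proof
    assume a: "X : {X\<in>PT U F. X \<subseteq> Zp F U k & (\<exists>Y\<in>PT {..<d} F. f Y = 1 & btype Y = btype X)}"
    have "Zp F U k \<subseteq> E" using U(1) by (auto simp: E_def Zp_def Om2_def)
    then show "X : {X\<in>XX. \<Union>(snd ` X) = U}" using a PT_cover[of X U F] by (auto simp: XX_def good_def)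
   next
    assume "X : {X\<in>XX. \<Union>(snd ` X) = U}"
    then have X: "X : XX" "\<Union>(snd ` X) = U" by auto
    have XE: "X \<subseteq> E" "finite X" using X finE finite_subset by (auto simp: XX_def)
    have XO: "X \<subseteq> Om2 U F"
    proof
     fix x assume x: "x : X"
     then have "x : Om2 {..<n} F" "snd x \<subseteq> U" using XE EO X(2) by auto
     then show "x : Om2 U F" by (auto simp: Om2_def)
    qed
    have "\<exists>!x. x : X & i : snd x" if "i : U" for i
     by (rule cover_count[OF XE(2)]) (use blk XE sumd[OF X(1)] X(2) U(2) that in auto)
    then have "X : PT U F" using XO by (simp add: PT_def)
    moreover have "X \<subseteq> Zp F U k" using XO XE(1) by (auto simp: E_def Zp_def)
    ultimately show "X : {X\<in>PT U F. X \<subseteq> Zp F U k & (\<exists>Y\<in>PT {..<d} F. f Y = 1 & btype Y = btype X)}"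
     using X(1) by (auto simp: XX_def good_def)
   qed
  qed
  finally show ?thesis by (simp add: nS_def)
 qed
 have Qpd: "pd n d Q"
 proof (rule pd_cong)
  show "(\<Sum>S\<in>Pow {..<n}. zmul (mono S x) (cf P S - half (of_nat (nS S)))) = Q x" if "x : FF n" for x
   unfolding Q_def G0 mono_expansion[OF that, of P] by (simp add: zmul_diff_right sum_subtractf)
  show "pd n d (%x. \<Sum>S\<in>Pow {..<n}. zmul (mono S x) (cf P S - half (of_nat (nS S))))"
  proof (rule pd_sum, rule pd_mono_term)
   fix S assume "S : Pow {..<n}"
   then have S: "S \<subseteq> {..<n}" by simp
   show finS: "finite S" using S finite_subset by blast
   \<comment> \<open>Below the top both coefficients are only known to be killed by 2, which is
     enough for degree below \<open>d\<close>. At the top they coincide, and above it both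
     vanish.\<close>
   consider "card S < d" | "card S = d" | "card S > d" by linarith
   then show "zmul (2 ^ (d - card S)) (cf P S - half (of_nat (nS S))) = 0"
   proof cases
    case 1
    obtain as where as: "mset as = hm eu S" using ex_mset by blast
    have "zmul 2 (cf P S) = DL as (%x. zmul 2 (P x)) 0"
     unfolding cf_def as[symmetric] DM_mset DL_zmul ..
    also have "... = DL as (%_. 0) 0"
    proof (rule DL_cong[of _ n])
     have "set as = set_mset (hm eu S)" using as by (metis set_mset_mset)
     then show "set as \<subseteq> FF n" using hmF[OF S] by simp
    qed (use P(2) FF_zero in auto)
    finally have "zmul (2 ^ 1) (cf P S - half (of_nat (nS S))) = 0"
     by (simp add: DL_zero zmul_diff_right) (simp add: zmul_two half_double)
    then show ?thesis by (rule zmul_pow_mono) (use 1 in simp)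
   next
    case 2
    then show ?thesis using coef[OF S] by simp
   next
    case 3
    have "cf P S = 0" unfolding cf_def
     by (rule DM_vanish[OF P(1) _ hmF[OF S] FF_zero]) (use 3 in simp)
    moreover have "{X\<in>XX. \<Union>(snd ` X) = S} = {}" using cardU(1) 3 by fastforce
    then have "nS S = 0" unfolding nS_def by (simp only: card.empty)
    ultimately show ?thesis by simp
   qed
  qed
 qed
 obtain m where m: "d = Suc m" using d by (cases d) auto
 \<comment> \<open>The remainder has degree below \<open>d\<close>, so each of its successive halves
   serves as its own witness of rank 1.\<close>
 obtain R where R: "R 0 = Q" "!!t. pd n (d + t) (R t)" "!!t x. x : FF n ==> zmul 2 (R (Suc t) x) = R t x"
  using root_chain[of n m Q] Qpd unfolding m by auto
 show ?thesis
  unfolding chain_def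
 proof (intro exI[of _ "%t x. G t x + R t x"] conjI ballI allI impI)
  fix x show "G 0 x + R 0 x = P x" by (simp add: R(1) Q_def)
 next
  fix t x assume "x : FF n"
  then show "zmul 2 (G (Suc t) x + R (Suc t) x) = G t x + R t x"
   by (simp only: zmul_add_right Gdouble R(3))
 next
  fix t
  show "pd n (Suc (d + t)) (%x. G t x + R t x)"
   by (rule pd_add[OF Gpd pd_mono[OF R(2)]]) simp
  show "frank n (d + t) (length F + 1) (%x. G t x + R t x)"
   by (rule frank_add[OF Gfr frank_self[OF R(2)]])
 qed
qed

section \<open>Polynomials with biased top form have finite rank\<close>

lemma chain_add:
 assumes "chain n d K L P" "chain n d K' L Q"
 shows "chain n d (K + K') L (%x. P x + Q x)"
proof -
 obtain R where R: "\<forall>x\<in>FF n. R 0 x = P x" "\<forall>t<L. \<forall>x\<in>FF n. zmul 2 (R (Suc t) x) = R t x"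
  "\<forall>t\<le>L. pd n (Suc (d + t)) (R t) & frank n (d + t) K (R t)"
  using assms(1) unfolding chain_def by blast
 obtain S where S: "\<forall>x\<in>FF n. S 0 x = Q x" "\<forall>t<L. \<forall>x\<in>FF n. zmul 2 (S (Suc t) x) = S t x"
  "\<forall>t\<le>L. pd n (Suc (d + t)) (S t) & frank n (d + t) K' (S t)"
  using assms(2) unfolding chain_def by blast
 show ?thesis
  unfolding chain_def
 proof (intro exI[of _ "%t x. R t x + S t x"] conjI allI impI ballI)
  show "R 0 x + S 0 x = P x + Q x" if "x : FF n" for x using that R(1) S(1) by simp
  show "zmul 2 (R (Suc t) x + S (Suc t) x) = R t x + S t x" if "t < L" "x : FF n" for t x
   using that R(2) S(2) by (simp add: zmul_add_right)
  show "pd n (Suc (d + t)) (%x. R t x + S t x)" if "t \<le> L" for t using that R(3) S(3) by (blast intro: pd_add)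
  show "frank n (d + t) (K + K') (%x. R t x + S t x)" if "t \<le> L" for t
   using that R(3) S(3) by (blast intro: frank_add)
 qed
qed

lemma chain_lin:
 assumes "chain n d K L P" and \<pi>: "lin n \<pi>"
 shows "chain n d K L (%x. P (\<pi> x))"
proof -
 obtain R where R: "\<forall>x\<in>FF n. R 0 x = P x" "\<forall>t<L. \<forall>x\<in>FF n. zmul 2 (R (Suc t) x) = R t x"
  "\<forall>t\<le>L. pd n (Suc (d + t)) (R t) & frank n (d + t) K (R t)"
  using assms(1) unfolding chain_def by blast
 show ?thesis
  unfolding chain_def
 proof (intro exI[of _ "%t x. R t (\<pi> x)"] conjI allI impI ballI)
  show "R 0 (\<pi> x) = P (\<pi> x)" if "x : FF n" for x using linD[OF \<pi> that] R(1) by simp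
  show "zmul 2 (R (Suc t) (\<pi> x)) = R t (\<pi> x)" if "t < L" "x : FF n" for t x
   using that linD[OF \<pi> that(2)] R(2) by simp
  show "pd n (Suc (d + t)) (%x. R t (\<pi> x))" if "t \<le> L" for t using that R(3) pd_lin[OF _ \<pi>] by simp
  show "frank n (d + t) K (%x. R t (\<pi> x))" if "t \<le> L" for t using that R(3) frank_lin[OF _ \<pi>] by simp
 qed
qed

lemma chain_mono:
 assumes "chain n d K L P" "K \<le> K'"
 shows "chain n d K' L P"
proof -
 obtain R where R: "\<forall>x\<in>FF n. R 0 x = P x" "\<forall>t<L. \<forall>x\<in>FF n. zmul 2 (R (Suc t) x) = R t x"
  "\<forall>t\<le>L. pd n (Suc (d + t)) (R t) & frank n (d + t) K (R t)"
  using assms(1) unfolding chain_def by blast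
 then have "\<forall>t\<le>L. pd n (Suc (d + t)) (R t) & frank n (d + t) K' (R t)"
  using frank_mono[OF _ assms(2)] by simp
 then show ?thesis unfolding chain_def by (intro exI[of _ R] conjI R)
qed

lemma chain_cong:
 assumes "chain n d K L P" "!!x. x : FF n ==> P x = Q x"
 shows "chain n d K L Q"
proof -
 obtain R where R: "\<forall>x\<in>FF n. R 0 x = P x" "\<forall>t<L. \<forall>x\<in>FF n. zmul 2 (R (Suc t) x) = R t x"
  "\<forall>t\<le>L. pd n (Suc (d + t)) (R t) & frank n (d + t) K (R t)"
  using assms(1) unfolding chain_def by blast
 have "\<forall>x\<in>FF n. R 0 x = Q x" using R(1) assms(2) by simp
 then show ?thesis unfolding chain_def by (intro exI[of _ R] conjI R)
qed

text \<open>The first halving becomes the base of the new tower, which is one step shorter and one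
  degree higher.\<close>

lemma chain_root:
 assumes "chain n d K (Suc L) P"
 obtains R where "!!x. x : FF n ==> zmul 2 (R x) = P x" "pd n (Suc (Suc d)) R" "frank n (Suc d) K R"
  "chain n (Suc d) K L R"
proof -
 obtain R where R: "\<forall>x\<in>FF n. R 0 x = P x" "\<forall>t<Suc L. \<forall>x\<in>FF n. zmul 2 (R (Suc t) x) = R t x"
  "\<forall>t\<le>Suc L. pd n (Suc (d + t)) (R t) & frank n (d + t) K (R t)"
  using assms unfolding chain_def by blast
 have R1: "pd n (Suc (d + Suc 0)) (R (Suc 0)) & frank n (d + Suc 0) K (R (Suc 0))"
  by (rule R(3)[rule_format]) simp
 show ?thesis
 proof (rule that[of "R (Suc 0)"])
  show "zmul 2 (R (Suc 0) x) = P x" if "x : FF n" for x using R(1,2) that by simp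
  show "pd n (Suc (Suc d)) (R (Suc 0))" "frank n (Suc d) K (R (Suc 0))" using R1 by simp_all
  show "chain n (Suc d) K L (R (Suc 0))"
   unfolding chain_def
  proof (intro exI[of _ "%t. R (Suc t)"] conjI allI impI ballI)
   show "zmul 2 (R (Suc (Suc t)) x) = R (Suc t) x" if "t < L" "x : FF n" for t x
    using R(2) that by simp
   show "pd n (Suc (Suc d + t)) (R (Suc t))" "frank n (Suc d + t) K (R (Suc t))" if "t \<le> L" for t
    using R(3)[rule_format, of "Suc t"] that by simp_all
  qed simp
 qed
qed

lemma chain_const: "chain n d 0 L (%_. c)"
 unfolding chain_def
proof (intro exI[of _ "%t _. (hc ^^ t) c"] conjI allI impI ballI)
 show "zmul 2 ((hc ^^ Suc t) c) = (hc ^^ t) c" for t by (simp add: hc)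
qed (auto intro: pd_const frank_const)

lemma frank_cong:
 assumes "frank n m K P" "!!x. x : FF n ==> P x = Q x"
 shows "frank n m K Q"
 using assms(1) unfolding frank_def by (simp add: assms(2)[symmetric])

lemma lin_zero:
 assumes "lin n \<pi>"
 shows "\<pi> 0 = 0"
proof -
 have "\<pi> 0 = \<pi> (0 + 0)" by (simp only: add_0)
 also have "... = \<pi> 0 + \<pi> 0" using assms FF_zero unfolding lin_def by blast
 finally show ?thesis by (simp only: vec_add_self)
qed

lemma tb_lin:
 assumes \<pi>: "lin n \<pi>" and M: "set_mset M \<subseteq> FF n"
 shows "tb (%x. P (\<pi> x)) M = tb P (image_mset \<pi> M)"
proof -
 obtain as where as: "M = mset as" using ex_mset by metis
 have "DL as (%x. P (\<pi> x)) 0 = DL (map \<pi> as) P (\<pi> 0)"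
  by (rule DL_lin[OF \<pi> _ FF_zero]) (use as M in simp)
 then have "DM M (%x. P (\<pi> x)) 0 = DM (image_mset \<pi> M) P 0"
  unfolding as DM_mset lin_zero[OF \<pi>] mset_map[symmetric] .
 then show ?thesis by (simp add: tb_def)
qed

lemma hm_image: "image_mset \<pi> (hm h J) = hm (%i. \<pi> (h i)) J"
 by (simp add: hm_def multiset.map_comp comp_def)

lemma Om2_card:
 assumes "finite I"
 shows "card (Om2 I F) \<le> length F * 2 ^ card I"
proof -
 have "card (Om2 I F) \<le> card ({..<length F} \<times> Pow I)"
  by (rule card_mono) (use assms in \<open>auto simp: Om2_def\<close>)
 then show ?thesis using assms by (simp add: card_cartesian_product card_Pow)
qed

text \<open>The forms of order 1 in the family are linear functionals, at most
  \<open>length F\<close> many, and \<open>kill_functionals\<close> applies to them.\<close>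

lemma singles_killed:
 assumes "fam alt n d F"
 shows "\<exists>\<pi>. nid n (length F) \<pi> &
  (\<forall>k I x. k ` I \<subseteq> FF n & x : Om2 I F & card (snd x) = 1 --> ev F (%i. \<pi> (k i)) x = 0)"
proof -
 define ls where "ls = map (%p v. snd p {#v#}) (filter (%p. fst p = 1) F)"
 have "\<forall>l\<in>set ls. additive n l"
 proof
  fix l assume "l : set ls"
  then obtain p where p: "p : set F" "fst p = 1" "l = (%v. snd p {#v#})" by (auto simp: ls_def)
  then have f: "form alt n 1 (snd p)" using assms unfolding fam_def by fastforce
  show "additive n l"
   unfolding additive_def p(3)
  proof (intro ballI)
   fix x y assume "x : FF n" "y : FF n"
   then show "snd p {#x + y#} = snd p {#x#} + snd p {#y#}" by (intro form_add[OF f]) auto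
  qed
 qed
 from kill_functionals[OF this] obtain \<pi> where \<pi>: "nid n (length ls) \<pi>" "\<forall>l\<in>set ls. \<forall>x\<in>FF n. l (\<pi> x) = 0"
  by blast
 have "length ls \<le> length F" unfolding ls_def by simp
 then have "nid n (length F) \<pi>" by (rule nid_mono[OF \<pi>(1)])
 moreover have "ev F (%i. \<pi> (k i)) x = 0" if kx: "k ` I \<subseteq> FF n & x : Om2 I F & card (snd x) = 1" for k I x
 proof -
  have x: "x : Om2 I F" and c: "card (snd x) = 1" and k: "k ` I \<subseteq> FF n" using kx by simp_all
  obtain j where j: "snd x = {j}" using c by (auto simp: card_1_singleton_iff)
  have "j : I" using Om2_D(2)[OF x] j by simp
  then have kj: "k j : FF n" using k by blast
  have "fst (F ! fst x) = 1" using Om2_D(3)[OF x] c by simp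
  then have "(%v. snd (F ! fst x) {#v#}) : set ls" using Om2_D(1)[OF x] by (auto simp: ls_def)
  from bspec[OF bspec[OF \<pi>(2) this] kj] show ?thesis by (simp add: ev_def j hm_def)
 qed
 ultimately show ?thesis by blast
qed

text \<open>A shift by a vector with value 1 changes the sign of the average, which would therefore
  be 0.\<close>

lemma linear_biased_zero:
 assumes T: "form alt n 1 T" and b: "bias n 1 T > 0" and a: "a : FF n"
 shows "T {#a#} = 0"
proof (rule ccontr)
 assume "T {#a#} ~= 0"
 then have Ta: "T {#a#} = 1" by (cases "T {#a#}") auto
 have "avg (FF n) (%x. \<chi> (T {#x#})) = avg (FF n) (%x. \<chi> (T {#x + a#}))"
  by (rule avg_shift[OF fin_grp_FF a, symmetric])
 also have "... = avg (FF n) (%x. (-1) * \<chi> (T {#x#}))"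
 proof (rule avg_cong)
  fix x assume x: "x : FF n"
  have "T {#x + a#} = T {#x#} + T {#a#}" by (rule form_add[OF T x a]) auto
  then show "\<chi> (T {#x + a#}) = (-1) * \<chi> (T {#x#})" unfolding Ta by (cases "T {#x#}") (auto simp: \<chi>_def)
 qed
 also have "... = (-1) * avg (FF n) (%x. \<chi> (T {#x#}))" by (rule avg_cmult_left)
 finally have "avg (FF n) (%x. \<chi> (T {#x#})) = 0" by simp
 then show False using b by (simp add: bias_def)
qed

section \<open>Derivatives at 0 and values at the cube points \<open>sum h T\<close>\<close>

lemma DM_determined:
 assumes "finite S" "!!T. T \<subseteq> S ==> Q (sum h T) = Q (sum k T)"
 shows "DM (hm h S) Q 0 = DM (hm k S) Q 0"
 using assms
proof (induction "card S" arbitrary: S rule: less_induct)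
 case less
 have e: "(\<Sum>J\<in>Pow S. DM (hm h J) Q 0) = DM (hm h S) Q 0 + (\<Sum>J\<in>Pow S - {S}. DM (hm h J) Q 0)" for h
  by (rule sum.remove) (use less.prems in auto)
 have "(\<Sum>J\<in>Pow S. DM (hm h J) Q 0) = (\<Sum>J\<in>Pow S. DM (hm k J) Q 0)"
  unfolding DM_expand[OF less.prems(1), symmetric] by (simp only: add_0 less.prems(2)[OF subset_refl])
 moreover have "(\<Sum>J\<in>Pow S - {S}. DM (hm h J) Q 0) = (\<Sum>J\<in>Pow S - {S}. DM (hm k J) Q 0)"
 proof (rule sum.cong[OF refl])
  fix J assume "J : Pow S - {S}"
  then have J: "J \<subset> S" by blast
  show "DM (hm h J) Q 0 = DM (hm k J) Q 0"
   by (rule less.hyps[OF psubset_card_mono[OF less.prems(1) J]])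
    (use J less.prems finite_subset[of J S] in auto)
 qed
 ultimately show ?case unfolding e by simp
qed

text \<open>The derivative along all \<open>d\<close> directions vanishes. Newton's expansion thus
  expresses the value at the top vertex by derivatives over proper subsets, and these only see the
  other vertices.\<close>

lemma cube_top:
 assumes Q: "pd n d Q" and h: "h ` {..<d} \<subseteq> FF n" "h' ` {..<d} \<subseteq> FF n"
  and eq: "!!I. I \<subset> {..<d} ==> Q (sum h I) = Q (sum h' I)"
 shows "Q (sum h {..<d}) = Q (sum h' {..<d})"
proof -
 have v: "(\<Sum>I\<in>Pow {..<d}. DM (hm k I) Q 0) = (\<Sum>I\<in>Pow {..<d} - {{..<d}}. DM (hm k I) Q 0)"
  if k: "k ` {..<d} \<subseteq> FF n" for k
 proof (rule sum.mono_neutral_right)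
  show "\<forall>I\<in>Pow {..<d} - (Pow {..<d} - {{..<d}}). DM (hm k I) Q 0 = 0"
  proof
   fix I assume "I : Pow {..<d} - (Pow {..<d} - {{..<d}})"
   then have "I = {..<d}" by blast
   then show "DM (hm k I) Q 0 = 0" using k by (intro DM_vanish[OF Q _ _ FF_zero]) (auto simp: set_hm)
  qed
 qed auto
 have "Q (sum k {..<d}) = (\<Sum>I\<in>Pow {..<d} - {{..<d}}. DM (hm k I) Q 0)"
  if k: "k ` {..<d} \<subseteq> FF n" for k
  using DM_expand[of "{..<d}" Q 0 k] v[OF k] by (simp only: finite_lessThan add_0 simp_thms)
 moreover have "DM (hm h I) Q 0 = DM (hm h' I) Q 0" if I: "I \<subset> {..<d}" for I
 proof (rule DM_determined)
  show "finite I" using I finite_subset by blast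
  show "Q (sum h T) = Q (sum h' T)" if "T \<subseteq> I" for T by (rule eq) (use that I in blast)
 qed
 ultimately show ?thesis using h by (auto intro!: sum.cong)
qed

text \<open>A single difference Q(y) - Q(0) is already killed by \<open>2 ^ d\<close>, which bounds
  the number of values independently of \<open>n\<close>.\<close>

lemma pd_values:
 assumes Q: "pd n d Q"
 shows "Q ` FF n \<subseteq> (%z. z + Q 0) ` {z. zmul (2 ^ d) z = 0}"
proof
 fix q assume "q : Q ` FF n"
 then obtain y where y: "y : FF n" "q = Q y" by blast
 have "zmul (2 ^ (Suc d - length [y])) (DL [y] Q 0) = 0"
  by (rule DL_torsion[OF pd_mono[OF Q] _ _ FF_zero]) (use y in auto)
 then have "zmul (2 ^ d) (Q y - Q 0) = 0" by simp
 then show "q : (%z. z + Q 0) ` {z. zmul (2 ^ d) z = 0}"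
  unfolding y(2) by (intro image_eqI[of _ _ "Q y - Q 0"]) auto
qed

lemma pd_values_card:
 assumes Q: "pd n d Q" and A: "A \<subseteq> Q ` FF n"
 shows "finite A" "card A \<le> 2 ^ d"
proof -
 let ?Z = "(%z. z + Q 0) ` {z. zmul (2 ^ d) z = 0}"
 have sub: "A \<subseteq> ?Z" using A pd_values[OF Q] by (rule subset_trans)
 have fin: "finite ?Z" using torsion_card(1) by (rule finite_imageI)
 show "finite A" using sub fin by (rule finite_subset)
 have "card A \<le> card ?Z" using fin sub by (rule card_mono)
 also have "... \<le> 2 ^ d" using card_image_le[OF torsion_card(1)] torsion_card(2) by (rule order_trans)
 finally show "card A \<le> 2 ^ d" .
qed

lemma half_values:
 assumes "A \<subseteq> range half"
 shows "finite A" "card A \<le> 2"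
proof -
 have s: "A \<subseteq> {half 0, half 1}"
 proof
  fix x assume "x : A"
  then obtain b where "x = half b" using assms by blast
  then show "x : {half 0, half 1}" by (cases b) auto
 qed
 show "finite A" using s by (rule finite_subset) simp
 have "card A \<le> card {half 0, half 1}" using s by (intro card_mono) auto
 then show "card A \<le> 2" by (simp add: card_insert_if split: if_splits)
qed

lemma ev_inv_dir:
 assumes \<pi>: "lin n \<pi>" and i: "i \<notin> snd x"
 shows "inv_dir (FF n) (VI I n) (sing i) (%h. half (ev F (%j. \<pi> (h j)) x))"
 unfolding inv_dir_def
proof (intro ballI)
 fix w a
 have "hm (%j. \<pi> ((w + sing i a) j)) (snd x) = hm (%j. \<pi> (w j)) (snd x)"
  by (rule hm_cong) (use i in \<open>auto simp: sing_def\<close>)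
 then show "half (ev F (%j. \<pi> ((w + sing i a) j)) x) = half (ev F (%j. \<pi> (w j)) x)"
  unfolding ev_def by (simp only:)
qed

lemma sum_inv_dir:
 assumes i: "i \<notin> \<omega>"
 shows "inv_dir (FF n) (VI I n) (sing i) (%h. Q (sum h \<omega>))"
 unfolding inv_dir_def
proof (intro ballI)
 fix w a
 have "sum (w + sing i a) \<omega> = sum w \<omega>"
  by (rule sum.cong[OF refl]) (use i in \<open>auto simp: sing_def\<close>)
 then show "Q (sum (w + sing i a) \<omega>) = Q (sum w \<omega>)" by (simp only:)
qed

lemma tb_structure_half:
 assumes "pd n (Suc d) P" "d \<ge> 1" "!!i. i < d ==> h i : FF n"
 shows "DM (hm h {..<d}) P 0 = half (tb P (hm h {..<d}))"
 by (rule DM_half[OF assms(1)]) (use assms in \<open>auto simp: set_hm\<close>)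

text \<open>The identity D_a D_a = -2 D_a turns doubling into a repetition of the argument
  \<open>h 0\<close>; the sign does not matter on 2-torsion.\<close>

lemma doubled_top:
 assumes P: "pd n (Suc d) P" and d: "d \<ge> 2" and h: "!!i. i < d - 1 ==> h i : FF n"
 shows "tb (%x. zmul 2 (P x)) (hm h {..<d - 1}) = tb P (hm (h(d - 1 := h 0)) {..<d})"
proof -
 define k where "k = h(d - 1 := h 0)"
 define M where "M = hm h ({..<d - 1} - {0})"
 have hM: "hm h {..<d - 1} = add_mset (h 0) M"
  unfolding M_def by (rule hm_remove) (use d in auto)
 have "hm k {..<d} = add_mset (k (d - 1)) (hm k ({..<d} - {d - 1}))" by (rule hm_remove) (use d in auto)
 also have "{..<d} - {d - 1} = {..<d - 1}" using d by auto
 also have "hm k {..<d - 1} = hm h {..<d - 1}" by (rule hm_cong) (auto simp: k_def)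
 also have "k (d - 1) = h 0" by (simp add: k_def)
 finally have kM: "hm k {..<d} = add_mset (h 0) (add_mset (h 0) M)" unfolding hM .
 have P2: "pd n (Suc (d - 1)) (%x. zmul 2 (P x))" using pd_double[OF P] d by simp
 have kF: "k i : FF n" if "i < d" for i using that h[of i] h[of 0] d by (auto simp: k_def)
 have "half (tb (%x. zmul 2 (P x)) (hm h {..<d - 1})) = DM (hm h {..<d - 1}) (%x. zmul 2 (P x)) 0"
  by (rule tb_structure_half[OF P2, symmetric]) (use d h in auto)
 also have "... = zmul 2 (DM (add_mset (h 0) M) P 0)" unfolding DM_zmul hM ..
 also have "... = - DM (hm k {..<d}) P 0" unfolding kM DM_double by simp
 also have "... = - half (tb P (hm k {..<d}))"
  by (rule arg_cong[OF tb_structure_half[OF P]]) (use d kF in auto)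
 also have "... = half (tb P (hm k {..<d}))"
  using half_double[of "tb P (hm k {..<d})"] by (metis add_eq_0_iff)
 finally show ?thesis unfolding k_def by (rule half_inj)
qed

text \<open>In the description with a repeated argument all contributing blocks have between 2 and d
  - 2 elements: singletons are zero by \<open>kill\<close>, and the complement of a block is a
  nonempty union of blocks of size at least 2. Such a block involves at most d - 2 of the d - 1
  variables, so \<open>box\<close> applies.\<close>

lemma doubled_bias:
 assumes P: "pd n (Suc d) P" and d: "d \<ge> 2" and F: "fam alt n d F" and K: "length F \<le> K"
  and supp: "!!X. f X ~= (0::bit) ==> X : PT {..<d} F"
  and rep: "!!h. h ` {..<d} \<subseteq> FF n ==> tb P (hm h {..<d}) = (\<Sum>X\<in>Pow (Zp F {..<d} h). f X)"
  and \<pi>: "lin n \<pi>"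
  and kill: "!!k I x. k ` I \<subseteq> FF n ==> x : Om2 I F ==> card (snd x) = 1 ==> ev F (%i. \<pi> (k i)) x = 0"
 shows "bias n (d - 1) (tb (%x. zmul 2 (P (\<pi> x)))) \<ge> (1 / real 2 ^ (K * 2 ^ d)) ^ (2 ^ (d - 1))"
proof -
 define up where "up h = h(d - 1 := h 0)" for h :: "nat => vec"
 define Om where "Om = {x\<in>Om2 {..<d} F. card (snd x) \<le> d - 2}"
 define g where "g x h = half (ev F (%i. \<pi> (up h i)) x)" for x h
 have P\<pi>: "pd n (Suc d) (%x. P (\<pi> x))" by (rule pd_lin[OF P \<pi>])
 have P2: "pd n (Suc (d - 1)) (%x. zmul 2 (P (\<pi> x)))" using pd_double[OF P\<pi>] d by simp
 have finOm: "finite Om" unfolding Om_def using Om2_finite[of "{..<d}" F] by simp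
 have upF: "up h i : FF n" if "h : VI {..<d - 1} n" for h i using VI_D[OF that] by (simp add: up_def)
 have S: "tb (%x. zmul 2 (P (\<pi> x))) (hm h {..<d - 1}) = (\<Sum>X\<in>Pow (Zp F {..<d} (%i. \<pi> (up h i))). f X)"
  if h: "h : VI {..<d - 1} n" for h
 proof -
  have "tb (%x. zmul 2 (P (\<pi> x))) (hm h {..<d - 1}) = tb (%x. P (\<pi> x)) (hm (up h) {..<d})"
   unfolding up_def by (rule doubled_top[OF P\<pi> d]) (rule VI_D[OF h])
  also have "... = tb P (hm (%i. \<pi> (up h i)) {..<d})"
   unfolding hm_image[symmetric] by (rule tb_lin[OF \<pi>]) (use upF[OF h] in \<open>auto simp: set_hm\<close>)
  also have "... = (\<Sum>X\<in>Pow (Zp F {..<d} (%i. \<pi> (up h i))). f X)"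
   by (rule rep) (use linD[OF \<pi> upF[OF h]] in auto)
  finally show ?thesis .
 qed
 have blocks: "X \<subseteq> Om" if X: "X : PT {..<d} F" "X \<subseteq> Zp F {..<d} (%i. \<pi> (up h i))"
  and h: "h : VI {..<d - 1} n" for X h
 proof
  fix x assume x: "x : X"
  have xO: "y : Om2 {..<d} F" if "y : X" for y using subsetD[OF PT_sub[OF X(1)] that] .
  have ge2: "card (snd y) \<ge> 2" if y: "y : X" for y
  proof -
   have "ev F (%i. \<pi> (up h i)) y = 1" using X(2) y by (auto simp: Zp_def)
   moreover have "up h ` {..<d} \<subseteq> FF n" using upF[OF h] by auto
   ultimately have "card (snd y) ~= 1" using kill[OF _ xO[OF y], of "up h"] by auto
   moreover have "card (snd y) ~= 0"
    using F nth_mem[OF Om2_D(1)[OF xO[OF y]]] Om2_D(3)[OF xO[OF y]] unfolding fam_def by fastforce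
   ultimately show ?thesis by linarith
  qed
  have lt: "card (snd x) < d"
   using F nth_mem[OF Om2_D(1)[OF xO[OF x]]] Om2_D(3)[OF xO[OF x]] unfolding fam_def by fastforce
  have finX: "finite X" by (rule PT_finite[OF _ X(1)]) simp
  have "\<exists>y\<in>X. y ~= x"
  proof (rule ccontr)
   assume "\<not> (\<exists>y\<in>X. y ~= x)"
   then have "X = {x}" using x by blast
   then show False using PT_sum[OF _ X(1)] lt by simp
  qed
  then obtain y where y: "y : X" "y ~= x" by blast
  have "card (snd x) + card (snd y) = (\<Sum>z\<in>{x, y}. card (snd z))" using y(2) by simp
  also have "... \<le> (\<Sum>z\<in>X. card (snd z))" by (rule sum_mono2[OF finX]) (use x y in auto)
  also have "... = d" using PT_sum[OF _ X(1)] by simp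
  finally have "card (snd x) \<le> d - 2" using ge2[OF y(1)] by linarith
  then show "x : Om" using xO[OF x] by (simp add: Om_def)
 qed
 have red: "(\<Sum>X\<in>Pow (Zp F {..<d} (%i. \<pi> (up h i))). f X)
   = (\<Sum>X\<in>Pow {x\<in>Om. ev F (%i. \<pi> (up h i)) x = 1}. f X)" if h: "h : VI {..<d - 1} n" for h
 proof (rule sum.mono_neutral_right)
  have "Zp F {..<d} (%i. \<pi> (up h i)) \<subseteq> Om2 {..<d} F" by (auto simp: Zp_def)
  then show "finite (Pow (Zp F {..<d} (%i. \<pi> (up h i))))"
   using finite_subset[OF _ Om2_finite[of "{..<d}" F]] by simp
  show "Pow {x\<in>Om. ev F (%i. \<pi> (up h i)) x = 1} \<subseteq> Pow (Zp F {..<d} (%i. \<pi> (up h i)))"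
   by (rule Pow_mono) (auto simp: Zp_def Om_def)
  show "\<forall>X\<in>Pow (Zp F {..<d} (%i. \<pi> (up h i))) - Pow {x\<in>Om. ev F (%i. \<pi> (up h i)) x = 1}. f X = 0"
  proof
   fix X assume X: "X : Pow (Zp F {..<d} (%i. \<pi> (up h i))) - Pow {x\<in>Om. ev F (%i. \<pi> (up h i)) x = 1}"
   show "f X = 0"
   proof (rule ccontr)
    assume "f X ~= 0"
    then have "X \<subseteq> Om" using blocks[OF supp _ h] X by blast
    then have "X : Pow {x\<in>Om. ev F (%i. \<pi> (up h i)) x = 1}" using X by (auto simp: Zp_def)
    then show False using X by blast
   qed
  qed
 qed
 show ?thesis
 proof (rule box[where G = "g ` Om" and alt = False])
  show "form False n (d - 1) (tb (%x. zmul 2 (P (\<pi> x))))" by (rule form_tb[OF P2]) (use d in auto)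
  show "d - 1 \<ge> 1" "(2::nat) \<ge> 1" using d by auto
  show "finite (g ` Om)" using finOm by simp
  have "card (g ` Om) \<le> card Om" by (rule card_image_le[OF finOm])
  also have "... \<le> card (Om2 {..<d} F)" by (rule card_mono) (auto simp: Om_def Om2_finite)
  also have "... \<le> length F * 2 ^ d" using Om2_card[of "{..<d}" F] by simp
  also have "... \<le> K * 2 ^ d" using K by simp
  finally show "card (g ` Om) \<le> K * 2 ^ d" .
 next
  fix q assume "q : g ` Om"
  then obtain x where x: "x : Om" "q = g x" by blast
  define J where "J = snd x"
  have xO: "x : Om2 {..<d} F" and "card (snd x) \<le> d - 2" using x(1) by (simp_all add: Om_def)
  then have J: "J \<subseteq> {..<d}" "card J \<le> d - 2" using Om2_D(2)[OF xO] by (simp_all add: J_def)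
  have finJ: "finite J" using J(1) finite_subset by blast
  \<comment> \<open>The variables occurring in the block: positions \<open>d - 1\<close> and 0 both
    carry variable 0.\<close>
  define J' where "J' = (if d - 1 : J then insert 0 (J - {d - 1}) else J)"
  have "card J' \<le> d - 2"
  proof (cases "d - 1 : J")
   case True
   have "card (insert 0 (J - {d - 1})) \<le> Suc (card (J - {d - 1}))" by (rule card_insert_le_m1) (use finJ in auto)
   also have "... = card J" using card_Suc_Diff1[OF finJ True] .
   finally show ?thesis using J(2) True by (simp add: J'_def)
  qed (use J in \<open>simp add: J'_def\<close>)
  have "\<not> {..<d - 1} \<subseteq> J'"
  proof
   assume "{..<d - 1} \<subseteq> J'"
   then have "card {..<d - 1} \<le> card J'" by (rule card_mono[rotated]) (use finJ in \<open>simp add: J'_def\<close>)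
   then show False using \<open>card J' \<le> d - 2\<close> d by simp
  qed
  then obtain i where i: "i < d - 1" "i \<notin> J'" by auto
  have iJ: "i \<notin> J" "i = 0 ==> d - 1 \<notin> J" using i by (auto simp: J'_def split: if_splits)
  have "inv_dir (FF n) (VI {..<d - 1} n) (sing i) q"
   unfolding inv_dir_def
  proof (intro ballI)
   fix w a
   have "\<pi> (up (w + sing i a) j) = \<pi> (up w j)" if "j : J" for j
   proof -
    have "up (w + sing i a) j = up w j"
     using iJ that by (cases "j = d - 1"; cases "i = 0") (auto simp: up_def sing_def)
    then show ?thesis by (rule arg_cong)
   qed
   then have "hm (%j. \<pi> (up (w + sing i a) j)) J = hm (%j. \<pi> (up w j)) J" by (rule hm_cong)
   then show "q (w + sing i a) = q w" unfolding x(2) g_def ev_def J_def by (simp only:)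
  qed
  then show "\<exists>i<d - 1. inv_dir (FF n) (VI {..<d - 1} n) (sing i) q" using i(1) by blast
  have "q ` VI {..<d - 1} n \<subseteq> range half" by (auto simp: x(2) g_def)
  then show "finite (q ` VI {..<d - 1} n) & card (q ` VI {..<d - 1} n) \<le> 2" using half_values by blast
 next
  fix h h' assume h: "h : VI {..<d - 1} n" "h' : VI {..<d - 1} n"
   and eq: "!!q. q : g ` Om ==> q h = q h'"
  have "ev F (%i. \<pi> (up h i)) x = ev F (%i. \<pi> (up h' i)) x" if "x : Om" for x
   using eq[OF imageI[OF that]] unfolding g_def by (rule half_inj)
  then have "{x\<in>Om. ev F (%i. \<pi> (up h i)) x = 1} = {x\<in>Om. ev F (%i. \<pi> (up h' i)) x = 1}"
   by (intro Collect_cong conj_cong refl) simp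
  then show "tb (%x. zmul 2 (P (\<pi> x))) (hm h {..<d - 1}) = tb (%x. zmul 2 (P (\<pi> x))) (hm h' {..<d - 1})"
   unfolding S[OF h(1)] S[OF h(2)] red[OF h(1)] red[OF h(2)] by (simp only:)
 qed
qed

text \<open>The top form of P \<circ> \<pi> is a function of block bits, and the top derivative of R
  is a function of the values of the \<open>Qs\<close> at the cube points. The full vertex is
  recovered from the others by \<open>cube_top\<close>; all the remaining data miss a variable, so
  that \<open>box\<close> gives a bias.\<close>

lemma corrected_bias:
 assumes P: "pd n (Suc d) P" and d: "d \<ge> 2" and F: "fam alt n d F" and K: "length F \<le> K"
  and supp: "!!X. f X ~= (0::bit) ==> X : PT {..<d} F"
  and rep: "!!h. h ` {..<d} \<subseteq> FF n ==> tb P (hm h {..<d}) = (\<Sum>X\<in>Pow (Zp F {..<d} h). f X)"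
  and \<pi>: "lin n \<pi>" and R: "pd n (Suc d) R" "frank n d L R"
  and two: "!!x. x : FF n ==> zmul 2 (R x) = zmul 2 (P (\<pi> x))"
 shows "bias n d (tb (%x. P (\<pi> x) - R x)) \<ge> (1 / real (2 ^ d) ^ ((K + L) * 2 ^ d)) ^ (2 ^ d)"
proof -
 let ?P = "%x. P (\<pi> x) - R x"
 obtain Qs where Qs: "length Qs \<le> L" "!!Q. Q : set Qs ==> pd n d Q"
  "!!x y. x : FF n ==> y : FF n ==> (\<forall>Q\<in>set Qs. Q x = Q y) ==> R x = R y"
  using R(2) unfolding frank_def by blast
 have P\<pi>: "pd n (Suc d) (%x. P (\<pi> x))" by (rule pd_lin[OF P \<pi>])
 have Pb: "pd n (Suc d) ?P" by (rule pd_diff[OF P\<pi> R(1)])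
 define g where "g x h = half (ev F (%i. \<pi> (h i)) x)" for x h
 define G1 where "G1 = g ` Om2 {..<d} F"
 define k where "k p h = fst p (sum h (snd p))" for p :: "(vec => circle) \<times> nat set" and h :: "nat => vec"
 \<comment> \<open>Only sums over proper subsets are listed, since the sum over all of
   \<open>{..<d}\<close> misses no variable.\<close>
 define Z where "Z = set Qs \<times> (Pow {..<d} - {{..<d}})"
 have finZ: "finite Z" by (simp add: Z_def)
 have cG1: "finite G1" "card G1 \<le> K * 2 ^ d"
 proof -
  show "finite G1" unfolding G1_def using Om2_finite[of "{..<d}" F] by simp
  have "card G1 \<le> card (Om2 {..<d} F)" unfolding G1_def by (rule card_image_le) (simp add: Om2_finite)
  also have "... \<le> length F * 2 ^ d" using Om2_card[of "{..<d}" F] by simp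
  also have "... \<le> K * 2 ^ d" using K by simp
  finally show "card G1 \<le> K * 2 ^ d" .
 qed
 have cG2: "card (k ` Z) \<le> L * 2 ^ d"
 proof -
  have "card (k ` Z) \<le> card Z" by (rule card_image_le[OF finZ])
  also have "... = card (set Qs) * card (Pow {..<d} - {{..<d}})" by (simp add: Z_def card_cartesian_product)
  also have "... \<le> L * 2 ^ d"
  proof (rule mult_le_mono)
   show "card (set Qs) \<le> L" using card_length[of Qs] Qs(1) by simp
   show "card (Pow {..<d} - {{..<d}}) \<le> 2 ^ d"
    using card_mono[of "Pow {..<d}" "Pow {..<d} - {{..<d}}"] by (simp add: card_Pow)
  qed
  finally show ?thesis .
 qed
 \<comment> \<open>Block bits have two values and polynomials of degree below \<open>d\<close> at
   most \<open>2 ^ d\<close>; the bound \<open>2 ^ d\<close> covers both kinds.\<close>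
 have B2: "(2::nat) \<le> 2 ^ d" using d by (metis self_le_power one_le_numeral less_le_trans pos2)
 have sumF: "sum h I : FF n" if "h : VI {..<d} n" for h and I :: "nat set"
  using VI_D[OF that] by (intro FF_sum) auto
 show ?thesis
 proof (rule box[where G = "G1 \<union> k ` Z" and alt = False])
  show "form False n d (tb ?P)" by (rule form_tb[OF Pb]) (use d in auto)
  show "d \<ge> 1" "(2::nat) ^ d \<ge> 1" using d by auto
  show "finite (G1 \<union> k ` Z)" using cG1 finZ by simp
  have "card (G1 \<union> k ` Z) \<le> card G1 + card (k ` Z)" by (rule card_Un_le)
  also have "... \<le> (K + L) * 2 ^ d" using cG1(2) cG2 by (simp add: add_mult_distrib)
  finally show "card (G1 \<union> k ` Z) \<le> (K + L) * 2 ^ d" .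
 next
  fix q assume "q : G1 \<union> k ` Z"
  then consider x where "x : Om2 {..<d} F" "q = g x" | p where "p : Z" "q = k p"
   unfolding G1_def by blast
  then have "(\<exists>i<d. inv_dir (FF n) (VI {..<d} n) (sing i) q) &
   finite (q ` VI {..<d} n) & card (q ` VI {..<d} n) \<le> 2 ^ d"
  proof cases
   case 1
   have "card (snd x) < d"
    using F nth_mem[OF Om2_D(1)[OF 1(1)]] Om2_D(3)[OF 1(1)] unfolding fam_def by fastforce
   moreover have "snd x \<subseteq> {..<d}" using Om2_D(2)[OF 1(1)] .
   ultimately have "snd x \<subset> {..<d}" by auto
   then obtain i where i: "i < d" "i \<notin> snd x" by auto
   have "inv_dir (FF n) (VI {..<d} n) (sing i) q"
    unfolding 1(2) g_def[abs_def] by (rule ev_inv_dir[OF \<pi> i(2)])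
   moreover have "q ` VI {..<d} n \<subseteq> range half" by (auto simp: 1(2) g_def)
   ultimately show ?thesis using half_values[of "q ` VI {..<d} n"] i(1) B2 by (meson order_trans)
  next
   case 2
   obtain Q \<omega> where p: "p = (Q, \<omega>)" by fastforce
   have Q: "Q : set Qs" and \<omega>: "\<omega> \<subset> {..<d}" using 2(1) by (auto simp: p Z_def)
   obtain i where i: "i < d" "i \<notin> \<omega>" using \<omega> by auto
   have q: "q = (%h. Q (sum h \<omega>))" unfolding 2(2) k_def[abs_def] p by simp
   have "inv_dir (FF n) (VI {..<d} n) (sing i) q" unfolding q by (rule sum_inv_dir[OF i(2)])
   moreover have "q ` VI {..<d} n \<subseteq> Q ` FF n" unfolding q using sumF by blast
   ultimately show ?thesis using pd_values_card[OF Qs(2)[OF Q], of "q ` VI {..<d} n"] i(1) by blast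
  qed
  then show "\<exists>i<d. inv_dir (FF n) (VI {..<d} n) (sing i) q"
   and "finite (q ` VI {..<d} n) & card (q ` VI {..<d} n) \<le> 2 ^ d" by simp_all
 next
  fix h h' assume h: "h : VI {..<d} n" "h' : VI {..<d} n"
   and eq: "!!q. q : G1 \<union> k ` Z ==> q h = q h'"
  have hF: "h ` {..<d} \<subseteq> FF n" "h' ` {..<d} \<subseteq> FF n" using VI_D[OF h(1)] VI_D[OF h(2)] by auto
  have bits: "ev F (%i. \<pi> (h i)) x = ev F (%i. \<pi> (h' i)) x" if "x : Om2 {..<d} F" for x
  proof -
   have "g x : G1 \<union> k ` Z" using that by (simp add: G1_def)
   from eq[OF this] show ?thesis unfolding g_def by (rule half_inj)
  qed
  have "Zp F {..<d} (%i. \<pi> (h i)) = Zp F {..<d} (%i. \<pi> (h' i))"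
   unfolding Zp_def by (intro Collect_cong conj_cong refl) (simp add: bits)
  moreover have tbP: "tb (%x. P (\<pi> x)) (hm k {..<d}) = (\<Sum>X\<in>Pow (Zp F {..<d} (%i. \<pi> (k i))). f X)"
   if k: "k ` {..<d} \<subseteq> FF n" for k
  proof -
   have "tb (%x. P (\<pi> x)) (hm k {..<d}) = tb P (hm (%i. \<pi> (k i)) {..<d})"
    unfolding hm_image[symmetric] by (rule tb_lin[OF \<pi>]) (use k in \<open>simp add: set_hm\<close>)
   also have "... = (\<Sum>X\<in>Pow (Zp F {..<d} (%i. \<pi> (k i))). f X)"
    by (rule rep) (use k linD[OF \<pi>] in blast)
   finally show ?thesis .
  qed
  ultimately have t: "tb (%x. P (\<pi> x)) (hm h {..<d}) = tb (%x. P (\<pi> x)) (hm h' {..<d})"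
   unfolding tbP[OF hF(1)] tbP[OF hF(2)] by (simp only:)
  have DP: "DM (hm h {..<d}) (%x. P (\<pi> x)) 0 = DM (hm h' {..<d}) (%x. P (\<pi> x)) 0"
  proof -
   have "DM (hm h {..<d}) (%x. P (\<pi> x)) 0 = half (tb (%x. P (\<pi> x)) (hm h {..<d}))"
    by (rule tb_structure_half[OF P\<pi>]) (use d hF in auto)
   moreover have "DM (hm h' {..<d}) (%x. P (\<pi> x)) 0 = half (tb (%x. P (\<pi> x)) (hm h' {..<d}))"
    by (rule tb_structure_half[OF P\<pi>]) (use d hF in auto)
   ultimately show ?thesis using t by simp
  qed
  have DR: "DM (hm h {..<d}) R 0 = DM (hm h' {..<d}) R 0"
  proof (rule DM_determined[OF finite_lessThan], rule Qs(3)[OF sumF[OF h(1)] sumF[OF h(2)]], rule ballI)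
   fix I Q assume I: "I \<subseteq> {..<d}" and Q: "Q : set Qs"
   have e: "Q (sum h J) = Q (sum h' J)" if "J \<subset> {..<d}" for J
   proof -
    have "(Q, J) : Z" using Q that by (auto simp: Z_def)
    then have "k (Q, J) : G1 \<union> k ` Z" by blast
    from eq[OF this] show ?thesis by (simp add: k_def)
   qed
   show "Q (sum h I) = Q (sum h' I)"
   proof (cases "I = {..<d}")
    case True
    then show ?thesis using cube_top[OF Qs(2)[OF Q] hF e] by simp
   next
    case False
    then have "I \<subset> {..<d}" using I by blast
    then show ?thesis by (rule e)
   qed
  qed
  show "tb ?P (hm h {..<d}) = tb ?P (hm h' {..<d})"
   unfolding tb_def DM_diff DP DR ..
 qed
qed

definition structured :: "bool => nat => nat => nat => (vec multiset => bit) => bool" where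
 "structured alt n d K T \<longleftrightarrow> (\<exists>F f. length F \<le> K & fam alt n d F & (\<forall>X. f X ~= (0::bit) --> X : PT {..<d} F) &
   (\<forall>X\<in>PT {..<d} F. \<forall>Y\<in>PT {..<d} F. btype X = btype Y --> f X = f Y) &
   (\<forall>h. h ` {..<d} \<subseteq> FF n --> T (hm h {..<d}) = (\<Sum>X\<in>Pow (Zp F {..<d} h). f X)))"

lemma biased_structured:
 assumes "d \<ge> 1" "\<delta> > 0"
 obtains K where "!!n T. form alt n d T ==> bias n d T \<ge> \<delta> ==> structured alt n d K T"
proof -
 from biased_form_structure[OF assms, of alt] obtain K where
  K: "\<forall>n T. form alt n d T & \<delta> \<le> bias n d T --> structured alt n d K T"
  unfolding structured_def[symmetric] by (elim exE)
 show ?thesis by (rule that[of K]) (rule K[rule_format], rule conjI)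
qed

text \<open>The tower length \<open>L\<close> is quantified inside the induction: length L + 1 for
  2P is needed for length L for P, because the first halving is spent on the square root R and the
  others on the tower above R. Only P \<circ> \<pi> is treated, so that linear changes can be
  accumulated.\<close>

theorem biased_top_form_chain:
 "\<forall>\<delta>>0. \<forall>L. \<exists>K. \<forall>n P. pd n (Suc (Suc e)) P & bias n (Suc e) (tb P) \<ge> \<delta> -->
  (\<exists>\<pi>. nid n K \<pi> & chain n (Suc e) K L (%x. P (\<pi> x)))"
proof (induction e)
 case 0
 show ?case
 proof (intro allI impI, rule exI[of _ 0], intro allI impI, elim conjE)
  fix \<delta> :: real and L n P assume \<delta>: "\<delta> > 0" and P: "pd n (Suc (Suc 0)) P" and b: "\<delta> \<le> bias n (Suc 0) (tb P)"
  have f: "form False n 1 (tb P)" by (rule form_tb) (use P in auto)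
  have c: "P 0 = P a" if a: "a : FF n" for a
  proof -
   have "tb P {#a#} = 0" by (rule linear_biased_zero[OF f _ a]) (use b \<delta> in simp)
   then have "DM {#a#} P 0 = 0" by (simp add: tb_def split: if_splits)
   then show ?thesis by (simp add: DM_add_mset)
  qed
  have "chain n (Suc 0) 0 L P" by (rule chain_cong[OF chain_const c])
  then show "\<exists>\<pi>. nid n 0 \<pi> & chain n (Suc 0) 0 L (%x. P (\<pi> x))"
   using nid_id[of n 0] by (intro exI[of _ "%x. x"]) simp
 qed
next
 case (Suc e)
 define d where "d = Suc (Suc e)"
 have d: "d \<ge> 2" "d \<ge> 1" "d - 1 = Suc e" "Suc (d - 1) = d" by (simp_all add: d_def)
 show ?case
 proof (intro allI impI)
  fix \<delta> :: real and L assume \<delta>: "\<delta> > 0"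
  obtain K1 where K1: "!!n T. form False n d T ==> bias n d T \<ge> \<delta> ==> structured False n d K1 T"
   by (rule biased_structured[OF d(2) \<delta>, of False]) blast
  define \<delta>1 where "\<delta>1 = (1 / real 2 ^ (K1 * 2 ^ d)) ^ (2 ^ (d - 1))"
  have \<delta>1: "\<delta>1 > 0" by (simp add: \<delta>1_def)
  obtain K2 where K2: "!!n P. pd n (Suc (Suc e)) P ==> bias n (Suc e) (tb P) \<ge> \<delta>1 ==>
   (\<exists>\<pi>. nid n K2 \<pi> & chain n (Suc e) K2 (Suc L) (%x. P (\<pi> x)))"
   using Suc.IH[rule_format, OF \<delta>1, of "Suc L"] by blast
  define \<delta>2 where "\<delta>2 = (1 / real (2 ^ d) ^ ((K1 + K2) * 2 ^ d)) ^ (2 ^ d)"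
  have \<delta>2: "\<delta>2 > 0" by (simp add: \<delta>2_def)
  obtain K3 where K3: "!!n T. form True n d T ==> bias n d T \<ge> \<delta>2 ==> structured True n d K3 T"
   by (rule biased_structured[OF d(2) \<delta>2, of True]) blast
  \<comment> \<open>The summand 1 is the rank of the remainder in \<open>integrate\<close>.\<close>
  define K where "K = K1 + K2 + K3 + 1"
  have main: "\<exists>\<pi>. nid n K \<pi> & chain n d K L (%x. P (\<pi> x))"
   if P: "pd n (Suc d) P" and b: "bias n d (tb P) \<ge> \<delta>" for n P
  proof -
   have f: "form False n d (tb P)" by (rule form_tb[OF P]) (use d in auto)
   obtain F f where F: "length F \<le> K1" "fam False n d F" "\<forall>X. f X ~= (0::bit) --> X : PT {..<d} F"
    "\<forall>X\<in>PT {..<d} F. \<forall>Y\<in>PT {..<d} F. btype X = btype Y --> f X = f Y"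
    "\<forall>h. h ` {..<d} \<subseteq> FF n --> tb P (hm h {..<d}) = (\<Sum>X\<in>Pow (Zp F {..<d} h). f X)"
    using K1[OF f b] unfolding structured_def by (elim exE conjE) (rule that)
   obtain \<pi>1 where \<pi>1: "nid n (length F) \<pi>1"
    "\<forall>k I x. k ` I \<subseteq> FF n & x : Om2 I F & card (snd x) = 1 --> ev F (%i. \<pi>1 (k i)) x = 0"
    using singles_killed[OF F(2)] by (elim exE conjE) (rule that)
   have lin1: "lin n \<pi>1" using \<pi>1(1) by (simp add: nid_def)
   have "bias n (d - 1) (tb (%x. zmul 2 (P (\<pi>1 x)))) \<ge> \<delta>1"
    unfolding \<delta>1_def by (rule doubled_bias[OF P d(1) F(2,1) F(3)[rule_format] F(5)[rule_format] lin1 \<pi>1(2)[rule_format, OF conjI, OF _ conjI]])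
   then have b1: "bias n (Suc e) (tb (%x. zmul 2 (P (\<pi>1 x)))) \<ge> \<delta>1" by (simp only: d(3))
   have "pd n d (%x. zmul 2 (P (\<pi>1 x)))" by (rule pd_double[OF pd_lin[OF P lin1] d(2)])
   then have p1: "pd n (Suc (Suc e)) (%x. zmul 2 (P (\<pi>1 x)))" by (simp only: d_def)
   obtain \<pi>2 where \<pi>2: "nid n K2 \<pi>2" "chain n (Suc e) K2 (Suc L) (%x. zmul 2 (P (\<pi>1 (\<pi>2 x))))"
    using K2[OF p1 b1] by blast
   have lin2: "lin n \<pi>2" using \<pi>2(1) by (simp add: nid_def)
   define \<pi> where "\<pi> x = \<pi>1 (\<pi>2 x)" for x
   have lin\<pi>: "lin n \<pi>" unfolding \<pi>_def by (rule lin_comp[OF lin1 lin2])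
   obtain R where R: "!!x. x : FF n ==> zmul 2 (R x) = zmul 2 (P (\<pi> x))"
    "pd n (Suc d) R" "frank n d K2 R" "chain n d K2 L R"
    using chain_root[OF \<pi>2(2)] unfolding \<pi>_def d_def by blast
   define Pb where "Pb x = P (\<pi> x) - R x" for x
   have Pb: "pd n (Suc d) Pb" unfolding Pb_def[abs_def] by (rule pd_diff[OF pd_lin[OF P lin\<pi>] R(2)])
   have Pb2: "zmul 2 (Pb x) = 0" if "x : FF n" for x
    unfolding Pb_def zmul_diff_right R(1)[OF that] by simp
   have b2: "bias n d (tb Pb) \<ge> \<delta>2"
    unfolding \<delta>2_def Pb_def[abs_def]
    by (rule corrected_bias[OF P d(1) F(2,1) F(3)[rule_format] F(5)[rule_format] lin\<pi> R(2,3,1)])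
   have f2: "form True n d (tb Pb)" by (rule form_tb[OF Pb]) (use d Pb2 in auto)
   obtain F' f' where F': "length F' \<le> K3" "fam True n d F'" "\<forall>X. f' X ~= (0::bit) --> X : PT {..<d} F'"
    "\<forall>X\<in>PT {..<d} F'. \<forall>Y\<in>PT {..<d} F'. btype X = btype Y --> f' X = f' Y"
    "\<forall>h. h ` {..<d} \<subseteq> FF n --> tb Pb (hm h {..<d}) = (\<Sum>X\<in>Pow (Zp F' {..<d} h). f' X)"
    using K3[OF f2 b2] unfolding structured_def by (elim exE conjE) (rule that)
   obtain \<pi>3 where \<pi>3: "nid n (length F') \<pi>3"
    "\<forall>k I x. k ` I \<subseteq> FF n & x : Om2 I F' & card (snd x) = 1 --> ev F' (%i. \<pi>3 (k i)) x = 0"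
    using singles_killed[OF F'(2)] by (elim exE conjE) (rule that)
   have lin3: "lin n \<pi>3" using \<pi>3(1) by (simp add: nid_def)
   have "chain n d (length F' + 1) L (%x. Pb (\<pi>3 x))"
   proof (rule integrate[OF F'(2) d(1) F'(3)[rule_format] F'(4)[rule_format] F'(5)[rule_format], where k = "%i. \<pi>3 (eu i)"])
    show "\<pi>3 (eu i) : FF n" if "i < n" for i by (rule linD[OF lin3 eu_FF[OF that]])
    show "ev F' (%i. \<pi>3 (eu i)) x = 0" if "x : Om2 {..<n} F'" "card (snd x) = 1" for x
     by (rule \<pi>3(2)[rule_format, OF conjI, OF _ conjI, OF _ that]) (use eu_FF in auto)
    show "pd n (Suc d) (%x. Pb (\<pi>3 x))" by (rule pd_lin[OF Pb lin3])
    show "zmul 2 (Pb (\<pi>3 x)) = 0" if "x : FF n" for x by (rule Pb2[OF linD[OF lin3 that]])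
    show "tb (%x. Pb (\<pi>3 x)) (hm eu U) = tb Pb (hm (%i. \<pi>3 (eu i)) U)" if "U \<subseteq> {..<n}" for U
    proof -
     have "finite U" using that finite_subset by blast
     then show ?thesis
      unfolding hm_image[symmetric] using that eu_FF by (intro tb_lin[OF lin3]) (auto simp: set_hm)
    qed
   qed
   \<comment> \<open>P \<circ> \<pi> is the sum of \<open>Pb\<close> and R, and both have towers
     after composition with \<open>\<pi>3\<close>.\<close>
   from chain_add[OF this chain_lin[OF R(4) lin3]]
   have "chain n d (length F' + 1 + K2) L (%x. P (\<pi> (\<pi>3 x)))" by (simp add: Pb_def)
   then have "chain n d K L (%x. P (\<pi> (\<pi>3 x)))" by (rule chain_mono) (use F'(1) in \<open>simp add: K_def\<close>)
   moreover have "nid n K (%x. \<pi> (\<pi>3 x))"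
    unfolding \<pi>_def
    by (rule nid_mono[OF nid_comp[OF nid_comp[OF \<pi>1(1) \<pi>2(1)] \<pi>3(1)]]) (use F(1) F'(1) in \<open>simp add: K_def\<close>)
   ultimately show ?thesis by blast
  qed
  show "\<exists>K. \<forall>n P. pd n (Suc (Suc (Suc e))) P & bias n (Suc (Suc e)) (tb P) \<ge> \<delta> -->
   (\<exists>\<pi>. nid n K \<pi> & chain n (Suc (Suc e)) K L (%x. P (\<pi> x)))"
  proof (rule exI[of _ K], intro allI impI, elim conjE)
   fix n P assume "pd n (Suc (Suc (Suc e))) P" "\<delta> \<le> bias n (Suc (Suc e)) (tb P)"
   from main[unfolded d_def, OF this] show "\<exists>\<pi>. nid n K \<pi> & chain n (Suc (Suc e)) K L (%x. P (\<pi> x))" .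
  qed
 qed
qed

text \<open>The bottom of the tower gives the rank of P \<circ> \<pi>, and \<open>frank_nid\<close>
  returns to P. Order 1 is treated apart because linear functionals do not have degree below 1;
  there P is constant.\<close>

theorem biased_top_form_rank:
 assumes d: "d \<ge> 1" and \<delta>: "\<delta> > 0"
 shows "\<exists>K. \<forall>n P. pd n (Suc d) P & bias n d (tb P) \<ge> \<delta> --> frank n d K P"
proof -
 obtain e where e: "d = Suc e" using d by (cases d) auto
 obtain K where K: "!!n P. pd n (Suc d) P ==> bias n d (tb P) \<ge> \<delta> ==>
   \<exists>\<pi>. nid n K \<pi> & chain n d K 0 (%x. P (\<pi> x))"
  using biased_top_form_chain[of e, rule_format, OF \<delta>, of 0] unfolding e by blast
 show ?thesis
 proof (cases "d = 1")
  case True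
  have "frank n d 0 P" if P: "pd n (Suc d) P" and b: "bias n d (tb P) \<ge> \<delta>" for n P
  proof (rule frank_const)
   fix a assume a: "a : FF n"
   have f: "form False n 1 (tb P)" by (rule form_tb) (use P True in auto)
   have "tb P {#a#} = 0" by (rule linear_biased_zero[OF f _ a]) (use b \<delta> True in simp)
   then have "DM {#a#} P 0 = 0" by (simp add: tb_def split: if_splits)
   then show "P a = P 0" by (simp add: DM_add_mset)
  qed
  then show ?thesis by blast
 next
  case False
  then have d2: "d \<ge> 2" using d by simp
  have "frank n d (K + K + 2 ^ K) P" if P: "pd n (Suc d) P" and b: "bias n d (tb P) \<ge> \<delta>" for n P
  proof -
   obtain \<pi> R where \<pi>: "nid n K \<pi>" and R: "\<forall>x\<in>FF n. R 0 x = P (\<pi> x)" "frank n (d + 0) K (R (0::nat))"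
    using K[OF P b] unfolding chain_def by blast
   have "frank n d K (R (0::nat))" using R(2) by simp
   then have "frank n d K (%x. P (\<pi> x))" by (rule frank_cong) (use R(1) in simp)
   then show ?thesis by (rule frank_nid[OF P d2 \<pi>])
  qed
  then show ?thesis by blast
 qed
qed

section \<open>Regular factors\<close>

lemma expansion_value:
 assumes c: "poly_expansion n d P \<alpha> c"
 defines "a \<equiv> %S. \<Sum>k\<in>{k. (S, k) : c}. circle_of_real (1 / 2 ^ (k + 1))"
 shows "finite c" "x : FF n ==> P x = \<alpha> + (\<Sum>S\<in>Pow {..<n}. zmul (mono S x) (a S))"
proof -
 have sub: "c \<subseteq> Pow {..<n} \<times> {..d}" using c by (auto simp: poly_expansion_def)
 show fin: "finite c" by (rule finite_subset[OF sub]) simp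
 have cS: "c = Sigma (Pow {..<n}) (%S. {k. (S, k) : c})" using sub by auto
 have fk: "finite {k. (S, k) : c}" for S by (rule finite_subset[of _ "{..d}"]) (use sub in auto)
 assume x: "x : FF n"
 have "P x = \<alpha> + circle_of_real (\<Sum>(S, k)\<in>c. (\<Prod>i\<in>S. of_bool (x i = 1)) / 2 ^ (k + 1))"
  using c x by (simp add: poly_expansion_def)
 also have "circle_of_real (\<Sum>(S, k)\<in>c. (\<Prod>i\<in>S. of_bool (x i = 1)) / 2 ^ (k + 1))
   = (\<Sum>p\<in>c. zmul (mono (fst p) x) (circle_of_real (1 / 2 ^ (snd p + 1))))"
  unfolding circle_of_real_sum
  by (rule sum.cong[OF refl]) (simp add: case_prod_beta zmul_circle_of_real mono_def)
 also have "... = (\<Sum>p\<in>Sigma (Pow {..<n}) (%S. {k. (S, k) : c}). zmul (mono (fst p) x) (circle_of_real (1 / 2 ^ (snd p + 1))))"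
  by (rule arg_cong[OF cS])
 also have "... = (\<Sum>S\<in>Pow {..<n}. \<Sum>k\<in>{k. (S, k) : c}. zmul (mono S x) (circle_of_real (1 / 2 ^ (k + 1))))"
  using fk by (subst sum.Sigma) (auto simp: case_prod_beta)
 finally show "P x = \<alpha> + (\<Sum>S\<in>Pow {..<n}. zmul (mono S x) (a S))"
  by (simp add: a_def zmul_sum_right)
qed

text \<open>Evaluation at sums of basis vectors and induction on \<open>S\<close> identify the
  coefficients of any expansion with derivatives at 0, so they do not depend on the
  expansion.\<close>

lemma expansion_cf:
 assumes c: "poly_expansion n d P \<alpha> c" and S: "S \<subseteq> {..<n}" "S ~= {}"
 shows "cf P S = (\<Sum>k\<in>{k. (S, k) : c}. circle_of_real (1 / 2 ^ (k + 1)))"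
proof -
 define a where "a S = (\<Sum>k\<in>{k. (S, k) : c}. circle_of_real (1 / 2 ^ (k + 1)))" for S
 have v: "P (sum eu T) = \<alpha> + (\<Sum>I\<in>Pow T. a I)" if T: "T \<subseteq> {..<n}" for T
 proof -
  have sF: "sum eu T : FF n" using T eu_FF by (intro FF_sum) auto
  have fin: "finite T" using T finite_subset by blast
  have "sum eu T i = (if i : T then 1 else 0)" for i
   unfolding sum_fun_apply' eu_def using fin by (simp add: sum.delta)
  then have m: "mono I (sum eu T) = of_bool (I \<subseteq> T)" if "I \<subseteq> {..<n}" for I
   using finite_subset[OF that] by (auto simp: mono_eq)
  have "(\<Sum>I\<in>Pow {..<n}. zmul (mono I (sum eu T)) (a I)) = (\<Sum>I\<in>Pow T. a I)"
   by (rule sum.mono_neutral_cong_right) (use T m in auto)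
  then show ?thesis using expansion_value(2)[OF c sF] by (simp add: a_def)
 qed
 have a0: "a {} = 0"
 proof -
  have "{k. ({}, k) : c} = {}" using c by (auto simp: poly_expansion_def)
  then show ?thesis unfolding a_def by (simp only: sum.empty)
 qed
 have cf0: "cf P {} = \<alpha>" using v[of "{}"] a0 by (simp add: cf_def)
 have "[|S \<subseteq> {..<n}; S ~= {}|] ==> cf P S = a S" for S
 proof (induction "card S" arbitrary: S rule: less_induct)
  case less
  have fin: "finite S" using less.prems(1) finite_subset by blast
  have "P (0 + sum eu S) = (\<Sum>I\<in>Pow S. cf P I)" unfolding cf_def by (rule DM_expand[OF fin])
  then have e: "(\<Sum>I\<in>Pow S. cf P I) = \<alpha> + (\<Sum>I\<in>Pow S. a I)" using v[OF less.prems(1)] by simp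
  have "(\<Sum>I\<in>Pow S. cf P I) = cf P S + (\<Sum>I\<in>Pow S - {S}. cf P I)" by (rule sum.remove) (use fin in auto)
  also have "(\<Sum>I\<in>Pow S - {S}. cf P I) = cf P {} + (\<Sum>I\<in>Pow S - {S} - {{}}. cf P I)"
   by (rule sum.remove) (use fin less.prems in auto)
  also note cf0
  also have "(\<Sum>I\<in>Pow S - {S} - {{}}. cf P I) = (\<Sum>I\<in>Pow S - {S} - {{}}. a I)"
  proof (rule sum.cong[OF refl])
   fix I assume "I : Pow S - {S} - {{}}"
   then have I: "I \<subset> S" "I ~= {}" by auto
   show "cf P I = a I" by (rule less.hyps[OF psubset_card_mono[OF fin I(1)] _ I(2)]) (use I less.prems in auto)
  qed
  finally have l: "(\<Sum>I\<in>Pow S. cf P I) = cf P S + (\<alpha> + (\<Sum>I\<in>Pow S - {S} - {{}}. a I))" .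
  have "(\<Sum>I\<in>Pow S. a I) = a S + (\<Sum>I\<in>Pow S - {S}. a I)" by (rule sum.remove) (use fin in auto)
  also have "(\<Sum>I\<in>Pow S - {S}. a I) = a {} + (\<Sum>I\<in>Pow S - {S} - {{}}. a I)"
   by (rule sum.remove) (use fin less.prems in auto)
  also note a0
  finally show ?case using e l by simp
 qed
 then show ?thesis using S by (simp add: a_def)
qed

text \<open>The largest \<open>k\<close> occurring with \<open>S\<close> shows in the exact torsion
  of the coefficient: after multiplication by 2^K all other terms are integers and 1/2 remains. This
  torsion is bounded by \<open>cf_torsion\<close>.\<close>

lemma expansion_depth:
 assumes P: "pd n (Suc d) P" and c: "poly_expansion n e P \<alpha> c" and Sk: "(S, k) : c"
 shows "k + 1 \<le> d"
proof (rule ccontr)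
 assume k: "\<not> k + 1 \<le> d"
 have S: "S \<subseteq> {..<n}" "S ~= {}" using c Sk by (auto simp: poly_expansion_def)
 have fin: "finite {k. (S, k) : c}"
 proof (rule finite_subset)
  show "{k. (S, k) : c} \<subseteq> {..e}" using c by (auto simp: poly_expansion_def)
 qed simp
 define A where "A = {k. (S, k) : c}"
 define K where "K = Max A"
 have finA: "finite A" and kA: "k : A" using fin Sk by (simp_all add: A_def)
 have K: "K : A" "!!j. j : A ==> j \<le> K" "k \<le> K"
  unfolding K_def using Max_in[OF finA] Max_ge[OF finA] kA by blast+
 have "card S \<ge> 1" using S finite_subset[of S "{..<n}"] by (simp add: Suc_le_eq card_gt_0_iff)
 then have "Suc d - card S \<le> K" using K(3) k by linarith
 then have "zmul (2 ^ K) (cf P S) = 0" by (rule zmul_pow_mono[OF cf_torsion[OF P S]])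
 then have "circle_of_real (\<Sum>j\<in>A. 2 ^ K / 2 ^ (j + 1)) = 0"
  unfolding expansion_cf[OF c S] A_def[symmetric]
  by (simp add: zmul_sum_right zmul_circle_of_real circle_of_real_sum)
 then have Z: "(\<Sum>j\<in>A. 2 ^ K / 2 ^ (j + 1) :: real) : \<int>" by (simp only: circle_of_real_eq_zero)
 have "(\<Sum>j\<in>A. 2 ^ K / 2 ^ (j + 1) :: real) = 2 ^ K / 2 ^ (K + 1) + (\<Sum>j\<in>A - {K}. 2 ^ K / 2 ^ (j + 1))"
  by (rule sum.remove) (use fin K in \<open>auto simp: A_def\<close>)
 moreover have "(\<Sum>j\<in>A - {K}. 2 ^ K / 2 ^ (j + 1) :: real) : \<int>"
 proof (rule Ints_sum)
  fix j assume "j : A - {K}"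
  then have "j + 1 \<le> K" using K(2)[of j] by auto
  then have "(2::real) ^ K / 2 ^ (j + 1) = 2 ^ (K - (j + 1))" by (simp add: power_diff)
  then show "(2::real) ^ K / 2 ^ (j + 1) : \<int>" by simp
 qed
 ultimately have "(2::real) ^ K / 2 ^ (K + 1) : \<int>" using Z by (metis Ints_diff add_diff_cancel_right')
 then have "(1 / 2 :: real) : \<int>" by simp
 then have "circle_of_real (1 / 2) = 0" by (simp only: circle_of_real_eq_zero)
 then show False using half_one_nonzero by (simp add: half_def)
qed

lemma depth_facts:
 assumes P: "pd n (Suc d) P" and z: "zero_shift n P"
 shows "P 0 = 0" "x : FF n ==> zmul (2 ^ (poly_depth n P + 1)) (P x) = 0" "poly_depth n P \<le> d"
proof -
 obtain e c where c: "poly_expansion n e P 0 c" using z by (auto simp: zero_shift_def)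
 define D where "D = {k. \<exists>d \<alpha> c S. poly_expansion n d P \<alpha> c & (S, k) : c}"
 have D: "k \<le> d" if "k : D" for k
 proof -
  obtain e' \<alpha> c' S where "poly_expansion n e' P \<alpha> c'" "(S, k) : c'" using \<open>k : D\<close> unfolding D_def by blast
  then show ?thesis using expansion_depth[OF P] by fastforce
 qed
 \<comment> \<open>Without a bound the supremum in the definition of \<open>poly_depth\<close> need
   not be an upper bound.\<close>
 have bdd: "bdd_above D" using D by (rule bdd_aboveI)
 have dep: "poly_depth n P = Sup D" by (simp add: poly_depth_def D_def)
 show "poly_depth n P \<le> d"
 proof (cases "D = {}")
  case True
  then show ?thesis unfolding dep by (simp add: Sup_nat_def)
 next
  case False
  then show ?thesis unfolding dep by (rule cSup_least) (rule D)
 qed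
 have kd: "k \<le> poly_depth n P" if "(S, k) : c" for S k
  unfolding dep by (rule cSup_upper[OF _ bdd]) (use that c in \<open>auto simp: D_def\<close>)
 show "zmul (2 ^ (poly_depth n P + 1)) (P x) = 0" if x: "x : FF n"
 proof -
  have "P x = circle_of_real (\<Sum>(S, k)\<in>c. (\<Prod>i\<in>S. of_bool (x i = 1)) / 2 ^ (k + 1))"
   using c x by (simp add: poly_expansion_def)
  then have "zmul (2 ^ (poly_depth n P + 1)) (P x)
   = circle_of_real (2 ^ (poly_depth n P + 1) * (\<Sum>(S, k)\<in>c. (\<Prod>i\<in>S. of_bool (x i = 1)) / 2 ^ (k + 1)))"
   by (simp add: zmul_circle_of_real)
  also have "... = 0"
   unfolding circle_of_real_eq_zero sum_distrib_left
  proof (rule Ints_sum)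
   fix p assume "p : c"
   obtain S k where p: "p = (S, k)" by fastforce
   have "k + 1 \<le> poly_depth n P + 1" using kd \<open>p : c\<close> p by simp
   then have "(2::real) ^ (poly_depth n P + 1) / 2 ^ (k + 1) = 2 ^ (poly_depth n P + 1 - (k + 1))"
    by (subst power_diff) auto
   then have e: "(2::real) ^ (poly_depth n P + 1) * (y / 2 ^ (k + 1)) = 2 ^ (poly_depth n P + 1 - (k + 1)) * y" for y
    by (metis mult.commute times_divide_eq_left times_divide_eq_right)
   have "(\<Prod>i\<in>S. of_bool (x i = 1) :: real) = of_int (mono S x)" by (simp add: mono_def)
   then show "2 ^ (poly_depth n P + 1) * (case p of (S, k) => (\<Prod>i\<in>S. of_bool (x i = 1)) / 2 ^ (k + 1)) : (\<int> :: real set)"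
    unfolding p case_prod_conv e by simp
  qed
  finally show ?thesis .
 qed
 have "(\<Sum>(S, k)\<in>c. (\<Prod>i\<in>S. of_bool ((0::vec) i = 1)) / 2 ^ (k + 1) :: real) = 0"
 proof (rule sum.neutral, rule ballI)
  fix p assume p: "p : c"
  obtain S k where Sk: "p = (S, k)" by fastforce
  have "S ~= {}" "S \<subseteq> {..<n}" using c p Sk by (auto simp: poly_expansion_def)
  then have "(\<Prod>i\<in>S. of_bool ((0::vec) i = 1) :: real) = 0" using finite_subset[of S "{..<n}"] by (auto simp: prod_zero_iff)
  then show "(case p of (S, k) => (\<Prod>i\<in>S. of_bool ((0::vec) i = 1)) / 2 ^ (k + 1)) = (0::real)" by (simp add: Sk)
 qed
 then show "P 0 = 0" using c FF_zero[of n] by (simp add: poly_expansion_def circle_of_real_zero)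
qed

lemma frank_d_rank:
 assumes "frank n d K Q"
 shows "d_rank n d Q \<le> enat K"
proof -
 obtain Qs where Qs: "length Qs \<le> K" "\<forall>P\<in>set Qs. pd n d P"
   "\<forall>x\<in>FF n. \<forall>y\<in>FF n. (\<forall>P\<in>set Qs. P x = P y) --> Q x = Q y"
  using assms unfolding frank_def by (elim exE conjE) (rule that)
 define \<Gamma> where "\<Gamma> l = Q (SOME x. x : FF n & map (%P. P x) Qs = l)" for l
 have \<Gamma>: "\<forall>x\<in>FF n. Q x = \<Gamma> (map (%P. P x) Qs)"
 proof
  fix x assume x: "x : FF n"
  define y where "y = (SOME y. y : FF n & map (%P. P y) Qs = map (%P. P x) Qs)"
  have y: "y : FF n & map (%P. P y) Qs = map (%P. P x) Qs"
   unfolding y_def by (rule someI[of _ x]) (use x in simp)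
  then have "\<forall>P\<in>set Qs. P x = P y" by (auto dest: sym)
  then have "Q x = Q y" using Qs(3)[rule_format, OF x, of y] y by simp
  then show "Q x = \<Gamma> (map (%P. P x) Qs)" by (simp add: \<Gamma>_def y_def)
 qed
 have "d_rank n d Q \<le> enat (length Qs)"
  unfolding d_rank_def
 proof (rule Inf_lower, rule CollectI, intro exI[of _ Qs] conjI)
  show "\<forall>P\<in>set Qs. poly_deg_less n d P" using Qs(2) by (simp add: pd_iff)
  show "\<exists>\<Gamma>. \<forall>x\<in>FF n. Q x = \<Gamma> (map (%P. P x) Qs)" by (rule exI[of _ \<Gamma>]) (rule \<Gamma>)
 qed simp
 also have "... \<le> enat K" using Qs(1) by simp
 finally show ?thesis .
qed

lemma degree_pd:
 assumes "pd n (Suc d) P"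
 shows "pd n (Suc (poly_degree n P)) P" "poly_degree n P \<le> d"
proof -
 have "poly_deg_le n d P" using assms by (simp add: poly_deg_le_def pd_iff)
 then have "poly_deg_le n (poly_degree n P) P" "poly_degree n P \<le> d"
  unfolding poly_degree_def by (rule LeastI, rule Least_le)
 then show "pd n (Suc (poly_degree n P)) P" "poly_degree n P \<le> d" by (simp_all add: poly_deg_le_def pd_iff)
qed

lemma factor_pd:
 assumes "poly_factor n Ps" "factor_degree n Ps \<le> d" "P : set Ps"
 shows "pd n (Suc d) P" "zero_shift n P"
proof -
 obtain e where "poly_deg_le n e P" using assms by (auto simp: poly_factor_def)
 then have "pd n (Suc e) P" by (simp add: poly_deg_le_def pd_iff)
 then have p: "pd n (Suc (poly_degree n P)) P" by (rule degree_pd)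
 have "poly_degree n P \<le> factor_degree n Ps" unfolding factor_degree_def using assms(3) by (intro Max_ge) auto
 then show "pd n (Suc d) P" using assms(2) by (intro pd_mono[OF p]) simp
 show "zero_shift n P" using assms by (simp add: poly_factor_def)
qed

text \<open>\<open>D\<close> is the degree used in the definition of the rank, the maximum over the
  multiples, which may exceed the degree of their sum. If the form of order \<open>D\<close> were
  biased, the combination would have \<open>D\<close>-rank at most \<open>K\<close>, contrary to
  regularity.\<close>

lemma regular_factor_bias:
 assumes f: "poly_factor n Ps" "factor_degree n Ps \<le> d" and reg: "regular_factor n r Ps"
  and K: "!!D n P. 1 \<le> D ==> D \<le> d ==> pd n (Suc D) P ==> bias n D (tb P) \<ge> \<delta> ==> frank n D K P"
  and r: "K \<le> r (length Ps)"
  and l: "i < length Ps" "\<not> 2 ^ (poly_depth n (Ps ! i) + 1) dvd (l i :: int)"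
 shows "\<exists>D. 1 \<le> D & D \<le> d & pd n (Suc D) (%x. \<Sum>i<length Ps. zmul (l i) ((Ps ! i) x)) &
  bias n D (tb (%x. \<Sum>i<length Ps. zmul (l i) ((Ps ! i) x))) < \<delta>"
proof -
 define Q where "Q x = (\<Sum>i<length Ps. zmul (l i) ((Ps ! i) x))" for x
 define D where "D = Max ((%i. poly_degree n (%x. zmul (l i) ((Ps ! i) x))) ` {..<length Ps})"
 have pdi: "pd n (Suc d) (%x. zmul (l i) ((Ps ! i) x))" if "i < length Ps" for i
  by (rule pd_zmul, rule factor_pd(1)[OF f]) (use that in simp)
 have Q: "pd n (Suc D) Q"
  unfolding Q_def[abs_def]
 proof (rule pd_sum)
  fix j assume j: "j : {..<length Ps}"
  have "poly_degree n (%x. zmul (l j) ((Ps ! j) x)) \<le> D" unfolding D_def using j by (intro Max_ge) auto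
  then show "pd n (Suc D) (%x. zmul (l j) ((Ps ! j) x))"
   using pd_mono[OF degree_pd(1)[OF pdi]] j by simp
 qed
 have Dd: "D \<le> d" unfolding D_def using l(1) degree_pd(2)[OF pdi] by (subst Max_le_iff) auto
 have "factor_rank n Ps \<le> d_rank n D Q"
  unfolding factor_rank_def D_def Q_def[abs_def]
  by (rule Inf_lower, rule CollectI, rule exI[of _ l]) (use l in \<open>auto simp: mod_eq_0_iff_dvd\<close>)
 then have rk: "d_rank n D Q > enat (r (length Ps))"
  using reg unfolding regular_factor_def by (rule order_less_le_trans[rotated])
 have nf: "\<not> frank n D L Q" if "L \<le> K" for L
 proof
  assume "frank n D L Q"
  then have "d_rank n D Q \<le> enat L" by (rule frank_d_rank)
  also have "... \<le> enat (r (length Ps))" using that r by simp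
  finally show False using rk by simp
 qed
 \<comment> \<open>In degree 0 the combination is constant and has rank 0, which regularity
   excludes; so a top form exists.\<close>
 have "D ~= 0"
 proof
  assume "D = 0"
  then have Q0: "pd n (Suc 0) Q" using Q by simp
  have "frank n D 0 Q"
  proof (rule frank_const)
   fix x assume x: "x : FF n"
   have "DL [x] Q 0 = 0" by (rule pdD[OF Q0 _ _ FF_zero]) (use x in auto)
   then show "Q x = Q 0" by simp
  qed
  then show False using nf[of 0] by simp
 qed
 then have D1: "1 \<le> D" by simp
 then have "bias n D (tb Q) < \<delta>" using K[OF D1 Dd Q] nf[of K] by (meson not_le order_refl)
 then show ?thesis using D1 Dd Q unfolding Q_def[abs_def] by blast
qed

lemma uniform_biased_rank:
 assumes "\<delta> > 0"
 shows "\<exists>K. \<forall>D n P. 1 \<le> D & D \<le> d & pd n (Suc D) P & bias n D (tb P) \<ge> \<delta> --> frank n D K P"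
proof (induction d)
 case (Suc d)
 then obtain K where K: "\<forall>D n P. 1 \<le> D & D \<le> d & pd n (Suc D) P & bias n D (tb P) \<ge> \<delta> --> frank n D K P"
  by blast
 obtain L where L: "\<forall>n P. pd n (Suc (Suc d)) P & bias n (Suc d) (tb P) \<ge> \<delta> --> frank n (Suc d) L P"
  using biased_top_form_rank[OF _ assms, of "Suc d"] by auto
 have "frank n D (max K L) P"
  if a: "1 \<le> D" "D \<le> Suc d" "pd n (Suc D) P" "bias n D (tb P) \<ge> \<delta>" for D n P
 proof (cases "D \<le> d")
  case True
  then have "frank n D K P" using K a by simp
  then show ?thesis by (rule frank_mono) simp
 next
  case False
  then have D: "D = Suc d" using a(2) by simp
  then have "frank n D L P" using L a(3,4) by simp
  then show ?thesis by (rule frank_mono) simp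
 qed
 then show ?case by blast
qed simp

section \<open>Characters of the circle and of its cyclic subgroups\<close>

lemma ee_eq_one: "ee x = 1 ==> x = 0"
proof (transfer, goal_cases)
 case (1 x)
 then have "cos (2 * pi * x) = 1" by (simp add: complex_eq_iff)
 then obtain k :: int where "2 * pi * x = of_int k * 2 * pi" by (auto simp: cos_one_2pi_int)
 then have "x = of_int k" by simp
 then show ?case by simp
qed

lemma ee_zmul_nat: "ee (zmul (int k) x) = ee x ^ k"
 by (induction k) (simp_all add: zmul_add_left ee_add)

lemma ee_sum: "ee (sum f I) = (\<Prod>i\<in>I. ee (f i))"
 by (induction I rule: infinite_finite_induct) (auto simp: ee_add)

text \<open>Orthogonality of the characters of a cyclic group of order \<open>2 ^ q\<close>, as a
  geometric sum.\<close>

lemma torsion_indicator: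
 assumes "zmul (2 ^ q) z = 0"
 shows "(\<Sum>l<2 ^ q. ee (zmul (int l) z)) = 2 ^ q * of_bool (z = 0)"
proof (cases "z = 0")
 case False
 then have ne: "ee z ~= 1" using ee_eq_one by blast
 have "ee z ^ (2 ^ q) = 1" using assms by (simp flip: ee_zmul_nat)
 then show ?thesis using geometric_sum[OF ne, of "2 ^ q"] False by (simp add: ee_zmul_nat)
qed simp

section \<open>Equidistribution of regular factors\<close>

lemma Ds_proj:
 assumes "\<forall>i\<in>set is. \<forall>a w. p (w + i a) = p w + a" "length as = length is"
 shows "Ds is as (%w. R (p w)) w = DL as R (p w)"
 using assms
proof (induction "is" arbitrary: as R)
 case (Cons i "is")
 obtain a as' where as: "as = a # as'" using Cons.prems(2) by (cases as) auto
 have "p (w + i a) = p w + a" for w using Cons.prems(1) by (meson list.set_intros(1))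
 then have "Ds (i # is) as (%w. R (p w)) = Ds is as' (%w. (%x. R (x + a) - R x) (p w))"
  unfolding as Ds.simps by (simp only:)
 moreover have "\<forall>j\<in>set is. \<forall>a w. p (w + j a) = p w + a" using Cons.prems(1) by (meson list.set_intros(2))
 ultimately show ?case using Cons.IH[of as' "%x. R (x + a) - R x"] Cons.prems(2) by (simp only: as DL.simps list.size)
qed simp

lemma sum_sing:
 assumes "finite J" "j : J"
 shows "sum (w + sing j a) J = sum w J + a"
proof -
 have "sum (w + sing j a) J = (\<Sum>i\<in>J. w i + sing j a i)" by (rule sum.cong[OF refl]) (rule plus_fun_apply)
 also have "... = sum w J + (\<Sum>i\<in>J. sing j a i)" by (rule sum.distrib)
 also have "(\<Sum>i\<in>J. sing j a i) = a" unfolding sing_def using assms by (simp only: sum.delta' sum.delta if_True)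
 finally show ?thesis .
qed

text \<open>Moving any coordinate in \<open>J\<close> moves the argument of \<open>R\<close>, while
  each \<open>g x\<close> misses one of them; so \<open>D\<close> differences leave only the
  derivative of \<open>R\<close> of order \<open>D\<close>. If \<open>card J < D\<close>, the list
  of directions is filled up with copies of \<open>j0\<close> that carry the constant function
  1.\<close>

lemma vn_bound:
 assumes R: "pd n (Suc D) R" "D \<ge> 1" and I: "finite I" "J \<subseteq> I" "J ~= {}" "card J \<le> D" and X: "finite X"
  and inv: "!!x. x : X ==> \<exists>j\<in>J. inv_dir (FF n) (VI I n) (sing j) (g x)"
  and le1: "!!x w. x : X ==> w : VI I n ==> cmod (g x w) \<le> 1"
 shows "cmod (avg (VI I n) (%h. ee (R (sum h J)) * (\<Prod>x\<in>X. g x h))) ^ (2 ^ D) \<le> bias n D (tb R)"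
proof -
 let ?W = "VI I n"
 have W: "fin_grp ?W" by (rule fin_grp_VI[OF I(1)])
 have finJ: "finite J" using I finite_subset by blast
 obtain j0 where j0: "j0 : J" using I(3) by blast
 obtain ms where ms: "\<forall>x\<in>X. ms x : J & inv_dir (FF n) ?W (sing (ms x)) (g x)"
  using bchoice[of X "%x j. j : J & inv_dir (FF n) ?W (sing j) (g x)"] inv by blast
 define H where "H j h = (\<Prod>x\<in>{x\<in>X. ms x = j}. g x h)" for j h
 obtain js where js: "set js = J" "distinct js" using finite_distinct_list[OF finJ] by blast
 define L where "L = map (%j. (sing j :: vec => _, H j)) js @ replicate (D - card J) (sing j0, %_. 1)"
 have lenjs: "length js = card J" using distinct_card[OF js(2)] js(1) by simp
 have lenL: "length L = D" using I(4) by (simp add: L_def lenjs)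
 have prodL: "prod_list (map (%(i, H). H h) L) = (\<Prod>x\<in>X. g x h)" for h
 proof -
  have "prod_list (map (%(i, H). H h) L) = prod_list (map (%j. H j h) js)"
   by (simp add: L_def comp_def)
  also have "... = (\<Prod>j\<in>J. H j h)" using prod.distinct_set_conv_list[OF js(2), of "%j. H j h"] js(1) by simp
  also have "... = (\<Prod>x\<in>X. g x h)" unfolding H_def by (rule prod.group[OF X finJ]) (use ms in auto)
  finally show ?thesis .
 qed
 have fstL: "\<exists>j\<in>J. i = sing j" if "i : set (map fst L)" for i
  using that j0 js(1) by (auto simp: L_def)
 obtain m where m: "D = Suc m" using R(2) by (cases D) auto
 have "cmod (avg ?W (%w. ee (R (sum w J)) * prod_list (map (%(i, H). H w) L))) ^ (2 ^ Suc m)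
   \<le> Re (EE (FF n) (Suc m) (%as. ee (half (tb R (mset as)))))"
 proof (rule phase_bound[OF W fin_grp_FF phase_ee])
  show "length L = Suc m" using lenL m by simp
  show "\<forall>(i, H)\<in>set L. dirhom (FF n) ?W i & (\<forall>w\<in>?W. cmod (H w) \<le> 1) & inv_dir (FF n) ?W i H"
  proof
   fix iH assume "iH : set L"
   then consider j where "j : J" "iH = (sing j, H j)" | "iH = (sing j0, %_. 1)"
    using js(1) by (auto simp: L_def)
   then show "case iH of (i, H) => dirhom (FF n) ?W i & (\<forall>w\<in>?W. cmod (H w) \<le> 1) & inv_dir (FF n) ?W i H"
   proof cases
    case 1
    have "dirhom (FF n) ?W (sing j)" by (rule dirhom_sing) (use 1 I in blast)
    moreover have "cmod (H j w) \<le> 1" if "w : ?W" for w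
     unfolding H_def prod_norm[symmetric] by (rule prod_le_1) (use le1 that in auto)
    moreover have "inv_dir (FF n) ?W (sing j) (H j)"
     unfolding inv_dir_def
    proof (intro ballI)
     fix w a assume wa: "w : ?W" "a : FF n"
     show "H j (w + sing j a) = H j w"
      unfolding H_def
     proof (rule prod.cong[OF refl])
      fix x assume "x : {x\<in>X. ms x = j}"
      then have "inv_dir (FF n) ?W (sing j) (g x)" using ms by auto
      then show "g x (w + sing j a) = g x w" using wa unfolding inv_dir_def by blast
     qed
    qed
    ultimately show ?thesis by (simp add: 1(2))
   next
    case 2
    have "dirhom (FF n) ?W (sing j0)" by (rule dirhom_sing) (use j0 I in blast)
    then show ?thesis by (simp add: 2 inv_dir_def)
   qed
  qed
  fix as w assume as: "length as = Suc m" "set as \<subseteq> FF n" and w: "w : ?W"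
  have sF: "sum w J : FF n" using VI_D[OF w] by (intro FF_sum) auto
  have "Ds (map fst L) as (%w. R (sum w J)) w = DL as R (sum w J)"
  proof (rule Ds_proj)
   show "\<forall>i\<in>set (map fst L). \<forall>a w. sum (w + i a) J = sum w J + a"
    using fstL sum_sing[OF finJ] by metis
   show "length as = length (map fst L)" using as lenL m by simp
  qed
  \<comment> \<open>One further derivative vanishes, so the derivative of order \<open>D\<close> is
    the same at \<open>sum w J\<close> and at 0.\<close>
  also have "... = DL as R 0"
  proof -
   have "DL (as @ [sum w J]) R 0 = 0"
    by (rule pdD[OF R(1) _ _ FF_zero]) (use as m sF in auto)
   then show ?thesis by (simp add: DL_append)
  qed
  also have "... = half (tb R (mset as))"
   unfolding DM_mset[symmetric] by (rule DM_half[OF R(1)]) (use as m in auto)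
  finally show "Ds (map fst L) as (%w. R (sum w J)) w = half (tb R (mset as))" .
 qed
 then show ?thesis by (simp only: prodL ee_half bias_def m)
qed

lemma DM_sum: "DM M (%x. \<Sum>i\<in>I. P i x) = (%x. \<Sum>i\<in>I. DM M (P i) x)"
 unfolding DM_def by (rule DL_sum)

lemma DM_eq_zero:
 assumes "set_mset M \<subseteq> FF n" "!!x. x : FF n ==> P x = 0"
 shows "DM M P 0 = 0"
 by (rule DM_vanish[of n 0]) (use assms FF_zero in \<open>auto simp: pd_def\<close>)

lemma hm_set_FF: "finite J ==> h : VI I n ==> set_mset (hm h J) \<subseteq> FF n"
 using VI_D by (auto simp: set_hm)

lemma prod_of_bool: "finite A ==> (\<Prod>p\<in>A. of_bool (b p)) = (of_bool (\<forall>p\<in>A. b p) :: complex)"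
 by (induction A rule: finite_induct) auto

text \<open>Regularity in the form in which it is used. In the application \<open>q i\<close> is the
  depth plus 1, and the threshold \<open>\<theta> ^ 2 ^ d\<close> leaves \<open>\<theta>\<close>
  after at most \<open>d\<close> applications of Cauchy-Schwarz.\<close>

locale equi_factor =
 fixes n d C :: nat and P :: "nat => vec => circle" and q :: "nat => nat" and \<theta> :: real
 assumes zero: "i < C ==> P i 0 = 0"
  and torsion: "i < C ==> x : FF n ==> zmul (2 ^ q i) (P i x) = 0"
  and \<theta>: "0 < \<theta>" "\<theta> \<le> 1"
  and reg: "i < C ==> \<not> 2 ^ q i dvd l i ==>
   \<exists>D. 1 \<le> D & D \<le> d & pd n (Suc D) (%x. \<Sum>i<C. zmul (l i) (P i x)) &
    bias n D (tb (%x. \<Sum>i<C. zmul (l i) (P i x))) < \<theta> ^ 2 ^ d"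
begin

definition \<Lambda> :: "'u set => ('u \<times> nat => nat) set" where
 "\<Lambda> U = PiE (U \<times> {..<C}) (%p. {..<2 ^ q (snd p)})"

definition \<Psi> :: "'u set => ('u => nat set) => ('u \<times> nat => nat) => (nat => vec) => circle" where
 "\<Psi> U S l h = (\<Sum>p\<in>U \<times> {..<C}. zmul (int (l p)) (P (snd p) (sum h (S (fst p)))))"

text \<open>The polynomial whose derivative along \<open>J\<close> is the part of order
  \<open>J\<close> in the expansion of \<open>\<Psi>\<close>: it collects the points whose linear
  form involves all variables of \<open>J\<close>.\<close>

definition R :: "'u set => ('u => nat set) => ('u \<times> nat => nat) => nat set => vec => circle" where
 "R U S l J x = (\<Sum>i<C. zmul (\<Sum>u\<in>U. if J \<subseteq> S u then int (l (u, i)) else 0) (P i x))"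

definition ord :: nat where
 "ord = (\<Prod>i<C. 2 ^ q i)"

lemma ord_pos: "ord > 0"
 by (simp add: ord_def)

lemma card_\<Lambda>: "finite U ==> card (\<Lambda> U) = ord ^ card U"
 using prod.cartesian_product[of "%u i. 2 ^ q i :: nat" "{..<C}" U]
 by (simp add: \<Lambda>_def ord_def card_PiE case_prod_beta)

lemma finite_\<Lambda>: "finite U ==> finite (\<Lambda> U)"
 unfolding \<Lambda>_def by (rule finite_PiE) auto

lemma indicator_expand:
 assumes U: "finite U" and S: "!!u. u : U ==> S u \<subseteq> I" and h: "h : VI I n" "k : VI I n"
 shows "of_bool (\<forall>u\<in>U. \<forall>i<C. P i (sum h (S u)) = P i (sum k (S u)))
   = (\<Sum>l\<in>\<Lambda> U. ee (\<Psi> U S l h - \<Psi> U S l k)) / of_nat (card (\<Lambda> U))"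
proof -
 let ?A = "U \<times> {..<C}"
 define z where "z p = P (snd p) (sum h (S (fst p))) - P (snd p) (sum k (S (fst p)))" for p
 have finA: "finite ?A" using U by simp
 have "sum h T : FF n" "sum k T : FF n" for T :: "nat set" using VI_D[OF h(1)] VI_D[OF h(2)] by (auto intro!: FF_sum)
 then have tz: "zmul (2 ^ q (snd p)) (z p) = 0" if "p : ?A" for p
  using that torsion by (auto simp: z_def zmul_diff_right)
 have "(\<Sum>l\<in>\<Lambda> U. ee (\<Psi> U S l h - \<Psi> U S l k)) = (\<Sum>l\<in>\<Lambda> U. \<Prod>p\<in>?A. ee (zmul (int (l p)) (z p)))"
  by (simp add: \<Psi>_def sum_subtractf[symmetric] zmul_diff_right[symmetric] z_def ee_sum)
 also have "... = (\<Prod>p\<in>?A. \<Sum>l<2 ^ q (snd p). ee (zmul (int l) (z p)))"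
  unfolding \<Lambda>_def by (rule prod_sum_PiE[symmetric]) (use finA in auto)
 also have "... = (\<Prod>p\<in>?A. 2 ^ q (snd p) * of_bool (z p = 0))"
  by (rule prod.cong[OF refl]) (rule torsion_indicator[OF tz])
 also have "... = of_nat (card (\<Lambda> U)) * (\<Prod>p\<in>?A. of_bool (z p = 0))"
  using finA by (simp add: prod.distrib \<Lambda>_def card_PiE)
 also have "(\<Prod>p\<in>?A. of_bool (z p = 0)) = (of_bool (\<forall>p\<in>?A. z p = 0) :: complex)"
  by (rule prod_of_bool[OF finA])
 also have "(\<forall>p\<in>?A. z p = 0) \<longleftrightarrow> (\<forall>u\<in>U. \<forall>i<C. P i (sum h (S u)) = P i (sum k (S u)))"
  by (auto simp: z_def)
 finally show ?thesis using card_\<Lambda>[OF U] ord_pos by (simp add: field_simps)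
qed

lemma \<Psi>_expand:
 assumes I: "finite I" and S: "!!u. u : U ==> S u \<subseteq> I"
 shows "\<Psi> U S l h = (\<Sum>J\<in>Pow I. DM (hm h J) (R U S l J) 0)"
proof -
 have "(\<Sum>J\<in>Pow I. DM (hm h J) (R U S l J) 0)
   = (\<Sum>J\<in>Pow I. \<Sum>i<C. \<Sum>u\<in>U. zmul (if J \<subseteq> S u then int (l (u, i)) else 0) (DM (hm h J) (P i) 0))"
  by (simp add: R_def[abs_def] DM_sum DM_zmul zmul_sum_left)
 also have "... = (\<Sum>i<C. \<Sum>u\<in>U. \<Sum>J\<in>Pow I. zmul (if J \<subseteq> S u then int (l (u, i)) else 0) (DM (hm h J) (P i) 0))"
  by (subst sum.swap, rule sum.cong[OF refl], rule sum.swap)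
 also have "... = (\<Sum>i<C. \<Sum>u\<in>U. zmul (int (l (u, i))) (P i (sum h (S u))))"
 proof (intro sum.cong refl)
  fix i u assume "u : U"
  then have Su: "S u \<subseteq> I" "finite (S u)" using S I finite_subset by blast+
  have "(\<Sum>J\<in>Pow I. zmul (if J \<subseteq> S u then int (l (u, i)) else 0) (DM (hm h J) (P i) 0))
    = (\<Sum>J\<in>Pow (S u). zmul (int (l (u, i))) (DM (hm h J) (P i) 0))"
   by (rule sum.mono_neutral_cong_right) (use I Su in auto)
  also have "... = zmul (int (l (u, i))) (P i (0 + sum h (S u)))"
   unfolding DM_expand[OF Su(2)] zmul_sum_right ..
  finally show "(\<Sum>J\<in>Pow I. zmul (if J \<subseteq> S u then int (l (u, i)) else 0) (DM (hm h J) (P i) 0))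
    = zmul (int (l (u, i))) (P i (sum h (S u)))" by (simp only: add_0)
 qed
 also have "... = (\<Sum>u\<in>U. \<Sum>i<C. zmul (int (l (u, i))) (P i (sum h (S u))))" by (rule sum.swap)
 also have "... = \<Psi> U S l h" by (simp add: \<Psi>_def sum.cartesian_product case_prod_beta)
 finally show ?thesis ..
qed

text \<open>Choose \<open>J\<close> maximal among the sets outside \<open>Js\<close> whose term in
  the expansion of \<open>\<Psi>\<close> is not identically 0, and let \<open>Q\<close> be its
  polynomial. The term is Q(sum h J) up to derivatives over proper subsets of \<open>J\<close>,
  every other nonzero term misses a variable of \<open>J\<close>, and so does the weight. The
  coefficients of \<open>Q\<close> cannot all be trivial, so regularity makes its top form unbiased
  and \<open>vn_bound\<close> applies.\<close>

lemma bad_character: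
 assumes I: "finite I" and Js: "Js \<subseteq> I"
  and S: "!!u. u : U ==> S u \<subseteq> I"
  and a1: "!!h. h : VI I n ==> \<bar>a h\<bar> \<le> 1" and ainv: "!!j. j : I - Js ==> inv_dir (FF n) (VI I n) (sing j) a"
  and bad: "J0 \<subseteq> I" "\<not> J0 \<subseteq> Js" "h0 : VI I n" "DM (hm h0 J0) (R U S l J0) 0 ~= 0"
 shows "cmod (avg (VI I n) (%h. ee (\<Psi> U S l h) * of_real (a h))) \<le> \<theta>"
proof -
 let ?W = "VI I n"
 define Bad where "Bad = {J\<in>Pow I. \<not> J \<subseteq> Js & (\<exists>h\<in>?W. DM (hm h J) (R U S l J) 0 ~= 0)}"
 have "finite Bad" "Bad ~= {}" using I bad by (auto simp: Bad_def)
 then obtain J where J: "J : Bad" "!!J'. J' : Bad ==> J \<subseteq> J' ==> J = J'"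
  using finite_has_maximal[of Bad] by blast
 have JI: "J \<subseteq> I" "\<not> J \<subseteq> Js" using J(1) by (auto simp: Bad_def)
 have finJ: "finite J" using JI I finite_subset by blast
 obtain h1 where h1: "h1 : ?W" "DM (hm h1 J) (R U S l J) 0 ~= 0" using J(1) by (auto simp: Bad_def)
 define \<mu> where "\<mu> i = (\<Sum>u\<in>U. if J \<subseteq> S u then int (l (u, i)) else 0)" for i
 define Q where "Q = R U S l J"
 have Q: "Q = (%x. \<Sum>i<C. zmul (\<mu> i) (P i x))" by (simp add: Q_def R_def[abs_def] \<mu>_def)
 have "\<exists>i<C. \<not> 2 ^ q i dvd \<mu> i"
 proof (rule ccontr)
  assume "\<not> (\<exists>i<C. \<not> 2 ^ q i dvd \<mu> i)"
  then have dv: "2 ^ q i dvd \<mu> i" if "i < C" for i using that by blast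
  have "Q x = 0" if x: "x : FF n" for x
   unfolding Q
  proof (rule sum.neutral, rule ballI)
   fix i assume i: "i : {..<C}"
   then obtain m where "\<mu> i = m * 2 ^ q i" using dv by (metis dvd_def lessThan_iff mult.commute)
   then show "zmul (\<mu> i) (P i x) = 0" using torsion[OF _ x] i by (simp flip: zmul_zmul)
  qed
  then have "DM (hm h1 J) Q 0 = 0" by (intro DM_eq_zero[OF hm_set_FF[OF finJ h1(1)]])
  then show False using h1(2) by (simp add: Q_def)
 qed
 then obtain D where D: "1 \<le> D" "D \<le> d" "pd n (Suc D) Q" "bias n D (tb Q) < \<theta> ^ 2 ^ d"
  using reg[of _ \<mu>] unfolding Q by blast
 have cJ: "card J \<le> D"
 proof (rule ccontr)
  assume "\<not> card J \<le> D"
  then have "DM (hm h1 J) Q 0 = 0" by (intro DM_vanish[OF D(3) _ hm_set_FF[OF finJ h1(1)] FF_zero]) simp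
  then show False using h1(2) by (simp add: Q_def)
 qed
 define X where "X = {J'\<in>Pow I. \<not> J \<subseteq> J'}"
 have finX: "finite X" using I by (simp add: X_def)
 define c where "c J' h = DM (hm h J') (R U S l J') 0 - (if J' \<subset> J then DM (hm h J') Q 0 else 0)" for J' h
 \<comment> \<open>The weight is attached to the factor with index \<open>Js\<close>, which belongs
   to \<open>X\<close> because \<open>J\<close> is not contained in \<open>Js\<close>.\<close>
 define g where "g J' h = ee (c J' h) * (if J' = Js then complex_of_real (a h) else 1)" for J' h
 have JsX: "Js : X" using Js JI by (simp add: X_def)
 have \<Psi>: "\<Psi> U S l h = Q (sum h J) + (\<Sum>J'\<in>X. c J' h)" if h: "h : ?W" for h
 proof -
  have "\<Psi> U S l h = (\<Sum>J'\<in>Pow I. DM (hm h J') (R U S l J') 0)" by (rule \<Psi>_expand[OF I S])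
  also have "... = (\<Sum>J'\<in>insert J X. DM (hm h J') (R U S l J') 0)"
  proof (rule sum.mono_neutral_right)
   show "\<forall>J'\<in>Pow I - insert J X. DM (hm h J') (R U S l J') 0 = 0"
   proof
    fix J' assume J': "J' : Pow I - insert J X"
    then have s: "J \<subseteq> J'" "J' ~= J" "J' : Pow I" by (auto simp: X_def)
    then have "J' \<notin> Bad" using J(2) by blast
    moreover have "\<not> J' \<subseteq> Js" using s JI by blast
    ultimately show "DM (hm h J') (R U S l J') 0 = 0" using s h by (auto simp: Bad_def)
   qed
  qed (use I JI in \<open>auto simp: X_def\<close>)
  also have "... = DM (hm h J) Q 0 + (\<Sum>J'\<in>X. DM (hm h J') (R U S l J') 0)"
   using finX by (subst sum.insert) (auto simp: X_def Q_def)
  also have "DM (hm h J) Q 0 = Q (sum h J) - (\<Sum>J'\<in>X. if J' \<subset> J then DM (hm h J') Q 0 else 0)"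
  proof -
   have "Q (0 + sum h J) = (\<Sum>J'\<in>Pow J. DM (hm h J') Q 0)" by (rule DM_expand[OF finJ])
   also have "... = DM (hm h J) Q 0 + (\<Sum>J'\<in>Pow J - {J}. DM (hm h J') Q 0)"
    by (rule sum.remove) (use finJ in auto)
   also have "(\<Sum>J'\<in>Pow J - {J}. DM (hm h J') Q 0) = (\<Sum>J'\<in>X. if J' \<subset> J then DM (hm h J') Q 0 else 0)"
    by (rule sum.mono_neutral_cong_left) (use finX JI in \<open>auto simp: X_def\<close>)
   finally have e: "Q (sum h J) = DM (hm h J) Q 0 + (\<Sum>J'\<in>X. if J' \<subset> J then DM (hm h J') Q 0 else 0)"
    by (simp only: add_0)
   show ?thesis unfolding e by (rule add_diff_cancel_right'[symmetric])
  qed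
  finally show ?thesis unfolding c_def sum_subtractf by (simp only: algebra_simps)
 qed
 have prod: "ee (\<Psi> U S l h) * of_real (a h) = ee (Q (sum h J)) * (\<Prod>J'\<in>X. g J' h)" if "h : ?W" for h
 proof -
  have "(\<Prod>J'\<in>X. if J' = Js then complex_of_real (a h) else 1) = complex_of_real (a h)"
   using finX JsX by (simp add: prod.delta)
  then show ?thesis by (simp add: \<Psi>[OF that] g_def prod.distrib ee_add ee_sum)
 qed
 have "cmod (avg ?W (%h. ee (Q (sum h J)) * (\<Prod>J'\<in>X. g J' h))) ^ (2 ^ D) \<le> bias n D (tb Q)"
 proof (rule vn_bound[OF D(3,1) I JI(1) _ cJ finX])
  show "J ~= {}" using JI by auto
  fix J' assume J': "J' : X"
  then obtain j where j: "j : J" "j \<notin> J'" by (auto simp: X_def)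
  have "inv_dir (FF n) ?W (sing j) (g J')"
   unfolding inv_dir_def
  proof (intro ballI)
   fix w b assume wb: "w : ?W" "b : FF n"
   have hm: "hm (w + sing j b) J' = hm w J'" by (rule hm_cong) (use j in \<open>auto simp: sing_def\<close>)
   have "a (w + sing j b) = a w" if "J' = Js"
   proof -
    have "j : I - Js" using j JI that by auto
    then show ?thesis using ainv wb unfolding inv_dir_def by blast
   qed
   then show "g J' (w + sing j b) = g J' w" unfolding g_def c_def hm by (cases "J' = Js") (simp_all only: if_True if_False)
  qed
  then show "\<exists>j\<in>J. inv_dir (FF n) ?W (sing j) (g J')" using j(1) by blast
  show "cmod (g J' w) \<le> 1" if "w : ?W" for w
   using phase_ee a1[OF that] by (simp add: g_def norm_mult phase_def)
 qed
 then have "cmod (avg ?W (%h. ee (\<Psi> U S l h) * of_real (a h))) ^ (2 ^ D) \<le> bias n D (tb Q)"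
  using avg_cong[of ?W "%h. ee (\<Psi> U S l h) * of_real (a h)", OF prod] by simp
 also have "... \<le> \<theta> ^ 2 ^ d" using D(4) by simp
 also have "... \<le> \<theta> ^ 2 ^ D" by (rule power_decreasing) (use \<theta> D(2) in auto)
 finally show ?thesis using \<theta>(1) by (subst (asm) power_mono_iff) auto
qed

text \<open>The target atoms are those of a tuple \<open>k\<close>, so they satisfy all relations
  forced by the linear forms. The weight \<open>a\<close> depends on the variables in
  \<open>Js\<close> only and lives where these variables already hit the atoms of
  \<open>k\<close>.\<close>

definition equidistributed :: "nat set => 'u set => ('u => nat set) => nat set => real => bool" where
 "equidistributed I U S Js \<rho> \<longleftrightarrow> (\<forall>k a. k : VI I n --> (\<forall>h\<in>VI I n. \<bar>a h\<bar> \<le> 1) -->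
   (\<forall>h\<in>VI I n. a h ~= 0 --> (\<forall>T i. T \<subseteq> Js --> i < C --> P i (sum h T) = P i (sum k T))) -->
   (\<forall>j\<in>I - Js. inv_dir (FF n) (VI I n) (sing j) a) -->
   \<bar>avg (VI I n) (%h. of_bool (\<forall>u\<in>U. \<forall>i<C. P i (sum h (S u)) = P i (sum k (S u))) * a h)
    - \<rho> * avg (VI I n) a\<bar> \<le> \<theta>)"

text \<open>A character whose terms outside \<open>Js\<close> vanish identically is constant on the
  support of the weight and contributes the full average; every other one contributes at most
  \<theta>. Thus \<open>\<rho>\<close> is the share of the characters of the first kind, and the
  trivial character gives its lower bound.\<close>

theorem equidistribution:
 fixes S :: "'u => nat set"
 assumes I: "finite I" and U: "finite U" and S: "!!u. u : U ==> S u \<subseteq> I" and Js: "Js \<subseteq> I"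
 obtains \<rho> where "\<rho> \<ge> 1 / real ord ^ card U" "equidistributed I U S Js \<rho>"
proof -
 let ?W = "VI I n"
 have W: "fin_grp ?W" by (rule fin_grp_VI[OF I])
 define good where "good l \<longleftrightarrow> (\<forall>J\<in>Pow I. \<not> J \<subseteq> Js --> (\<forall>h\<in>?W. DM (hm h J) (R U S l J) 0 = 0))" for l
 define Gd where "Gd = {l\<in>\<Lambda> U. good l}"
 define \<rho> where "\<rho> = real (card Gd) / real (card (\<Lambda> U))"
 have fin\<Lambda>: "finite (\<Lambda> U)" by (rule finite_\<Lambda>[OF U])
 have finGd: "finite Gd" using fin\<Lambda> by (simp add: Gd_def)
 have c\<Lambda>: "card (\<Lambda> U) > 0" using card_\<Lambda>[OF U] ord_pos by simp
 have l0: "restrict (%_. 0) (U \<times> {..<C}) : Gd"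
 proof -
  have R0: "R U S (restrict (%_. 0) (U \<times> {..<C})) J x = 0" for J x
   unfolding R_def
  proof (rule sum.neutral, rule ballI)
   fix i assume "i : {..<C}"
   then have "(\<Sum>u\<in>U. if J \<subseteq> S u then int (restrict (%_. 0) (U \<times> {..<C}) (u, i)) else 0) = 0"
    by (intro sum.neutral) auto
   then show "zmul (\<Sum>u\<in>U. if J \<subseteq> S u then int (restrict (%_. 0) (U \<times> {..<C}) (u, i)) else 0) (P i x) = 0"
    by (simp only: zmul_zero_left)
  qed
  have "good (restrict (%_. 0) (U \<times> {..<C}))"
   unfolding good_def
  proof (intro ballI impI)
   fix J h assume "J : Pow I" "h : ?W"
   then show "DM (hm h J) (R U S (restrict (%_. 0) (U \<times> {..<C})) J) 0 = 0"
    using finite_subset[of J I] I R0 by (intro DM_eq_zero[OF hm_set_FF]) auto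
  qed
  then show ?thesis by (auto simp: Gd_def \<Lambda>_def)
 qed
 have "card Gd \<ge> 1" using l0 finGd by (metis One_nat_def Suc_leI card_gt_0_iff empty_iff)
 then have \<rho>1: "\<rho> \<ge> 1 / real ord ^ card U"
  unfolding \<rho>_def card_\<Lambda>[OF U] of_nat_power by (intro divide_right_mono) auto
 show ?thesis
 proof (rule that[OF \<rho>1], unfold equidistributed_def, intro allI impI)
  fix k and a :: "(nat => vec) => real"
  assume k: "k : ?W" and a1': "\<forall>h\<in>?W. \<bar>a h\<bar> \<le> 1"
   and ak': "\<forall>h\<in>?W. a h ~= 0 --> (\<forall>T i. T \<subseteq> Js --> i < C --> P i (sum h T) = P i (sum k T))"
   and ainv': "\<forall>j\<in>I - Js. inv_dir (FF n) ?W (sing j) a"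
  note a1 = bspec[OF a1'] and ak = ak'[rule_format] and ainv = bspec[OF ainv']
  define E where "E l = avg ?W (%h. ee (\<Psi> U S l h - \<Psi> U S l k) * complex_of_real (a h))" for l
  define A where "A = avg ?W (%h. of_bool (\<forall>u\<in>U. \<forall>i<C. P i (sum h (S u)) = P i (sum k (S u))) * a h)"
  have "complex_of_real A = avg ?W (%h. of_bool (\<forall>u\<in>U. \<forall>i<C. P i (sum h (S u)) = P i (sum k (S u))) * complex_of_real (a h))"
   unfolding A_def avg_of_real[symmetric] by (rule avg_cong) simp
  also have "... = avg ?W (%h. (1 / of_nat (card (\<Lambda> U))) * (\<Sum>l\<in>\<Lambda> U. ee (\<Psi> U S l h - \<Psi> U S l k) * complex_of_real (a h)))"
  proof (rule avg_cong)
   fix h assume h: "h : ?W"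
   have "of_bool (\<forall>u\<in>U. \<forall>i<C. P i (sum h (S u)) = P i (sum k (S u))) * complex_of_real (a h)
    = (\<Sum>l\<in>\<Lambda> U. ee (\<Psi> U S l h - \<Psi> U S l k)) / of_nat (card (\<Lambda> U)) * complex_of_real (a h)"
    by (rule arg_cong2[OF indicator_expand[OF U S h k] refl])
   also have "... = (1 / of_nat (card (\<Lambda> U))) * (\<Sum>l\<in>\<Lambda> U. ee (\<Psi> U S l h - \<Psi> U S l k) * complex_of_real (a h))"
    unfolding sum_distrib_right[symmetric] by (simp only: times_divide_eq_left mult_1_left)
   finally show "of_bool (\<forall>u\<in>U. \<forall>i<C. P i (sum h (S u)) = P i (sum k (S u))) * complex_of_real (a h)
    = (1 / of_nat (card (\<Lambda> U))) * (\<Sum>l\<in>\<Lambda> U. ee (\<Psi> U S l h - \<Psi> U S l k) * complex_of_real (a h))" .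
  qed
  also have "... = (1 / of_nat (card (\<Lambda> U))) * (\<Sum>l\<in>\<Lambda> U. E l)"
   unfolding avg_cmult_left avg_sum E_def ..
  finally have A: "complex_of_real A = (1 / of_nat (card (\<Lambda> U))) * (\<Sum>l\<in>\<Lambda> U. E l)" .
  have \<Psi>e: "\<Psi> U S l h = (\<Sum>J\<in>Pow I. DM (hm h J) (R U S l J) 0)" for l h
   by (rule \<Psi>_expand[OF I S])
  have Egood: "E l = of_real (avg ?W a)" if l: "l : Gd" for l
   unfolding E_def avg_of_real[symmetric]
  proof (rule avg_cong)
   fix h assume h: "h : ?W"
   show "ee (\<Psi> U S l h - \<Psi> U S l k) * complex_of_real (a h) = complex_of_real (a h)"
   proof (cases "a h = 0")
    case False
    have "\<Psi> U S l h = \<Psi> U S l k"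
     unfolding \<Psi>e
    proof (rule sum.cong[OF refl])
     fix J assume J: "J : Pow I"
     show "DM (hm h J) (R U S l J) 0 = DM (hm k J) (R U S l J) 0"
     proof (cases "J \<subseteq> Js")
      case True
      show ?thesis
      proof (rule DM_determined)
       show "finite J" using J I finite_subset by blast
       fix T assume "T \<subseteq> J"
       then have "P i (sum h T) = P i (sum k T)" if "i < C" for i using ak[OF h False _ that] True by blast
       then show "R U S l J (sum h T) = R U S l J (sum k T)" by (simp add: R_def)
      qed
     next
      case False
      have "good l" using l by (simp add: Gd_def)
      then show ?thesis using False J h k by (simp add: good_def)
     qed
    qed
    then show ?thesis by simp
   qed simp
  qed
  have Ebad: "cmod (E l) \<le> \<theta>" if l: "l : \<Lambda> U - Gd" for l
  proof -
   have "\<not> good l" using l by (simp add: Gd_def)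
   then obtain J h where J: "J \<subseteq> I" "\<not> J \<subseteq> Js" "h : ?W" "DM (hm h J) (R U S l J) 0 ~= 0"
    by (auto simp: good_def)
   have b: "cmod (avg ?W (%h. ee (\<Psi> U S l h) * of_real (a h))) \<le> \<theta>"
    by (rule bad_character[OF I Js S a1 ainv J])
   have "E l = cnj (ee (\<Psi> U S l k)) * avg ?W (%h. ee (\<Psi> U S l h) * of_real (a h))"
    unfolding E_def avg_cmult_left[symmetric] using phase_ee by (simp add: phase_def mult_ac)
   then show ?thesis using b phase_ee by (simp add: norm_mult phase_def)
  qed
  have "(\<Sum>l\<in>\<Lambda> U. E l) = (\<Sum>l\<in>\<Lambda> U - Gd. E l) + (\<Sum>l\<in>Gd. E l)"
   by (rule sum.subset_diff[OF _ fin\<Lambda>]) (auto simp: Gd_def)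
  also have "(\<Sum>l\<in>Gd. E l) = of_nat (card Gd) * of_real (avg ?W a)" using Egood by simp
  finally have "complex_of_real (A - \<rho> * avg ?W a) = (1 / of_nat (card (\<Lambda> U))) * (\<Sum>l\<in>\<Lambda> U - Gd. E l)"
   unfolding of_real_diff A by (simp add: \<rho>_def algebra_simps)
  then have "\<bar>A - \<rho> * avg ?W a\<bar> = (1 / real (card (\<Lambda> U))) * cmod (\<Sum>l\<in>\<Lambda> U - Gd. E l)"
   by (metis norm_divide norm_mult norm_of_nat norm_of_real norm_one)
  also have "... \<le> (1 / real (card (\<Lambda> U))) * (real (card (\<Lambda> U)) * \<theta>)"
  proof (rule mult_left_mono)
   have "cmod (\<Sum>l\<in>\<Lambda> U - Gd. E l) \<le> (\<Sum>l\<in>\<Lambda> U - Gd. \<theta>)" by (rule sum_norm_le[OF Ebad])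
   also have "... = real (card (\<Lambda> U - Gd)) * \<theta>" by simp
   also have "... \<le> real (card (\<Lambda> U)) * \<theta>"
    using \<theta>(1) card_mono[OF fin\<Lambda>, of "\<Lambda> U - Gd"] by (intro mult_right_mono) auto
   finally show "cmod (\<Sum>l\<in>\<Lambda> U - Gd. E l) \<le> real (card (\<Lambda> U)) * \<theta>" .
  qed simp
  also have "... = \<theta>" using c\<Lambda> by simp
  finally show "\<bar>avg ?W (%h. of_bool (\<forall>u\<in>U. \<forall>i<C. P i (sum h (S u)) = P i (sum k (S u))) * a h)
    - \<rho> * avg ?W a\<bar> \<le> \<theta>" by (simp only: A_def)
 qed
qed

end

section \<open>Control by Gowers norms\<close>

lemma Dls_proj:
 assumes "\<forall>i\<in>set is. \<forall>a w. p (w + i a) = p w + a" "length as = length is"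
 shows "Dls is as (%w. G (p w)) w = Dls (map (%_ x. x) as) as G (p w)"
 using assms
proof (induction "is" arbitrary: as G)
 case (Cons i "is")
 obtain a as' where as: "as = a # as'" using Cons.prems(2) by (cases as) auto
 have "p (w + i a) = p w + a" for w using Cons.prems(1) by (meson list.set_intros(1))
 then have "Dl (i a) (%w. G (p w)) = (%w. Dl a G (p w))" unfolding Dl_def by (simp only:)
 moreover have "\<forall>j\<in>set is. \<forall>a w. p (w + j a) = p w + a" using Cons.prems(1) by (meson list.set_intros(2))
 ultimately show ?case using Cons.IH[of as' "Dl a G"] Cons.prems(2) by (simp only: as Dls.simps list.size list.map)
qed simp

fun MD :: "vec list => (vec => real) => vec => real" where
 "MD [] f = f"
| "MD (a # as) f = MD as (%x. f (x + a) * f x)"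

lemma Dls_MD: "Dls (map (%_ x. x) as) as (%x. complex_of_real (f x)) = (%x. complex_of_real (MD as f x))"
proof (induction as arbitrary: f)
 case (Cons a as)
 have "Dl a (%x. complex_of_real (f x)) = (%x. complex_of_real (f (x + a) * f x))" by (simp add: Dl_def fun_eq_iff)
 then show ?case using Cons.IH[of "%x. f (x + a) * f x"] by simp
qed simp

lemma Dls_mult: "Dls is as (%w. F w * G w) = (%w. Dls is as F w * Dls is as G w)"
proof (induction "is" as F arbitrary: G rule: Dls.induct)
 case (1 i "is" a as F)
 have "Dl (i a) (%w. F w * G w) = (%w. Dl (i a) F w * Dl (i a) G w)" by (simp add: Dl_def fun_eq_iff)
 then show ?case using 1 by simp
qed auto

lemma MD_append: "MD (as @ [a]) f x = MD as f (x + a) * MD as f x"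
 by (induction as arbitrary: f) auto

lemma MD_cube: "MD (map h [0..<m]) f x = (\<Prod>I\<in>Pow {..<m}. f (x + sum h I))"
proof (induction m arbitrary: x)
 case (Suc m)
 have "(\<Prod>I\<in>Pow {..<Suc m}. f (x + sum h I))
   = (\<Prod>I\<in>Pow {..<m}. f (x + sum h I)) * (\<Prod>I\<in>insert m ` Pow {..<m}. f (x + sum h I))"
  unfolding lessThan_Suc Pow_insert by (rule prod.union_disjoint) auto
 also have "(\<Prod>I\<in>insert m ` Pow {..<m}. f (x + sum h I)) = (\<Prod>I\<in>Pow {..<m}. f (x + sum h (insert m I)))"
  by (subst prod.reindex) (auto simp: inj_on_def)
 also have "... = (\<Prod>I\<in>Pow {..<m}. f (x + h m + sum h I))"
 proof (rule prod.cong[OF refl])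
  fix I assume I: "I : Pow {..<m}"
  have "sum h (insert m I) = h m + sum h I" by (rule sum.insert) (use I finite_subset in auto)
  then show "f (x + sum h (insert m I)) = f (x + h m + sum h I)" by (simp only: add.assoc)
 qed
 finally show ?case using MD_append[of "map h [0..<m]" "h m" f x] by (simp only: upt_Suc_append zero_le map_append list.map Suc.IH mult.commute)
qed simp

lemma avg_bij: "bij_betw p A B ==> avg B f = avg A (%x. f (p x))"
 unfolding avg_def using sum.reindex_bij_betw[of p A B f] bij_betw_same_card[of p A B] by simp

lemma avg_prod: "avg (A \<times> B) (%(a, b). f a b) = avg A (%a. avg B (%b. f a b))"
 by (simp add: avg_def sum.cartesian_product[symmetric] card_cartesian_product sum_divide_distrib[symmetric])

lemma VI_PiE: "bij_betw (%h. restrict h I) (VI I n) (I \<rightarrow>\<^sub>E FF n)"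
proof (rule bij_betw_byWitness[where f' = "%h i. if i : I then h i else 0"])
 show "\<forall>h\<in>VI I n. (%i. if i : I then restrict h I i else 0) = h" by (auto simp: VI_def fun_eq_iff)
 show "\<forall>h\<in>I \<rightarrow>\<^sub>E FF n. restrict (%i. if i : I then h i else 0) I = h"
  by (auto simp: fun_eq_iff restrict_def PiE_def extensional_def)
qed (auto simp: VI_def)

lemma gowers_EE:
 "Re (EE (FF n) m (%as. avg (FF n) (%x. complex_of_real (MD as f x)))) \<le> gowers_norm n m (%x. complex_of_real (f x)) ^ 2 ^ m"
proof -
 define F where "F h = avg (FF n) (%x. \<Prod>I\<in>Pow {..<m}. complex_of_real (f (x + sum h I)))" for h :: "nat => vec"
 have cr: "(cnj ^^ k) (complex_of_real r) = complex_of_real r" for k r by (induction k) auto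
 have "avg (FF n \<times> ({..<m} \<rightarrow>\<^sub>E FF n)) (%(x, h). \<Prod>I\<in>Pow {..<m}. (cnj ^^ card I) (complex_of_real (f (x + sum h I))))
   = avg ({..<m} \<rightarrow>\<^sub>E FF n) F"
  unfolding cr avg_prod F_def by (rule avg_swap)
 also have "... = avg (VI {..<m} n) (%h. F (restrict h {..<m}))" by (rule avg_bij[OF VI_PiE])
 also have "... = avg (VI {..<m} n) F"
 proof (rule avg_cong)
  fix h :: "nat => vec"
  have "sum (restrict h {..<m}) I = sum h I" if "I : Pow {..<m}" for I
   by (rule sum.cong[OF refl]) (use that in auto)
  then show "F (restrict h {..<m}) = F h" unfolding F_def by (intro avg_cong prod.cong refl) (simp only:)
 qed
 also have "... = EE (FF n) m (%as. avg (FF n) (%x. complex_of_real (MD as f x)))"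
  unfolding EE_VI F_def MD_cube by simp
 finally have e: "EE (FF n) m (%as. avg (FF n) (%x. complex_of_real (MD as f x)))
  = avg (FF n \<times> ({..<m} \<rightarrow>\<^sub>E FF n)) (%(x, h). \<Prod>I\<in>Pow {..<m}. (cnj ^^ card I) (complex_of_real (f (x + sum h I))))" ..
 have pw: "(c powr (1 / 2 ^ m)) ^ 2 ^ m = c" if "c \<ge> 0" for c :: real
 proof (cases "c = 0")
  case False
  then have "(c powr (1 / 2 ^ m)) ^ 2 ^ m = c powr (1 / 2 ^ m * real (2 ^ m))"
   by (subst powr_realpow[symmetric]) (use that in \<open>auto simp: powr_powr\<close>)
  then show ?thesis using that False by simp
 qed simp
 show ?thesis unfolding gowers_norm_def pw[OF norm_ge_zero] e by (rule complex_Re_le_cmod)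
qed

text \<open>All coordinates in \<open>\<Xi>\<close> are shifted together. In characteristic 2 the
  sum over \<open>V\<close> moves only if \<open>\<Xi> \<inter> V\<close> has odd size, which makes
  it possible to move one linear form and fix another.\<close>

definition msing :: "nat set => vec => nat => vec" where
 "msing \<Xi> a = (%j. if j : \<Xi> then a else 0)"

lemma dirhom_msing: "\<Xi> \<subseteq> I ==> dirhom (FF n) (VI I n) (msing \<Xi>)"
 by (auto simp: dirhom_def VI_def msing_def FF_zero)

lemma sum_const_vec: "finite A ==> (\<Sum>i\<in>A. a :: vec) = (if odd (card A) then a else 0)"
proof (induction A rule: finite_induct)
 case (insert i A)
 have "(\<Sum>i\<in>insert i A. a) = a + (\<Sum>i\<in>A. a)" using insert by (simp only: sum.insert simp_thms)
 then show ?case unfolding insert.IH using insert.hyps vec_add_self[of a] by (cases "odd (card A)") (simp_all only: card_insert_disjoint odd_Suc_minus_one even_Suc if_True if_False simp_thms add_0_right)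
qed simp

lemma sum_msing:
 assumes "finite V"
 shows "sum (w + msing \<Xi> a) V = sum w V + (if odd (card (\<Xi> \<inter> V)) then a else 0)"
proof -
 have "sum (w + msing \<Xi> a) V = (\<Sum>i\<in>V. w i + msing \<Xi> a i)" by (rule sum.cong[OF refl]) (rule plus_fun_apply)
 also have "... = sum w V + (\<Sum>i\<in>V. msing \<Xi> a i)" by (rule sum.distrib)
 also have "(\<Sum>i\<in>V. msing \<Xi> a i) = (\<Sum>i\<in>\<Xi> \<inter> V. a)"
  by (rule sum.mono_neutral_cong_right) (use assms in \<open>auto simp: msing_def\<close>)
 also have "... = (if odd (card (\<Xi> \<inter> V)) then a else 0)" by (rule sum_const_vec) (use assms in simp)
 finally show ?thesis .
qed

text \<open>A single element of \<open>V\<close> outside \<open>S\<close> will do; if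
  \<open>V\<close> lies inside \<open>S\<close>, an element of \<open>V\<close> together with an
  element of \<open>S\<close> outside \<open>V\<close>.\<close>

lemma separating_direction:
 assumes "finite I" "V \<subseteq> I" "S \<subseteq> I" "V ~= {}" "V ~= S"
 obtains \<Xi> where "\<Xi> \<subseteq> I" "odd (card (\<Xi> \<inter> V))" "even (card (\<Xi> \<inter> S))"
proof (cases "V \<subseteq> S")
 case False
 then obtain j where j: "j : V" "j \<notin> S" by blast
 then have "{j} \<inter> V = {j}" "{j} \<inter> S = {}" by auto
 then show ?thesis using that[of "{j}"] j assms(2) by auto
next
 case True
 then obtain j i where j: "j : V" "i : S" "i \<notin> V" using assms by blast
 then have "{j, i} \<inter> V = {j}" "{j, i} \<inter> S = {j, i}" "j ~= i" using True by auto
 then show ?thesis using that[of "{j, i}"] j assms by auto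
qed

lemma avg_projection:
 assumes I: "finite I" "V \<subseteq> I" "j : V"
 shows "avg (VI I n) (%w. F (sum w V)) = avg (FF n) F"
proof -
 let ?W = "VI I n"
 have W: "fin_grp ?W" by (rule fin_grp_VI[OF I(1)])
 have finV: "finite V" using I finite_subset by blast
 have sV: "sum w V : FF n" if "w : ?W" for w using VI_D[OF that] by (intro FF_sum) auto
 have "avg ?W (%w. F (sum w V)) = avg (FF n) (%a. avg ?W (%w. F (sum w V)))"
  using FF_card_pos[of n] by (simp add: avg_const)
 also have "... = avg (FF n) (%a. avg ?W (%w. F (a + sum w V)))"
 proof (rule avg_cong)
  fix a assume a: "a : FF n"
  have "sing j a : ?W" using dirhom_sing[of j I n] a I by (auto simp: dirhom_def)
  then have "avg ?W (%w. F (sum w V)) = avg ?W (%w. F (sum (w + sing j a) V))"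
   by (rule avg_shift[OF W, symmetric])
  then show "avg ?W (%w. F (sum w V)) = avg ?W (%w. F (a + sum w V))"
   unfolding sum_sing[OF finV I(3)] by (simp only: add.commute)
 qed
 also have "... = avg ?W (%w. avg (FF n) (%a. F (a + sum w V)))" by (rule avg_swap)
 also have "... = avg ?W (%w. avg (FF n) F)"
  by (rule avg_cong) (rule avg_shift[OF fin_grp_FF sV])
 also have "... = avg (FF n) F" using fin_grp_card[OF W] by (simp add: avg_const)
 finally show ?thesis .
qed

text \<open>Each other factor is invariant in a direction that moves \<open>sum h V\<close>. After d
  + 1 differences the phase of degree at most \<open>d\<close> is gone and the Gowers average of
  \<open>f\<close> is left; if there are fewer factors, the directions are completed with a
  coordinate of \<open>V\<close>.\<close>

lemma gowers_control:
 assumes I: "finite I" "V \<subseteq> I" "V ~= {}" and f: "!!x. x : FF n ==> \<bar>f x\<bar> \<le> 1"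
  and Q: "pd n (Suc d) Q" and U: "finite U" "card U \<le> Suc d"
  and g1: "!!u w. u : U ==> w : VI I n ==> cmod (g u w) \<le> 1"
  and inv: "!!u. u : U ==> \<exists>\<Xi>. \<Xi> \<subseteq> I & odd (card (\<Xi> \<inter> V)) & inv_dir (FF n) (VI I n) (msing \<Xi>) (g u)"
 shows "cmod (avg (VI I n) (%h. complex_of_real (f (sum h V)) * ee (Q (sum h V)) * (\<Prod>u\<in>U. g u h)))
  \<le> gowers_norm n (Suc d) (%x. complex_of_real (f x))"
proof -
 let ?W = "VI I n"
 have W: "fin_grp ?W" by (rule fin_grp_VI[OF I(1)])
 have finV: "finite V" using I finite_subset by blast
 obtain j where j: "j : V" using I(3) by blast
 obtain X where X: "\<forall>u\<in>U. X u \<subseteq> I & odd (card (X u \<inter> V)) & inv_dir (FF n) ?W (msing (X u)) (g u)"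
  using bchoice[of U "%u \<Xi>. \<Xi> \<subseteq> I & odd (card (\<Xi> \<inter> V)) & inv_dir (FF n) ?W (msing \<Xi>) (g u)"] inv by blast
 obtain us where us: "set us = U" "distinct us" using finite_distinct_list[OF U(1)] by blast
 define L where "L = map (%u. (msing (X u), g u)) us @ replicate (Suc d - card U) (msing {j}, %_. 1)"
 have jV: "{j} \<inter> V = {j}" using j by auto
 have lenL: "length L = Suc d" using distinct_card[OF us(2)] us(1) U(2) by (simp add: L_def)
 have prodL: "prod_list (map (%(i, H). H h) L) = (\<Prod>u\<in>U. g u h)" for h
 proof -
  have "prod_list (map (%(i, H). H h) L) = prod_list (map (%u. g u h) us)" by (simp add: L_def comp_def)
  also have "... = (\<Prod>u\<in>U. g u h)" using prod.distinct_set_conv_list[OF us(2), of "%u. g u h"] us(1) by simp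
  finally show ?thesis .
 qed
 define G where "G x = complex_of_real (f x) * ee (Q x)" for x
 have sV: "sum w V : FF n" if "w : ?W" for w using VI_D[OF that] by (intro FF_sum) auto
 have "cmod (avg ?W (%w. G (sum w V) * prod_list (map (%(i, H). H w) L))) ^ (2 ^ Suc d)
   \<le> Re (EE (FF n) (Suc d) (%as. avg ?W (Dls (map fst L) as (%w. G (sum w V)))))"
 proof (rule directional_CS[OF W fin_grp_FF lenL])
  show "\<forall>w\<in>?W. cmod (G (sum w V)) \<le> 1" using f[OF sV] phase_ee by (auto simp: G_def norm_mult phase_def)
  show "\<forall>(i, H)\<in>set L. dirhom (FF n) ?W i & (\<forall>w\<in>?W. cmod (H w) \<le> 1) & inv_dir (FF n) ?W i H"
  proof
   fix iH assume "iH : set L"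
   then consider u where "u : U" "iH = (msing (X u), g u)" | "iH = (msing {j}, %_. 1)"
    using us(1) by (auto simp: L_def)
   then show "case iH of (i, H) => dirhom (FF n) ?W i & (\<forall>w\<in>?W. cmod (H w) \<le> 1) & inv_dir (FF n) ?W i H"
   proof cases
    case 1
    then show ?thesis using X g1[OF 1(1)] dirhom_msing[of "X u" I n] by simp
   next
    case 2
    have "{j} \<subseteq> I" using j I by blast
    then show ?thesis using dirhom_msing[of "{j}" I n] by (simp add: 2 inv_dir_def)
   qed
  qed
 qed
 also have "EE (FF n) (Suc d) (%as. avg ?W (Dls (map fst L) as (%w. G (sum w V))))
   = EE (FF n) (Suc d) (%as. avg (FF n) (%x. complex_of_real (MD as f x)))"
 proof (rule EE_cong)
  fix as assume as: "length as = Suc d" "set as \<subseteq> FF n"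
  have "avg ?W (Dls (map fst L) as (%w. G (sum w V))) = avg ?W (%w. Dls (map (%_ x. x) as) as G (sum w V))"
  proof (rule avg_cong, rule Dls_proj)
   show "\<forall>i\<in>set (map fst L). \<forall>a w. sum (w + i a) V = sum w V + a"
   proof (intro ballI allI)
    fix i a w assume "i : set (map fst L)"
    then obtain \<Xi> where "i = msing \<Xi>" "odd (card (\<Xi> \<inter> V))" using X us(1) jV by (auto simp: L_def)
    then show "sum (w + i a) V = sum w V + a" using sum_msing[OF finV, of w \<Xi> a] by (simp only: if_True simp_thms)
   qed
  qed (use as lenL in simp)
  also have "... = avg (FF n) (Dls (map (%_ x. x) as) as G)" by (rule avg_projection[OF I(1,2) j])
  also have "... = avg (FF n) (%x. complex_of_real (MD as f x))"
  proof (rule avg_cong)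
   fix x assume x: "x : FF n"
   have "Ds (map (%_ x. x) as) as Q x = DL as Q x" by (rule Ds_proj[where p = "%x. x"]) auto
   also have "... = 0" by (rule pdD[OF Q as x])
   finally show "Dls (map (%_ x. x) as) as G x = complex_of_real (MD as f x)"
    unfolding G_def[abs_def] Dls_mult Dls_MD Dls_phase[OF phase_ee] by simp
  qed
  finally show "avg ?W (Dls (map fst L) as (%w. G (sum w V))) = avg (FF n) (%x. complex_of_real (MD as f x))" .
 qed
 also have "Re ... \<le> gowers_norm n (Suc d) (%x. complex_of_real (f x)) ^ 2 ^ Suc d" by (rule gowers_EE)
 finally have "cmod (avg ?W (%w. G (sum w V) * prod_list (map (%(i, H). H w) L)))
   \<le> gowers_norm n (Suc d) (%x. complex_of_real (f x))"
  by (subst (asm) power_mono_iff) (auto simp: gowers_norm_def)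
 then show ?thesis unfolding prodL G_def .
qed

section \<open>Counting in a regular partition\<close>

text \<open>The factors are changed from \<open>b\<close> to \<open>a\<close> one at a time;
  \<open>T\<close> records those already changed.\<close>

lemma telescope:
 fixes a b :: "'u => 'h => real"
 assumes N: "finite N" and step: "!!v T. v : N ==>
  \<bar>avg W (%h. (a v h - b v h) * (\<Prod>u\<in>N - {v}. if u : T then a u h else b u h))\<bar> \<le> \<eta>"
 shows "\<bar>avg W (%h. \<Prod>u\<in>N. a u h) - avg W (%h. \<Prod>u\<in>N. b u h)\<bar> \<le> real (card N) * \<eta>"
proof -
 define F where "F T = avg W (%h. \<Prod>u\<in>N. if u : T then a u h else b u h)" for T
 have "T \<subseteq> N ==> \<bar>F T - F {}\<bar> \<le> real (card T) * \<eta>" if "finite T" for T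
  using that
 proof (induction T rule: finite_induct)
  case (insert v T)
  have v: "v : N" using insert.prems by simp
  have e: "(\<Prod>u\<in>N. if u : X then a u h else b u h)
   = (if v : X then a v h else b v h) * (\<Prod>u\<in>N - {v}. if u : X then a u h else b u h)" for X h
   by (rule prod.remove[OF N v])
  have e': "(\<Prod>u\<in>N - {v}. if u : insert v T then a u h else b u h) = (\<Prod>u\<in>N - {v}. if u : T then a u h else b u h)" for h
   by (rule prod.cong[OF refl]) auto
  have "F (insert v T) - F T = avg W (%h. (a v h - b v h) * (\<Prod>u\<in>N - {v}. if u : T then a u h else b u h))"
   unfolding F_def avg_diff[symmetric] e e' using insert.hyps(2) by (simp add: algebra_simps)
  then have "\<bar>F (insert v T) - F T\<bar> \<le> \<eta>" using step[OF v] by simp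
  moreover have "\<bar>F T - F {}\<bar> \<le> real (card T) * \<eta>" using insert by simp
  ultimately have "\<bar>F (insert v T) - F {}\<bar> \<le> real (card T) * \<eta> + \<eta>" by linarith
  then show ?case using insert.hyps by (simp add: algebra_simps)
 qed simp
 from this[OF N subset_refl] show ?thesis by (simp add: F_def)
qed

lemma sum_sym_diff:
 fixes h :: "nat => vec"
 assumes "finite A" "finite B"
 shows "sum h (sym_diff A B) = sum h A + sum h B"
proof -
 have A: "sum h A = sum h (A - B) + sum h (A \<inter> B)" using assms sum.Int_Diff[of A h B] by (simp only: add.commute)
 have B: "sum h B = sum h (B - A) + sum h (A \<inter> B)"
  using sum.Int_Diff[OF assms(2), of h A] by (simp only: add.commute Int_commute)
 have "sum h (sym_diff A B) = sum h (A - B) + sum h (B - A)" by (rule sum.union_disjoint) (use assms in auto)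
 also have "... = sum h (A - B) + sum h (B - A) + (sum h (A \<inter> B) + sum h (A \<inter> B))"
  by (simp only: vec_add_self add_0_right)
 also have "... = sum h A + sum h B" unfolding A B by (simp only: ac_simps)
 finally show ?thesis .
qed

lemma of_bool_cases: "(of_bool b :: real) = 0 \<or> (of_bool b :: real) = 1"
 by (cases b) auto

lemma complex_of_bool: "complex_of_real (of_bool b) = of_bool b"
 by (cases b) auto

context equi_factor
begin

definition cons :: "'u set => ('u => nat set) => (nat => vec) => (nat => vec) => bool" where
 "cons N S k h \<longleftrightarrow> (\<forall>u\<in>N. \<forall>i<C. P i (sum h (S u)) = P i (sum k (S u)))"

lemma cons_prob:
 fixes S :: "'u => nat set"
 assumes I: "finite I" and N: "finite N" and S: "!!u. u : N ==> S u \<subseteq> I" and k: "k : VI I n"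
 shows "avg (VI I n) (%h. of_bool (cons N S k h)) \<ge> 1 / real ord ^ card N - \<theta>"
proof -
 have c1: "avg (VI I n) (%_. 1 :: real) = 1" by (rule avg_const[OF fin_grp_card[OF fin_grp_VI[OF I]]])
 obtain \<rho> where \<rho>: "\<rho> \<ge> 1 / real ord ^ card N" "equidistributed I N S {} \<rho>"
  by (rule equidistribution[where I = I and U = N and S = S and Js = "{}"]) (use I N S in auto)
 have "\<bar>avg (VI I n) (%h. of_bool (\<forall>u\<in>N. \<forall>i<C. P i (sum h (S u)) = P i (sum k (S u))) * 1)
    - \<rho> * avg (VI I n) (%_. 1)\<bar> \<le> \<theta>"
  by (rule \<rho>(2)[unfolded equidistributed_def, rule_format, OF k]) (auto simp: inv_dir_def)
 then have "\<bar>avg (VI I n) (%h. of_bool (cons N S k h)) - \<rho>\<bar> \<le> \<theta>" by (simp add: c1 cons_def)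
 then show ?thesis using \<rho>(1) by linarith
qed

text \<open>Conditioning on the value of one linear form: the involution \<open>\<tau>\<close>
  exchanges that form with a coordinate \<open>j\<close> of its support, after which
  equidistribution applies with \<open>Js = {j}\<close>. Since \<open>\<rho>\<close> does not depend
  on the weight, different weights on the same atom can be compared.\<close>

lemma cons_conditional:
 fixes S :: "'u => nat set"
 assumes I: "finite I" and N: "finite N" and S0: "\<forall>u\<in>N. S u \<subseteq> I" and k: "k : VI I n"
  and v: "v : N" "S v ~= {}"
 shows "\<exists>\<rho>\<ge>0. \<forall>w :: vec => real. (\<forall>x. \<bar>w x\<bar> \<le> 1) &
   (\<forall>x i. w x ~= 0 --> i < C --> P i x = P i (sum k (S v))) -->
   \<bar>avg (VI I n) (%h. of_bool (cons N S k h) * w (sum h (S v))) - \<rho> * avg (FF n) w\<bar> \<le> \<theta>"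
proof -
 let ?W = "VI I n"
 note S = bspec[OF S0]
 obtain j where j: "j : S v" using v by blast
 have jI: "j : I" using j S v by blast
 have finS: "finite (S u)" if "u : N" for u using S[OF that] I by (rule finite_subset)
 define \<tau> where "\<tau> h = h(j := sum h (S v))" for h :: "nat => vec"
 define S' where "S' u = (if j : S u then sym_diff (S u - {j}) (S v) else S u)" for u
 have \<tau>S: "sum (\<tau> h) (S u) = sum h (S' u)" if u: "u : N" for h u
 proof (cases "j : S u")
  case True
  have "sum (\<tau> h) (S u) = \<tau> h j + sum (\<tau> h) (S u - {j})" by (rule sum.remove[OF finS[OF u] True])
  also have "\<tau> h j = sum h (S v)" by (simp add: \<tau>_def)
  also have "sum (\<tau> h) (S u - {j}) = sum h (S u - {j})" by (rule sum.cong[OF refl]) (simp add: \<tau>_def)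
  also have "sum h (S v) + sum h (S u - {j}) = sum h (sym_diff (S u - {j}) (S v))"
   using sum_sym_diff[of "S u - {j}" "S v" h] finS[OF u] finS[OF v(1)] by (simp only: finite_Diff add.commute)
  finally show ?thesis using True by (simp add: S'_def)
 next
  case False
  have "sum (\<tau> h) (S u) = sum h (S u)" by (rule sum.cong[OF refl]) (use False in \<open>auto simp: \<tau>_def\<close>)
  then show ?thesis using False by (simp add: S'_def)
 qed
 have S'v: "S' v = {j}" using j by (auto simp: S'_def)
 have S'I: "S' u \<subseteq> I" if "u : N" for u using S[OF that] S[OF v(1)] by (auto simp: S'_def)
 have \<tau>W: "\<tau> h : ?W" if h: "h : ?W" for h
 proof -
  have "sum h (S v) : FF n" using VI_D[OF h] by (intro FF_sum) auto
  then show ?thesis using h jI by (auto simp: VI_def \<tau>_def)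
 qed
 have \<tau>\<tau>: "\<tau> (\<tau> h) = h" for h
 proof -
  have "sum (\<tau> h) (S v) = h j" using \<tau>S[OF v(1), of h] unfolding S'v by (simp only: sum.insert finite.emptyI empty_iff sum.empty add_0_right simp_thms)
  then show ?thesis by (simp add: \<tau>_def fun_eq_iff)
 qed
 have bij: "bij_betw \<tau> ?W ?W" by (rule bij_betw_byWitness[where f' = \<tau>]) (use \<tau>\<tau> \<tau>W in auto)
 define k' where "k' = \<tau> k"
 have k': "k' : ?W" "\<tau> k' = k" using \<tau>W[OF k] \<tau>\<tau> by (simp_all add: k'_def)
 have kS: "sum k (S u) = sum k' (S' u)" if "u : N" for u using \<tau>S[OF that, of k'] k' by simp
 have s1: "sum h {j} = h j" for h :: "nat => vec" by simp
 obtain \<rho> where \<rho>: "\<rho> \<ge> 1 / real ord ^ card N" "equidistributed I N S' {j} \<rho>"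
  by (rule equidistribution[where I = I and U = N and S = S' and Js = "{j}"]) (use I N S'I jI in auto)
 show ?thesis
 proof (rule exI[of _ \<rho>], rule conjI)
  have "(0::real) \<le> 1 / real ord ^ card N" by simp
  then show "\<rho> \<ge> 0" using \<rho>(1) by linarith
  show "\<forall>w :: vec => real. (\<forall>x. \<bar>w x\<bar> \<le> 1) & (\<forall>x i. w x ~= 0 --> i < C --> P i x = P i (sum k (S v))) -->
   \<bar>avg (VI I n) (%h. of_bool (cons N S k h) * w (sum h (S v))) - \<rho> * avg (FF n) w\<bar> \<le> \<theta>"
  proof (intro allI impI, elim conjE)
  fix w :: "vec => real"
  assume w1': "\<forall>x. \<bar>w x\<bar> \<le> 1" and wB': "\<forall>x i. w x ~= 0 --> i < C --> P i x = P i (sum k (S v))"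
  note w1 = spec[OF w1'] and wB = wB'[rule_format]
  have "avg ?W (%h. of_bool (cons N S k h) * w (sum h (S v)))
    = avg ?W (%h. of_bool (cons N S k (\<tau> h)) * w (sum (\<tau> h) (S v)))"
   by (rule avg_bij[OF bij])
  also have "... = avg ?W (%h. of_bool (\<forall>u\<in>N. \<forall>i<C. P i (sum h (S' u)) = P i (sum k' (S' u))) * w (h j))"
  proof (rule avg_cong)
   fix h :: "nat => vec"
   have "cons N S k (\<tau> h) \<longleftrightarrow> (\<forall>u\<in>N. \<forall>i<C. P i (sum h (S' u)) = P i (sum k' (S' u)))"
    unfolding cons_def by (intro ball_cong refl) (simp only: \<tau>S kS)
   then show "of_bool (cons N S k (\<tau> h)) * w (sum (\<tau> h) (S v))
     = of_bool (\<forall>u\<in>N. \<forall>i<C. P i (sum h (S' u)) = P i (sum k' (S' u))) * w (h j)"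
    unfolding \<tau>S[OF v(1)] S'v s1 by (simp only:)
  qed
  finally have e: "avg ?W (%h. of_bool (cons N S k h) * w (sum h (S v)))
   = avg ?W (%h. of_bool (\<forall>u\<in>N. \<forall>i<C. P i (sum h (S' u)) = P i (sum k' (S' u))) * w (h j))" .
  have p: "avg ?W (%h. w (h j)) = avg (FF n) w"
   using avg_projection[OF I, of "{j}" j n w] jI unfolding s1 by simp
  have "\<bar>avg ?W (%h. of_bool (\<forall>u\<in>N. \<forall>i<C. P i (sum h (S' u)) = P i (sum k' (S' u))) * w (h j))
   - \<rho> * avg ?W (%h. w (h j))\<bar> \<le> \<theta>"
  proof (rule \<rho>(2)[unfolded equidistributed_def, rule_format, OF k'(1)])
   show "\<bar>w (h j)\<bar> \<le> 1" for h by (rule w1)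
   show "P i (sum h T) = P i (sum k' T)" if "w (h j) ~= 0" "T \<subseteq> {j}" "i < C" for h T i
   proof (cases "T = {}")
    case False
    then have T: "T = {j}" using that(2) by blast
    show ?thesis using wB[OF that(1,3)] kS[OF v(1)] unfolding T S'v s1 by (simp only:)
   qed simp
   show "inv_dir (FF n) ?W (sing j') (%h. w (h j))" if "j' : I - {j}" for j'
    unfolding inv_dir_def
   proof (intro ballI)
    fix h a
    have "(h + sing j' a) j = h j" using that by (simp add: sing_def)
    then show "w ((h + sing j' a) j) = w (h j)" by (rule arg_cong)
   qed
  qed
  then show "\<bar>avg ?W (%h. of_bool (cons N S k h) * w (sum h (S v))) - \<rho> * avg (FF n) w\<bar> \<le> \<theta>"
   unfolding e p .
  qed
 qed
qed

text \<open>The indicator of the atom at \<open>v\<close> is an average of phases of degree at most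
  \<open>d\<close>, which do not disturb the Gowers norm. Of the other factors there are at most d +
  1, since \<open>card N \<le> d + 2\<close>.\<close>

lemma gowers_small_term:
 fixes S :: "'u => nat set"
 assumes I: "finite I" and N: "finite N" "card N \<le> d + 2" and S: "!!u. u : N ==> S u \<subseteq> I" "!!u. u : N ==> S u ~= {}" "inj_on S N"
  and k: "k : VI I n" and v: "v : N" and pdP: "!!i. i < C ==> pd n (Suc d) (P i)"
  and f: "!!x. x : FF n ==> \<bar>f x\<bar> \<le> 1" and c: "!!u x. u : N ==> x : FF n ==> \<bar>c u x\<bar> \<le> 1"
 shows "\<bar>avg (VI I n) (%h. f (sum h (S v)) * of_bool (\<forall>i<C. P i (sum h (S v)) = P i (sum k (S v))) * (\<Prod>u\<in>N - {v}. c u (sum h (S u))))\<bar>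
  \<le> gowers_norm n (Suc d) (%x. complex_of_real (f x))"
proof -
 let ?W = "VI I n" and ?g = "gowers_norm n (Suc d) (%x. complex_of_real (f x))"
 define Q where "Q l x = (\<Sum>p\<in>{v} \<times> {..<C}. zmul (int (l p)) (P (snd p) x))" for l x
 define G where "G l = avg ?W (%h. complex_of_real (f (sum h (S v))) * ee (Q l (sum h (S v))) * (\<Prod>u\<in>N - {v}. complex_of_real (c u (sum h (S u)))))" for l
 have \<Psi>Q: "\<Psi> {v} S l h = Q l (sum h (S v))" for l h
  unfolding \<Psi>_def Q_def by (rule sum.cong[OF refl]) auto
 have sF: "sum w T : FF n" if "w : ?W" for w and T :: "nat set" using VI_D[OF that] by (intro FF_sum) auto
 have G: "cmod (G l) \<le> ?g" for l
  unfolding G_def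
 proof (rule gowers_control[OF I S(1)[OF v] S(2)[OF v] f])
  show "pd n (Suc d) (Q l)" unfolding Q_def[abs_def] by (rule pd_sum, rule pd_zmul, rule pdP) auto
  show "finite (N - {v})" using N by simp
  show "card (N - {v}) \<le> Suc d" using N v by simp
  fix u assume u: "u : N - {v}"
  show "cmod (complex_of_real (c u (sum w (S u)))) \<le> 1" if "w : ?W" for w
   using c[of u "sum w (S u)"] u sF[OF that] by simp
  have ne: "S v ~= S u" using u v S(3) by (auto dest: inj_onD)
  have finSu: "finite (S u)" using S(1)[of u] u I finite_subset by blast
  have SuI: "S u \<subseteq> I" using S(1) u by blast
  obtain \<Xi> where \<Xi>: "\<Xi> \<subseteq> I" "odd (card (\<Xi> \<inter> S v))" "even (card (\<Xi> \<inter> S u))"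
   by (rule separating_direction[OF I S(1)[OF v] SuI S(2)[OF v] ne]) blast
  have "inv_dir (FF n) ?W (msing \<Xi>) (%h. complex_of_real (c u (sum h (S u))))"
   unfolding inv_dir_def
  proof (intro ballI)
   fix w a
   have "sum (w + msing \<Xi> a) (S u) = sum w (S u)"
    unfolding sum_msing[OF finSu] using \<Xi>(3) by (simp only: simp_thms if_False add_0_right)
   then show "complex_of_real (c u (sum (w + msing \<Xi> a) (S u))) = complex_of_real (c u (sum w (S u)))" by (simp only:)
  qed
  then show "\<exists>\<Xi>. \<Xi> \<subseteq> I & odd (card (\<Xi> \<inter> S v)) & inv_dir (FF n) ?W (msing \<Xi>) (%h. complex_of_real (c u (sum h (S u))))"
   using \<Xi> by blast
 qed
 define \<Lambda>v where "\<Lambda>v = \<Lambda> {v}"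
 have c\<Lambda>: "card \<Lambda>v > 0" using card_\<Lambda>[of "{v}"] ord_pos by (simp add: \<Lambda>v_def)
 define A where "A = avg ?W (%h. f (sum h (S v)) * of_bool (\<forall>i<C. P i (sum h (S v)) = P i (sum k (S v))) * (\<Prod>u\<in>N - {v}. c u (sum h (S u))))"
 have "complex_of_real A = avg ?W (%h. (1 / of_nat (card \<Lambda>v)) * (\<Sum>l\<in>\<Lambda>v. cnj (ee (Q l (sum k (S v)))) *
   (complex_of_real (f (sum h (S v))) * ee (Q l (sum h (S v))) * (\<Prod>u\<in>N - {v}. complex_of_real (c u (sum h (S u)))))))"
  unfolding A_def avg_of_real[symmetric]
 proof (rule avg_cong)
  fix h assume h: "h : ?W"
  have "of_bool (\<forall>i<C. P i (sum h (S v)) = P i (sum k (S v))) = (\<Sum>l\<in>\<Lambda>v. ee (\<Psi> {v} S l h - \<Psi> {v} S l k)) / of_nat (card \<Lambda>v)"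
   using indicator_expand[of "{v}" S I h k] S(1) v h k by (simp add: \<Lambda>v_def)
  also have "(\<Sum>l\<in>\<Lambda>v. ee (\<Psi> {v} S l h - \<Psi> {v} S l k)) = (\<Sum>l\<in>\<Lambda>v. ee (Q l (sum h (S v))) * cnj (ee (Q l (sum k (S v)))))"
   unfolding \<Psi>Q using phase_ee by (simp add: phase_def)
  finally have e: "complex_of_real (of_bool (\<forall>i<C. P i (sum h (S v)) = P i (sum k (S v))))
    = (\<Sum>l\<in>\<Lambda>v. ee (Q l (sum h (S v))) * cnj (ee (Q l (sum k (S v))))) / of_nat (card \<Lambda>v)"
   by (simp only: complex_of_bool)
  show "complex_of_real (f (sum h (S v)) * of_bool (\<forall>i<C. P i (sum h (S v)) = P i (sum k (S v))) * (\<Prod>u\<in>N - {v}. c u (sum h (S u))))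
   = (1 / of_nat (card \<Lambda>v)) * (\<Sum>l\<in>\<Lambda>v. cnj (ee (Q l (sum k (S v)))) *
   (complex_of_real (f (sum h (S v))) * ee (Q l (sum h (S v))) * (\<Prod>u\<in>N - {v}. complex_of_real (c u (sum h (S u))))))"
   unfolding of_real_mult e of_real_prod by (simp add: sum_distrib_left sum_distrib_right sum_divide_distrib mult_ac)
 qed
 also have "... = (1 / of_nat (card \<Lambda>v)) * (\<Sum>l\<in>\<Lambda>v. cnj (ee (Q l (sum k (S v)))) * G l)"
  unfolding avg_cmult_left avg_sum G_def ..
 finally have A: "complex_of_real A = (1 / of_nat (card \<Lambda>v)) * (\<Sum>l\<in>\<Lambda>v. cnj (ee (Q l (sum k (S v)))) * G l)" .
 have "\<bar>A\<bar> = cmod (complex_of_real A)" by (simp only: norm_of_real)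
 also have "... = (1 / real (card \<Lambda>v)) * cmod (\<Sum>l\<in>\<Lambda>v. cnj (ee (Q l (sum k (S v)))) * G l)"
  unfolding A norm_mult by (simp only: norm_divide norm_one norm_of_nat)
 also have "... \<le> (1 / real (card \<Lambda>v)) * (\<Sum>l\<in>\<Lambda>v. ?g)"
 proof (rule mult_left_mono)
  show "cmod (\<Sum>l\<in>\<Lambda>v. cnj (ee (Q l (sum k (S v)))) * G l) \<le> (\<Sum>l\<in>\<Lambda>v. ?g)"
   by (rule sum_norm_le) (use G phase_ee in \<open>simp add: norm_mult phase_def\<close>)
 qed simp
 also have "... = ?g" using c\<Lambda> by simp
 finally show ?thesis by (simp only: A_def)
qed

text \<open>Restricting every point to its atom can only decrease the product. Then
  \<open>f2\<close> is removed factor by factor. On the atoms f1 \<ge> \<zeta>, so f1 + f3 \<ge>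
  \<zeta> / 2 unless \<open>f3\<close> is large, and this is rare even under the condition that all
  points lie in their atoms.\<close>

theorem hom_density:
 fixes S :: "'u => nat set"
 assumes I: "finite I" and N: "finite N" "card N \<le> d + 2" and S: "!!u. u : N ==> S u \<subseteq> I" "!!u. u : N ==> S u ~= {}" "inj_on S N"
  and k: "k : VI I n" and pdP: "!!i. i < C ==> pd n (Suc d) (P i)"
  and f: "!!x. x : FF n ==> f x = f1 x + f2 x + f3 x" "!!x. x : FF n ==> 0 \<le> f x & f x \<le> 1"
  and g: "!!x. x : FF n ==> 0 \<le> f1 x + f3 x & f1 x + f3 x \<le> 1" and f2: "!!x. x : FF n ==> \<bar>f2 x\<bar> \<le> 1"
  and gow: "gowers_norm n (Suc d) (%x. complex_of_real (f2 x)) \<le> \<eta>"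
  and \<zeta>: "\<zeta> > 0" and f1: "!!u x. u : N ==> x : FF n ==> (\<forall>i<C. P i x = P i (sum k (S u))) ==> f1 x \<ge> \<zeta>"
  and f3: "!!u. u : N ==> avg (FF n) (%x. of_bool (\<forall>i<C. P i x = P i (sum k (S u))) * (f3 x)\<^sup>2)
   \<le> \<epsilon>\<^sup>2 * avg (FF n) (%x. of_bool (\<forall>i<C. P i x = P i (sum k (S u))))"
  and \<epsilon>: "real (card N) * (4 * \<epsilon>\<^sup>2 / \<zeta>\<^sup>2) \<le> 1 / 2"
 shows "avg (VI I n) (%h. \<Prod>u\<in>N. f (sum h (S u)))
  \<ge> (\<zeta> / 2) ^ card N * ((1 / real ord ^ card N - \<theta>) / 2 - 2 * real (card N) * \<theta>) - real (card N) * \<eta>"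
proof -
 let ?W = "VI I n"
 have SN: "\<forall>u\<in>N. S u \<subseteq> I" using S(1) by blast
 define m where "m = real (card N)"
 define \<kappa> where "\<kappa> = 4 * \<epsilon>\<^sup>2 / \<zeta>\<^sup>2"
 define B where "B u x = (of_bool (\<forall>i<C. P i x = P i (sum k (S u))) :: real)" for u x
 define bad where "bad x = (of_bool (\<bar>f3 x\<bar> > \<zeta> / 2) :: real)" for x
 define a where "a u h = f (sum h (S u)) * B u (sum h (S u))" for u h
 define b where "b u h = (f1 (sum h (S u)) + f3 (sum h (S u))) * B u (sum h (S u))" for u h
 have B01: "B u x = 0 \<or> B u x = 1" for u x unfolding B_def by (rule of_bool_cases)
 have sF: "sum w T : FF n" if "w : ?W" for w and T :: "nat set" using VI_D[OF that] by (intro FF_sum) auto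
 have tele: "\<bar>avg ?W (%h. \<Prod>u\<in>N. a u h) - avg ?W (%h. \<Prod>u\<in>N. b u h)\<bar> \<le> real (card N) * \<eta>"
 proof (rule telescope[OF N(1)])
  fix v T assume v: "v : N"
  define c where "c u x = (if u : T then f x * B u x else (f1 x + f3 x) * B u x)" for u x
  have "avg ?W (%h. (a v h - b v h) * (\<Prod>u\<in>N - {v}. if u : T then a u h else b u h))
    = avg ?W (%h. f2 (sum h (S v)) * of_bool (\<forall>i<C. P i (sum h (S v)) = P i (sum k (S v))) * (\<Prod>u\<in>N - {v}. c u (sum h (S u))))"
  proof (rule avg_cong)
   fix h assume h: "h : ?W"
   have "a v h - b v h = f2 (sum h (S v)) * of_bool (\<forall>i<C. P i (sum h (S v)) = P i (sum k (S v)))"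
    using f(1)[OF sF[OF h, of "S v"]] by (simp add: a_def b_def B_def algebra_simps)
   moreover have "(\<Prod>u\<in>N - {v}. if u : T then a u h else b u h) = (\<Prod>u\<in>N - {v}. c u (sum h (S u)))"
    by (rule prod.cong[OF refl]) (simp add: a_def b_def c_def)
   ultimately show "(a v h - b v h) * (\<Prod>u\<in>N - {v}. if u : T then a u h else b u h)
    = f2 (sum h (S v)) * of_bool (\<forall>i<C. P i (sum h (S v)) = P i (sum k (S v))) * (\<Prod>u\<in>N - {v}. c u (sum h (S u)))"
    by (simp only:)
  qed
  also have "\<bar>...\<bar> \<le> gowers_norm n (Suc d) (%x. complex_of_real (f2 x))"
  proof (rule gowers_small_term[OF I N S k v pdP f2])
   show "\<bar>c u x\<bar> \<le> 1" if "x : FF n" for u x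
    using f(2)[OF that] g[OF that] B01[of u x] by (auto simp: c_def)
  qed
  finally show "\<bar>avg ?W (%h. (a v h - b v h) * (\<Prod>u\<in>N - {v}. if u : T then a u h else b u h))\<bar> \<le> \<eta>"
   using gow by linarith
 qed
 define Pc where "Pc = avg ?W (%h. of_bool (cons N S k h) :: real)"
 define Pv where "Pv v = avg ?W (%h. of_bool (cons N S k h) * bad (sum h (S v)))" for v
 have Pc: "Pc \<ge> 1 / real ord ^ card N - \<theta>" unfolding Pc_def by (rule cons_prob[OF I N(1) S(1) k])
 have \<kappa>0: "\<kappa> \<ge> 0" by (simp add: \<kappa>_def)
 \<comment> \<open>The weights compared are the indicator of the atom and that of its part where
   \<open>f3\<close> is large. Both involve the same \<open>\<rho>\<close>, so the Chebyshev bound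
   \<open>\<kappa>\<close> on the atom carries over to the conditional probability up to errors
   \<theta>.\<close>
 have Pv: "Pv v \<le> \<kappa> * (Pc + \<theta>) + \<theta>" if v: "v : N" for v
 proof -
  obtain \<rho> where \<rho>: "\<rho> \<ge> 0" "\<forall>w :: vec => real. (\<forall>x. \<bar>w x\<bar> \<le> 1) &
   (\<forall>x i. w x ~= 0 --> i < C --> P i x = P i (sum k (S v))) -->
   \<bar>avg (VI I n) (%h. of_bool (cons N S k h) * w (sum h (S v))) - \<rho> * avg (FF n) w\<bar> \<le> \<theta>"
   using cons_conditional[where S = S, OF I N(1) SN k v S(2)[OF v]] by (elim exE conjE) (rule that)
  have cB: "B v (sum h (S v)) = 1" if "cons N S k h" for h
   using that v by (simp add: B_def cons_def)
  have "\<bar>avg ?W (%h. of_bool (cons N S k h) * B v (sum h (S v))) - \<rho> * avg (FF n) (B v)\<bar> \<le> \<theta>"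
   by (rule \<rho>(2)[rule_format]) (auto simp: B_def)
  moreover have "avg ?W (%h. of_bool (cons N S k h) * B v (sum h (S v))) = Pc"
   unfolding Pc_def by (rule avg_cong) (use cB in \<open>auto simp: of_bool_def\<close>)
  ultimately have l: "\<rho> * avg (FF n) (B v) \<le> Pc + \<theta>" by linarith
  have "\<bar>avg ?W (%h. of_bool (cons N S k h) * (B v (sum h (S v)) * bad (sum h (S v)))) - \<rho> * avg (FF n) (%x. B v x * bad x)\<bar> \<le> \<theta>"
   by (rule \<rho>(2)[rule_format]) (auto simp: B_def bad_def)
  moreover have "avg ?W (%h. of_bool (cons N S k h) * (B v (sum h (S v)) * bad (sum h (S v)))) = Pv v"
   unfolding Pv_def by (rule avg_cong) (use cB in \<open>auto simp: of_bool_def\<close>)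
  ultimately have u: "Pv v \<le> \<rho> * avg (FF n) (%x. B v x * bad x) + \<theta>" by linarith
  have "avg (FF n) (%x. B v x * bad x) \<le> avg (FF n) (%x. (4 / \<zeta>\<^sup>2) * (B v x * (f3 x)\<^sup>2))"
  proof (rule avg_mono)
   fix x
   have "bad x \<le> (4 / \<zeta>\<^sup>2) * (f3 x)\<^sup>2"
   proof (cases "\<bar>f3 x\<bar> > \<zeta> / 2")
    case True
    then have "(\<zeta> / 2)\<^sup>2 \<le> \<bar>f3 x\<bar>\<^sup>2" using \<zeta> by (intro power_mono) auto
    then show ?thesis using True \<zeta> by (simp add: bad_def field_simps power2_eq_square)
   qed (simp add: bad_def)
   then show "B v x * bad x \<le> (4 / \<zeta>\<^sup>2) * (B v x * (f3 x)\<^sup>2)" using B01[of v x] by auto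
  qed
  also have "... = (4 / \<zeta>\<^sup>2) * avg (FF n) (%x. B v x * (f3 x)\<^sup>2)" by (rule avg_cmult_left)
  also have "... \<le> (4 / \<zeta>\<^sup>2) * (\<epsilon>\<^sup>2 * avg (FF n) (B v))"
   using f3[OF v] unfolding B_def by (intro mult_left_mono) auto
  also have "... = \<kappa> * avg (FF n) (B v)" by (simp add: \<kappa>_def)
  finally have "\<rho> * avg (FF n) (%x. B v x * bad x) \<le> \<rho> * (\<kappa> * avg (FF n) (B v))" using \<rho>(1) by (rule mult_left_mono)
  also have "... = \<kappa> * (\<rho> * avg (FF n) (B v))" by simp
  also have "... \<le> \<kappa> * (Pc + \<theta>)" using l \<kappa>0 by (rule mult_left_mono)
  finally show ?thesis using u by linarith
 qed
 \<comment> \<open>If all points are in their atoms and none is bad, every factor is at least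
   \<zeta> / 2. In all other cases the right-hand side is at most 0.\<close>
 have prodb: "(\<Prod>u\<in>N. b u h) \<ge> (\<zeta> / 2) ^ card N * (of_bool (cons N S k h) - (\<Sum>v\<in>N. of_bool (cons N S k h) * bad (sum h (S v))))"
  if h: "h : ?W" for h
 proof -
  have b0: "b u h \<ge> 0" for u using g[OF sF[OF h, of "S u"]] B01[of u "sum h (S u)"] by (auto simp: b_def)
  have p0: "(\<Prod>u\<in>N. b u h) \<ge> 0" by (rule prod_nonneg) (use b0 in auto)
  consider "\<not> cons N S k h" | v where "cons N S k h" "v : N" "bad (sum h (S v)) = 1" | "cons N S k h" "\<forall>v\<in>N. bad (sum h (S v)) = 0"
   by (auto simp: bad_def)
  then show ?thesis
  proof cases
   case 1
   then show ?thesis using p0 by simp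
  next
   case 2
   have "1 \<le> (\<Sum>v\<in>N. bad (sum h (S v)))"
    using member_le_sum[OF 2(2), of "%v. bad (sum h (S v))"] 2(3) N(1) by (simp add: bad_def)
   then have "(\<zeta> / 2) ^ card N * (1 - (\<Sum>v\<in>N. bad (sum h (S v)))) \<le> 0"
    using \<zeta> by (intro mult_nonneg_nonpos) auto
   then show ?thesis using p0 2(1) by simp
  next
   case 3
   have "\<zeta> / 2 \<le> b u h" if u: "u : N" for u
   proof -
    have c: "\<forall>i<C. P i (sum h (S u)) = P i (sum k (S u))" using 3(1) u by (simp add: cons_def)
    have "f1 (sum h (S u)) \<ge> \<zeta>" by (rule f1[OF u sF[OF h] c])
    moreover have "\<bar>f3 (sum h (S u))\<bar> \<le> \<zeta> / 2"
    proof (rule ccontr)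
     assume "\<not> \<bar>f3 (sum h (S u))\<bar> \<le> \<zeta> / 2"
     then have "bad (sum h (S u)) = 1" unfolding bad_def by simp
     then show False using 3(2) u by simp
    qed
    moreover have "B u (sum h (S u)) = 1" using c by (simp add: B_def)
    ultimately show ?thesis by (simp add: b_def)
   qed
   then have "(\<Prod>u\<in>N. \<zeta> / 2) \<le> (\<Prod>u\<in>N. b u h)" using \<zeta> by (intro prod_mono) auto
   then show ?thesis using 3 by simp
  qed
 qed
 have "(\<zeta> / 2) ^ card N * (Pc - (\<Sum>v\<in>N. Pv v)) \<le> avg ?W (%h. \<Prod>u\<in>N. b u h)"
 proof -
  have "(\<zeta> / 2) ^ card N * (Pc - (\<Sum>v\<in>N. Pv v))
   = avg ?W (%h. (\<zeta> / 2) ^ card N * (of_bool (cons N S k h) - (\<Sum>v\<in>N. of_bool (cons N S k h) * bad (sum h (S v)))))"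
   unfolding Pc_def Pv_def avg_cmult_left avg_diff avg_sum ..
  also have "... \<le> avg ?W (%h. \<Prod>u\<in>N. b u h)" by (rule avg_mono[OF prodb])
  finally show ?thesis .
 qed
 moreover have "(\<zeta> / 2) ^ card N * ((1 / real ord ^ card N - \<theta>) / 2 - 2 * m * \<theta>) \<le> (\<zeta> / 2) ^ card N * (Pc - (\<Sum>v\<in>N. Pv v))"
 proof (rule mult_left_mono)
  have Pc0: "Pc \<ge> 0" unfolding Pc_def by (rule avg_nonneg) simp
  have "(\<Sum>v\<in>N. Pv v) \<le> (\<Sum>v\<in>N. \<kappa> * (Pc + \<theta>) + \<theta>)" by (rule sum_mono[OF Pv])
  also have "... = (m * \<kappa>) * (Pc + \<theta>) + m * \<theta>" by (simp add: m_def algebra_simps)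
  finally have s: "(\<Sum>v\<in>N. Pv v) \<le> (m * \<kappa>) * (Pc + \<theta>) + m * \<theta>" .
  have m\<kappa>: "m * \<kappa> \<le> 1 / 2" using \<epsilon> by (simp add: m_def \<kappa>_def)
  then have "(m * \<kappa>) * Pc \<le> (1 / 2) * Pc" using Pc0 by (rule mult_right_mono)
  moreover have "(m * \<kappa>) * \<theta> \<le> m * \<theta>"
  proof (cases "card N = 0")
   case False
   have "m \<ge> 1" using False by (simp add: m_def)
   have "(m * \<kappa>) * \<theta> \<le> (1 / 2) * \<theta>" using m\<kappa> \<theta>(1) by (intro mult_right_mono) auto
   also have "... \<le> m * \<theta>" using \<open>m \<ge> 1\<close> \<theta>(1) by (intro mult_right_mono) auto
   finally show ?thesis .
  qed (simp add: m_def)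
  ultimately have sP: "(\<Sum>v\<in>N. Pv v) \<le> Pc / 2 + 2 * m * \<theta>" using s by (simp add: distrib_left)
  have aux: "x / 2 - y \<le> Pc - z" if "z \<le> Pc / 2 + y" "x \<le> Pc" for x y z :: real using that by linarith
  show "(1 / real ord ^ card N - \<theta>) / 2 - 2 * m * \<theta> \<le> Pc - (\<Sum>v\<in>N. Pv v)" by (rule aux[OF sP Pc])
 qed (use \<zeta> in simp)
 moreover have "avg ?W (%h. \<Prod>u\<in>N. a u h) \<le> avg ?W (%h. \<Prod>u\<in>N. f (sum h (S u)))"
 proof (rule avg_mono, rule prod_mono)
  fix h u assume h: "h : ?W"
  show "0 \<le> a u h & a u h \<le> f (sum h (S u))"
   using f(2)[OF sF[OF h, of "S u"]] B01[of u "sum h (S u)"] by (auto simp: a_def)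
 qed
 moreover have "x - e \<le> z" if "y \<le> b" "x \<le> y" "a \<le> z" "\<bar>a - b\<bar> \<le> e" for x y z a b e :: real
  using that by linarith
 ultimately show ?thesis using tele unfolding m_def by blast
qed

end

section \<open>From homomorphisms to copies\<close>

lemma card_FF: "card (FF n) = 2 ^ n"
proof -
 have "bij_betw (%x :: vec. {i. x i = 1}) (FF n) (Pow {..<n})"
 proof (rule bij_betw_byWitness[where f' = "%A i. if i : A then 1 else 0"])
  show "\<forall>x\<in>FF n. (%i. if i : {i. x i = 1} then 1 else 0) = x"
   by (auto simp: fun_eq_iff)
  show "(%x. {i. x i = 1}) ` FF n \<subseteq> Pow {..<n}" using vec_sum_eu(2) by blast
 qed (auto simp: FF_def)
 then show ?thesis using bij_betw_same_card card_Pow[of "{..<n}"] by fastforce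
qed

lemma card_VI: "card (VI {..<r} n) = (2 ^ n) ^ r"
 using bij_betw_same_card[OF VI_PiE[of "{..<r}" n]] by (simp add: card_PiE card_FF)

definition supp :: "nat => vec => nat set" where
 "supp r x = {j. j < r & x j = 1}"

lemma supp_sub: "supp r x \<subseteq> {..<r}" and finite_supp: "finite (supp r x)"
 by (auto simp: supp_def)

text \<open>The linear map given by the images \<open>h\<close> of the basis vectors. An element
  \<open>x\<close> thereby becomes the linear form with support \<open>supp r x\<close>, and random
  tuples are random homomorphisms.\<close>

definition \<Phi> :: "nat => (nat => vec) => vec => vec" where
 "\<Phi> r h x = sum h (supp r x)"

lemma \<Phi>_add: "\<Phi> r h (x + y) = \<Phi> r h x + \<Phi> r h y"
proof -
 have "(x + y) j = 1 \<longleftrightarrow> (x j = 1) ~= (y j = 1)" for j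
  by (cases "x j"; cases "y j") auto
 then have "supp r (x + y) = sym_diff (supp r x) (supp r y)" unfolding supp_def by blast
 then show ?thesis unfolding \<Phi>_def using sum_sym_diff[OF finite_supp finite_supp] by (simp only:)
qed

lemma \<Phi>_zero: "\<Phi> r h 0 = 0"
 by (simp add: \<Phi>_def supp_def)

lemma \<Phi>_scale: "\<Phi> r h (f2_scale c x) = f2_scale c (\<Phi> r h x)"
proof (cases c)
 case zero
 have "f2_scale 0 y = 0" for y by (simp add: f2_scale_def fun_eq_iff)
 then show ?thesis using zero \<Phi>_zero by simp
next
 case one
 have "f2_scale 1 y = y" for y by (simp add: f2_scale_def)
 then show ?thesis using one by simp
qed

lemma \<Phi>_FF: "h : VI {..<r} n ==> \<Phi> r h x : FF n"
 unfolding \<Phi>_def by (rule FF_sum) (erule VI_D)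

lemma \<Phi>_linear: "h : VI {..<r} n ==> linear_map r n (\<Phi> r h)"
 by (auto simp: linear_map_def \<Phi>_add \<Phi>_scale \<Phi>_FF)

lemma \<Phi>_eu: "j < r ==> \<Phi> r h (eu j) = h j"
proof -
 assume "j < r"
 then have "supp r (eu j) = {j}" by (auto simp: supp_def eu_def)
 then show ?thesis by (simp add: \<Phi>_def)
qed

lemma linear_map_\<Phi>:
 assumes \<phi>: "linear_map r n \<phi>"
 shows "\<exists>h\<in>VI {..<r} n. \<forall>x\<in>FF r. \<phi> x = \<Phi> r h x"
proof -
 define h where "h j = (if j < r then \<phi> (eu j) else 0)" for j
 have z: "\<phi> 0 = 0"
 proof -
  have "\<phi> (0 + 0) = \<phi> 0 + \<phi> 0" using \<phi> FF_zero unfolding linear_map_def by blast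
  then show ?thesis by (simp only: add_0_right vec_add_self)
 qed
 have s: "\<phi> (sum eu A) = sum h A" if "finite A" "A \<subseteq> {..<r}" for A
  using that
 proof (induction A rule: finite_induct)
  case (insert j A)
  have "eu j : FF r" "sum eu A : FF r" using insert.prems eu_FF by (auto intro!: FF_sum)
  then have "\<phi> (eu j + sum eu A) = \<phi> (eu j) + \<phi> (sum eu A)" using \<phi> unfolding linear_map_def by blast
  also have "\<phi> (eu j) = h j" using insert.prems by (simp add: h_def)
  also have "\<phi> (sum eu A) = sum h A" using insert by blast
  finally show ?case unfolding sum.insert[OF insert.hyps] .
 qed (simp add: z)
 have "\<phi> x = \<Phi> r h x" if x: "x : FF r" for x
 proof -
  have "supp r x = {i. x i = 1}" using vec_sum_eu(2)[OF x] by (auto simp: supp_def)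
  then have "\<phi> (sum eu {i. x i = 1}) = \<Phi> r h x" using s[OF finite_supp supp_sub, of x] by (simp add: \<Phi>_def)
  then show ?thesis using vec_sum_eu(1)[OF x] by simp
 qed
 moreover have "h : VI {..<r} n" using \<phi> eu_FF by (auto simp: VI_def h_def linear_map_def)
 ultimately show ?thesis by blast
qed

lemma supp_inj: "inj_on (supp r) (FF r)"
proof (rule inj_onI)
 fix x y assume xy: "x : FF r" "y : FF r" "supp r x = supp r y"
 have "x j = y j" for j
 proof (cases "j < r")
  case True
  then have "x j = 1 \<longleftrightarrow> y j = 1" using xy(3) by (auto simp: supp_def)
  then show ?thesis by (cases "x j"; cases "y j") auto
 qed (use xy in \<open>simp add: FF_def\<close>)
 then show "x = y" by (rule ext)
qed

text \<open>A union bound over the nonzero \<open>x\<close>, at each of which the image is uniformly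
  distributed.\<close>

lemma noninjective_density:
 "avg (VI {..<r} n) (%h. of_bool (\<not> inj_on (\<Phi> r h) (FF r))) \<le> (2 ^ r / 2 ^ n :: real)"
proof -
 let ?W = "VI {..<r} n"
 have "avg ?W (%h. of_bool (\<not> inj_on (\<Phi> r h) (FF r))) \<le> avg ?W (%h. \<Sum>x\<in>FF r - {0}. of_bool (\<Phi> r h x = 0) :: real)"
 proof (rule avg_mono)
  fix h :: "nat => vec"
  show "of_bool (\<not> inj_on (\<Phi> r h) (FF r)) \<le> (\<Sum>x\<in>FF r - {0}. of_bool (\<Phi> r h x = 0) :: real)"
  proof (cases "inj_on (\<Phi> r h) (FF r)")
   case False
   then obtain x y where xy: "x : FF r" "y : FF r" "x ~= y" "\<Phi> r h x = \<Phi> r h y" unfolding inj_on_def by blast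
   have "x + y ~= 0" using xy(3) vec_minus[of x y] by (metis eq_iff_diff_eq_0)
   moreover have "\<Phi> r h (x + y) = 0" unfolding \<Phi>_add xy(4) by (rule vec_add_self)
   moreover have "x + y : FF r" using xy by (intro FF_add)
   ultimately have "(1::real) \<le> (\<Sum>x\<in>FF r - {0}. of_bool (\<Phi> r h x = 0))"
    using member_le_sum[of "x + y" "FF r - {0}" "%x. of_bool (\<Phi> r h x = 0) :: real"] FF_finite[of r] by simp
   then show ?thesis using False by simp
  qed (simp add: sum_nonneg)
 qed
 also have "... = (\<Sum>x\<in>FF r - {0}. avg ?W (%h. of_bool (\<Phi> r h x = 0)))" by (rule avg_sum)
 also have "... = (\<Sum>x\<in>FF r - {0}. 1 / 2 ^ n)"
 proof (rule sum.cong[OF refl])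
  fix x assume x: "x : FF r - {0}"
  have "supp r x ~= supp r 0" using inj_onD[OF supp_inj, of r x 0] x FF_zero[of r] by blast
  then obtain j where j: "j : supp r x" by (auto simp: supp_def)
  have "avg ?W (%h. of_bool (\<Phi> r h x = 0) :: real) = avg (FF n) (%y. of_bool (y = 0))"
   unfolding \<Phi>_def by (rule avg_projection[OF _ supp_sub j]) simp
  also have "... = 1 / 2 ^ n"
  proof -
   have "FF n \<inter> {y. y = 0} = {0}" using FF_zero[of n] by blast
   then have "(\<Sum>y\<in>FF n. of_bool (y = 0) :: real) = 1"
    using FF_finite[of n] FF_zero[of n] by (simp add: sum.If_cases of_bool_def)
   then show ?thesis by (simp add: avg_def card_FF)
  qed
  finally show "avg ?W (%h. of_bool (\<Phi> r h x = 0) :: real) = 1 / 2 ^ n" .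
 qed
 also have "... \<le> 2 ^ r / 2 ^ n"
 proof -
  have "real (card (FF r - {0})) \<le> 2 ^ r" using card_mono[of "FF r" "FF r - {0}"] FF_finite[of r] card_FF[of r]
   by (metis Diff_subset of_nat_le_iff of_nat_numeral of_nat_power)
  then show ?thesis by (simp add: divide_right_mono)
 qed
 finally show ?thesis .
qed

text \<open>As \<open>N\<close> spans, a linear map is determined by its restriction to
  \<open>N\<close>, so at most \<open>card N ^ card N\<close> maps have the same image; this is the
  loss in passing from maps to copies.\<close>

lemma copies_from_density:
 assumes N: "matroid r N" and M: "M \<subseteq> FF n"
  and c: "avg (VI {..<r} n) (%h. \<Prod>u\<in>N. indicator M (\<Phi> r h u)) \<ge> c + (2 ^ r / 2 ^ n :: real)"
 shows "c * (2 ^ n) ^ r \<le> real (card (copies r N n M)) * real (card N) ^ card N"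
proof -
 let ?W = "VI {..<r} n"
 have NF: "N \<subseteq> FF r" using N by (auto simp: matroid_def)
 have finN: "finite N" by (rule finite_subset[OF NF FF_finite])
 have finM: "finite M" by (rule finite_subset[OF M FF_finite])
 have finW: "finite ?W" by (rule fin_grp_finite[OF fin_grp_VI]) simp
 define T where "T = {h\<in>?W. \<Phi> r h ` N \<subseteq> M & inj_on (\<Phi> r h) (FF r)}"
 have "avg ?W (%h. \<Prod>u\<in>N. indicator M (\<Phi> r h u)) \<le> avg ?W (%h. of_bool (h : T) + of_bool (\<not> inj_on (\<Phi> r h) (FF r)) :: real)"
 proof (rule avg_mono)
  fix h assume h: "h : ?W"
  show "(\<Prod>u\<in>N. indicator M (\<Phi> r h u)) \<le> (of_bool (h : T) + of_bool (\<not> inj_on (\<Phi> r h) (FF r)) :: real)"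
  proof (cases "\<Phi> r h ` N \<subseteq> M")
   case True
   have "(\<Prod>u\<in>N. indicator M (\<Phi> r h u) :: real) = 1" by (rule prod.neutral) (use True in auto)
   then show ?thesis using True h by (auto simp: T_def)
  next
   case False
   then obtain u where "u : N" "\<Phi> r h u \<notin> M" by blast
   then have "(\<Prod>u\<in>N. indicator M (\<Phi> r h u) :: real) = 0" using finN by (intro prod_zero bexI[of _ u]) auto
   then show ?thesis by simp
  qed
 qed
 also have "... = avg ?W (%h. of_bool (h : T)) + avg ?W (%h. of_bool (\<not> inj_on (\<Phi> r h) (FF r)))" by (rule avg_add)
 finally have "c \<le> avg ?W (%h. of_bool (h : T))" using c noninjective_density[of r n] by linarith
 also have "... = real (card T) / (2 ^ n) ^ r"
 proof -
  have "?W \<inter> T = T" by (auto simp: T_def)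
  then have "(\<Sum>h\<in>?W. of_bool (h : T) :: real) = real (card T)" using finW by (simp add: of_bool_def sum.If_cases Int_def)
  then show ?thesis by (simp add: avg_def card_VI)
 qed
 finally have cT: "c * (2 ^ n) ^ r \<le> real (card T)" by (simp add: pos_le_divide_eq)
 \<comment> \<open>Pairs of a copy and a function from \<open>N\<close> into it.\<close>
 define Z where "Z = Sigma (copies r N n M) (%Y. N \<rightarrow>\<^sub>E Y)"
 have "copies r N n M \<subseteq> Pow M" by (auto simp: copies_def)
 then have finC: "finite (copies r N n M)" using finM finite_subset by blast
 have cY: "finite Y & card Y = card N" if Y: "Y : copies r N n M" for Y
 proof -
  obtain \<phi> where "inj_on \<phi> (FF r)" "Y = \<phi> ` N" using Y unfolding copies_def by blast
  then show ?thesis using finN card_image[OF inj_on_subset[OF _ NF]] by auto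
 qed
 have cZ: "card Z = card (copies r N n M) * card N ^ card N"
 proof -
  have "card Z = (\<Sum>Y\<in>copies r N n M. card (N \<rightarrow>\<^sub>E Y))"
   unfolding Z_def using finC cY finN by (subst card_SigmaI) (auto intro!: finite_PiE)
  also have "... = (\<Sum>Y\<in>copies r N n M. card N ^ card N)"
   by (rule sum.cong[OF refl]) (use cY finN in \<open>simp add: card_PiE\<close>)
  finally show ?thesis by simp
 qed
 have finZ: "finite Z" unfolding Z_def using finC cY finN by (auto intro!: finite_SigmaI finite_PiE)
 have "card T \<le> card Z"
 proof (rule card_inj_on_le[of "%h. (\<Phi> r h ` N, restrict (\<Phi> r h) N)", OF _ _ finZ])
  show "inj_on (%h. (\<Phi> r h ` N, restrict (\<Phi> r h) N)) T"
  proof (rule inj_onI)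
   fix h h' assume hh: "h : T" "h' : T" "(\<Phi> r h ` N, restrict (\<Phi> r h) N) = (\<Phi> r h' ` N, restrict (\<Phi> r h') N)"
   have "N \<subseteq> {x. \<Phi> r h x = \<Phi> r h' x}"
   proof
    fix u assume u: "u : N"
    have "restrict (\<Phi> r h) N u = restrict (\<Phi> r h') N u" using hh(3) by simp
    then show "u : {x. \<Phi> r h x = \<Phi> r h' x}" using u by simp
   qed
   moreover have "F2.subspace {x. \<Phi> r h x = \<Phi> r h' x}"
    unfolding F2.subspace_def by (auto simp: \<Phi>_zero \<Phi>_add \<Phi>_scale)
   ultimately have "F2.span N \<subseteq> {x. \<Phi> r h x = \<Phi> r h' x}" by (rule F2.span_minimal)
   then have e: "\<Phi> r h x = \<Phi> r h' x" if "x : FF r" for x using N that by (auto simp: matroid_def)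
   show "h = h'"
   proof
    fix j show "h j = h' j"
    proof (cases "j < r")
     case True
     then show ?thesis using e[OF eu_FF[OF True]] by (simp add: \<Phi>_eu)
    next
     case False
     then show ?thesis using hh(1,2) by (simp add: T_def VI_def)
    qed
   qed
  qed
  show "(%h. (\<Phi> r h ` N, restrict (\<Phi> r h) N)) ` T \<subseteq> Z"
  proof
   fix p assume "p : (%h. (\<Phi> r h ` N, restrict (\<Phi> r h) N)) ` T"
   then obtain h where h: "h : T" "p = (\<Phi> r h ` N, restrict (\<Phi> r h) N)" by blast
   have "\<Phi> r h ` N : copies r N n M"
    using h(1) \<Phi>_linear[of h r n] unfolding copies_def T_def by blast
   then show "p : Z" unfolding h(2) Z_def by auto
  qed
 qed
 then have "real (card T) \<le> real (card (copies r N n M)) * real (card N) ^ card N"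
  unfolding cZ by (metis of_nat_le_iff of_nat_mult of_nat_power)
 then show ?thesis using cT by linarith
qed

section \<open>The counting lemma\<close>

text \<open>Depths are bounded by the degree. This allows thresholds that must beat the order to
  depend on the complexity alone.\<close>

lemma factor_order_le:
 assumes "poly_factor n Ps" "factor_degree n Ps \<le> d"
 shows "factor_order n Ps \<le> (2 ^ (d + 1)) ^ length Ps"
proof -
 have "factor_order n Ps \<le> (\<Prod>i<length Ps. 2 ^ (d + 1))"
  unfolding factor_order_def
 proof (rule prod_mono, intro conjI)
  fix i assume "i : {..<length Ps}"
  then have "Ps ! i : set Ps" by simp
  then have "poly_depth n (Ps ! i) \<le> d" using depth_facts(3) factor_pd[OF assms] by blast
  then show "(2::nat) ^ (poly_depth n (Ps ! i) + 1) \<le> 2 ^ (d + 1)" by (intro power_increasing) auto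
 qed simp
 then show ?thesis by simp
qed

lemma avg_restrict:
 fixes g :: "vec => real"
 assumes "!!x. x : FF n ==> b x \<longleftrightarrow> x : A" "A \<subseteq> FF n" "A ~= {}" "avg A g \<le> e"
 shows "avg (FF n) (%x. of_bool (b x) * g x) \<le> e * avg (FF n) (%x. of_bool (b x))"
proof -
 have finA: "finite A" using assms(2) FF_finite by (rule finite_subset)
 have s: "(\<Sum>x\<in>FF n. of_bool (b x) * k x) = sum k A" for k :: "vec => real"
  by (rule sum.mono_neutral_cong_right) (use assms(1,2) FF_finite in auto)
 have "sum g A \<le> e * real (card A)"
  using assms(3,4) finA by (simp add: avg_def pos_divide_le_eq card_gt_0_iff)
 then have "(\<Sum>x\<in>FF n. of_bool (b x) * g x) \<le> e * (\<Sum>x\<in>FF n. of_bool (b x) * 1)"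
  unfolding s by simp
 from divide_right_mono[OF this, of "real (card (FF n))"] show ?thesis by (simp add: avg_def)
qed

text \<open>The given homomorphism supplies the tuple \<open>k\<close>: its points lie in atoms of
  the reduced matroid, where \<open>f1\<close> is at least \<zeta> and \<open>f3\<close> is small on
  average.\<close>

lemma partition_hom_density:
 assumes N: "matroid rN N" "card N \<le> d + 2" and \<zeta>: "\<zeta> > 0"
  and part: "regular_partition n M \<eta> r d f1 f2 f3 Ps"
  and \<theta>: "0 < \<theta>" "\<theta> \<le> 1"
  and K: "!!D n P. 1 \<le> D ==> D \<le> d ==> pd n (Suc D) P ==> bias n D (tb P) \<ge> \<theta> ^ 2 ^ d ==> frank n D K P"
   "K \<le> r (length Ps)"
  and \<epsilon>: "real (card N) * (4 * \<epsilon>\<^sup>2 / \<zeta>\<^sup>2) \<le> 1 / 2"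
  and hom: "matroid_hom rN N n (reduced_matroid n M f3 Ps \<epsilon> \<zeta>) \<phi>"
 shows "avg (VI {..<rN} n) (%h. \<Prod>u\<in>N. indicator M (\<Phi> rN h u))
  \<ge> (\<zeta> / 2) ^ card N * ((1 / real (factor_order n Ps) ^ card N - \<theta>) / 2 - 2 * real (card N) * \<theta>)
   - real (card N) * \<eta> (length Ps)"
proof -
 define C where "C = length Ps"
 define P where "P i = Ps ! i" for i
 define q where "q i = poly_depth n (Ps ! i) + 1" for i
 have fac: "poly_factor n Ps" "factor_degree n Ps \<le> d" and reg: "regular_factor n r Ps"
  and sum: "!!x. x : FF n ==> indicator M x = f1 x + f2 x + f3 x"
  and f1c: "!!x. x : FF n ==> f1 x = cond_avg n Ps (indicator M) x"
  and gow: "gowers_norm n (d + 1) (%x. complex_of_real (f2 x)) \<le> \<eta> (length Ps)"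
  and ran: "!!x. x : FF n ==> f1 x : {0..1} & f1 x + f3 x : {0..1} & f2 x : {-1..1} & f3 x : {-1..1}"
  using part unfolding regular_partition_def by blast+
 have Pin: "P i : set Ps" if "i < C" for i using that by (simp add: P_def C_def)
 have pdP: "pd n (Suc d) (P i)" and zs: "zero_shift n (P i)" if "i < C" for i
  using factor_pd[OF fac Pin[OF that]] by simp_all
 interpret equi_factor n d C P q \<theta>
 proof
  show "P i 0 = 0" if "i < C" for i by (rule depth_facts(1)[OF pdP[OF that] zs[OF that]])
  show "zmul (2 ^ q i) (P i x) = 0" if "i < C" "x : FF n" for i x
   unfolding q_def using depth_facts(2)[OF pdP[OF that(1)] zs[OF that(1)] that(2)] by (simp add: P_def)
  show "0 < \<theta>" "\<theta> \<le> 1" using \<theta> by simp_all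
  fix i and l :: "nat => int" assume i: "i < C" "\<not> 2 ^ q i dvd l i"
  show "\<exists>D. 1 \<le> D & D \<le> d & pd n (Suc D) (%x. \<Sum>i<C. zmul (l i) (P i x)) &
    bias n D (tb (%x. \<Sum>i<C. zmul (l i) (P i x))) < \<theta> ^ 2 ^ d"
   using regular_factor_bias[OF fac reg K(1) K(2), where l = l and i = i] i unfolding q_def C_def P_def by blast
 qed
 have "ord = (\<Prod>i<C. 2 ^ q i)" by (rule ord_def)
 also have "... = factor_order n Ps" by (simp add: factor_order_def q_def C_def)
 finally have ord: "ord = factor_order n Ps" .
 have NF: "N \<subseteq> FF rN" "0 \<notin> N" using N by (auto simp: matroid_def)
 have finN: "finite N" by (rule finite_subset[OF NF(1) FF_finite])
 have lin: "linear_map rN n \<phi>" and red: "\<phi> ` N \<subseteq> reduced_matroid n M f3 Ps \<epsilon> \<zeta>"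
  using hom by (simp_all add: matroid_hom_def)
 obtain k where k: "k : VI {..<rN} n" "\<forall>x\<in>FF rN. \<phi> x = \<Phi> rN k x" using linear_map_\<Phi>[OF lin] by blast
 have \<phi>k: "\<phi> u = sum k (supp rN u)" if "u : N" for u using k(2) NF(1) that by (auto simp: \<Phi>_def)
 have at: "x : factor_atom n Ps (map (%P. P y) Ps) \<longleftrightarrow> (\<forall>i<C. P i x = P i y)" if "x : FF n" for x y
  using that by (auto simp: factor_atom_def list_eq_iff_nth_eq C_def P_def in_set_conv_nth)
 have atom: "avg (factor_atom n Ps (map (%P. P (\<phi> u)) Ps)) (%x. \<bar>f3 x\<bar>\<^sup>2) \<le> \<epsilon>\<^sup>2"
  "avg (factor_atom n Ps (map (%P. P (\<phi> u)) Ps)) (indicator M :: _ => real) \<ge> \<zeta>"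
  "\<phi> u : factor_atom n Ps (map (%P. P (\<phi> u)) Ps)" if u: "u : N" for u
 proof -
  obtain b where b: "b : factor_atoms n Ps" "avg b (%x. \<bar>f3 x\<bar>\<^sup>2) \<le> \<epsilon>\<^sup>2" "avg b (indicator M :: _ => real) \<ge> \<zeta>" "\<phi> u : b"
   using red u unfolding reduced_matroid_def by blast
  obtain c where c: "b = factor_atom n Ps c" using b(1) by (auto simp: factor_atoms_def)
  have "map (%P. P (\<phi> u)) Ps = c" using b(4) by (simp add: c factor_atom_def)
  then have "b = factor_atom n Ps (map (%P. P (\<phi> u)) Ps)" by (simp add: c)
  then show "avg (factor_atom n Ps (map (%P. P (\<phi> u)) Ps)) (%x. \<bar>f3 x\<bar>\<^sup>2) \<le> \<epsilon>\<^sup>2"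
   "avg (factor_atom n Ps (map (%P. P (\<phi> u)) Ps)) (indicator M :: _ => real) \<ge> \<zeta>"
   "\<phi> u : factor_atom n Ps (map (%P. P (\<phi> u)) Ps)" using b by simp_all
 qed
 show ?thesis
  unfolding \<Phi>_def ord[symmetric]
 proof (rule hom_density[OF _ finN N(2) _ _ _ k(1) pdP, where ?f1.0 = f1 and ?f2.0 = f2 and ?f3.0 = f3])
  show "supp rN u \<subseteq> {..<rN}" for u by (rule supp_sub)
  show "supp rN u ~= {}" if "u : N" for u
  proof
   assume "supp rN u = {}"
   then have "supp rN u = supp rN 0" by (simp add: supp_def)
   then show False using inj_onD[OF supp_inj, of rN u 0] NF that FF_zero[of rN] by blast
  qed
  show "inj_on (supp rN) N" by (rule inj_on_subset[OF supp_inj NF(1)])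
  show "indicator M x = f1 x + f2 x + f3 x" if "x : FF n" for x by (rule sum[OF that])
  show "0 \<le> (indicator M x :: real) & (indicator M x :: real) \<le> 1" for x by (simp add: indicator_def)
  show "0 \<le> f1 x + f3 x & f1 x + f3 x \<le> 1" if "x : FF n" for x using ran[OF that] by simp
  show "\<bar>f2 x\<bar> \<le> 1" if "x : FF n" for x using ran[OF that] by auto
  show "gowers_norm n (Suc d) (%x. complex_of_real (f2 x)) \<le> \<eta> (length Ps)" using gow by simp
  show "\<zeta> > 0" by (rule \<zeta>)
  show "real (card N) * (4 * \<epsilon>\<^sup>2 / \<zeta>\<^sup>2) \<le> 1 / 2" by (rule \<epsilon>)
  show "\<zeta> \<le> f1 x" if u: "u : N" and x: "x : FF n" and eq: "\<forall>i<C. P i x = P i (sum k (supp rN u))" for u x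
  proof -
   have "map (%P. P x) Ps = map (%P. P (\<phi> u)) Ps"
    using eq unfolding \<phi>k[OF u] by (simp add: list_eq_iff_nth_eq C_def P_def)
   note eq = this
   show ?thesis using atom(2)[OF u] unfolding f1c[OF x] cond_avg_def eq .
  qed
  show "avg (FF n) (%x. of_bool (\<forall>i<C. P i x = P i (sum k (supp rN u))) * (f3 x)\<^sup>2)
   \<le> \<epsilon>\<^sup>2 * avg (FF n) (%x. of_bool (\<forall>i<C. P i x = P i (sum k (supp rN u))))" if u: "u : N" for u
  proof (rule avg_restrict)
   show "(\<forall>i<C. P i x = P i (sum k (supp rN u))) \<longleftrightarrow> x : factor_atom n Ps (map (%P. P (\<phi> u)) Ps)" if "x : FF n" for x
    using at[OF that, of "\<phi> u"] \<phi>k[OF u] by simp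
   show "factor_atom n Ps (map (%P. P (\<phi> u)) Ps) \<subseteq> FF n" by (auto simp: factor_atom_def)
   show "factor_atom n Ps (map (%P. P (\<phi> u)) Ps) ~= {}" using atom(3)[OF u] by blast
   show "avg (factor_atom n Ps (map (%P. P (\<phi> u)) Ps)) (%x. (f3 x)\<^sup>2) \<le> \<epsilon>\<^sup>2" using atom(1)[OF u] by simp
  qed
 qed simp
qed

theorem mainTheorem2:
  fixes rN :: nat and N :: "(nat \<Rightarrow> bit) set" and \<zeta> :: real and d :: nat
  assumes "matroid rN N"
    and "\<zeta> > 0"
    and "int d \<ge> int (card N) - 2"
  shows "\<exists>(\<beta>::real) (\<epsilon>0::real) (\<eta> :: nat \<Rightarrow> real) (r :: nat \<Rightarrow> nat) (\<nu> :: nat \<Rightarrow> nat).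
    \<beta> > 0 \<and> \<epsilon>0 > 0 \<and>
    (\<forall>k\<ge>1. \<eta> k > 0) \<and> antimono_on {1..} \<eta> \<and>
    (\<forall>k\<ge>1. r k > 0) \<and> mono_on {1..} r \<and>
    (\<forall>k\<ge>1. \<nu> k > 0) \<and> mono_on {1..} \<nu> \<and>
    (\<forall>\<epsilon>. 0 < \<epsilon> \<and> \<epsilon> \<le> \<epsilon>0 \<longrightarrow>
      (\<forall>n M f1 f2 f3 Ps.
        matroid n M \<and>
        regular_partition n M \<eta> r d f1 f2 f3 Ps \<and>
        n \<ge> \<nu> (length Ps) \<and>
        (\<exists>\<phi>. matroid_hom rN N n (reduced_matroid n M f3 Ps \<epsilon> \<zeta>) \<phi>) \<longrightarrow>
        real (card (copies rN N n M)) \<ge>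
          \<beta> * ((2 ^ n) ^ rN / real (factor_order n Ps) ^ card N)))"
proof -
 define m where "m = card N"
 define z where "z = (\<zeta> / 2) ^ m"
 \<comment> \<open>A lower bound for the reciprocal of the order to the power \<open>m\<close>, in
   terms of the complexity \<open>C\<close>.\<close>
 define X where "X C = (1 / real ((2 ^ (d + 1)) ^ C)) ^ m" for C
 \<comment> \<open>With \<open>Y\<close> the reciprocal of the order to the power \<open>m\<close>,
   the main term is z Y / 2. The errors from \<theta>, from \<eta> and from non-injective maps are
   each allowed z Y / 8, which leaves z Y / 8.\<close>
 define \<theta> where "\<theta> C = X C / (8 * (1 + 2 * real m))" for C
 define \<eta> where "\<eta> C = z * X C / (8 * (real m + 1))" for C
 have z: "z > 0" using assms(2) by (simp add: z_def)
 have X0: "X C > 0" for C by (simp add: X_def)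
 have Xanti: "X C' \<le> X C" if "C \<le> C'" for C C'
 proof -
  have "((2::nat) ^ (d + 1)) ^ C \<le> (2 ^ (d + 1)) ^ C'" by (rule power_increasing[OF that]) simp
  then have "real ((2 ^ (d + 1)) ^ C) \<le> real ((2 ^ (d + 1)) ^ C')" by (simp only: of_nat_le_iff)
  then have "1 / real ((2 ^ (d + 1)) ^ C') \<le> 1 / real ((2 ^ (d + 1)) ^ C)" by (intro frac_le) auto
  then show ?thesis unfolding X_def by (rule power_mono) simp
 qed
 have X1: "X C \<le> 1" for C
  using Xanti[of 0 C] by (simp add: X_def)
 have \<theta>0: "\<theta> C > 0" for C using X0[of C] by (simp add: \<theta>_def)
 have \<theta>X: "(1 + 2 * real m) * \<theta> C = X C / 8" for C
 proof -
  have "a * (x / (8 * a)) = x / 8" if "a > 0" for a x :: real using that by simp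
  moreover have "1 + 2 * real m > 0" by simp
  ultimately show ?thesis unfolding \<theta>_def by blast
 qed
 have \<theta>1: "\<theta> C \<le> 1" for C
 proof -
  have "1 * \<theta> C \<le> (1 + 2 * real m) * \<theta> C" using \<theta>0[of C] by (intro mult_right_mono) auto
  then show ?thesis using X1[of C] \<theta>X[of C] by simp
 qed
 have "\<forall>C. \<exists>K. \<forall>D n P. 1 \<le> D & D \<le> d & pd n (Suc D) P & bias n D (tb P) \<ge> \<theta> C ^ 2 ^ d --> frank n D K P"
  using uniform_biased_rank \<theta>0 by simp
 from choice[OF this] obtain K where K: "\<forall>C. \<forall>D n P. 1 \<le> D & D \<le> d & pd n (Suc D) P & bias n D (tb P) \<ge> \<theta> C ^ 2 ^ d --> frank n D (K C) P"
  by (elim exE) (rule that)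
 have "\<exists>V. 2 ^ rN / 2 ^ V \<le> z * X C / 8" for C
 proof -
  have p: "z * X C / 8 > 0" using z X0 by simp
  obtain V where "2 ^ rN / (z * X C / 8) < (2::real) ^ V" using real_arch_pow[of 2] by auto
  then have "2 ^ rN < (2::real) ^ V * (z * X C / 8)" unfolding pos_divide_less_eq[OF p] .
  then have "2 ^ rN / 2 ^ V \<le> z * X C / 8" by (simp add: pos_divide_le_eq mult.commute)
  then show ?thesis by (rule exI)
 qed
 then obtain V where V: "2 ^ rN / 2 ^ V C \<le> z * X C / 8" for C by metis
 \<comment> \<open>Partial sums make the growth functions nondecreasing, and \<open>Suc\<close>
   makes them positive.\<close>
 define r where "r k = Suc (\<Sum>C\<le>k. K C)" for k
 define \<nu> where "\<nu> k = Suc (\<Sum>C\<le>k. V C)" for k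
 \<comment> \<open>Keeps 4 m \<epsilon>^2 / \<zeta>^2, the share that Chebyshev's inequality may
   cost, at most 1/2.\<close>
 define \<epsilon>0 where "\<epsilon>0 = \<zeta> / (8 * (real m + 1))"
 \<comment> \<open>The remaining 1/8 of the main term, divided by the number of maps with the same
   image. For m = 0 the power is 0^0 = 1.\<close>
 define \<beta> where "\<beta> = z / (8 * real m ^ m)"
 have mm: "real m ^ m > 0" by (cases "m = 0") auto
 have \<beta>: "\<beta> > 0" using z mm by (simp add: \<beta>_def)
 have \<epsilon>0: "\<epsilon>0 > 0" using assms(2) by (simp add: \<epsilon>0_def)
 have \<eta>0: "\<forall>k\<ge>1. \<eta> k > 0" using z X0 by (simp add: \<eta>_def)
 have \<eta>anti: "antimono_on {1..} \<eta>"
 proof (rule monotone_onI)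
  fix k l :: nat assume "k \<le> l"
  then show "\<eta> l \<le> \<eta> k"
   unfolding \<eta>_def using Xanti z by (intro divide_right_mono mult_left_mono) auto
 qed
 have rmono: "mono_on {1..} r" and \<nu>mono: "mono_on {1..} \<nu>"
  by (auto intro!: mono_onI sum_mono2 simp: r_def \<nu>_def)
 have main: "\<beta> * ((2 ^ n) ^ rN / real (factor_order n Ps) ^ card N) \<le> real (card (copies rN N n M))"
  if \<epsilon>: "0 < \<epsilon>" "\<epsilon> \<le> \<epsilon>0" and M: "matroid n M" and part: "regular_partition n M \<eta> r d f1 f2 f3 Ps"
   and n: "\<nu> (length Ps) \<le> n" and hom: "matroid_hom rN N n (reduced_matroid n M f3 Ps \<epsilon> \<zeta>) \<phi>"
  for \<epsilon> n M f1 f2 f3 Ps \<phi>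
 proof -
  define C where "C = length Ps"
  define Y where "Y = 1 / real (factor_order n Ps) ^ m"
  have fac: "poly_factor n Ps" "factor_degree n Ps \<le> d" using part by (simp_all add: regular_partition_def)
  have XY: "X C \<le> Y"
  proof -
   have "real (factor_order n Ps) \<le> real ((2 ^ (d + 1)) ^ C)"
    using factor_order_le[OF fac] by (simp only: C_def of_nat_le_iff)
   moreover have "real (factor_order n Ps) > 0" by (simp add: factor_order_def prod_pos)
   ultimately have "1 / real ((2 ^ (d + 1)) ^ C) \<le> 1 / real (factor_order n Ps)" by (intro frac_le) auto
   then have "X C \<le> (1 / real (factor_order n Ps)) ^ m" unfolding X_def by (rule power_mono) simp
   then show ?thesis by (simp add: Y_def power_one_over)
  qed
  have zXY: "z * X C / 8 \<le> z * Y / 8" using XY z by simp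
  have \<epsilon>\<zeta>: "real (card N) * (4 * \<epsilon>\<^sup>2 / \<zeta>\<^sup>2) \<le> 1 / 2"
  proof -
   have "\<epsilon>\<^sup>2 \<le> \<epsilon>0\<^sup>2" using \<epsilon> by (intro power_mono) auto
   also have "... = \<zeta>\<^sup>2 / (8 * (real m + 1))\<^sup>2" by (simp add: \<epsilon>0_def power_divide)
   finally have "\<epsilon>\<^sup>2 / \<zeta>\<^sup>2 \<le> 1 / (8 * (real m + 1))\<^sup>2" using assms(2) by (simp add: field_simps)
   also have "... \<le> 1 / (8 * (real m + 1))"
    by (intro frac_le) (auto simp: power2_eq_square intro: mult_left_mono[of 1 "8 * (real m + 1)" "8 * (real m + 1)", simplified])
   finally have "real m * (4 * (\<epsilon>\<^sup>2 / \<zeta>\<^sup>2)) \<le> real m * (4 * (1 / (8 * (real m + 1))))"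
    by (intro mult_left_mono) auto
   also have "... \<le> 1 / 2" by (simp add: field_simps)
   finally show ?thesis by (simp add: m_def)
  qed
  have KC: "frank n D (K C) P" if "1 \<le> D" "D \<le> d" "pd n (Suc D) P" "\<theta> C ^ 2 ^ d \<le> bias n D (tb P)" for D n P
   by (rule K[rule_format]) (intro conjI that)
  have "K C \<le> (\<Sum>C\<le>C. K C)" "V C \<le> (\<Sum>C\<le>C. V C)" by (rule member_le_sum; simp)+
  then have rC: "K C \<le> r (length Ps)" and VC: "V C \<le> n" using n by (simp_all add: r_def \<nu>_def C_def)
  have "card N \<le> d + 2" using assms(3) by linarith
  from partition_hom_density[OF assms(1) this assms(2) part \<theta>0 \<theta>1 KC rC \<epsilon>\<zeta> hom]
  have dens: "avg (VI {..<rN} n) (%h. \<Prod>u\<in>N. indicator M (\<Phi> rN h u))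
   \<ge> z * ((Y - \<theta> C) / 2 - 2 * real m * \<theta> C) - real m * \<eta> C"
   unfolding z_def Y_def m_def C_def .
  have "z * (3 / 8 * Y) \<le> z * ((Y - \<theta> C) / 2 - 2 * real m * \<theta> C)"
  proof (rule mult_left_mono)
   have "\<theta> C / 2 + 2 * real m * \<theta> C \<le> (1 + 2 * real m) * \<theta> C" using \<theta>0[of C] by (simp add: distrib_right)
   then have "\<theta> C / 2 + 2 * real m * \<theta> C \<le> Y / 8" using \<theta>X[of C] XY by simp
   then show "3 / 8 * Y \<le> (Y - \<theta> C) / 2 - 2 * real m * \<theta> C" by (simp add: diff_divide_distrib)
  qed (use z in simp)
  moreover have "real m * \<eta> C \<le> z * Y / 8"
  proof -
   have "real m * \<eta> C = z * X C / 8 * (real m / (real m + 1))" by (simp add: \<eta>_def)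
   also have "... \<le> z * X C / 8 * 1" using z X0[of C] by (intro mult_left_mono) auto
   finally show ?thesis using zXY by simp
  qed
  moreover have "2 ^ rN / 2 ^ n \<le> z * Y / 8"
  proof -
   have "(2::real) ^ rN / 2 ^ n \<le> 2 ^ rN / 2 ^ V C" using VC by (intro divide_left_mono power_increasing) auto
   then show ?thesis using V[of C] zXY by linarith
  qed
  moreover have "z * (3 / 8 * Y) = z * Y / 8 + z * Y / 8 + z * Y / 8" by simp
  ultimately have low: "z * Y / 8 + 2 ^ rN / 2 ^ n \<le> avg (VI {..<rN} n) (%h. \<Prod>u\<in>N. indicator M (\<Phi> rN h u))"
   using dens by linarith
  have "M \<subseteq> FF n" using M by (auto simp: matroid_def)
  from copies_from_density[OF assms(1) this low]
  have "z * Y / 8 * (2 ^ n) ^ rN / real m ^ m \<le> real (card (copies rN N n M))"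
   using mm by (simp add: pos_divide_le_eq m_def)
  moreover have "\<beta> * ((2 ^ n) ^ rN / real (factor_order n Ps) ^ card N) = z * Y / 8 * (2 ^ n) ^ rN / real m ^ m"
   by (simp add: \<beta>_def Y_def m_def)
  ultimately show ?thesis by simp
 qed
 show ?thesis
 proof (rule exI[of _ \<beta>], rule exI[of _ \<epsilon>0], rule exI[of _ \<eta>], rule exI[of _ r], rule exI[of _ \<nu>],
   intro conjI \<beta> \<epsilon>0 \<eta>0 \<eta>anti rmono \<nu>mono)
  show "\<forall>k\<ge>1. 0 < r k" "\<forall>k\<ge>1. 0 < \<nu> k" by (simp_all add: r_def \<nu>_def)
 qed (use main in blast)
qed

end
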